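(* Let $\alpha>0$, let $k\ge1$ be an integer and $s>n/2$. Then the initial value problem $$i\partial_tu+t^\alpha\Delta_xu=\pm u|u|^{2k},\qquad u(0,x)=u_0(x),\quad x\in\mathbb{R}^n,$$ is locally well-posed in $H^s(\mathbb{R}^n)$, and its solution satisfies the smoothing estimates: for $n=1$, $\sup_{x\in\mathbb{R}}\|t^{\alpha/2}D_x^{s+1/2}u\|_{L^2_t([0,T])}<\infty$; for $n\ge2$, $\sup_{\beta\in\mathbb{Z}^n}\|t^{\alpha/2}D_x^{s+1/2}u\|_{L^2_x(Q_\beta)L^2_t([0,T])}<\infty$, where $[0,T]$ is the existence interval.
   Context: Local well-posedness in $H^s(\mathbb{R}^n)$ means: for every ball $B$ in $H^s(\mathbb{R}^n)$ there exist a time $T>0$ and a Banach space $X\subset L^\infty([0,T];H^s(\mathbb{R}^n))$ such that for each $u_0\in B$ there is a unique solution $u\in X\cap C([0,T];H^s(\mathbb{R}^n))$ of the integral equation $u(t)=W_\alpha(t,0)u_0+\int_0^tW_\alpha(t,\tau)(\text{nonlinearity})(\tau)\,d\tau$, and the map $u_0\mapsto u$ is continuous from $H^s$ into $C([0,T];H^s)$. Here $W_\alpha(t,s)$ is the Fourier multiplier with symbol $e^{-i\frac{t^{\alpha+1}-s^{\alpha+1}}{\alpha+1}|\xi|^2}$. $D_x^\gamma$ is the Fourier multiplier with symbol $|\xi|^\gamma$; $\{Q_\beta\}_{\beta\in\mathbb{Z}^n}$ are the non-overlapping unit cubes covering $\mathbb{R}^n$. *)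

theory Defs
  imports "HOL-Analysis.Analysis"
begin

text \<open>Functions on R^n are modelled as complex-valued functions on real^'n.
  Fourier transform convention: hat f(xi) = integral of f(x) exp(-i x.xi) dx,
  so that Laplacian corresponds to -|xi|^2 and D^gamma to |xi|^gamma.\<close>

definition L2 :: "(real^'n \<Rightarrow> complex) \<Rightarrow> bool" where
  "L2 f \<longleftrightarrow> f \<in> borel_measurable lborel \<and> integrable lborel (\<lambda>x. (cmod (f x))^2)"

definition fourier1 :: "(real^'n \<Rightarrow> complex) \<Rightarrow> real^'n \<Rightarrow> complex" where
  "fourier1 f \<xi> = (LINT x|lborel. f x * cis (- (x \<bullet> \<xi>)))"

text \<open>g is the (Plancherel) Fourier transform of the L2 function f: characterised by
  the duality identity integral(hat f * phi) = integral(f * hat phi) for box indicators phi.\<close>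
definition is_fourier_L2 :: "(real^'n \<Rightarrow> complex) \<Rightarrow> (real^'n \<Rightarrow> complex) \<Rightarrow> bool" where
  "is_fourier_L2 f g \<longleftrightarrow> L2 f \<and> L2 g \<and>
     (\<forall>a b. (LINT \<xi>|lborel. g \<xi> * indicator (cbox a b) \<xi>)
            = (LINT x|lborel. f x * fourier1 (indicator (cbox a b)) x))"

definition FT :: "(real^'n \<Rightarrow> complex) \<Rightarrow> real^'n \<Rightarrow> complex" where
  "FT f = (SOME g. is_fourier_L2 f g)"

definition sobolev :: "real \<Rightarrow> (real^'n \<Rightarrow> complex) set" where
  "sobolev s = {f. L2 f \<and> integrable lborel (\<lambda>\<xi>. (1 + (norm \<xi>)^2) powr s * (cmod (FT f \<xi>))^2)}"

definition hs_norm :: "real \<Rightarrow> (real^'n \<Rightarrow> complex) \<Rightarrow> real" where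
  "hs_norm s f = sqrt (LINT \<xi>|lborel. (1 + (norm \<xi>)^2) powr s * (cmod (FT f \<xi>))^2)"

definition hs_inner :: "real \<Rightarrow> (real^'n \<Rightarrow> complex) \<Rightarrow> (real^'n \<Rightarrow> complex) \<Rightarrow> complex" where
  "hs_inner s f g = (LINT \<xi>|lborel. of_real ((1 + (norm \<xi>)^2) powr s) * FT f \<xi> * cnj (FT g \<xi>))"

definition hs_dist :: "real \<Rightarrow> (real^'n \<Rightarrow> complex) \<Rightarrow> (real^'n \<Rightarrow> complex) \<Rightarrow> real" where
  "hs_dist s f g = hs_norm s (\<lambda>x. f x - g x)"

definition Hball :: "real \<Rightarrow> real \<Rightarrow> (real^'n \<Rightarrow> complex) set" where
  "Hball s R = {f \<in> sobolev s. hs_norm s f \<le> R}"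

definition W :: "real \<Rightarrow> real \<Rightarrow> real \<Rightarrow> (real^'n \<Rightarrow> complex) \<Rightarrow> (real^'n \<Rightarrow> complex)" where
  "W \<alpha> t \<tau> F = (SOME h. is_fourier_L2 h
      (\<lambda>\<xi>. cis (- ((t powr (\<alpha>+1) - \<tau> powr (\<alpha>+1)) / (\<alpha>+1)) * (norm \<xi>)^2) * FT F \<xi>))"

definition nonlin :: "nat \<Rightarrow> (real^'n \<Rightarrow> complex) \<Rightarrow> (real^'n \<Rightarrow> complex)" where
  "nonlin k f = (\<lambda>x. f x * of_real ((cmod (f x)) ^ (2*k)))"

definition boxpair :: "(real^'n \<Rightarrow> complex) \<Rightarrow> real^'n \<Rightarrow> real^'n \<Rightarrow> complex" where
  "boxpair f a b = (LINT x|lborel. f x * indicator (cbox a b) x)"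

text \<open>Duhamel integral equation for  i u_t + t^alpha Lap u = sigma u |u|^(2k), u(0)=u0,
  i.e. u(t) = W(t,0)u0 + integral_0^t W(t,tau)(-i sigma u|u|^(2k))(tau) dtau,
  stated weakly (tested against box indicators, which determine an L2 function).\<close>
definition solves :: "real \<Rightarrow> real \<Rightarrow> nat \<Rightarrow> real \<Rightarrow> (real^'n \<Rightarrow> complex)
      \<Rightarrow> (real \<Rightarrow> real^'n \<Rightarrow> complex) \<Rightarrow> bool" where
  "solves \<alpha> \<sigma> k T u0 u \<longleftrightarrow> (\<forall>t\<in>{0..T}. \<forall>a b.
     boxpair (u t) a b = boxpair (W \<alpha> t 0 u0) a b
       + (LINT \<tau>:{0..t}|lborel. boxpair (W \<alpha> t \<tau> (\<lambda>x. - \<i> * of_real \<sigma> * nonlin k (u \<tau>) x)) a b))"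

definition cont_Hs :: "real \<Rightarrow> real \<Rightarrow> (real \<Rightarrow> real^'n \<Rightarrow> complex) \<Rightarrow> bool" where
  "cont_Hs s T u \<longleftrightarrow> (\<forall>t\<in>{0..T}. u t \<in> sobolev s) \<and>
     (\<forall>t\<in>{0..T}. \<forall>\<epsilon>>0. \<exists>\<delta>>0. \<forall>t'\<in>{0..T}. \<bar>t' - t\<bar> < \<delta> \<longrightarrow> hs_dist s (u t') (u t) < \<epsilon>)"

text \<open>(X, N) is a Banach space contained in L^infty([0,T]; H^s):
  a complex vector space of functions with a complete seminorm whose kernel consists of
  functions vanishing a.e. on [0,T] (so the quotient is a Banach space), and whose elements
  are (weakly, hence by Pettis strongly) measurable, essentially bounded H^s-valued maps.\<close>
definition banach_Linf :: "real \<Rightarrow> real \<Rightarrow> (real \<Rightarrow> real^'n \<Rightarrow> complex) set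
      \<Rightarrow> ((real \<Rightarrow> real^'n \<Rightarrow> complex) \<Rightarrow> real) \<Rightarrow> bool" where
  "banach_Linf s T X N \<longleftrightarrow>
     (\<lambda>_ _. 0) \<in> X \<and>
     (\<forall>u\<in>X. \<forall>v\<in>X. (\<lambda>t x. u t x + v t x) \<in> X) \<and>
     (\<forall>c::complex. \<forall>u\<in>X. (\<lambda>t x. c * u t x) \<in> X) \<and>
     (\<forall>u\<in>X. N u \<ge> 0) \<and>
     (\<forall>u\<in>X. \<forall>v\<in>X. N (\<lambda>t x. u t x + v t x) \<le> N u + N v) \<and>
     (\<forall>c::complex. \<forall>u\<in>X. N (\<lambda>t x. c * u t x) = cmod c * N u) \<and>
     (\<forall>u\<in>X. N u = 0 \<longrightarrow> (AE t in lborel. t \<in> {0..T} \<longrightarrow> hs_norm s (u t) = 0)) \<and>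
     (\<forall>f. (\<forall>n. f n \<in> X) \<longrightarrow>
        (\<forall>\<epsilon>>0. \<exists>M. \<forall>m\<ge>M. \<forall>n\<ge>M. N (\<lambda>t x. f m t x - f n t x) < \<epsilon>) \<longrightarrow>
        (\<exists>v\<in>X. (\<lambda>n. N (\<lambda>t x. f n t x - v t x)) \<longlonglongrightarrow> 0)) \<and>
     (\<forall>u\<in>X. (AE t in lborel. t \<in> {0..T} \<longrightarrow> u t \<in> sobolev s) \<and>
        (\<forall>v\<in>sobolev s. (\<lambda>t. hs_inner s (u t) v) \<in> borel_measurable (restrict_space lborel {0..T})) \<and>
        (\<exists>C. AE t in lborel. t \<in> {0..T} \<longrightarrow> hs_norm s (u t) \<le> C))"

text \<open>Test functions: bounded, measurable, compactly supported, with rapidly decaying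
  Fourier transform (equivalently, C_c^infty up to a.e. modification).\<close>
definition test_fn :: "(real^'n \<Rightarrow> complex) \<Rightarrow> bool" where
  "test_fn \<phi> \<longleftrightarrow> \<phi> \<in> borel_measurable lborel \<and> bounded (range \<phi>) \<and>
     (\<exists>R. \<forall>x. norm x > R \<longrightarrow> \<phi> x = 0) \<and>
     (\<forall>m::nat. \<exists>C. \<forall>\<xi>. (1 + norm \<xi>)^m * cmod (fourier1 \<phi> \<xi>) \<le> C)"

text \<open>w(t,x) is (a measurable space-time representative of) D_x^gamma u(t,x) on [0,T]:
  for a.e. t, w(t,.) agrees with D^gamma u(t) as a distribution, via
  integral(w phi) = (2 pi)^(-n) integral(|xi|^gamma hat u(xi) hat phi(-xi)).\<close>
definition is_Dx :: "real \<Rightarrow> real \<Rightarrow> (real \<Rightarrow> real^'n \<Rightarrow> complex) \<Rightarrow> (real \<times> (real^'n) \<Rightarrow> complex) \<Rightarrow> bool" where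
  "is_Dx \<gamma> T u w \<longleftrightarrow> w \<in> borel_measurable (lborel \<Otimes>\<^sub>M lborel) \<and>
     (AE t in lborel. t \<in> {0..T} \<longrightarrow> (\<forall>\<phi>. test_fn \<phi> \<longrightarrow>
        integrable lborel (\<lambda>x. w (t, x) * \<phi> x) \<and>
        (LINT x|lborel. w (t, x) * \<phi> x) =
          of_real (1 / (2 * pi) ^ CARD('n)) *
          (LINT \<xi>|lborel. of_real (norm \<xi> powr \<gamma>) * FT (u t) \<xi> * fourier1 \<phi> (- \<xi>))))"

definition cube :: "('n \<Rightarrow> int) \<Rightarrow> (real^'n) set" where
  "cube \<beta> = {x. \<forall>i. of_int (\<beta> i) \<le> x $ i \<and> x $ i < of_int (\<beta> i) + 1}"

end

theory Submission
  imports Defs "HOL-Probability.Probability"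
begin

text \<open>Write \<open>r(t) = t powr (\<alpha> + 1) / (\<alpha> + 1)\<close>. In the interaction picture
  \<open>V(t) = (1 + |\<xi>|\<^sup>2) powr (s/2) * exp(i r(t) |\<xi>|\<^sup>2) * FT (u(t))\<close> the integral equation becomes
  \<open>V(t) = V(0) + \<integral>\<^sub>0\<^sup>t N(\<tau>, V(\<tau>)) d\<tau>\<close> in \<open>L\<^sup>2\<close>. For \<open>s > n/2\<close> the Sobolev space is an algebra, so \<open>N\<close> is
  Lipschitz on balls, uniformly in \<open>\<tau>\<close>; Picard iteration and Gronwall's inequality give well-posedness.

  For the smoothing, \<open>dr = t powr \<alpha> dt\<close> turns the weighted time integral into one for the free
  Schroedinger group. Inserting a Gaussian in \<open>r\<close> and a spatial weight \<open>\<rho>\<close> and expanding the square produces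
  a quadratic form in frequency with kernel
  \<open>(|\<xi>| |\<eta>|) powr (1/2) * exp (- (|\<xi>|\<^sup>2 - |\<eta>|\<^sup>2)\<^sup>2 / 2) * FT \<rho> (\<xi> - \<eta>)\<close>,
  which Schur's test bounds: for a Gaussian \<open>\<rho>\<close> with a constant independent of its centre, and for \<open>n = 1\<close>
  and \<open>\<rho>\<close> the indicator of \<open>A\<close> with a constant proportional to \<open>|A|\<close>. The former covers the cubes, the latter
  gives the bound for almost every \<open>x\<close>. The integral term is handled by Cauchy-Schwarz in \<open>\<tau>\<close>, and truncation
  of the frequencies is removed by completeness of a weighted \<open>L\<^sup>2\<close> space.\<close>

section \<open>The Hilbert space of square-integrable functions\<close>

text \<open>Everything is carried by one Hilbert space: an H^s function is replaced by the L2 class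
  of its weighted transform, so H^s norms, limits and integrals become those of a real Hilbert
  space. \<open>FT\<close> and \<open>W\<close> come from \<open>SOME\<close> and are determined
  only up to null sets, so identities pass through classes; the everywhere defined representative
  \<open>emb\<close> supplies pointwise algebra. The derivative of order s + 1/2 of an H^s function
  is at first only a distribution, without values to estimate. It has to be built: truncated
  frequencies give honest functions with bounds independent of the cut-off, and a single limit must
  then serve all weights at once. The Duhamel term needs no separate smoothing estimate, because the
  nonlinearity stays in H^s: for each fixed \<tau> it is again a free evolution. The Gaussian in r
  makes the double integral absolutely convergent; the price is only its size on the bounded range
  of phases. In Schur's test the danger is high frequency, where the factor |\<xi>| must be
  compensated by the speed at which |\<eta>|^2 varies near \<xi>.\<close>

definition sqi :: "('a::euclidean_space \<Rightarrow> complex) \<Rightarrow> bool" where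
  "sqi f \<longleftrightarrow> f \<in> borel_measurable lborel \<and> integrable lborel (\<lambda>x. (cmod (f x))\<^sup>2)"

lemma L2_eq_sqi: "L2 f = sqi f"
  by (simp add: L2_def sqi_def)

lemma sqi_measurable [measurable_dest]: "sqi f \<Longrightarrow> f \<in> borel_measurable lborel"
  by (simp add: sqi_def)

lemma sqi_measurable_borel: "sqi f \<Longrightarrow> f \<in> borel_measurable borel"
  by (simp add: sqi_def)

lemma sqi_sq_integrable: "sqi f \<Longrightarrow> integrable lborel (\<lambda>x. (cmod (f x))\<^sup>2)"
  by (simp add: sqi_def)

lemma sqi_dominated:
  assumes "sqi f" "g \<in> borel_measurable lborel" "AE x in lborel. cmod (g x) \<le> C * cmod (f x)"
  shows "sqi g"
  unfolding sqi_def
proof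
  show "g \<in> borel_measurable lborel" by fact
  show "integrable lborel (\<lambda>x. (cmod (g x))\<^sup>2)"
  proof (rule Bochner_Integration.integrable_bound)
    show "integrable lborel (\<lambda>x. C\<^sup>2 * (cmod (f x))\<^sup>2)"
      using sqi_sq_integrable[OF assms(1)] by simp
    show "(\<lambda>x. (cmod (g x))\<^sup>2) \<in> borel_measurable lborel" using assms(2) by simp
    show "AE x in lborel. norm ((cmod (g x))\<^sup>2) \<le> norm (C\<^sup>2 * (cmod (f x))\<^sup>2)"
      using assms(3)
    proof eventually_elim
      case (elim x)
      then have "(cmod (g x))\<^sup>2 \<le> (C * cmod (f x))\<^sup>2"
        by (intro power_mono) auto
      then show ?case by (simp add: power_mult_distrib)
    qed
  qed
qed

lemma sqi_mult_bounded:
  assumes "sqi f" "m \<in> borel_measurable borel" "\<And>x. cmod (m x) \<le> C"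
  shows "sqi (\<lambda>x. m x * f x)"
proof (rule sqi_dominated[OF assms(1)])
  show "(\<lambda>x. m x * f x) \<in> borel_measurable lborel"
    using assms(1,2) by (auto simp: sqi_def)
  show "AE x in lborel. cmod (m x * f x) \<le> C * cmod (f x)"
    by (intro AE_I2) (simp add: norm_mult mult_right_mono assms(3))
qed

lemma sqi_cmult: "sqi f \<Longrightarrow> sqi (\<lambda>x. c * f x)"
  by (rule sqi_mult_bounded[where C="cmod c"]) auto

lemma borel_measurable_cnj [measurable (raw)]:
  "f \<in> borel_measurable M \<Longrightarrow> (\<lambda>x. cnj (f x)) \<in> borel_measurable M"
  by (rule borel_measurable_continuous_on[where f=cnj]) (auto intro!: continuous_intros)

lemma sqi_cnj: "sqi f \<Longrightarrow> sqi (\<lambda>x. cnj (f x))"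
  by (rule sqi_dominated[where C=1]) (auto simp: sqi_def borel_measurable_cnj)

lemma sqi_zero: "sqi (\<lambda>_. 0)"
  by (simp add: sqi_def)

lemma sqi_add:
  assumes "sqi f" "sqi g" shows "sqi (\<lambda>x. f x + g x)"
  unfolding sqi_def
proof
  show m: "(\<lambda>x. f x + g x) \<in> borel_measurable lborel" using assms by (auto simp: sqi_def)
  show "integrable lborel (\<lambda>x. (cmod (f x + g x))\<^sup>2)"
  proof (rule Bochner_Integration.integrable_bound)
    show "integrable lborel (\<lambda>x. 2 * (cmod (f x))\<^sup>2 + 2 * (cmod (g x))\<^sup>2)"
      using assms by (auto simp: sqi_def)
    show "AE x in lborel. norm ((cmod (f x + g x))\<^sup>2) \<le> norm (2 * (cmod (f x))\<^sup>2 + 2 * (cmod (g x))\<^sup>2)"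
    proof (intro AE_I2)
      fix x
      have "(cmod (f x + g x))\<^sup>2 \<le> (cmod (f x) + cmod (g x))\<^sup>2"
        by (intro power_mono norm_triangle_ineq) auto
      also have "\<dots> \<le> 2 * (cmod (f x))\<^sup>2 + 2 * (cmod (g x))\<^sup>2"
        using zero_le_power2[of "cmod (f x) - cmod (g x)"] by (simp add: power2_eq_square algebra_simps)
      finally show "norm ((cmod (f x + g x))\<^sup>2) \<le> norm (2 * (cmod (f x))\<^sup>2 + 2 * (cmod (g x))\<^sup>2)"
        by simp
    qed
  qed (use m in simp)
qed

lemma sqi_uminus: "sqi f \<Longrightarrow> sqi (\<lambda>x. - f x)"
  using sqi_cmult[of f "-1"] by simp

lemma sqi_diff: "sqi f \<Longrightarrow> sqi g \<Longrightarrow> sqi (\<lambda>x. f x - g x)"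
  using sqi_add[OF _ sqi_uminus, of f g] by simp

lemma sqi_mult_integrable:
  assumes "sqi f" "sqi g" shows "integrable lborel (\<lambda>x. f x * g x)"
proof (rule Bochner_Integration.integrable_bound)
  show "integrable lborel (\<lambda>x. (cmod (f x))\<^sup>2 + (cmod (g x))\<^sup>2)"
    using assms by (auto simp: sqi_def)
  show "AE x in lborel. norm (f x * g x) \<le> norm ((cmod (f x))\<^sup>2 + (cmod (g x))\<^sup>2)"
  proof (intro AE_I2)
    fix x
    have "2 * (cmod (f x) * cmod (g x)) \<le> (cmod (f x))\<^sup>2 + (cmod (g x))\<^sup>2"
      using zero_le_power2[of "cmod (f x) - cmod (g x)"] by (simp add: power2_eq_square algebra_simps)
    moreover have "0 \<le> cmod (f x) * cmod (g x)" by simp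
    ultimately have "cmod (f x) * cmod (g x) \<le> (cmod (f x))\<^sup>2 + (cmod (g x))\<^sup>2"
      by linarith
    then show "norm (f x * g x) \<le> norm ((cmod (f x))\<^sup>2 + (cmod (g x))\<^sup>2)"
      by (simp add: norm_mult)
  qed
  show "(\<lambda>x. f x * g x) \<in> borel_measurable lborel" using assms by (auto simp: sqi_def)
qed

lemma sqi_cong_AE:
  assumes "sqi f" "g \<in> borel_measurable lborel" "AE x in lborel. f x = g x"
  shows "sqi g"
  by (rule sqi_dominated[OF assms(1,2), of 1]) (use assms(3) in auto)

\<comment> \<open>The relation is partial: functions that are not square-integrable are not related
  even to themselves and have no class. Hence \<open>abs_lsq f\<close> is meaningful only under
  \<open>sqi f\<close>, whereas \<open>rep_lsq\<close> always yields a measurable square-integrable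
  representative.\<close>
quotient_type (overloaded) 'a lsq = "'a::euclidean_space \<Rightarrow> complex" / partial:
  "\<lambda>f g. sqi f \<and> sqi g \<and> (AE x in lborel. f x = g x)"
proof (intro part_equivpI)
  show "\<exists>x. sqi x \<and> sqi x \<and> (AE xa in lborel. x xa = x xa)" by (auto intro!: exI[of _ "\<lambda>_. 0"] sqi_zero)
  show "symp (\<lambda>f g. sqi f \<and> sqi g \<and> (AE x in lborel. f x = g x))"
    by (auto simp: symp_def)
  show "transp (\<lambda>f g. sqi f \<and> sqi g \<and> (AE x in lborel. f x = g x))"
    by (rule transpI) auto
qed

lemma sqi_rep: "sqi (rep_lsq U)"
  using Quotient3_rel_rep[OF Quotient3_lsq, of U U] by auto

lemma rep_measurable [measurable]: "rep_lsq U \<in> borel_measurable borel"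
  using sqi_rep[of U] by (simp add: sqi_def)

lemma abs_rep_lsq: "abs_lsq (rep_lsq U) = U"
  by (rule Quotient3_abs_rep[OF Quotient3_lsq])

lemma rep_abs_lsq:
  assumes "sqi f" shows "AE x in lborel. rep_lsq (abs_lsq f) x = f x"
  using rep_abs_rsp_left[OF Quotient3_lsq, of f f] assms by auto

lemma abs_lsq_eqI:
  assumes "sqi f" "sqi g" "AE x in lborel. f x = g x" shows "abs_lsq f = abs_lsq g"
  using Quotient3_rel_abs[OF Quotient3_lsq, of f g] assms by auto

lemma lsq_eqI:
  assumes "AE x in lborel. rep_lsq U x = rep_lsq V x" shows "U = V"
  using abs_lsq_eqI[OF sqi_rep sqi_rep assms] by (simp add: abs_rep_lsq)

lemma lsq_eqI_abs:
  assumes "sqi f" "AE x in lborel. rep_lsq U x = f x" shows "U = abs_lsq f"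
  using abs_lsq_eqI[OF sqi_rep assms] by (simp add: abs_rep_lsq)

text \<open>The type classes offer real scalars, so the real part of the Hermitian form serves as
  inner product. Complex scalars act as the constant multipliers
  \<open>lmult (\<lambda>_. c)\<close>, and complex-valued pairings are carried by
  \<open>pair\<close>.\<close>

instantiation lsq :: (euclidean_space) real_inner
begin

definition zero_lsq :: "'a lsq" where "0 = abs_lsq (\<lambda>_. 0)"
definition plus_lsq :: "'a lsq \<Rightarrow> 'a lsq \<Rightarrow> 'a lsq" where
  "U + V = abs_lsq (\<lambda>x. rep_lsq U x + rep_lsq V x)"
definition minus_lsq :: "'a lsq \<Rightarrow> 'a lsq \<Rightarrow> 'a lsq" where
  "U - V = abs_lsq (\<lambda>x. rep_lsq U x - rep_lsq V x)"
definition uminus_lsq :: "'a lsq \<Rightarrow> 'a lsq" where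
  "- U = abs_lsq (\<lambda>x. - rep_lsq U x)"
definition scaleR_lsq :: "real \<Rightarrow> 'a lsq \<Rightarrow> 'a lsq" where
  "c *\<^sub>R U = abs_lsq (\<lambda>x. of_real c * rep_lsq U x)"
definition inner_lsq :: "'a lsq \<Rightarrow> 'a lsq \<Rightarrow> real" where
  "U \<bullet> V = Re (LINT x|lborel. rep_lsq U x * cnj (rep_lsq V x))"
definition norm_lsq :: "'a lsq \<Rightarrow> real" where "norm_lsq U = sqrt (U \<bullet> U)"
definition dist_lsq :: "'a lsq \<Rightarrow> 'a lsq \<Rightarrow> real" where "dist_lsq U V = norm (U - V)"
definition sgn_lsq :: "'a lsq \<Rightarrow> 'a lsq" where "sgn_lsq U = inverse (norm U) *\<^sub>R U"
definition uniformity_lsq :: "('a lsq \<times> 'a lsq) filter" where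
  "uniformity_lsq = (INF e\<in>{0 <..}. principal {(x, y). dist x y < e})"
definition open_lsq :: "'a lsq set \<Rightarrow> bool" where
  "open_lsq U \<longleftrightarrow> (\<forall>x\<in>U. eventually (\<lambda>(x', y). x' = x \<longrightarrow> y \<in> U) uniformity)"

lemma rep_add: "AE x in lborel. rep_lsq (U + V) x = rep_lsq U x + rep_lsq V x"
  unfolding plus_lsq_def by (rule rep_abs_lsq) (intro sqi_add sqi_rep)
lemma rep_diff: "AE x in lborel. rep_lsq (U - V) x = rep_lsq U x - rep_lsq V x"
  unfolding minus_lsq_def by (rule rep_abs_lsq) (intro sqi_diff sqi_rep)
lemma rep_uminus: "AE x in lborel. rep_lsq (- U) x = - rep_lsq U x"
  unfolding uminus_lsq_def by (rule rep_abs_lsq) (intro sqi_uminus sqi_rep)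
lemma rep_scaleR: "AE x in lborel. rep_lsq (c *\<^sub>R U) x = of_real c * rep_lsq U x"
  unfolding scaleR_lsq_def by (rule rep_abs_lsq) (intro sqi_cmult sqi_rep)
lemma rep_zero: "AE x in lborel. rep_lsq (0::'a lsq) x = 0"
  unfolding zero_lsq_def by (rule rep_abs_lsq) (rule sqi_zero)

lemma inner_lsq_self: "U \<bullet> U = (LINT x|lborel. (cmod (rep_lsq U x))\<^sup>2)"
proof -
  have "(LINT x|lborel. rep_lsq U x * cnj (rep_lsq U x)) = (LINT x|lborel. of_real ((cmod (rep_lsq U x))\<^sup>2))"
    by (simp flip: complex_norm_square)
  also have "\<dots> = of_real (LINT x|lborel. (cmod (rep_lsq U x))\<^sup>2)"
    by (rule integral_complex_of_real)
  finally show ?thesis by (simp add: inner_lsq_def)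
qed

instance
proof
  fix U V Z :: "'a lsq" and a b :: real
  show "U + V + Z = U + (V + Z)"
    apply (rule lsq_eqI)
    using rep_add[of "U + V" Z] rep_add[of U V] rep_add[of U "V+Z"] rep_add[of V Z] by eventually_elim simp
  show "U + V = V + U"
    apply (rule lsq_eqI)
    using rep_add[of U V] rep_add[of V U] by eventually_elim simp
  show "0 + U = U"
    apply (rule lsq_eqI)
    using rep_add[of 0 U] rep_zero by eventually_elim simp
  show "- U + U = 0"
    apply (rule lsq_eqI)
    using rep_add[of "-U" U] rep_zero rep_uminus[of U] by eventually_elim simp
  show "U - V = U + - V"
    apply (rule lsq_eqI)
    using rep_add[of U "-V"] rep_diff[of U V] rep_uminus[of V] by eventually_elim simp
  show "a *\<^sub>R (U + V) = a *\<^sub>R U + a *\<^sub>R V"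
    apply (rule lsq_eqI)
    using rep_scaleR[of a "U+V"] rep_add[of U V] rep_add[of "a *\<^sub>R U" "a *\<^sub>R V"] rep_scaleR[of a U] rep_scaleR[of a V]
    by eventually_elim (simp add: algebra_simps)
  show "(a + b) *\<^sub>R U = a *\<^sub>R U + b *\<^sub>R U"
    apply (rule lsq_eqI)
    using rep_scaleR[of "a+b" U] rep_add[of "a *\<^sub>R U" "b *\<^sub>R U"] rep_scaleR[of a U] rep_scaleR[of b U]
    by eventually_elim (simp add: algebra_simps)
  show "a *\<^sub>R b *\<^sub>R U = (a * b) *\<^sub>R U"
    apply (rule lsq_eqI)
    using rep_scaleR[of "a*b" U] rep_scaleR[of a "b *\<^sub>R U"] rep_scaleR[of b U]
    by eventually_elim (simp add: algebra_simps)
  show "1 *\<^sub>R U = U"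
    apply (rule lsq_eqI)
    using rep_scaleR[of 1 U] by eventually_elim simp
  show "dist U V = norm (U - V)" by (rule dist_lsq_def)
  show "sgn U = inverse (norm U) *\<^sub>R U" by (rule sgn_lsq_def)
  show "norm U = sqrt (U \<bullet> U)" by (rule norm_lsq_def)
  have mi: "integrable lborel (\<lambda>x. rep_lsq U x * cnj (rep_lsq V x))" for U V :: "'a lsq"
    by (intro sqi_mult_integrable sqi_rep sqi_cnj)
  have "(LINT x|lborel. rep_lsq V x * cnj (rep_lsq U x)) = cnj (LINT x|lborel. rep_lsq U x * cnj (rep_lsq V x))"
    unfolding Bochner_Integration.integral_cnj[symmetric] by (simp add: mult.commute)
  then show "U \<bullet> V = V \<bullet> U" by (simp add: inner_lsq_def)
  have "(LINT x|lborel. rep_lsq (U+V) x * cnj (rep_lsq Z x)) =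
        (LINT x|lborel. rep_lsq U x * cnj (rep_lsq Z x) + rep_lsq V x * cnj (rep_lsq Z x))"
  proof (rule integral_cong_AE)
    show "AE x in lborel. rep_lsq (U+V) x * cnj (rep_lsq Z x) = rep_lsq U x * cnj (rep_lsq Z x) + rep_lsq V x * cnj (rep_lsq Z x)"
      using rep_add[of U V] by eventually_elim (simp add: algebra_simps)
  qed measurable
  also have "\<dots> = (LINT x|lborel. rep_lsq U x * cnj (rep_lsq Z x)) + (LINT x|lborel. rep_lsq V x * cnj (rep_lsq Z x))"
    by (intro Bochner_Integration.integral_add mi)
  finally show "(U + V) \<bullet> Z = U \<bullet> Z + V \<bullet> Z" by (simp add: inner_lsq_def)
  have "(LINT x|lborel. rep_lsq (a *\<^sub>R U) x * cnj (rep_lsq V x)) =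
        (LINT x|lborel. of_real a * (rep_lsq U x * cnj (rep_lsq V x)))"
  proof (rule integral_cong_AE)
    show "AE x in lborel. rep_lsq (a *\<^sub>R U) x * cnj (rep_lsq V x) = of_real a * (rep_lsq U x * cnj (rep_lsq V x))"
      using rep_scaleR[of a U] by eventually_elim (simp add: algebra_simps)
  qed measurable
  then show "a *\<^sub>R U \<bullet> V = a * (U \<bullet> V)" by (simp add: inner_lsq_def)
  show "0 \<le> U \<bullet> U" by (simp add: inner_lsq_self)
  have "U \<bullet> U = 0 \<longleftrightarrow> (AE x in lborel. (cmod (rep_lsq U x))\<^sup>2 = 0)"
    unfolding inner_lsq_self by (rule integral_nonneg_eq_0_iff_AE) (auto intro: sqi_sq_integrable sqi_rep)
  also have "\<dots> \<longleftrightarrow> (AE x in lborel. rep_lsq U x = rep_lsq 0 x)"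
  proof -
    have "(AE x in lborel. (cmod (rep_lsq U x))\<^sup>2 = 0 \<longleftrightarrow> rep_lsq U x = rep_lsq 0 x)"
      using rep_zero by eventually_elim simp
    then show ?thesis by (rule eventually_subst)
  qed
  also have "\<dots> \<longleftrightarrow> U = 0" by (auto intro: lsq_eqI)
  finally show "U \<bullet> U = 0 \<longleftrightarrow> U = 0" .
qed (rule uniformity_lsq_def open_lsq_def)+

end

lemma norm_lsq_sq: "(norm U)\<^sup>2 = (LINT x|lborel. (cmod (rep_lsq U x))\<^sup>2)"
  by (simp add: power2_norm_eq_inner inner_lsq_self)

lemma norm_abs_lsq_sq:
  assumes "sqi f" shows "(norm (abs_lsq f))\<^sup>2 = (LINT x|lborel. (cmod (f x))\<^sup>2)"
  unfolding norm_lsq_sq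
proof (rule integral_cong_AE)
  show "AE x in lborel. (cmod (rep_lsq (abs_lsq f) x))\<^sup>2 = (cmod (f x))\<^sup>2"
    using rep_abs_lsq[OF assms] by eventually_elim simp
qed (use assms sqi_rep[of "abs_lsq f"] in \<open>auto simp: sqi_def\<close>)

lemma nn_integral_abs_lsq:
  assumes "sqi f" shows "(\<integral>\<^sup>+x. ennreal ((cmod (f x))\<^sup>2) \<partial>lborel) = ennreal ((norm (abs_lsq f))\<^sup>2)"
  unfolding norm_abs_lsq_sq[OF assms]
  by (rule nn_integral_eq_integral) (use assms in \<open>auto simp: sqi_def\<close>)

lemma nn_integral_rep_lsq:
  "(\<integral>\<^sup>+x. ennreal ((cmod (rep_lsq U x))\<^sup>2) \<partial>lborel) = ennreal ((norm U)\<^sup>2)"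
  using nn_integral_abs_lsq[OF sqi_rep[of U]] by (simp add: abs_rep_lsq)

lemma sqi_nn_integral:
  assumes "f \<in> borel_measurable lborel" "(\<integral>\<^sup>+x. ennreal ((cmod (f x))\<^sup>2) \<partial>lborel) < \<infinity>"
  shows "sqi f"
  unfolding sqi_def using assms by (auto intro!: integrableI_bounded)

lemma abs_lsq_add: "sqi f \<Longrightarrow> sqi g \<Longrightarrow> abs_lsq (\<lambda>x. f x + g x) = abs_lsq f + abs_lsq g"
  unfolding plus_lsq_def
  by (rule abs_lsq_eqI) (use rep_abs_lsq[of f] rep_abs_lsq[of g] in \<open>auto intro!: sqi_add sqi_rep\<close>)

lemma abs_lsq_diff: "sqi f \<Longrightarrow> sqi g \<Longrightarrow> abs_lsq (\<lambda>x. f x - g x) = abs_lsq f - abs_lsq g"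
  unfolding minus_lsq_def
  by (rule abs_lsq_eqI) (use rep_abs_lsq[of f] rep_abs_lsq[of g] in \<open>auto intro!: sqi_diff sqi_rep\<close>)

text \<open>Riesz-Fischer: a rapidly Cauchy subsequence converges almost everywhere, and Fatou's
  lemma shows that its pointwise limit is the norm limit of the whole sequence.\<close>

instance lsq :: (euclidean_space) complete_space
proof
  fix X :: "nat \<Rightarrow> 'a lsq" assume "Cauchy X"
  then have "\<forall>n::nat. \<exists>M. \<forall>m\<ge>M. \<forall>k\<ge>M. norm (X m - X k) < (1/4)^n"
    by (auto simp: Cauchy_def dist_norm)
  then obtain N where N: "\<And>n m k. m \<ge> N n \<Longrightarrow> k \<ge> N n \<Longrightarrow> norm (X m - X k) < (1/4)^n"
    by metis
  \<comment> \<open>Taking the maximum makes \<open>r k\<close> at least \<open>N n\<close> whenever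
    k \<ge> n, whatever the order of the values of \<open>N\<close>.\<close>
  define r where "r n = Max (N ` {..n})" for n
  have rN: "r k \<ge> N n" if "k \<ge> n" for k n
    unfolding r_def using that by (intro Max_ge) auto
  define f where "f n = rep_lsq (X (r n))" for n
  have f: "sqi (f n)" for n unfolding f_def by (rule sqi_rep)
  then have fm [measurable]: "f n \<in> borel_measurable lborel" for n by (simp add: sqi_def)
  have sq2: "((2::real)^n)\<^sup>2 = 4^n" and sq2': "((1/2::real)^n)\<^sup>2 = (1/4)^n" for n
    by (simp_all add: power2_eq_square flip: power_mult_distrib)
  define d where "d n x = f (Suc n) x - f n x" for n x
  have dm [measurable]: "d n \<in> borel_measurable lborel" for n unfolding d_def by measurable
  have diff: "(\<integral>\<^sup>+x. ennreal ((cmod (rep_lsq (X m) x - rep_lsq (X k) x))\<^sup>2) \<partial>lborel) = ennreal ((norm (X m - X k))\<^sup>2)" for m k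
    by (subst nn_integral_abs_lsq) (auto intro: sqi_diff sqi_rep simp: minus_lsq_def)
  \<comment> \<open>The increments have norm below (1/4)^n, so their squares can be weighted by 4^n
    and still leave the geometric series of ratio 1/4.\<close>
  have "(\<integral>\<^sup>+x. (\<Sum>n. ennreal (4^n * (cmod (d n x))\<^sup>2)) \<partial>lborel) = (\<Sum>n. \<integral>\<^sup>+x. ennreal (4^n * (cmod (d n x))\<^sup>2) \<partial>lborel)"
    by (rule nn_integral_suminf) measurable
  also have "\<dots> \<le> (\<Sum>n. ennreal ((1/4)^n))"
  proof (intro suminf_le summableI)
    fix n
    have "(\<integral>\<^sup>+x. ennreal (4^n * (cmod (d n x))\<^sup>2) \<partial>lborel) = ennreal (4^n) * (\<integral>\<^sup>+x. ennreal ((cmod (d n x))\<^sup>2) \<partial>lborel)"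
      by (subst nn_integral_cmult[symmetric]) (auto simp: ennreal_mult)
    also have "\<dots> = ennreal (4^n * (norm (X (r (Suc n)) - X (r n)))\<^sup>2)"
      unfolding d_def f_def diff by (simp add: ennreal_mult)
    also have "\<dots> \<le> ennreal (4^n * ((1/4)^n)\<^sup>2)"
      using N[of n "r (Suc n)" "r n"] rN
      by (intro ennreal_leI mult_left_mono power_mono) (auto simp: less_imp_le)
    also have "4^n * ((1/4)^n)\<^sup>2 = (1/4::real)^n"
      by (simp add: power2_eq_square power_divide)
    finally show "(\<integral>\<^sup>+x. ennreal (4^n * (cmod (d n x))\<^sup>2) \<partial>lborel) \<le> ennreal ((1/4)^n)" .
  qed
  also have "\<dots> = ennreal (\<Sum>n. (1/4)^n)"
    by (rule suminf_ennreal2) (auto intro!: summable_geometric)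
  also have "\<dots> < \<infinity>" by simp
  finally have "AE x in lborel. (\<Sum>n. ennreal (4^n * (cmod (d n x))\<^sup>2)) \<noteq> \<infinity>"
    by (intro nn_integral_noteq_infinite) (auto simp: less_top)
  then have conv: "AE x in lborel. convergent (\<lambda>n. f n x)"
  proof eventually_elim
    case (elim x)
    have "summable (\<lambda>n. 4^n * (cmod (d n x))\<^sup>2)"
      using elim by (intro summable_suminf_not_top) auto
    then have "summable (\<lambda>n. 4^n * (cmod (d n x))\<^sup>2 + (1/4::real)^n)"
      by (intro summable_add) (auto intro!: summable_geometric)
    then have "summable (\<lambda>n. norm (d n x))"
    proof (rule summable_comparison_test')
      fix n
      \<comment> \<open>The product of 2^n |d| and 2^(-n) is |d|, so square summability with weight
        4^n controls the plain sum of the increments.\<close>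
      have "2 * ((2^n * cmod (d n x)) * (1/2)^n) \<le> (2^n * cmod (d n x))\<^sup>2 + ((1/2)^n)\<^sup>2"
        using zero_le_power2[of "2^n * cmod (d n x) - (1/2)^n"] by (simp add: power2_eq_square algebra_simps)
      also have "\<dots> = 4^n * (cmod (d n x))\<^sup>2 + (1/4)^n"
        unfolding power_mult_distrib sq2 sq2' ..
      also have "2 * ((2^n * cmod (d n x)) * (1/2)^n) = 2 * cmod (d n x)"
        by (simp add: power_divide)
      finally have "2 * cmod (d n x) \<le> 4^n * (cmod (d n x))\<^sup>2 + (1/4::real)^n" .
      moreover have "norm (norm (d n x)) \<le> 2 * cmod (d n x)" by simp
      ultimately show "norm (norm (d n x)) \<le> 4^n * (cmod (d n x))\<^sup>2 + (1/4::real)^n" by linarith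
    qed
    then have "summable (\<lambda>n. f (Suc n) x - f n x)"
      unfolding d_def by (rule summable_norm_cancel)
    then have "convergent (\<lambda>n. \<Sum>i<n. f (Suc i) x - f i x)" by (simp add: summable_iff_convergent)
    then have "convergent (\<lambda>n. (f n x - f 0 x) + f 0 x)"
      using sum_lessThan_telescope[of "\<lambda>n. f n x"] by (intro convergent_add convergent_const) simp
    then show ?case by simp
  qed
  define F where "F x = lim (\<lambda>n. f n x)" for x
  have Fm [measurable]: "F \<in> borel_measurable lborel"
    unfolding F_def by (rule borel_measurable_lim_metric) measurable
  have lim: "AE x in lborel. (\<lambda>n. f n x) \<longlonglongrightarrow> F x"
    using conv by eventually_elim (simp add: F_def convergent_LIMSEQ_iff)
  \<comment> \<open>The comparison is with an arbitrary late member \<open>X m\<close>, not only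
    with members of the subsequence; this is what gives convergence of the full sequence.\<close>
  have fatou: "(\<integral>\<^sup>+x. ennreal ((cmod (rep_lsq (X m) x - F x))\<^sup>2) \<partial>lborel) \<le> ennreal (((1/4)^n)\<^sup>2)" if m: "m \<ge> N n" for m n
  proof -
    have [measurable]: "rep_lsq (X m) \<in> borel_measurable lborel" using sqi_rep[of "X m"] by (simp add: sqi_def)
    have "(\<integral>\<^sup>+x. ennreal ((cmod (rep_lsq (X m) x - F x))\<^sup>2) \<partial>lborel) =
          (\<integral>\<^sup>+x. liminf (\<lambda>k. ennreal ((cmod (rep_lsq (X m) x - f k x))\<^sup>2)) \<partial>lborel)"
    proof (rule nn_integral_cong_AE)
      show "AE x in lborel. ennreal ((cmod (rep_lsq (X m) x - F x))\<^sup>2) = liminf (\<lambda>k. ennreal ((cmod (rep_lsq (X m) x - f k x))\<^sup>2))"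
        using lim
      proof eventually_elim
        case (elim x)
        have "(\<lambda>k. ennreal ((cmod (rep_lsq (X m) x - f k x))\<^sup>2)) \<longlonglongrightarrow> ennreal ((cmod (rep_lsq (X m) x - F x))\<^sup>2)"
          by (intro tendsto_ennrealI tendsto_power tendsto_norm tendsto_diff tendsto_const elim)
        then show ?case by (rule lim_imp_Liminf[symmetric, OF sequentially_bot])
      qed
    qed
    also have "\<dots> \<le> liminf (\<lambda>k. \<integral>\<^sup>+x. ennreal ((cmod (rep_lsq (X m) x - f k x))\<^sup>2) \<partial>lborel)"
      by (rule nn_integral_liminf) measurable
    also have "\<dots> \<le> liminf (\<lambda>k. ennreal (((1/4)^n)\<^sup>2))"
    proof (rule Liminf_mono)
      show "\<forall>\<^sub>F k in sequentially. (\<integral>\<^sup>+x. ennreal ((cmod (rep_lsq (X m) x - f k x))\<^sup>2) \<partial>lborel) \<le> ennreal (((1/4)^n)\<^sup>2)"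
        using eventually_ge_at_top[of n]
      proof eventually_elim
        case (elim k)
        show ?case unfolding f_def diff
          using N[OF m rN[OF elim]] by (intro ennreal_leI power_mono) auto
      qed
    qed
    also have "\<dots> = ennreal (((1/4)^n)\<^sup>2)" by (simp add: Liminf_const)
    finally show ?thesis .
  qed
  have Fdiff: "sqi (\<lambda>x. rep_lsq (X (N 0)) x - F x)"
  proof (rule sqi_nn_integral)
    show "(\<lambda>x. rep_lsq (X (N 0)) x - F x) \<in> borel_measurable lborel"
      using sqi_rep[of "X (N 0)"] by (auto simp: sqi_def)
    show "(\<integral>\<^sup>+x. ennreal ((cmod (rep_lsq (X (N 0)) x - F x))\<^sup>2) \<partial>lborel) < \<infinity>"
      using fatou[of 0 "N 0"] by (auto intro: le_less_trans)
  qed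
  have F: "sqi F"
    using sqi_diff[OF sqi_rep[of "X (N 0)"] Fdiff] by simp
  have "X \<longlonglongrightarrow> abs_lsq F"
  proof (rule LIMSEQ_I)
    fix e :: real assume "e > 0"
    then obtain n where n: "(1/4::real)^n < e" using real_arch_pow_inv[of e "1/4"] by auto
    show "\<exists>no. \<forall>m\<ge>no. norm (X m - abs_lsq F) < e"
    proof (intro exI allI impI)
      fix m assume m: "N n \<le> m"
      have "X m - abs_lsq F = abs_lsq (\<lambda>x. rep_lsq (X m) x - F x)"
        by (simp add: abs_lsq_diff sqi_rep F abs_rep_lsq)
      then have "ennreal ((norm (X m - abs_lsq F))\<^sup>2) = (\<integral>\<^sup>+x. ennreal ((cmod (rep_lsq (X m) x - F x))\<^sup>2) \<partial>lborel)"
        by (simp add: nn_integral_abs_lsq sqi_diff sqi_rep F)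
      also have "\<dots> \<le> ennreal (((1/4)^n)\<^sup>2)" by (rule fatou[OF m])
      finally have "(norm (X m - abs_lsq F))\<^sup>2 \<le> ((1/4)^n)\<^sup>2" by simp
      then have "norm (X m - abs_lsq F) \<le> (1/4)^n" by (rule power2_le_imp_le) simp
      with n show "norm (X m - abs_lsq F) < e" by simp
    qed
  qed
  then show "convergent X" by (rule convergentI)
qed

instance lsq :: (euclidean_space) banach ..

lemma norm_abs_lsq_le:
  assumes "f \<in> borel_measurable lborel" "0 \<le> C" "(\<integral>\<^sup>+x. ennreal ((cmod (f x))\<^sup>2) \<partial>lborel) \<le> ennreal (C\<^sup>2)"
  shows "sqi f" "norm (abs_lsq f) \<le> C"
proof -
  show f: "sqi f" using assms by (intro sqi_nn_integral) (auto intro: le_less_trans)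
  then have "(norm (abs_lsq f))\<^sup>2 \<le> C\<^sup>2" using assms(3) by (simp add: nn_integral_abs_lsq)
  then show "norm (abs_lsq f) \<le> C" using assms(2) by (rule power2_le_imp_le)
qed

text \<open>Bilinear rather than Hermitian, because the duality identity of the Fourier transform
  contains no conjugate; complex-valued, so that unlike the inner product it keeps the imaginary
  part.\<close>

definition pair :: "('a::euclidean_space \<Rightarrow> complex) \<Rightarrow> 'a lsq \<Rightarrow> complex" where
  "pair g U = (LINT x|lborel. g x * rep_lsq U x)"

lemma pair_abs:
  assumes "sqi g" "sqi f" shows "pair g (abs_lsq f) = (LINT x|lborel. g x * f x)"
  unfolding pair_def
proof (rule integral_cong_AE)
  show "AE x in lborel. g x * rep_lsq (abs_lsq f) x = g x * f x"
    using rep_abs_lsq[OF assms(2)] by eventually_elim simp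
qed (use assms sqi_rep[of "abs_lsq f"] in \<open>auto simp: sqi_def\<close>)

text \<open>The inequality of the real inner product is applied to the classes of |f| and |g|, for
  which taking real parts loses nothing.\<close>

lemma sqi_Cauchy_Schwarz:
  assumes "sqi f" "sqi g"
  shows "(LINT x|lborel. cmod (f x) * cmod (g x)) \<le> norm (abs_lsq f) * norm (abs_lsq g)"
proof -
  let ?f = "\<lambda>x. complex_of_real (cmod (f x))" and ?g = "\<lambda>x. complex_of_real (cmod (g x))"
  have s: "sqi ?f" "sqi ?g" using assms by (auto simp: sqi_def)
  have n: "norm (abs_lsq ?f) = norm (abs_lsq f)" "norm (abs_lsq ?g) = norm (abs_lsq g)"
    by (rule power2_eq_imp_eq; simp add: norm_abs_lsq_sq s assms)+
  have "abs_lsq ?f \<bullet> abs_lsq ?g = Re (LINT x|lborel. ?f x * cnj (?g x))"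
    unfolding inner_lsq_def
  proof (intro arg_cong[of _ _ Re] integral_cong_AE)
    show "AE x in lborel. rep_lsq (abs_lsq ?f) x * cnj (rep_lsq (abs_lsq ?g) x) = ?f x * cnj (?g x)"
      using rep_abs_lsq[OF s(1)] rep_abs_lsq[OF s(2)] by eventually_elim simp
  qed (use s[THEN sqi_measurable] in measurable)
  also have "\<dots> = Re (LINT x|lborel. of_real (cmod (f x) * cmod (g x)))" by simp
  also have "\<dots> = (LINT x|lborel. cmod (f x) * cmod (g x))"
    by (simp only: integral_complex_of_real Re_complex_of_real)
  finally show ?thesis using norm_cauchy_schwarz[of "abs_lsq ?f" "abs_lsq ?g"] n by simp
qed

lemma norm_pair_le:
  assumes "sqi g" shows "cmod (pair g U) \<le> norm (abs_lsq g) * norm U"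
proof -
  have "cmod (pair g U) \<le> (LINT x|lborel. cmod (g x * rep_lsq U x))"
    unfolding pair_def by (rule integral_norm_bound)
  also have "\<dots> \<le> norm (abs_lsq g) * norm (abs_lsq (rep_lsq U))"
    unfolding norm_mult by (rule sqi_Cauchy_Schwarz[OF assms sqi_rep])
  finally show ?thesis by (simp add: abs_rep_lsq)
qed

lemma pair_add:
  assumes "sqi g" shows "pair g (U + V) = pair g U + pair g V"
proof -
  have "pair g (U + V) = (LINT x|lborel. g x * (rep_lsq U x + rep_lsq V x))"
    unfolding plus_lsq_def by (rule pair_abs[OF assms]) (intro sqi_add sqi_rep)
  then show ?thesis
    by (simp add: pair_def distrib_left sqi_mult_integrable assms sqi_rep)
qed

lemma pair_scaleR:
  assumes "sqi g" shows "pair g (c *\<^sub>R U) = c *\<^sub>R pair g U"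
proof -
  have "pair g (c *\<^sub>R U) = (LINT x|lborel. g x * (of_real c * rep_lsq U x))"
    unfolding scaleR_lsq_def by (rule pair_abs[OF assms]) (intro sqi_cmult sqi_rep)
  also have "\<dots> = (LINT x|lborel. of_real c * (g x * rep_lsq U x))" by (simp add: algebra_simps)
  finally show ?thesis by (simp add: pair_def scaleR_conv_of_real)
qed

lemma bounded_linear_pair: "sqi g \<Longrightarrow> bounded_linear (pair g)"
  by (rule bounded_linear_intro[where K="norm (abs_lsq g)"])
     (simp_all add: pair_add pair_scaleR norm_pair_le mult.commute[of "norm _" "norm (abs_lsq g)"])

definition lmult :: "('a::euclidean_space \<Rightarrow> complex) \<Rightarrow> 'a lsq \<Rightarrow> 'a lsq" where
  "lmult m U = abs_lsq (\<lambda>x. m x * rep_lsq U x)"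

lemma sqi_lmult:
  "m \<in> borel_measurable borel \<Longrightarrow> (\<And>x. cmod (m x) \<le> C) \<Longrightarrow> sqi (\<lambda>x. m x * rep_lsq U x)"
  by (rule sqi_mult_bounded[OF sqi_rep])

lemma rep_lmult:
  assumes "m \<in> borel_measurable borel" "\<And>x. cmod (m x) \<le> C"
  shows "AE x in lborel. rep_lsq (lmult m U) x = m x * rep_lsq U x"
  unfolding lmult_def by (rule rep_abs_lsq) (rule sqi_lmult[OF assms])

lemma lmult_abs:
  assumes "m \<in> borel_measurable borel" "\<And>x. cmod (m x) \<le> C" "sqi f"
  shows "lmult m (abs_lsq f) = abs_lsq (\<lambda>x. m x * f x)"
  unfolding lmult_def
  by (rule abs_lsq_eqI[OF sqi_lmult[OF assms(1,2)] sqi_mult_bounded[OF assms(3,1,2)]])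
     (use rep_abs_lsq[OF assms(3)] in auto)

lemma norm_lmult_le:
  assumes "m \<in> borel_measurable borel" "\<And>x. cmod (m x) \<le> C"
  shows "norm (lmult m U) \<le> C * norm U"
proof -
  have C: "0 \<le> C" using assms(2)[of 0] norm_ge_zero order_trans by blast
  have "(norm (lmult m U))\<^sup>2 = (LINT x|lborel. (cmod (m x * rep_lsq U x))\<^sup>2)"
    unfolding lmult_def by (rule norm_abs_lsq_sq) (rule sqi_lmult[OF assms])
  also have "\<dots> \<le> (LINT x|lborel. C\<^sup>2 * (cmod (rep_lsq U x))\<^sup>2)"
  proof (rule integral_mono)
    show "integrable lborel (\<lambda>x. (cmod (m x * rep_lsq U x))\<^sup>2)"
      by (rule sqi_sq_integrable) (rule sqi_lmult[OF assms])
    show "integrable lborel (\<lambda>x. C\<^sup>2 * (cmod (rep_lsq U x))\<^sup>2)"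
      using sqi_sq_integrable[OF sqi_rep[of U]] by simp
    show "(cmod (m x * rep_lsq U x))\<^sup>2 \<le> C\<^sup>2 * (cmod (rep_lsq U x))\<^sup>2" for x
      unfolding norm_mult power_mult_distrib by (intro mult_right_mono power_mono assms) auto
  qed
  also have "\<dots> = (C * norm U)\<^sup>2" by (simp add: norm_lsq_sq power_mult_distrib)
  finally show ?thesis by (rule power2_le_imp_le) (simp add: C)
qed

lemma lmult_add:
  assumes "m \<in> borel_measurable borel" "\<And>x. cmod (m x) \<le> C"
  shows "lmult m (U + V) = lmult m U + lmult m V"
  apply (rule lsq_eqI)
  using rep_lmult[OF assms, of "U+V"] rep_lmult[OF assms, of U] rep_lmult[OF assms, of V] rep_add[of U V] rep_add[of "lmult m U" "lmult m V"]
  by eventually_elim (simp add: algebra_simps)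

lemma lmult_scaleR:
  assumes "m \<in> borel_measurable borel" "\<And>x. cmod (m x) \<le> C"
  shows "lmult m (c *\<^sub>R U) = c *\<^sub>R lmult m U"
  apply (rule lsq_eqI)
  using rep_lmult[OF assms, of "c *\<^sub>R U"] rep_lmult[OF assms, of U] rep_scaleR[of c U] rep_scaleR[of c "lmult m U"]
  by eventually_elim (simp add: algebra_simps)

lemma bounded_linear_lmult:
  assumes "m \<in> borel_measurable borel" "\<And>x. cmod (m x) \<le> C"
  shows "bounded_linear (lmult m)"
  by (rule bounded_linear_intro[where K=C])
     (use lmult_add[OF assms] lmult_scaleR[OF assms] norm_lmult_le[OF assms] in \<open>auto simp: mult.commute\<close>)

lemma lmult_lmult:
  assumes "m \<in> borel_measurable borel" "\<And>x. cmod (m x) \<le> C" "l \<in> borel_measurable borel" "\<And>x. cmod (l x) \<le> D"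
  shows "lmult m (lmult l U) = lmult (\<lambda>x. m x * l x) U"
proof -
  have "cmod (m x * l x) \<le> C * D" for x
    unfolding norm_mult using order_trans[OF norm_ge_zero assms(2)] by (intro mult_mono assms) auto
  moreover have "(\<lambda>x. m x * l x) \<in> borel_measurable borel" using assms by simp
  ultimately show ?thesis
    apply (intro lsq_eqI)
    using rep_lmult[OF assms(1,2), of "lmult l U"] rep_lmult[OF assms(3,4), of U] rep_lmult[of "\<lambda>x. m x * l x" "C * D" U]
    by auto
qed

lemma lmult_one: "lmult (\<lambda>_. 1) U = U"
  by (simp add: lmult_def abs_rep_lsq)

text \<open>Multiplication operators converge strongly as soon as their symbols converge pointwise
  under a common bound: dominated convergence with majorant (2C)^2 |U|^2. This gives the density
  argument, the continuity of the evolution and the removal of frequency cut-offs.\<close>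

lemma tendsto_lmult:
  assumes "\<And>n. m n \<in> borel_measurable borel" "\<And>n x. cmod (m n x) \<le> C"
    "l \<in> borel_measurable borel" "\<And>x. cmod (l x) \<le> C" "\<And>x. (\<lambda>n. m n x) \<longlonglongrightarrow> l x"
  shows "(\<lambda>n. lmult (m n) U) \<longlonglongrightarrow> lmult l U"
proof -
  have bd: "cmod (m n x - l x) \<le> 2 * C" for n x
    using norm_triangle_ineq4[of "m n x" "l x"] assms(2)[of n x] assms(4)[of x] by simp
  have s: "sqi (\<lambda>x. (m n x - l x) * rep_lsq U x)" for n
    by (rule sqi_mult_bounded[OF sqi_rep _ bd]) (use assms in simp)
  have eq: "lmult (m n) U - lmult l U = abs_lsq (\<lambda>x. (m n x - l x) * rep_lsq U x)" for n
    unfolding lmult_def using sqi_lmult[OF assms(1) assms(2), of n U] sqi_lmult[OF assms(3,4), of U]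
    by (simp add: abs_lsq_diff[symmetric] left_diff_distrib)
  have "(\<lambda>n. LINT x|lborel. (cmod ((m n x - l x) * rep_lsq U x))\<^sup>2) \<longlonglongrightarrow> (LINT x::'a|lborel. 0)"
  proof (rule integral_dominated_convergence[where w="\<lambda>x. (2*C)\<^sup>2 * (cmod (rep_lsq U x))\<^sup>2"])
    show "integrable lborel (\<lambda>x. (2*C)\<^sup>2 * (cmod (rep_lsq U x))\<^sup>2)"
      using sqi_sq_integrable[OF sqi_rep[of U]] by simp
    show "AE x in lborel. (\<lambda>n. (cmod ((m n x - l x) * rep_lsq U x))\<^sup>2) \<longlonglongrightarrow> 0"
    proof (intro AE_I2)
      fix x
      have "(\<lambda>n. (cmod ((m n x - l x) * rep_lsq U x))\<^sup>2) \<longlonglongrightarrow> (cmod ((l x - l x) * rep_lsq U x))\<^sup>2"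
        by (intro tendsto_power tendsto_norm tendsto_mult tendsto_diff assms tendsto_const)
      then show "(\<lambda>n. (cmod ((m n x - l x) * rep_lsq U x))\<^sup>2) \<longlonglongrightarrow> 0" by simp
    qed
    show "AE x in lborel. norm ((cmod ((m n x - l x) * rep_lsq U x))\<^sup>2) \<le> (2*C)\<^sup>2 * (cmod (rep_lsq U x))\<^sup>2" for n
      unfolding norm_mult power_mult_distrib
      by (intro AE_I2) (simp del: power_mult_distrib, intro mult_right_mono order_trans[OF power_mono[OF bd]], auto)
    show "(\<lambda>x. (cmod ((m n x - l x) * rep_lsq U x))\<^sup>2) \<in> borel_measurable lborel" for n
      by (rule borel_measurable_integrable) (rule sqi_sq_integrable[OF s])
  qed simp
  then have "(\<lambda>n. (norm (lmult (m n) U - lmult l U))\<^sup>2) \<longlonglongrightarrow> 0"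
    by (simp add: eq norm_abs_lsq_sq s)
  then have "(\<lambda>n. sqrt ((norm (lmult (m n) U - lmult l U))\<^sup>2)) \<longlonglongrightarrow> sqrt 0"
    by (rule tendsto_real_sqrt)
  then have "(\<lambda>n. norm (lmult (m n) U - lmult l U)) \<longlonglongrightarrow> 0" by simp
  then show ?thesis by (simp add: tendsto_norm_zero_iff LIM_zero_iff)
qed

section \<open>Plancherel's theorem\<close>

definition interval_FT :: "real \<Rightarrow> real \<Rightarrow> real \<Rightarrow> complex" where
  "interval_FT a b t = (LINT x|lborel. indicator {a..b} x * cis (- (x * t)))"

lemma borel_measurable_cis [measurable (raw)]:
  "f \<in> borel_measurable M \<Longrightarrow> (\<lambda>x. cis (f x)) \<in> borel_measurable M"
  by (rule borel_measurable_continuous_on[where f=cis]) (auto simp: cis_conv_exp intro!: continuous_intros)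

lemma integrable_indicator_cis:
  "integrable lborel (\<lambda>x. indicator {a..b} x * cis (g x) :: complex)" if [measurable]: "g \<in> borel_measurable borel" for g :: "real \<Rightarrow> real"
proof (rule Bochner_Integration.integrable_bound)
  show "integrable lborel (indicator {a..b} :: real \<Rightarrow> real)"
    by (simp add: integrable_indicator_iff emeasure_lborel_Icc_eq)
qed (auto simp: norm_mult indicator_def)

lemma interval_FT_measurable [measurable]: "interval_FT a b \<in> borel_measurable borel"
  unfolding interval_FT_def[abs_def] by measurable

lemma interval_FT_empty: "b \<le> a \<Longrightarrow> interval_FT a b t = 0"
  unfolding interval_FT_def
proof (rule integral_eq_zero_AE)
  assume "b \<le> a"
  then show "AE x in lborel. indicator {a..b} x * cis (- (x * t)) = 0"
    by (intro eventually_mono[OF AE_lborel_singleton[of a]]) (auto simp: indicator_def)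
qed

lemma interval_FT_eq:
  assumes "a \<le> b" "t \<noteq> 0"
  shows "interval_FT a b t = (iexp (- (t * a)) - iexp (- (t * b))) / (\<i> * t)"
proof -
  have "(\<integral>x. indicator {a .. b} x *\<^sub>R cis (- (x * t)) \<partial>lborel) = - iexp (- (t * b)) / (\<i> * t) - (- iexp (- (t * a)) / (\<i> * t))"
  proof (rule integral_FTC_Icc[OF assms(1)])
    fix x
    show "((\<lambda>x. - iexp (- (t * x)) / (\<i> * t)) has_vector_derivative cis (- (x * t))) (at x within {a..b})"
    proof -
      have "((\<lambda>z. - exp (- (\<i> * t * z)) / (\<i> * t)) has_field_derivative exp (- (\<i> * t * of_real x))) (at (of_real x))"
        using assms(2) by (auto intro!: derivative_eq_intros simp: field_simps)
      from has_vector_derivative_real_field[OF this, of "{a..b}"]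
      show ?thesis by (simp add: cis_conv_exp mult_ac)
    qed
  qed (auto simp: cis_conv_exp intro!: continuous_intros)
  moreover have "indicator {a .. b} x *\<^sub>R cis (- (x * t)) = indicator {a .. b} x * cis (- (x * t))" for x
    by (simp add: indicator_def)
  ultimately show ?thesis by (simp add: interval_FT_def diff_divide_distrib)
qed

text \<open>Two elementary bounds are added: the length of the interval bounds the transform itself,
  and the explicit primitive bounds t times the transform by 2. Together they give decay like 1 / (1
  + t^2) for the square, hence square integrability.\<close>

lemma interval_FT_bound: "(1 + t\<^sup>2) * (cmod (interval_FT a b t))\<^sup>2 \<le> (b - a)\<^sup>2 + 4"
proof (cases "a \<le> b")
  case True
  have 1: "cmod (interval_FT a b t) \<le> b - a"
  proof -
    have "cmod (interval_FT a b t) \<le> (LINT x|lborel. cmod (indicator {a..b} x * cis (- (x * t))))"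
      unfolding interval_FT_def by (rule integral_norm_bound)
    also have "\<dots> = (LINT x|lborel. indicator {a..b} x)"
      by (intro Bochner_Integration.integral_cong) (auto simp: norm_mult indicator_def)
    finally show ?thesis using True by simp
  qed
  have 2: "t\<^sup>2 * (cmod (interval_FT a b t))\<^sup>2 \<le> 2\<^sup>2"
  proof (cases "t = 0")
    case False
    then have "\<bar>t\<bar> * cmod (interval_FT a b t) = cmod (iexp (- (t * a)) - iexp (- (t * b)))"
      unfolding interval_FT_eq[OF True False] by (simp add: norm_divide norm_mult)
    also have "\<dots> \<le> cmod (iexp (- (t * a))) + cmod (iexp (- (t * b)))"
      by (rule norm_triangle_ineq4)
    also have "\<dots> = 2"
    proof -
      have "cmod (iexp x) = 1" for x :: real by simp
      from this[of "- (t * a)"] this[of "- (t * b)"] show ?thesis by simp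
    qed
    finally have "(\<bar>t\<bar> * cmod (interval_FT a b t))\<^sup>2 \<le> 2\<^sup>2" by (intro power_mono) auto
    then show ?thesis by (simp add: power_mult_distrib)
  qed simp
  have "(cmod (interval_FT a b t))\<^sup>2 \<le> (b - a)\<^sup>2" using 1 by (intro power_mono) auto
  with 2 show ?thesis by (simp add: algebra_simps)
qed (simp add: interval_FT_empty)

lemma integrable_inverse_1_plus_square_real: "integrable lborel (\<lambda>t::real. inverse (1 + t\<^sup>2))"
  using integrable_inverse_1_plus_square
  by (simp add: set_integrable_def einterval_eq_UNIV)

lemma sqi_interval_FT: "sqi (interval_FT a b)"
  unfolding sqi_def
proof
  show "integrable lborel (\<lambda>x. (cmod (interval_FT a b x))\<^sup>2)"
  proof (rule Bochner_Integration.integrable_bound)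
    show "integrable lborel (\<lambda>t. ((b - a)\<^sup>2 + 4) * inverse (1 + t\<^sup>2))"
      using integrable_inverse_1_plus_square_real by simp
    show "AE t in lborel. norm ((cmod (interval_FT a b t))\<^sup>2) \<le> norm (((b - a)\<^sup>2 + 4) * inverse (1 + t\<^sup>2))"
    proof (intro AE_I2)
      fix t :: real
      have "0 < 1 + t\<^sup>2" by (simp add: add_pos_nonneg)
      then show "norm ((cmod (interval_FT a b t))\<^sup>2) \<le> norm (((b - a)\<^sup>2 + 4) * inverse (1 + t\<^sup>2))"
        using interval_FT_bound[of t a b] by (simp add: field_simps)
    qed
  qed measurable
qed measurable

text \<open>Levy's inversion formula for the uniform law on {c..d}: its characteristic function is
  the conjugate of \<open>interval_FT c d\<close> divided by d - c, and the kernel of the formula is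
  \<open>interval_FT a b\<close>. As the product of the two transforms is integrable, the limit over
  symmetric intervals is an ordinary integral.\<close>

lemma Parseval_interval_aux:
  assumes "a \<le> b" "c < d"
  shows "(LINT t|lborel. interval_FT a b t * cnj (interval_FT c d t)) = 2 * pi * (LINT x|lborel. indicator {a..b} x * indicator {c..d} x)"
proof -
  define M where "M = uniform_measure lborel {c..d}"
  interpret M: prob_space M unfolding M_def
    using assms by (intro prob_space_uniform_measure) auto
  interpret real_distribution M
    by standard (auto simp: M_def)
  have em: "emeasure lborel {c..d} = ennreal (d - c)" using assms by simp
  have ch: "char M t = cnj (interval_FT c d t) / (d - c)" for t
  proof -
    have "M = density lborel (\<lambda>x. ennreal (indicator {c..d} x / (d - c)))"
      unfolding M_def uniform_measure_def em using assms
      by (intro density_cong) (auto simp: indicator_def divide_ennreal simp flip: ennreal_1 )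
    then have "char M t = (LINT x|lborel. (indicator {c..d} x / (d - c)) *\<^sub>R iexp (t * x))"
      unfolding char_def using assms by (simp add: integral_density)
    also have "\<dots> = (LINT x|lborel. cnj (indicator {c..d} x * cis (- (x * t))) / (d - c))"
      by (intro Bochner_Integration.integral_cong)
         (auto simp: indicator_def scaleR_conv_of_real cis_conv_exp exp_cnj mult.commute)
    also have "\<dots> = cnj (interval_FT c d t) / (d - c)"
      unfolding interval_FT_def Bochner_Integration.integral_cnj[symmetric] by (simp del: Bochner_Integration.integral_cnj)
    finally show ?thesis .
  qed
  \<comment> \<open>Levy inversion asks for endpoints without mass; the uniform law has no
    atoms.\<close>
  have "measure M {x} = 0" for x
    unfolding M_def using assms by (subst measure_uniform_measure) (auto simp: measure_def Int_insert_right)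
  from Levy_Inversion[OF assms(1) this this]
  have lim1: "(\<lambda>T::nat. 1 / (2 * pi) * (CLBINT t=-T..T. (iexp (-(t * a)) - iexp (-(t * b))) / (\<i> * t) * char M t))
    \<longlonglongrightarrow> measure M {a<..b}" .
  have int: "integrable lborel (\<lambda>t. interval_FT a b t * cnj (interval_FT c d t))"
    by (intro sqi_mult_integrable sqi_cnj sqi_interval_FT)
  have eq: "(CLBINT t=-real T..real T. (iexp (-(t * a)) - iexp (-(t * b))) / (\<i> * t) * char M t)
     = (LINT t|lborel. indicator {-real T<..<real T} t *\<^sub>R (interval_FT a b t * cnj (interval_FT c d t))) / (d - c)" for T :: nat
  proof -
    have "(CLBINT t=-real T..real T. (iexp (-(t * a)) - iexp (-(t * b))) / (\<i> * t) * char M t)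
      = (LINT t|lborel. indicator {-real T<..<real T} t *\<^sub>R ((iexp (-(t * a)) - iexp (-(t * b))) / (\<i> * t) * char M t))"
      by (simp add: interval_lebesgue_integral_def set_lebesgue_integral_def)
    also have "\<dots> = (LINT t|lborel. indicator {-real T<..<real T} t *\<^sub>R (interval_FT a b t * cnj (interval_FT c d t)) / (d - c))"
    proof (rule integral_cong_AE)
      \<comment> \<open>The closed form of \<open>interval_FT\<close> needs t \<noteq> 0. At 0 the
        quotient is 0 by the convention for division, so the two integrands agree only almost
        everywhere.\<close>
      show "AE t in lborel. indicator {-real T<..<real T} t *\<^sub>R ((iexp (-(t * a)) - iexp (-(t * b))) / (\<i> * t) * char M t)
        = indicator {-real T<..<real T} t *\<^sub>R (interval_FT a b t * cnj (interval_FT c d t)) / (d - c)"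
        using AE_lborel_singleton[of 0]
        by eventually_elim (simp add: ch interval_FT_eq[OF assms(1)] scaleR_conv_of_real)
    qed (simp_all add: ch)
    finally show ?thesis by simp
  qed
  have lim2: "(\<lambda>T::nat. LINT t|lborel. indicator {-real T<..<real T} t *\<^sub>R (interval_FT a b t * cnj (interval_FT c d t)))
     \<longlonglongrightarrow> (LINT t|lborel. interval_FT a b t * cnj (interval_FT c d t))"
  proof (rule integral_dominated_convergence[where w="\<lambda>t. norm (interval_FT a b t * cnj (interval_FT c d t))"])
    show "AE t in lborel. (\<lambda>T. indicator {-real T<..<real T} t *\<^sub>R (interval_FT a b t * cnj (interval_FT c d t)))
         \<longlonglongrightarrow> interval_FT a b t * cnj (interval_FT c d t)"
    proof (intro AE_I2 tendsto_eventually)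
      fix t :: real
      obtain n :: nat where n: "\<bar>t\<bar> < real n" using reals_Archimedean2 by blast
      show "\<forall>\<^sub>F T in sequentially. indicator {-real T<..<real T} t *\<^sub>R (interval_FT a b t * cnj (interval_FT c d t)) = interval_FT a b t * cnj (interval_FT c d t)"
        using eventually_ge_at_top[of n] by eventually_elim (use n in \<open>auto simp: indicator_def\<close>)
    qed
    show "integrable lborel (\<lambda>t. norm (interval_FT a b t * cnj (interval_FT c d t)))" using int by (rule integrable_norm)
  qed (auto simp: indicator_def)
  have "(\<lambda>T::nat. 1 / (2 * pi) * ((LINT t|lborel. indicator {-real T<..<real T} t *\<^sub>R (interval_FT a b t * cnj (interval_FT c d t))) / (d - c)))
    \<longlonglongrightarrow> 1 / (2 * pi) * ((LINT t|lborel. interval_FT a b t * cnj (interval_FT c d t)) / (d - c))"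
    using assms by (intro tendsto_intros lim2) auto
  moreover have "(\<lambda>T::nat. 1 / (2 * pi) * ((LINT t|lborel. indicator {-real T<..<real T} t *\<^sub>R (interval_FT a b t * cnj (interval_FT c d t))) / (d - c)))
    \<longlonglongrightarrow> measure M {a<..b}"
    using lim1 unfolding eq[symmetric] by simp
  ultimately have "1 / (2 * pi) * ((LINT t|lborel. interval_FT a b t * cnj (interval_FT c d t)) / (d - c)) = complex_of_real (measure M {a<..b})"
    by (rule LIMSEQ_unique)
  also have "measure M {a<..b} = measure lborel ({c..d} \<inter> {a<..b}) / (d - c)"
    unfolding M_def using assms by (subst measure_uniform_measure) auto
  also have "measure lborel ({c..d} \<inter> {a<..b}) = (LINT x|lborel. indicator {a..b} x * indicator {c..d} x)"
  proof -
    \<comment> \<open>Inversion yields the half-open interval; the left end \<open>a\<close> is a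
      null set.\<close>
    have "(LINT x|lborel. indicator {a..b} x * indicator {c..d} x) = (LINT x|lborel. indicator ({c..d} \<inter> {a<..b}) x :: real)"
      by (rule integral_cong_AE; measurable?)
         (use AE_lborel_singleton[of a] in eventually_elim, auto simp: indicator_def)
    then show ?thesis by simp
  qed
  finally have eq1: "1 / (2 * pi) * ((LINT t|lborel. interval_FT a b t * cnj (interval_FT c d t)) / (d - c)) = complex_of_real ((LINT x|lborel. indicator {a..b} x * indicator {c..d} x) / (d - c))" .
  have "d - c \<noteq> 0" using assms by simp
  then have "complex_of_real d - complex_of_real c \<noteq> 0" by (metis of_real_diff of_real_eq_0_iff)
  have cancel: "X = 2 * of_real pi * Y" if "1 / (2 * of_real pi) * (X / w) = Y / w" "w \<noteq> 0" for X Y w :: complex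
  proof -
    have "(1 / (2 * of_real pi) * X) / w = Y / w" using that(1) by simp
    then have "1 / (2 * of_real pi) * X = Y" using that(2) by (simp only: divide_cancel_right) simp
    then show ?thesis by (simp add: field_simps)
  qed
  have "1 / (2 * of_real pi) * ((LINT t|lborel. interval_FT a b t * cnj (interval_FT c d t)) / (of_real d - of_real c)) = complex_of_real (LINT x|lborel. indicator {a..b} x * indicator {c..d} x) / (of_real d - of_real c)"
    using eq1 by (simp only: of_real_mult of_real_divide of_real_diff of_real_numeral of_real_1)
  from cancel[OF this \<open>complex_of_real d - complex_of_real c \<noteq> 0\<close>] show ?thesis
    by (simp only: of_real_mult of_real_numeral)
qed

text \<open>Degenerate intervals have to be covered because an arbitrary \<open>cbox\<close> may be
  flat or empty. Both sides vanish there, the right one because at most a single point of overlap is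
  left.\<close>

lemma Parseval_interval:
  "(LINT t|lborel. interval_FT a b t * cnj (interval_FT c d t)) = of_real (2 * pi) * (LINT x|lborel. indicator {a..b} x * indicator {c..d} x)"
proof (cases "a \<le> b \<and> c < d")
  case True
  have "(LINT x|lborel. indicator {a..b} x * indicator {c..d} x :: complex) = (LINT x|lborel. complex_of_real (indicator {a..b} x * indicator {c..d} x))"
    by (intro Bochner_Integration.integral_cong) (auto simp: indicator_def)
  also have "\<dots> = of_real (LINT x|lborel. indicator {a..b} x * indicator {c..d} x)"
    by (rule integral_complex_of_real)
  finally show ?thesis using Parseval_interval_aux[of a b c d] True by simp
next
  case False
  have "(LINT x|lborel. indicator {a..b} x * indicator {c..d} x :: complex) = 0"
    by (rule integral_eq_zero_AE, use AE_lborel_singleton[of c] in eventually_elim)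
       (use False in \<open>auto simp: indicator_def\<close>)
  moreover have "interval_FT a b t * cnj (interval_FT c d t) = 0" for t
    using False by (auto simp: interval_FT_empty not_le not_less)
  ultimately show ?thesis by (simp only: mult_zero_right Bochner_Integration.integral_zero)
qed

section \<open>Products over coordinates and Parseval's identity for boxes\<close>

lemma
  fixes f :: "'a::euclidean_space \<Rightarrow> real \<Rightarrow> complex"
  assumes "\<And>b. b \<in> Basis \<Longrightarrow> integrable lborel (f b)"
  shows integrable_lborel_prod: "integrable lborel (\<lambda>x::'a. \<Prod>b\<in>Basis. f b (x \<bullet> b))"
    and integral_lborel_prod: "(LINT x::'a|lborel. (\<Prod>b\<in>Basis. f b (x \<bullet> b))) = (\<Prod>b\<in>Basis. LINT t|lborel. f b t)"
proof -
  interpret product_sigma_finite "\<lambda>_::'a. lborel :: real measure"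
    by standard
  have meas [measurable]: "(\<lambda>g. \<Sum>b\<in>Basis. g b *\<^sub>R b :: 'a) \<in> measurable (Pi\<^sub>M Basis (\<lambda>_. lborel)) borel"
    by measurable
  have [measurable]: "f b \<in> borel_measurable borel" if "b \<in> Basis" for b
    using borel_measurable_integrable[OF assms[OF that]] by simp
  have eq: "(\<Prod>b\<in>Basis. f b ((\<Sum>b\<in>Basis. g b *\<^sub>R b) \<bullet> b)) = (\<Prod>b\<in>Basis. f b (g b))" for g :: "'a \<Rightarrow> real"
    by (intro prod.cong refl) simp
  show "integrable lborel (\<lambda>x::'a. \<Prod>b\<in>Basis. f b (x \<bullet> b))"
    by (subst lborel_eq, subst integrable_distr_eq)
       (auto simp: eq intro!: product_integrable_prod assms)
  show "(LINT x::'a|lborel. (\<Prod>b\<in>Basis. f b (x \<bullet> b))) = (\<Prod>b\<in>Basis. LINT t|lborel. f b t)"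
    by (subst lborel_eq, subst integral_distr)
       (auto simp: eq intro!: product_integral_prod assms)
qed

lemma subspace_closure:
  fixes S :: "'b::real_normed_vector set"
  assumes "subspace S" shows "subspace (closure S)"
proof (rule subspaceI)
  show "0 \<in> closure S" using subspace_0[OF assms] closure_subset by blast
next
  fix x y assume "x \<in> closure S" "y \<in> closure S"
  then obtain f g where "\<And>n. f n \<in> S" "f \<longlonglongrightarrow> x" "\<And>n. g n \<in> S" "g \<longlonglongrightarrow> y"
    unfolding closure_sequential by metis
  then show "x + y \<in> closure S"
    unfolding closure_sequential
    by (intro exI[of _ "\<lambda>n::nat. f n + g n"]) (auto intro!: tendsto_add subspace_add[OF assms])
next
  fix c x assume "x \<in> closure S"
  then obtain f where "\<And>n. f n \<in> S" "f \<longlonglongrightarrow> x"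
    unfolding closure_sequential by metis
  then show "c *\<^sub>R x \<in> closure S"
    unfolding closure_sequential
    by (intro exI[of _ "\<lambda>n::nat. c *\<^sub>R f n"]) (auto intro!: tendsto_scaleR subspace_scale[OF assms])
qed

lemma cis_sum: "finite I \<Longrightarrow> cis (\<Sum>i\<in>I. f i) = (\<Prod>i\<in>I. cis (f i))"
  by (induction I rule: finite_induct) (simp_all flip: cis_mult)

lemma indicator_cbox_prod:
  "(indicator (cbox a b) x :: complex) = (\<Prod>i\<in>Basis. indicator {a \<bullet> i..b \<bullet> i} (x \<bullet> i))"
proof (cases "x \<in> cbox a b")
  case True
  then have "(\<Prod>i\<in>Basis. indicator {a \<bullet> i..b \<bullet> i} (x \<bullet> i) :: complex) = (\<Prod>i\<in>(Basis::'a set). 1)"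
    by (intro prod.cong) (auto simp: mem_box)
  with True show ?thesis by simp
next
  case False
  then obtain i where "i \<in> Basis" "indicator {a \<bullet> i..b \<bullet> i} (x \<bullet> i) = (0::complex)"
    by (auto simp: mem_box indicator_def)
  then have "(\<Prod>i\<in>Basis. indicator {a \<bullet> i..b \<bullet> i} (x \<bullet> i) :: complex) = 0"
    by (intro prod_zero) auto
  with False show ?thesis by simp
qed

lemma sqi_indicator:
  assumes "A \<in> sets borel" "emeasure lborel A < \<infinity>"
  shows "sqi (indicator A :: 'a::euclidean_space \<Rightarrow> complex)"
proof (rule sqi_nn_integral)
  have "(\<integral>\<^sup>+x. ennreal ((cmod (indicator A x))\<^sup>2) \<partial>lborel) = (\<integral>\<^sup>+x. indicator A x \<partial>lborel)"
    by (intro nn_integral_cong) (auto simp: indicator_def)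
  also have "\<dots> < \<infinity>" using assms by simp
  finally show "(\<integral>\<^sup>+x. ennreal ((cmod (indicator A x))\<^sup>2) \<partial>lborel) < \<infinity>" .
qed (use assms in simp)

lemma integrable_indicator_complex:
  assumes "A \<in> sets borel" "emeasure lborel A < \<infinity>"
  shows "integrable lborel (indicator A :: 'a::euclidean_space \<Rightarrow> complex)"
proof (rule Bochner_Integration.integrable_bound)
  show "integrable lborel (indicator A :: 'a \<Rightarrow> real)" using assms by (simp add: integrable_indicator_iff)
qed (use assms in \<open>auto simp: indicator_def\<close>)

lemma emeasure_cbox_finite: "emeasure lborel (cbox a b :: 'a::euclidean_space set) < \<infinity>"
  using emeasure_lborel_cbox_finite[of a b] by simp

lemmas sqi_cbox = sqi_indicator[OF borel_closed[OF closed_cbox] emeasure_cbox_finite]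
lemmas integrable_cbox = integrable_indicator_complex[OF borel_closed[OF closed_cbox] emeasure_cbox_finite]

lemma fourier1_cbox:
  fixes a b :: "real^'n"
  shows "fourier1 (indicator (cbox a b)) \<xi> = (\<Prod>i\<in>Basis. interval_FT (a \<bullet> i) (b \<bullet> i) (\<xi> \<bullet> i))"
proof -
  have "fourier1 (indicator (cbox a b)) \<xi> =
      (LINT x|lborel. (\<Prod>i\<in>Basis. indicator {a \<bullet> i..b \<bullet> i} (x \<bullet> i) * cis (- ((x \<bullet> i) * (\<xi> \<bullet> i)))))"
    unfolding fourier1_def
  proof (intro Bochner_Integration.integral_cong refl)
    fix x :: "real^'n"
    have "- (x \<bullet> \<xi>) = (\<Sum>i\<in>Basis. - ((x \<bullet> i) * (\<xi> \<bullet> i)))"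
      by (simp add: euclidean_inner[of x \<xi>] sum_negf)
    then have "cis (- (x \<bullet> \<xi>)) = (\<Prod>i\<in>Basis. cis (- ((x \<bullet> i) * (\<xi> \<bullet> i))))"
      by (simp only: cis_sum[OF finite_Basis])
    then show "indicator (cbox a b) x * cis (- (x \<bullet> \<xi>)) = (\<Prod>i\<in>Basis. indicator {a \<bullet> i..b \<bullet> i} (x \<bullet> i) * cis (- ((x \<bullet> i) * (\<xi> \<bullet> i))))"
      by (simp only: indicator_cbox_prod prod.distrib)
  qed
  also have "\<dots> = (\<Prod>i\<in>Basis. LINT t|lborel. indicator {a \<bullet> i..b \<bullet> i} t * cis (- (t * (\<xi> \<bullet> i))))"
    by (rule integral_lborel_prod[where f="\<lambda>i t. indicator {a \<bullet> i..b \<bullet> i} t * cis (- (t * (\<xi> \<bullet> i)))"]) (intro integrable_indicator_cis, measurable)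
  finally show ?thesis by (simp add: interval_FT_def)
qed

lemma fourier1_measurable [measurable]:
  assumes [measurable]: "f \<in> borel_measurable borel"
  shows "fourier1 f \<in> borel_measurable borel"
  unfolding fourier1_def[abs_def] by measurable

lemma
  fixes a b c d :: "real^'n"
  defines "A \<equiv> fourier1 (indicator (cbox a b))" and "B \<equiv> fourier1 (indicator (cbox c d))"
  shows integrable_Parseval_cbox: "integrable lborel (\<lambda>\<xi>. A \<xi> * cnj (B \<xi>))"
    and Parseval_cbox: "(LINT \<xi>|lborel. A \<xi> * cnj (B \<xi>)) = of_real ((2 * pi) ^ CARD('n)) * (LINT x|lborel. indicator (cbox a b) x * indicator (cbox c d) x)"
proof -
  let ?f = "\<lambda>(i::real^'n) t. interval_FT (a \<bullet> i) (b \<bullet> i) t * cnj (interval_FT (c \<bullet> i) (d \<bullet> i) t)"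
  let ?g = "\<lambda>(i::real^'n) t. indicator {a \<bullet> i..b \<bullet> i} t * indicator {c \<bullet> i..d \<bullet> i} t :: complex"
  have eq: "A \<xi> * cnj (B \<xi>) = (\<Prod>i\<in>Basis. ?f i (\<xi> \<bullet> i))" for \<xi>
    by (simp add: A_def B_def fourier1_cbox prod.distrib)
  have f: "integrable lborel (?f i)" for i
    by (intro sqi_mult_integrable sqi_cnj sqi_interval_FT)
  have g: "integrable lborel (?g i)" for i
    using sqi_mult_integrable[OF sqi_cbox[of "a \<bullet> i" "b \<bullet> i"] sqi_cbox[of "c \<bullet> i" "d \<bullet> i"]] by (simp add: cbox_interval)
  show "integrable lborel (\<lambda>\<xi>. A \<xi> * cnj (B \<xi>))"
    unfolding eq using integrable_lborel_prod[where f="?f"] f by blast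
  have "(LINT \<xi>|lborel. A \<xi> * cnj (B \<xi>)) = (\<Prod>i\<in>Basis. LINT t|lborel. ?f i t)"
    unfolding eq using integral_lborel_prod[where f="?f"] f by blast
  also have "\<dots> = (\<Prod>i\<in>(Basis::(real^'n) set). of_real (2 * pi) * (LINT t|lborel. ?g i t))"
    by (simp only: Parseval_interval)
  also have "\<dots> = of_real ((2 * pi) ^ CARD('n)) * (\<Prod>i\<in>(Basis::(real^'n) set). LINT t|lborel. ?g i t)"
    by (simp add: prod.distrib)
  also have "(\<Prod>i\<in>(Basis::(real^'n) set). LINT t|lborel. ?g i t) = (LINT x::real^'n|lborel. (\<Prod>i\<in>Basis. ?g i (x \<bullet> i)))"
    using integral_lborel_prod[where f="?g"] g by (metis (no_types, lifting))
  also have "\<dots> = (LINT x|lborel. indicator (cbox a b) x * indicator (cbox c d) x)"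
    by (simp only: indicator_cbox_prod prod.distrib)
  finally show "(LINT \<xi>|lborel. A \<xi> * cnj (B \<xi>)) = of_real ((2 * pi) ^ CARD('n)) * (LINT x|lborel. indicator (cbox a b) x * indicator (cbox c d) x)" .
qed

lemma sqi_fourier1_cbox: "sqi (fourier1 (indicator (cbox a b)))"
  unfolding sqi_def
proof
  show "fourier1 (indicator (cbox a b)) \<in> borel_measurable lborel" by measurable
  have "integrable lborel (\<lambda>\<xi>. Re (fourier1 (indicator (cbox a b)) \<xi> * cnj (fourier1 (indicator (cbox a b)) \<xi>)))"
    by (rule integrable_Re[OF integrable_Parseval_cbox])
  then show "integrable lborel (\<lambda>x. (cmod (fourier1 (indicator (cbox a b)) x))\<^sup>2)"
    by (simp only: complex_norm_square[symmetric] of_real_power[symmetric] Re_complex_of_real)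
qed

lemma inner_abs_lsq:
  assumes "sqi f" "sqi g" shows "abs_lsq f \<bullet> abs_lsq g = Re (LINT x|lborel. f x * cnj (g x))"
  unfolding inner_lsq_def
proof (intro arg_cong[of _ _ Re] integral_cong_AE)
  show "AE x in lborel. rep_lsq (abs_lsq f) x * cnj (rep_lsq (abs_lsq g) x) = f x * cnj (g x)"
    using rep_abs_lsq[OF assms(1)] rep_abs_lsq[OF assms(2)] by eventually_elim simp
qed (use assms[THEN sqi_measurable] in measurable)

text \<open>The complex coefficient is part of the generator because \<open>span\<close> is taken
  over the reals: real combinations of these classes are all complex step functions.\<close>

definition cbox_lsq :: "complex \<Rightarrow> real^'n \<Rightarrow> real^'n \<Rightarrow> (real^'n) lsq" where
  "cbox_lsq c a b = abs_lsq (\<lambda>x. c * indicator (cbox a b) x)"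

definition cbox_FT :: "complex \<Rightarrow> real^'n \<Rightarrow> real^'n \<Rightarrow> (real^'n) lsq" where
  "cbox_FT c a b = abs_lsq (\<lambda>x. c * fourier1 (indicator (cbox a b)) x)"

lemma inner_cbox_FT:
  fixes a b a' b' :: "real^'n"
  shows "cbox_FT c a b \<bullet> cbox_FT d a' b' = (2 * pi) ^ CARD('n) * (cbox_lsq c a b \<bullet> cbox_lsq d a' b')"
proof -
  have "cbox_FT c a b \<bullet> cbox_FT d a' b' =
    Re (LINT x|lborel. c * cnj d * (fourier1 (indicator (cbox a b)) x * cnj (fourier1 (indicator (cbox a' b')) x)))"
    unfolding cbox_FT_def by (subst inner_abs_lsq) (auto intro!: sqi_cmult sqi_fourier1_cbox simp: mult_ac)
  also have "\<dots> = Re (c * cnj d * (of_real ((2 * pi) ^ CARD('n)) * (LINT x|lborel. indicator (cbox a b) x * indicator (cbox a' b') x)))"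
    unfolding Parseval_cbox[symmetric] by simp
  also have "\<dots> = (2 * pi) ^ CARD('n) * Re (c * cnj d * (LINT x|lborel. indicator (cbox a b) x * indicator (cbox a' b') x))"
  proof -
    have "Re (w * (of_real r * z)) = r * Re (w * z)" for w z :: complex and r
      by (simp add: algebra_simps)
    then show ?thesis by (simp only:)
  qed
  also have "c * cnj d * (LINT x|lborel. indicator (cbox a b) x * indicator (cbox a' b') x) =
     (LINT x|lborel. (c * indicator (cbox a b) x) * cnj (d * indicator (cbox a' b') x))"
    unfolding integral_mult_right_zero[symmetric]
    by (intro Bochner_Integration.integral_cong) (auto simp: indicator_def)
  also have "Re \<dots> = cbox_lsq c a b \<bullet> cbox_lsq d a' b'"
    unfolding cbox_lsq_def by (subst inner_abs_lsq) (auto intro!: sqi_cmult sqi_cbox)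
  finally show ?thesis .
qed

lemma lmult_indicator_cbox:
  assumes "m \<in> borel_measurable borel" "\<And>x. cmod (m x) \<le> C"
  shows "lmult m (cbox_lsq 1 a b) = abs_lsq (\<lambda>x. m x * indicator (cbox a b) x)"
  unfolding cbox_lsq_def by (subst lmult_abs[OF assms]) (auto intro: sqi_cbox)

section \<open>Density of step functions\<close>

lemma Int_stable_cbox: "Int_stable (range (\<lambda>(a,b). cbox a b :: 'a::euclidean_space set))"
  by (auto simp: Int_stable_def) (metis (mono_tags, lifting) Int_interval case_prod_conv rangeI)

lemma borel_eq_sigma_cbox: "(borel :: (real^'n) measure) = sigma UNIV (range (\<lambda>(a,b). cbox a b))"
  using borel_eq_atLeastAtMost[where 'a="real^'n"] by (simp add: interval_cbox_cart)

text \<open>A monotone class argument. Inside a fixed box, Dynkin's lemma passes from boxes to Borel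
  sets; linearity and pointwise limits then give simple and bounded measurable symbols; truncation
  reaches every class.\<close>

lemma closure_span_cbox:
  "closure (span (range (\<lambda>(c, a, b). cbox_lsq c a b))) = (UNIV :: (real^'n) lsq set)"
proof -
  define D :: "(real^'n) lsq set" where "D = closure (span (range (\<lambda>(c, a, b). cbox_lsq c a b)))"
  have sub: "subspace D" unfolding D_def by (intro subspace_closure subspace_span)
  have lim: "U \<in> D" if "\<And>n. F n \<in> D" "F \<longlonglongrightarrow> U" for F and U
    using that closed_closure closed_sequentially unfolding D_def by blast
  have box: "cbox_lsq c a b \<in> D" for c a b
    unfolding D_def using closure_subset
    by (rule subsetD) (intro span_base image_eqI[where x="(c, a, b)"], auto)
  let ?i = "\<lambda>c A x. c * indicator A x :: complex"
  have bd: "cmod (?i c A x) \<le> cmod c" for c A x by (auto simp: indicator_def)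
  \<comment> \<open>The fixed box keeps every class square-integrable, so the complement and
    countable union steps of Dynkin's lemma never leave L2.\<close>
  have ind: "lmult (?i c A) (cbox_lsq 1 a b) \<in> D" if "A \<in> sets borel" for A c a b
  proof -
    let ?G = "range (\<lambda>(a,b). cbox a b :: (real^'n) set)"
    have "Int_stable ?G" "?G \<subseteq> Pow UNIV" "A \<in> sigma_sets UNIV ?G"
      using that Int_stable_cbox by (auto simp: borel_eq_sigma_cbox)
    then show ?thesis
    proof (induction rule: sigma_sets_induct_disjoint)
      case (basic A)
      then obtain a' b' where A: "A = cbox a' b'" by auto
      obtain a'' b'' where ab: "cbox a' b' \<inter> cbox a b = cbox a'' b''"
        by (rule that) (rule Int_interval)
      have "lmult (?i c A) (cbox_lsq 1 a b) = cbox_lsq c a'' b''"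
        unfolding cbox_lsq_def[of c] ab[symmetric]
        by (subst lmult_indicator_cbox[OF _ bd], simp add: A)
           (intro arg_cong[of _ _ abs_lsq], auto simp: A indicator_def)
      then show ?case using box by simp
    next
      case empty
      have "lmult (?i c {}) (cbox_lsq 1 a b) = 0" by (simp add: lmult_def zero_lsq_def)
      then show ?case using subspace_0[OF sub] by simp
    next
      case (compl A)
      then have [measurable]: "A \<in> sets borel" by (simp add: borel_eq_sigma_cbox)
      have m: "sqi (\<lambda>x. ?i c A x * indicator (cbox a b) x)"
        by (rule sqi_mult_bounded[OF sqi_cbox _ bd]) measurable
      have "lmult (?i c (UNIV - A)) (cbox_lsq 1 a b) = abs_lsq (\<lambda>x. c * indicator (cbox a b) x - ?i c A x * indicator (cbox a b) x)"
        by (subst lmult_indicator_cbox[OF _ bd], measurable)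
           (intro arg_cong[of _ _ abs_lsq], auto simp: indicator_def)
      also have "\<dots> = cbox_lsq c a b - lmult (?i c A) (cbox_lsq 1 a b)"
        unfolding cbox_lsq_def[of c] by (subst lmult_indicator_cbox[OF _ bd], measurable)
           (intro abs_lsq_diff sqi_cmult sqi_cbox m)
      finally show ?case using subspace_diff[OF sub box compl(2)] by simp
    next
      case (union A)
      then have Am [measurable]: "A i \<in> sets borel" for i by (auto simp: borel_eq_sigma_cbox)
      let ?s = "\<lambda>n x. ?i c (\<Union>i<n. A i) x"
      have "lmult (?s n) (cbox_lsq 1 a b) = (\<Sum>i<n. lmult (?i c (A i)) (cbox_lsq 1 a b))" for n
      proof (induction n)
        case 0
        then show ?case by (simp add: lmult_def zero_lsq_def)
      next
        case (Suc n)
        have dis: "A n \<inter> (\<Union>i<n. A i) = {}"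
        proof -
          have "A n \<inter> A i = {}" if "i < n" for i
            using disjoint_family_onD[OF union(1), of n i] that by simp
          then show ?thesis by auto
        qed
        have m: "sqi (\<lambda>x. ?i c A x * indicator (cbox a b) x)" if [measurable]: "A \<in> sets borel" for A
          by (rule sqi_mult_bounded[OF sqi_cbox _ bd]) measurable
        have e: "lmult (?i c A) (cbox_lsq 1 a b) = abs_lsq (\<lambda>x. ?i c A x * indicator (cbox a b) x)" if [measurable]: "A \<in> sets borel" for A
          by (rule lmult_indicator_cbox[OF _ bd]) measurable
        have un: "(\<Union>i<n. A i) \<in> sets borel" by measurable
        have un': "(\<Union>i<Suc n. A i) \<in> sets borel" by measurable
        have "lmult (?s (Suc n)) (cbox_lsq 1 a b) = abs_lsq (\<lambda>x. ?s n x * indicator (cbox a b) x + ?i c (A n) x * indicator (cbox a b) x)"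
          unfolding e[OF un'] using dis
          by (intro arg_cong[of _ _ abs_lsq] ext) (auto simp: indicator_def lessThan_Suc)
        also have "\<dots> = lmult (?s n) (cbox_lsq 1 a b) + lmult (?i c (A n)) (cbox_lsq 1 a b)"
          unfolding e[OF un] e[OF Am] by (intro abs_lsq_add m un Am)
        finally show ?case using Suc.IH by simp
      qed
      then have "lmult (?s n) (cbox_lsq 1 a b) \<in> D" for n
        using union(3) by (auto intro!: subspace_sum[OF sub])
      moreover have "(\<lambda>n. lmult (?s n) (cbox_lsq 1 a b)) \<longlonglongrightarrow> lmult (?i c (\<Union>i. A i)) (cbox_lsq 1 a b)"
      proof (rule tendsto_lmult[where C="cmod c"])
        fix x
        show "(\<lambda>n. ?s n x) \<longlonglongrightarrow> ?i c (\<Union>i. A i) x"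
        proof (cases "x \<in> (\<Union>i. A i)")
          case True
          then obtain k where k: "x \<in> A k" by auto
          have "\<forall>\<^sub>F n in sequentially. ?s n x = ?i c (\<Union>i. A i) x"
            using eventually_gt_at_top[of k] by eventually_elim (use k in \<open>auto simp: indicator_def\<close>)
          then show ?thesis by (rule tendsto_eventually)
        qed (auto simp: indicator_def)
      qed (auto intro: bd)
      ultimately show ?case by (rule lim)
    qed
  qed
  have simple: "lmult s (cbox_lsq 1 a b) \<in> D" if s: "simple_function borel s" for s a b
  proof -
    let ?R = "range s"
    have fin: "finite ?R" using s by (simp add: simple_function_def)
    have sm [measurable]: "s -` {y} \<in> sets borel" for y
      using measurable_sets[OF borel_measurable_simple_function[OF s], of "{y}"] by simp
    have m: "sqi (\<lambda>x. ?i c A x * indicator (cbox a b) x)" if [measurable]: "A \<in> sets borel" for A c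
      by (rule sqi_mult_bounded[OF sqi_cbox _ bd]) measurable
    have e: "lmult (?i c A) (cbox_lsq 1 a b) = abs_lsq (\<lambda>x. ?i c A x * indicator (cbox a b) x)" if [measurable]: "A \<in> sets borel" for A c
      by (rule lmult_indicator_cbox[OF _ bd]) measurable
    have "sqi (\<lambda>x. (\<Sum>y\<in>F. ?i y (s -` {y}) x * indicator (cbox a b) x)) \<and> abs_lsq (\<lambda>x. (\<Sum>y\<in>F. ?i y (s -` {y}) x * indicator (cbox a b) x)) \<in> D" if "finite F" for F
      using that
    proof induction
      case empty
      then show ?case using subspace_0[OF sub] by (simp add: sqi_zero zero_lsq_def)
    next
      case (insert y F)
      have m1: "sqi (\<lambda>x. ?i y (s -` {y}) x * indicator (cbox a b) x)" by (rule m[OF sm])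
      have m2: "abs_lsq (\<lambda>x. ?i y (s -` {y}) x * indicator (cbox a b) x) \<in> D"
        using ind[OF sm[of y], of y a b] unfolding e[OF sm] .
      show ?case
        unfolding sum.insert[OF insert(1,2)] abs_lsq_add[OF m1 conjunct1[OF insert(3)]]
        by (intro conjI sqi_add subspace_add[OF sub] m1 m2 conjunct1[OF insert(3)] conjunct2[OF insert(3)])
    qed
    from this[OF fin] have mem: "abs_lsq (\<lambda>x. (\<Sum>y\<in>?R. ?i y (s -` {y}) x * indicator (cbox a b) x)) \<in> D" by simp
    have "(\<Sum>y\<in>?R. ?i y (s -` {y}) x * indicator (cbox a b) x) = s x * indicator (cbox a b) x" for x
    proof -
      have "(\<Sum>y\<in>?R. ?i y (s -` {y}) x * indicator (cbox a b) x) = (\<Sum>y\<in>?R. if y = s x then y * indicator (cbox a b) x else 0)"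
        by (intro sum.cong) (auto simp: indicator_def)
      then show ?thesis using fin by simp
    qed
    then have mem': "abs_lsq (\<lambda>x. s x * indicator (cbox a b) x) \<in> D" using mem by simp
    obtain C where C: "\<And>x. cmod (s x) \<le> C"
      using finite_imp_bounded[OF fin] by (auto simp: bounded_iff)
    have "s \<in> borel_measurable borel" using s by (rule borel_measurable_simple_function)
    then show ?thesis using mem' by (simp add: lmult_indicator_cbox[OF _ C])
  qed
  have bounded: "lmult m (cbox_lsq 1 a b) \<in> D" if m: "m \<in> borel_measurable borel" "\<And>x. cmod (m x) \<le> C" for m C a b
  proof -
    obtain F where F: "\<And>i. simple_function borel (F i)" "\<And>x. (\<lambda>i. F i x) \<longlonglongrightarrow> m x" "\<And>i x. cmod (F i x) \<le> 2 * cmod (m x)"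
      using borel_measurable_implies_sequence_metric[OF m(1), of 0] by auto
    have "0 \<le> C" using order_trans[OF norm_ge_zero m(2)] .
    have "(\<lambda>i. lmult (F i) (cbox_lsq 1 a b)) \<longlonglongrightarrow> lmult m (cbox_lsq 1 a b)"
    proof (rule tendsto_lmult[where C="2 * C"])
      show "F i \<in> borel_measurable borel" for i using F(1) by (rule borel_measurable_simple_function)
      show "cmod (F i x) \<le> 2 * C" for i x using F(3)[of i x] m(2)[of x] by linarith
      show "cmod (m x) \<le> 2 * C" for x using m(2)[of x] \<open>0 \<le> C\<close> by linarith
    qed (use m F in auto)
    with simple[OF F(1)] show ?thesis by (rule lim)
  qed
  have "U \<in> D" for U
  proof -
    \<comment> \<open>Truncation in space and in size at once: what remains is a bounded symbol
      times a box, and it exhausts \<open>U\<close> as n grows.\<close>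
    let ?K = "\<lambda>n. cbox (- (real n *\<^sub>R One)) (real n *\<^sub>R One) :: (real^'n) set"
    let ?S = "\<lambda>n. {x. cmod (rep_lsq U x) \<le> real n} \<inter> ?K n"
    let ?m = "\<lambda>n x. indicator {x. cmod (rep_lsq U x) \<le> real n} x * rep_lsq U x :: complex"
    have Sm [measurable]: "{x. cmod (rep_lsq U x) \<le> real n} \<in> sets borel" for n by measurable
    have "lmult (indicator (?S n)) U = lmult (?m n) (cbox_lsq 1 (- (real n *\<^sub>R One)) (real n *\<^sub>R One))" for n
    proof -
      have "lmult (?m n) (cbox_lsq 1 (- (real n *\<^sub>R One)) (real n *\<^sub>R One)) = abs_lsq (\<lambda>x. ?m n x * indicator (?K n) x)"
        by (rule lmult_indicator_cbox[where C="real n"]) (auto simp: indicator_def)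
      also have "(\<lambda>x. ?m n x * indicator (?K n) x) = (\<lambda>x. indicator (?S n) x * rep_lsq U x)"
        by (auto simp: indicator_def)
      finally show ?thesis unfolding lmult_def by simp
    qed
    moreover have "lmult (?m n) (cbox_lsq 1 (- (real n *\<^sub>R One)) (real n *\<^sub>R One)) \<in> D" for n
      by (rule bounded[of "?m n" "real n"]) (auto simp: indicator_def)
    ultimately have mem: "lmult (indicator (?S n)) U \<in> D" for n by simp
    have "(\<lambda>n. lmult (indicator (?S n)) U) \<longlonglongrightarrow> lmult (\<lambda>_. 1) U"
    proof (rule tendsto_lmult[where C=1])
      fix x :: "real^'n"
      obtain k1 :: nat where k1: "cmod (rep_lsq U x) \<le> real k1" using real_arch_simple by blast
      obtain k2 :: nat where k2: "norm x \<le> real k2" using real_arch_simple by blast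
      have "\<forall>\<^sub>F n in sequentially. indicator (?S n) x = (1::complex)"
        using eventually_ge_at_top[of "max k1 k2"]
      proof eventually_elim
        case (elim n)
        have "\<bar>x \<bullet> i\<bar> \<le> real n" if "i \<in> Basis" for i
          using Basis_le_norm[OF that, of x] k2 elim by simp
        then have "x \<in> ?K n" by (auto simp: mem_box abs_le_iff) (metis minus_le_iff)
        with k1 elim show ?case by (auto simp: indicator_def)
      qed
      then show "(\<lambda>n. indicator (?S n) x) \<longlonglongrightarrow> (1::complex)" by (rule tendsto_eventually)
    qed (auto simp: indicator_def)
    then have "lmult (\<lambda>_. 1) U \<in> D" by (rule lim[OF mem])
    then show ?thesis by (simp only: lmult_one)
  qed
  then show ?thesis unfolding D_def by auto
qed

section \<open>Duality and the Fourier isometry as a closed graph\<close>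

lemma integrable_mult_pair:
  fixes f :: "'a::euclidean_space \<Rightarrow> complex" and g :: "'b::euclidean_space \<Rightarrow> complex"
  assumes f: "integrable lborel f" and g: "integrable lborel g"
    and h [measurable]: "h \<in> borel_measurable (lborel \<Otimes>\<^sub>M lborel)" and "\<And>p. cmod (h p) \<le> C"
  shows "integrable (lborel \<Otimes>\<^sub>M lborel) (\<lambda>p. f (fst p) * g (snd p) * h p)"
proof -
  have [measurable]: "f \<in> borel_measurable lborel" "g \<in> borel_measurable lborel"
    using f g by auto
  have "integrable (lborel \<Otimes>\<^sub>M lborel) (\<lambda>p. f (fst p) * g (snd p))"
  proof (rule lborel_pair.Fubini_integrable)
    show "integrable lborel (\<lambda>x. LINT y|lborel. norm (f (fst (x, y)) * g (snd (x, y))))"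
      using f by (simp add: norm_mult)
  qed (use g in auto)
  then have "integrable (lborel \<Otimes>\<^sub>M lborel) (\<lambda>p. C * cmod (f (fst p) * g (snd p)))"
    by (intro integrable_mult_right integrable_norm)
  then show ?thesis
  proof (rule Bochner_Integration.integrable_bound)
    have C: "0 \<le> C" using order_trans[OF norm_ge_zero assms(4)] .
    show "AE p in lborel \<Otimes>\<^sub>M lborel. norm (f (fst p) * g (snd p) * h p) \<le> norm (C * cmod (f (fst p) * g (snd p)))"
    proof (intro AE_I2)
      fix p :: "'a \<times> 'b"
      have "cmod (f (fst p) * g (snd p)) * cmod (h p) \<le> cmod (f (fst p) * g (snd p)) * C"
        by (intro mult_left_mono assms) simp
      then show "norm (f (fst p) * g (snd p) * h p) \<le> norm (C * cmod (f (fst p) * g (snd p)))"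
        using C by (simp add: norm_mult mult_ac)
    qed
  qed measurable
qed

lemma fourier1_duality:
  fixes f g :: "real^'n \<Rightarrow> complex"
  assumes "integrable lborel f" "integrable lborel g"
  shows "(LINT \<xi>|lborel. fourier1 f \<xi> * g \<xi>) = (LINT x|lborel. f x * fourier1 g x)"
proof -
  have int: "integrable (lborel \<Otimes>\<^sub>M lborel) (\<lambda>(x, \<xi>). f x * g \<xi> * cis (- (x \<bullet> \<xi>)))"
    using integrable_mult_pair[OF assms, of "\<lambda>(x, \<xi>). cis (- (x \<bullet> \<xi>))" 1]
    by (simp add: split_def)
  have "(LINT \<xi>|lborel. fourier1 f \<xi> * g \<xi>) = (LINT \<xi>|lborel. LINT x|lborel. f x * g \<xi> * cis (- (x \<bullet> \<xi>)))"
    unfolding fourier1_def integral_mult_left_zero[symmetric] by (simp add: mult_ac)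
  also have "\<dots> = (LINT x|lborel. LINT \<xi>|lborel. f x * g \<xi> * cis (- (x \<bullet> \<xi>)))"
    by (rule lborel_pair.Fubini_integral[OF int])
  also have "\<dots> = (LINT x|lborel. f x * fourier1 g x)"
    unfolding fourier1_def integral_mult_right_zero[symmetric]
    by (simp add: mult_ac inner_commute)
  finally show ?thesis .
qed

text \<open>The Fourier transform is extended from step functions by closing its graph. Parseval
  makes this closure the graph of a scaled isometry, and any closed linear property of pairs has to
  be checked on boxes only, which is \<open>fourier_graph_induct\<close>.\<close>

definition fourier_graph :: "((real^'n) lsq \<times> (real^'n) lsq) set" where
  "fourier_graph = closure (span (range (\<lambda>(c, a, b). (cbox_lsq c a b, cbox_FT c a b))))"

lemma subspace_fourier_graph: "subspace fourier_graph"
  unfolding fourier_graph_def by (intro subspace_closure subspace_span)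

lemma closed_fourier_graph: "closed fourier_graph"
  unfolding fourier_graph_def by simp

lemma fourier_graph_induct:
  assumes "p \<in> fourier_graph" "closed {p. P p}" "subspace {p. P p}"
    "\<And>c a b. P (cbox_lsq c a b, cbox_FT c a b)"
  shows "P p"
proof -
  have "span (range (\<lambda>(c, a, b). (cbox_lsq c a b, cbox_FT c a b))) \<subseteq> {p. P p}"
    using assms(3,4) by (intro span_minimal) auto
  then have "fourier_graph \<subseteq> {p. P p}"
    unfolding fourier_graph_def using assms(2) by (rule closure_minimal)
  then show ?thesis using assms(1) by auto
qed

text \<open>Two inductions over the graph, one in each argument, reduce Parseval to the generators,
  where it is \<open>inner_cbox_FT\<close>.\<close>

lemma fourier_graph_inner:
  fixes p q :: "(real^'n) lsq \<times> (real^'n) lsq"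
  assumes "p \<in> fourier_graph" "q \<in> fourier_graph"
  shows "snd p \<bullet> snd q = (2 * pi) ^ CARD('n) * (fst p \<bullet> fst q)"
proof -
  have *: "snd p \<bullet> cbox_FT c a b = (2 * pi) ^ CARD('n) * (fst p \<bullet> cbox_lsq c a b)" for c and a b :: "real^'n"
    using assms(1)
  proof (rule fourier_graph_induct)
    show "closed {p. snd p \<bullet> cbox_FT c a b = (2 * pi) ^ CARD('n) * (fst p \<bullet> cbox_lsq c a b)}"
      by (intro closed_Collect_eq continuous_intros)
  qed (auto simp: subspace_def inner_add_left inner_cbox_FT algebra_simps)
  show ?thesis using assms(2)
  proof (rule fourier_graph_induct)
    show "closed {q. snd p \<bullet> snd q = (2 * pi) ^ CARD('n) * (fst p \<bullet> fst q)}"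
      by (intro closed_Collect_eq continuous_intros)
  qed (auto simp: subspace_def inner_add_right * algebra_simps)
qed

lemma fourier_graph_norm:
  fixes p :: "(real^'n) lsq \<times> (real^'n) lsq"
  assumes "p \<in> fourier_graph"
  shows "norm (snd p) = sqrt ((2 * pi) ^ CARD('n)) * norm (fst p)"
  using fourier_graph_inner[OF assms assms] by (simp add: norm_eq_sqrt_inner real_sqrt_mult)

text \<open>Step functions approximate \<open>U\<close>, each has a partner in the span of the
  generating pairs, and the isometry turns the Cauchy property of the approximants into that of the
  partners.\<close>

lemma fourier_graph_total: "\<exists>V. (U, V) \<in> fourier_graph" for U :: "(real^'n) lsq"
proof -
  let ?S = "range (\<lambda>(c, a, b). (cbox_lsq c a b, cbox_FT c a b)) :: ((real^'n) lsq \<times> (real^'n) lsq) set"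
  let ?B = "range (\<lambda>(c, a, b). cbox_lsq c a b) :: (real^'n) lsq set"
  have B: "?B = fst ` ?S" by (auto simp: image_image split_def)
  have sp: "span ?B = fst ` span ?S"
    unfolding B by (rule linear_span_image[OF linear_fst])
  obtain f where f: "\<And>n. f n \<in> span ?B" "f \<longlonglongrightarrow> U"
  proof -
    have "U \<in> closure (span ?B)" by (simp only: closure_span_cbox UNIV_I)
    then obtain f where "\<forall>n. f n \<in> span ?B" "f \<longlonglongrightarrow> U" unfolding closure_sequential by (elim exE conjE)
    then show ?thesis using that[of f] by (simp only:)
  qed
  have "\<exists>g. (f n, g) \<in> span ?S" for n
  proof -
    obtain p where p: "p \<in> span ?S" "f n = fst p" using f(1)[of n] unfolding sp by blast
    show ?thesis by (rule exI[of _ "snd p"]) (subst p(2), subst prod.collapse, rule p(1))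
  qed
  define g where "g n = (SOME g. (f n, g) \<in> span ?S)" for n
  have g: "(f n, g n) \<in> span ?S" for n
    unfolding g_def by (rule someI_ex) fact
  then have g': "(f n, g n) \<in> fourier_graph" for n
    unfolding fourier_graph_def by (rule subsetD[OF closure_subset])
  have d: "norm (g m - g n) = sqrt ((2 * pi) ^ CARD('n)) * norm (f m - f n)" for m n
    using fourier_graph_norm[OF subspace_diff[OF subspace_fourier_graph g'[of m] g'[of n]]] by simp
  have "Cauchy g"
    unfolding Cauchy_iff
  proof (intro allI impI)
    fix e :: real assume "e > 0"
    let ?c = "sqrt ((2 * pi) ^ CARD('n))"
    have c: "?c > 0" by simp
    then have "e / ?c > 0" using \<open>e > 0\<close> by simp
    moreover have "Cauchy f" using f(2) by (rule LIMSEQ_imp_Cauchy)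
    ultimately obtain M where M: "\<And>m n. m \<ge> M \<Longrightarrow> n \<ge> M \<Longrightarrow> norm (f m - f n) < e / ?c"
      unfolding Cauchy_iff by meson
    show "\<exists>M. \<forall>m\<ge>M. \<forall>n\<ge>M. norm (g m - g n) < e"
      using M c by (intro exI[of _ M] allI impI) (simp add: d pos_less_divide_eq mult.commute)
  qed
  then obtain V where "g \<longlonglongrightarrow> V" using Cauchy_convergent convergent_def by blast
  then have "(\<lambda>n. (f n, g n)) \<longlonglongrightarrow> (U, V)" using f(2) by (intro tendsto_Pair)
  then have "(U, V) \<in> fourier_graph" by (rule closed_sequentially[OF closed_fourier_graph g'])
  then show ?thesis ..
qed

lemma fourier_graph_unique:
  assumes "(U, V) \<in> fourier_graph" "(U, V') \<in> fourier_graph" shows "V = V'"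
  using fourier_graph_norm[OF subspace_diff[OF subspace_fourier_graph assms]] by simp

definition Fou :: "(real^'n) lsq \<Rightarrow> (real^'n) lsq" where
  "Fou U = (THE V. (U, V) \<in> fourier_graph)"

lemma Fou_graph: "(U, Fou U) \<in> fourier_graph"
proof -
  obtain V where V: "(U, V) \<in> fourier_graph" using fourier_graph_total[of U] ..
  then show ?thesis unfolding Fou_def by (rule theI) (rule fourier_graph_unique[OF _ V])
qed

lemma Fou_eqI: "(U, V) \<in> fourier_graph \<Longrightarrow> Fou U = V"
  using fourier_graph_unique Fou_graph by blast

lemma Fou_add: "Fou (U + V) = Fou U + Fou V"
  using subspace_add[OF subspace_fourier_graph Fou_graph[of U] Fou_graph[of V]] by (intro Fou_eqI) simp

lemma Fou_scaleR: "Fou (c *\<^sub>R U) = c *\<^sub>R Fou U"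
  using subspace_scale[OF subspace_fourier_graph Fou_graph[of U], of c] by (intro Fou_eqI) simp

lemma Fou_inner: "Fou U \<bullet> Fou V = (2 * pi) ^ CARD('n) * (U \<bullet> V)" for U V :: "(real^'n) lsq"
  using fourier_graph_inner[OF Fou_graph[of U] Fou_graph[of V]] by simp

lemma norm_Fou: "norm (Fou U) = sqrt ((2 * pi) ^ CARD('n)) * norm U" for U :: "(real^'n) lsq"
  using fourier_graph_norm[OF Fou_graph[of U]] by simp

lemma bounded_linear_Fou: "bounded_linear (Fou :: (real^'n) lsq \<Rightarrow> _)"
  by (rule bounded_linear_intro[where K="sqrt ((2 * pi) ^ CARD('n))"])
     (simp_all add: Fou_add Fou_scaleR norm_Fou mult.commute)

text \<open>This is the identity tested in \<open>is_fourier_L2\<close>. Both sides are continuous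
  and linear in the pair, so it suffices to check box classes, where it is the Fubini identity
  \<open>fourier1_duality\<close>.\<close>

lemma Fou_box_duality:
  "pair (indicator (cbox a b)) (Fou U) = pair (fourier1 (indicator (cbox a b))) U"
proof -
  interpret l1: bounded_linear "pair (indicator (cbox a b))" by (rule bounded_linear_pair[OF sqi_cbox])
  interpret l2: bounded_linear "pair (fourier1 (indicator (cbox a b)))" by (rule bounded_linear_pair[OF sqi_fourier1_cbox])
  have "pair (indicator (cbox a b)) (snd (U, Fou U)) = pair (fourier1 (indicator (cbox a b))) (fst (U, Fou U))"
    using Fou_graph
  proof (rule fourier_graph_induct)
    show "closed {p. pair (indicator (cbox a b)) (snd p) = pair (fourier1 (indicator (cbox a b))) (fst p)}"
      by (intro closed_Collect_eq l1.continuous_on l2.continuous_on continuous_intros)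
    show "pair (indicator (cbox a b)) (snd (cbox_lsq c a' b', cbox_FT c a' b')) =
       pair (fourier1 (indicator (cbox a b))) (fst (cbox_lsq c a' b', cbox_FT c a' b'))" for c a' b'
    proof -
      have "(LINT x|lborel. indicator (cbox a b) x * (c * fourier1 (indicator (cbox a' b')) x)) =
            c * (LINT x|lborel. fourier1 (indicator (cbox a' b')) x * indicator (cbox a b) x)"
        unfolding integral_mult_right_zero[symmetric] by (simp add: mult_ac)
      also have "\<dots> = c * (LINT x|lborel. indicator (cbox a' b') x * fourier1 (indicator (cbox a b)) x)"
        by (simp only: fourier1_duality[OF integrable_cbox integrable_cbox])
      also have "\<dots> = (LINT x|lborel. fourier1 (indicator (cbox a b)) x * (c * indicator (cbox a' b') x))"
        unfolding integral_mult_right_zero[symmetric] by (simp add: mult_ac)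
      finally show ?thesis
        unfolding cbox_lsq_def cbox_FT_def fst_conv snd_conv
        by (subst (1 2) pair_abs) (auto intro!: sqi_cmult sqi_cbox sqi_fourier1_cbox)
    qed
  qed (auto simp: subspace_def l1.add l2.add l1.scaleR l2.scaleR l1.zero l2.zero)
  then show ?thesis by simp
qed

lemma inner_cbox_lsq:
  "U \<bullet> cbox_lsq c a b = Re (cnj c * pair (indicator (cbox a b)) U)"
proof -
  have "U \<bullet> cbox_lsq c a b = Re (LINT x|lborel. rep_lsq U x * cnj (c * indicator (cbox a b) x))"
    using inner_abs_lsq[OF sqi_rep[of U] sqi_cmult[OF sqi_cbox]] by (simp add: abs_rep_lsq cbox_lsq_def)
  also have "(LINT x|lborel. rep_lsq U x * cnj (c * indicator (cbox a b) x)) = cnj c * pair (indicator (cbox a b)) U"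
    unfolding pair_def integral_mult_right_zero[symmetric]
    by (intro Bochner_Integration.integral_cong) (auto simp: indicator_def)
  finally show ?thesis .
qed

lemma inner_dense_zero:
  fixes U :: "(real^'n) lsq"
  assumes "\<And>c a b. U \<bullet> cbox_lsq c a b = 0" shows "U = 0"
proof -
  have "closure (span (range (\<lambda>(c, a, b). cbox_lsq c a b))) \<subseteq> {V. U \<bullet> V = 0}"
  proof (rule closure_minimal)
    show "span (range (\<lambda>(c, a, b). cbox_lsq c a b)) \<subseteq> {V. U \<bullet> V = 0}"
      by (rule span_minimal) (auto simp: assms subspace_def inner_add_right)
    show "closed {V. U \<bullet> V = 0}" by (intro closed_Collect_eq continuous_intros)
  qed
  then have "U \<bullet> U = 0" unfolding closure_span_cbox by blast
  then show ?thesis by simp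
qed

lemma lsq_eq_boxI:
  fixes U V :: "(real^'n) lsq"
  assumes "\<And>a b. pair (indicator (cbox a b)) U = pair (indicator (cbox a b)) V" shows "U = V"
proof -
  have "U - V = 0"
    by (rule inner_dense_zero)
       (simp only: inner_cbox_lsq linear_diff[OF bounded_linear.linear[OF bounded_linear_pair[OF sqi_cbox]]] assms, simp)
  then show ?thesis by simp
qed

text \<open>The bridge from the specification, which tests against boxes, to the operator
  \<open>Fou\<close>. Since boxes separate classes, the functions selected by \<open>SOME\<close> in
  \<open>FT\<close> and \<open>W\<close> are determined up to null sets.\<close>

lemma is_fourier_L2_iff:
  "is_fourier_L2 f g \<longleftrightarrow> sqi f \<and> sqi g \<and> abs_lsq g = Fou (abs_lsq f)"
proof (cases "sqi f \<and> sqi g")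
  case True
  have 1: "(LINT \<xi>|lborel. g \<xi> * indicator (cbox a b) \<xi>) = pair (indicator (cbox a b)) (abs_lsq g)" for a b
    using True by (subst pair_abs[OF sqi_cbox]) (simp_all only: mult.commute)
  have 2: "(LINT x|lborel. f x * fourier1 (indicator (cbox a b)) x) = pair (indicator (cbox a b)) (Fou (abs_lsq f))" for a b
    unfolding Fou_box_duality using True by (subst pair_abs[OF sqi_fourier1_cbox]) (simp_all only: mult.commute)
  show ?thesis
    unfolding is_fourier_L2_def L2_eq_sqi 1 2 using True by (metis lsq_eq_boxI)
qed (auto simp: is_fourier_L2_def L2_eq_sqi)

definition lcnj :: "'a::euclidean_space lsq \<Rightarrow> 'a lsq" where
  "lcnj U = abs_lsq (\<lambda>x. cnj (rep_lsq U x))"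

lemma rep_lcnj: "AE x in lborel. rep_lsq (lcnj U) x = cnj (rep_lsq U x)"
  unfolding lcnj_def by (rule rep_abs_lsq) (intro sqi_cnj sqi_rep)

lemma lcnj_abs: "sqi f \<Longrightarrow> lcnj (abs_lsq f) = abs_lsq (\<lambda>x. cnj (f x))"
  unfolding lcnj_def
  by (rule abs_lsq_eqI) (auto intro!: sqi_cnj sqi_rep intro: eventually_mono[OF rep_abs_lsq[of f]])

lemma lcnj_lcnj [simp]: "lcnj (lcnj U) = U"
  unfolding lcnj_def[of U] by (simp add: lcnj_abs sqi_cnj sqi_rep abs_rep_lsq)

lemma inner_lcnj: "lcnj U \<bullet> V = U \<bullet> lcnj V"
proof -
  have "lcnj U \<bullet> V = Re (LINT x|lborel. cnj (rep_lsq U x) * cnj (rep_lsq V x))"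
    using inner_abs_lsq[OF sqi_cnj[OF sqi_rep[of U]] sqi_rep[of V]] by (simp add: abs_rep_lsq lcnj_def)
  also have "\<dots> = Re (LINT x|lborel. rep_lsq U x * rep_lsq V x)"
    unfolding complex_cnj_mult[symmetric] Bochner_Integration.integral_cnj by simp
  also have "\<dots> = U \<bullet> lcnj V"
    using inner_abs_lsq[OF sqi_rep[of U] sqi_cnj[OF sqi_rep[of V]]] by (simp add: abs_rep_lsq lcnj_def)
  finally show ?thesis .
qed

lemma norm_lcnj [simp]: "norm (lcnj U) = norm U"
  unfolding norm_eq_sqrt_inner inner_lcnj lcnj_lcnj ..

lemma lcnj_add: "lcnj (U + V) = lcnj U + lcnj V"
  apply (rule lsq_eqI)
  using rep_lcnj[of "U + V"] rep_lcnj[of U] rep_lcnj[of V] rep_add[of U V] rep_add[of "lcnj U" "lcnj V"]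
  by eventually_elim simp

lemma lcnj_scaleR: "lcnj (c *\<^sub>R U) = c *\<^sub>R lcnj U"
  apply (rule lsq_eqI)
  using rep_lcnj[of "c *\<^sub>R U"] rep_lcnj[of U] rep_scaleR[of c U] rep_scaleR[of c "lcnj U"]
  by eventually_elim simp

lemma bounded_linear_lcnj: "bounded_linear lcnj"
  by (rule bounded_linear_intro[where K=1]) (simp_all add: lcnj_add lcnj_scaleR)

text \<open>The transform is symmetric for the bilinear pairing without conjugate; in terms of the
  real inner product this symmetry is written with \<open>lcnj\<close> on the second factor.\<close>

lemma Fou_selfadjoint: "Fou U \<bullet> lcnj V = U \<bullet> lcnj (Fou V)"
proof -
  interpret l: bounded_linear lcnj by (rule bounded_linear_lcnj)
  have "Fou U \<bullet> lcnj (fst (V, Fou V)) = U \<bullet> lcnj (snd (V, Fou V))"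
    using Fou_graph
  proof (rule fourier_graph_induct)
    show "closed {p. Fou U \<bullet> lcnj (fst p) = U \<bullet> lcnj (snd p)}"
      by (intro closed_Collect_eq continuous_intros l.continuous_on)
    show "Fou U \<bullet> lcnj (fst (cbox_lsq c a b, cbox_FT c a b)) = U \<bullet> lcnj (snd (cbox_lsq c a b, cbox_FT c a b))" for c a b
    proof -
      have s: "sqi (\<lambda>x. c * fourier1 (indicator (cbox a b)) x)" by (intro sqi_cmult sqi_fourier1_cbox)
      have "lcnj (cbox_lsq c a b) = cbox_lsq (cnj c) a b"
      proof -
        have "(\<lambda>x. cnj (c * indicator (cbox a b) x)) = (\<lambda>x. cnj c * indicator (cbox a b) x)"
          by (auto simp: indicator_def)
        then show ?thesis unfolding cbox_lsq_def lcnj_abs[OF sqi_cmult[OF sqi_cbox]] by (simp only:)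
      qed
      then have "Fou U \<bullet> lcnj (cbox_lsq c a b) = Re (c * pair (fourier1 (indicator (cbox a b))) U)"
        by (simp add: inner_cbox_lsq Fou_box_duality)
      also have "\<dots> = Re (LINT x|lborel. rep_lsq U x * cnj (cnj (c * fourier1 (indicator (cbox a b)) x)))"
        unfolding pair_def integral_mult_right_zero[symmetric] by (simp add: mult_ac)
      also have "\<dots> = U \<bullet> lcnj (cbox_FT c a b)"
        unfolding cbox_FT_def lcnj_abs[OF s]
        using inner_abs_lsq[OF sqi_rep[of U] sqi_cnj[OF s]] by (simp only: abs_rep_lsq)
      finally show ?thesis by simp
    qed
  qed (auto simp: subspace_def l.add l.scaleR l.zero inner_add_right)
  then show ?thesis by simp
qed

text \<open>The usual inversion integral with the opposite sign in the exponent: conjugating before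
  and after the transform flips that sign.\<close>

definition Finv :: "(real^'n) lsq \<Rightarrow> (real^'n) lsq" where
  "Finv V = (1 / (2 * pi) ^ CARD('n)) *\<^sub>R lcnj (Fou (lcnj V))"

text \<open>Symmetry of the bilinear pairing turns the inner product with an arbitrary
  \<open>V\<close> into an inner product of two transforms, where Parseval applies.\<close>

lemma Finv_Fou: "Finv (Fou U) = U" for U :: "(real^'n) lsq"
proof -
  have "V \<bullet> lcnj (Fou (lcnj (Fou U))) = V \<bullet> ((2 * pi) ^ CARD('n) *\<^sub>R U)" for V
    using Fou_selfadjoint[of V "lcnj (Fou U)"] Fou_inner[of V U] by simp
  then have "lcnj (Fou (lcnj (Fou U))) = (2 * pi) ^ CARD('n) *\<^sub>R U"
    using vector_eq_ldot by blast
  then show ?thesis by (simp add: Finv_def)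
qed

text \<open>Conjugating the left inverse identity at \<open>lcnj V\<close> produces a right inverse,
  so the scaled isometry is onto.\<close>

lemma Fou_Finv: "Fou (Finv V) = V" for V :: "(real^'n) lsq"
proof -
  have "Fou (lcnj (Fou (lcnj V))) = lcnj (lcnj (Fou (lcnj (Fou (lcnj V)))))" by simp
  also have "lcnj (Fou (lcnj (Fou (lcnj V)))) = (2 * pi) ^ CARD('n) *\<^sub>R Finv (Fou (lcnj V))"
    unfolding Finv_def by simp
  also have "lcnj \<dots> = (2 * pi) ^ CARD('n) *\<^sub>R V"
    by (simp add: Finv_Fou lcnj_scaleR)
  finally show ?thesis by (simp add: Finv_def Fou_scaleR)
qed

lemma bounded_linear_Finv: "bounded_linear (Finv :: (real^'n) lsq \<Rightarrow> _)"
  unfolding Finv_def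
  by (intro bounded_linear_scaleR_right bounded_linear_compose[OF bounded_linear_scaleR_right]
      bounded_linear_compose[OF bounded_linear_lcnj] bounded_linear_compose[OF bounded_linear_Fou] bounded_linear_ident)

lemma sqi_FT_abs:
  assumes "sqi f" shows "sqi (FT f)" "abs_lsq (FT f) = Fou (abs_lsq f)"
proof -
  have "is_fourier_L2 f (rep_lsq (Fou (abs_lsq f)))"
    by (simp add: is_fourier_L2_iff assms sqi_rep abs_rep_lsq)
  then have "is_fourier_L2 f (FT f)" unfolding FT_def by (rule someI[of "is_fourier_L2 f"])
  then show "sqi (FT f)" "abs_lsq (FT f) = Fou (abs_lsq f)" by (simp_all add: is_fourier_L2_iff)
qed

lemma FT_AE: "sqi f \<Longrightarrow> AE x in lborel. FT f x = rep_lsq (Fou (abs_lsq f)) x"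
  using rep_abs_lsq[OF sqi_FT_abs(1), of f] sqi_FT_abs(2)[of f] by auto

text \<open>For the choice hidden in \<open>W\<close>: surjectivity of the transform supplies a
  witness, and injectivity fixes its class.\<close>

lemma SOME_is_fourier_L2:
  assumes "sqi g"
  shows "sqi (SOME h. is_fourier_L2 h g)" "abs_lsq (SOME h. is_fourier_L2 h g) = Finv (abs_lsq g)"
proof -
  have "is_fourier_L2 (rep_lsq (Finv (abs_lsq g))) g"
    by (simp add: is_fourier_L2_iff assms sqi_rep abs_rep_lsq Fou_Finv)
  then have "is_fourier_L2 (SOME h. is_fourier_L2 h g) g" by (rule someI[of "\<lambda>h. is_fourier_L2 h g"])
  note * = iffD1[OF is_fourier_L2_iff this]
  show "sqi (SOME h. is_fourier_L2 h g)" by (rule conjunct1[OF *])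
  have "Finv (abs_lsq g) = Finv (Fou (abs_lsq (SOME h. is_fourier_L2 h g)))"
    by (rule arg_cong[OF conjunct2[OF conjunct2[OF *]]])
  then show "abs_lsq (SOME h. is_fourier_L2 h g) = Finv (abs_lsq g)" by (simp only: Finv_Fou)
qed

section \<open>Sobolev spaces of order greater than half the dimension\<close>

lemma norm_fourier1_le: "cmod (fourier1 f \<xi>) \<le> (LINT x|lborel. cmod (f x))"
proof -
  have "cmod (fourier1 f \<xi>) \<le> (LINT x|lborel. cmod (f x * cis (- (x \<bullet> \<xi>))))"
    unfolding fourier1_def by (rule integral_norm_bound)
  then show ?thesis by (simp add: norm_mult)
qed

text \<open>The integral \<open>fourier1 f\<close> is bounded, but its square integrability is not
  yet available. After restriction to a box both sides lie in L2, and since boxes meet in boxes the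
  duality identity compares them.\<close>

lemma Fou_fourier1_box:
  fixes f :: "real^'n \<Rightarrow> complex"
  assumes "integrable lborel f" "sqi f"
  shows "AE x in lborel. x \<in> cbox u v \<longrightarrow> rep_lsq (Fou (abs_lsq f)) x = fourier1 f x"
proof -
  let ?G = "Fou (abs_lsq f)"
  let ?h1 = "\<lambda>x. indicator (cbox u v) x * rep_lsq ?G x" and ?h2 = "\<lambda>x. fourier1 f x * indicator (cbox u v) x"
  have fm [measurable]: "f \<in> borel_measurable borel" using assms(2) by (rule sqi_measurable_borel)
  have s1: "sqi ?h1" by (rule sqi_mult_bounded[OF sqi_rep, where C=1]) (auto simp: indicator_def)
  have s2: "sqi ?h2" by (rule sqi_mult_bounded[OF sqi_cbox _ norm_fourier1_le]) measurable
  have "abs_lsq ?h1 = abs_lsq ?h2"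
  proof (rule lsq_eq_boxI)
    fix a b :: "real^'n"
    obtain c d where cd: "cbox a b \<inter> cbox u v = cbox c d" by (rule that) (rule Int_interval)
    then have ind: "indicator (cbox a b) x * indicator (cbox u v) x = (indicator (cbox c d) x :: complex)" for x
      by (simp flip: cd indicator_inter_arith)
    have "pair (indicator (cbox a b)) (abs_lsq ?h1) = (LINT x|lborel. indicator (cbox c d) x * rep_lsq ?G x)"
      unfolding pair_abs[OF sqi_cbox s1] by (simp add: ind flip: mult.assoc)
    also have "\<dots> = pair (indicator (cbox c d)) ?G" by (simp add: pair_def)
    also have "\<dots> = (LINT x|lborel. fourier1 (indicator (cbox c d)) x * f x)"
      unfolding Fou_box_duality by (rule pair_abs[OF sqi_fourier1_cbox assms(2)])
    also have "\<dots> = (LINT x|lborel. indicator (cbox c d) x * fourier1 f x)"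
      by (rule fourier1_duality[OF integrable_cbox assms(1)])
    also have "\<dots> = (LINT x|lborel. indicator (cbox a b) x * ?h2 x)"
      by (intro Bochner_Integration.integral_cong refl) (simp add: mult_ac flip: ind)
    also have "\<dots> = pair (indicator (cbox a b)) (abs_lsq ?h2)"
      by (rule pair_abs[OF sqi_cbox s2, symmetric])
    finally show "pair (indicator (cbox a b)) (abs_lsq ?h1) = pair (indicator (cbox a b)) (abs_lsq ?h2)" .
  qed
  then have "AE x in lborel. ?h1 x = ?h2 x"
    using rep_abs_lsq[OF s1] rep_abs_lsq[OF s2] by auto
  then show ?thesis by eventually_elim (simp add: indicator_def split: if_splits)
qed

lemma Fou_fourier1:
  fixes f :: "real^'n \<Rightarrow> complex"
  assumes "integrable lborel f" "sqi f"
  shows "AE x in lborel. rep_lsq (Fou (abs_lsq f)) x = fourier1 f x"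
proof -
  have "AE x in lborel. \<forall>n::nat. x \<in> cbox (- (real n *\<^sub>R One)) (real n *\<^sub>R One) \<longrightarrow> rep_lsq (Fou (abs_lsq f)) x = fourier1 f x"
    unfolding AE_all_countable using Fou_fourier1_box[OF assms] by (intro allI)
  then show ?thesis
  proof eventually_elim
    case (elim x)
    obtain n :: nat where n: "norm x \<le> real n" using real_arch_simple by blast
    have "\<bar>x \<bullet> i\<bar> \<le> real n" if "i \<in> Basis" for i
      using Basis_le_norm[OF that, of x] n by simp
    then have "x \<in> cbox (- (real n *\<^sub>R One)) (real n *\<^sub>R One)" by (auto simp: mem_box abs_le_iff) (metis minus_le_iff)
    with elim show ?case by blast
  qed
qed

lemma cnj_fourier1: "cnj (fourier1 (\<lambda>x. cnj (g x)) x) = fourier1 g (- x)"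
  unfolding fourier1_def Bochner_Integration.integral_cnj[symmetric]
  by (simp add: cis_cnj)

lemma Finv_fourier1:
  fixes g :: "real^'n \<Rightarrow> complex"
  assumes "integrable lborel g" "sqi g"
  shows "AE x in lborel. rep_lsq (Finv (abs_lsq g)) x = of_real (1 / (2 * pi) ^ CARD('n)) * fourier1 g (- x)"
proof -
  have c: "integrable lborel (\<lambda>x. cnj (g x))" "sqi (\<lambda>x. cnj (g x))" using assms by (auto intro: sqi_cnj)
  show ?thesis
    unfolding Finv_def lcnj_abs[OF assms(2)]
    using Fou_fourier1[OF c] rep_lcnj[of "Fou (abs_lsq (\<lambda>x. cnj (g x)))"]
      rep_scaleR[of "1 / (2 * pi) ^ CARD('n)" "lcnj (Fou (abs_lsq (\<lambda>x. cnj (g x))))"]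
    by eventually_elim (simp only: cnj_fourier1)
qed

section \<open>Translations, Sobolev weights and convolutions\<close>

lemma distr_lborel_reflect: "distr lborel borel (\<lambda>x::'a::euclidean_space. t - x) = lborel"
  using lborel_affine[of "-1" t] by (simp add: density_1)

lemma distr_lborel_translate: "distr lborel borel (\<lambda>x::'a::euclidean_space. x - t) = lborel"
  using lborel_affine[of "1" "- t"] by (simp add: density_1 add.commute)

lemma nn_integral_reflect:
  assumes "f \<in> borel_measurable borel"
  shows "(\<integral>\<^sup>+x. f (t - x) \<partial>lborel) = (\<integral>\<^sup>+(x::'a::euclidean_space). f x \<partial>lborel)"
  by (subst (2) distr_lborel_reflect[of t, symmetric]) (simp add: nn_integral_distr assms)

lemma nn_integral_translate:
  assumes "f \<in> borel_measurable borel"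
  shows "(\<integral>\<^sup>+x. f (x - t) \<partial>lborel) = (\<integral>\<^sup>+(x::'a::euclidean_space). f x \<partial>lborel)"
  by (subst (2) distr_lborel_translate[of t, symmetric]) (simp add: nn_integral_distr assms)

lemma integral_translate:
  fixes f :: "'a::euclidean_space \<Rightarrow> complex"
  assumes "f \<in> borel_measurable borel"
  shows "(LINT x|lborel. f (x - t)) = (LINT x|lborel. f x)"
  by (subst (2) distr_lborel_translate[of t, symmetric]) (simp add: integral_distr assms)

lemma integral_reflect:
  fixes f :: "'a::euclidean_space \<Rightarrow> complex"
  assumes "f \<in> borel_measurable borel"
  shows "(LINT x|lborel. f (t - x)) = (LINT x|lborel. f x)"
  by (subst (2) distr_lborel_reflect[of t, symmetric]) (simp add: integral_distr assms)

text \<open>The exponent is halved: the H^s norm is the L2 norm of \<open>wt s\<close> times the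
  transform, with \<open>wt s\<close> unsquared.\<close>

definition wt :: "real \<Rightarrow> 'a::euclidean_space \<Rightarrow> real" where
  "wt s \<xi> = (1 + (norm \<xi>)\<^sup>2) powr (s / 2)"

lemma wt_pos: "wt s \<xi> > 0"
proof -
  have "1 + (norm \<xi>)\<^sup>2 > 0" by (simp add: add_pos_nonneg)
  then show ?thesis by (simp add: wt_def)
qed

lemma wt_nonneg [simp]: "wt s \<xi> \<ge> 0" using wt_pos[of s \<xi>] by simp

lemma wt_measurable [measurable]: "wt s \<in> borel_measurable borel"
  unfolding wt_def[abs_def] by measurable

lemma wt_mult_inverse [simp]: "wt s \<xi> * wt (- s) \<xi> = 1"
proof -
  have "1 + (norm \<xi>)\<^sup>2 \<noteq> 0" by (metis add_pos_nonneg less_irrefl zero_le_power2 zero_less_one)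
  then show ?thesis by (simp add: wt_def flip: powr_add)
qed

lemma wt_sq: "(wt s \<xi>)\<^sup>2 = (1 + (norm \<xi>)\<^sup>2) powr s"
  by (simp add: wt_def power2_eq_square flip: powr_add)

lemma wt_neg_le_1: "0 \<le> s \<Longrightarrow> wt (- s) \<xi> \<le> 1"
  unfolding wt_def using powr_mono[of "- s / 2" 0 "1 + (norm \<xi>)\<^sup>2"] by (auto split: if_splits)

lemma wt_minus [simp]: "wt s (- \<xi>) = wt s \<xi>" by (simp add: wt_def)

text \<open>The substitute for a triangle inequality: 1 + |\<xi>|^2 is at most four times the larger
  of the two quantities on the right, and 4 to the power s/2 is 2 to the power s. Bounding the
  maximum by the sum splits the weight between the two factors of a product.\<close>

lemma wt_subadd:
  assumes "0 \<le> s" shows "wt s \<xi> \<le> 2 powr s * (wt s (\<xi> - \<eta>) + wt s \<eta>)"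
proof -
  let ?m = "max (1 + (norm (\<xi> - \<eta>))\<^sup>2) (1 + (norm \<eta>)\<^sup>2)"
  have "norm \<xi> \<le> norm (\<xi> - \<eta>) + norm \<eta>" using norm_triangle_ineq[of "\<xi> - \<eta>" \<eta>] by simp
  then have "(norm \<xi>)\<^sup>2 \<le> (norm (\<xi> - \<eta>) + norm \<eta>)\<^sup>2" by (intro power_mono) auto
  also have "\<dots> \<le> 2 * (norm (\<xi> - \<eta>))\<^sup>2 + 2 * (norm \<eta>)\<^sup>2"
    using zero_le_power2[of "norm (\<xi> - \<eta>) - norm \<eta>"] by (simp add: power2_eq_square algebra_simps)
  finally have "(norm \<xi>)\<^sup>2 \<le> 2 * (norm (\<xi> - \<eta>))\<^sup>2 + 2 * (norm \<eta>)\<^sup>2" .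
  moreover have "1 + (norm (\<xi> - \<eta>))\<^sup>2 \<le> ?m" "1 + (norm \<eta>)\<^sup>2 \<le> ?m" by (rule max.cobounded1, rule max.cobounded2)
  ultimately have "1 + (norm \<xi>)\<^sup>2 \<le> 4 * ?m" by argo
  then have "wt s \<xi> \<le> (4 * ?m) powr (s / 2)"
    unfolding wt_def using assms by (intro powr_mono2) auto
  also have "\<dots> = 4 powr (s / 2) * ?m powr (s / 2)"
    by (rule powr_mult)
  also have "(4::real) powr (s / 2) = 2 powr s"
  proof -
    have "(4::real) = 2 powr 2" by simp
    then show ?thesis by (simp only: powr_powr) simp
  qed
  also have "?m powr (s / 2) \<le> wt s (\<xi> - \<eta>) + wt s \<eta>"
    using wt_nonneg[of s "\<xi> - \<eta>"] wt_nonneg[of s \<eta>] by (auto simp: max_def wt_def)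
  finally show ?thesis by simp
qed

lemma nn_integral_powr_finite:
  assumes "p > 1" shows "(\<integral>\<^sup>+t. ennreal ((1 + t) powr (- p)) * indicator {0..} t \<partial>lborel) < \<infinity>"
proof -
  have "(\<integral>\<^sup>+t. ennreal ((1 + t) powr (- p)) * indicator {0..} t \<partial>lborel) = ennreal (0 - (1 + 0) powr (1 - p) / (1 - p))"
  proof (rule nn_integral_FTC_atLeast)
    show "DERIV (\<lambda>t. (1 + t) powr (1 - p) / (1 - p)) t :> (1 + t) powr (- p)" if "0 \<le> t" for t
      using that assms by (auto intro!: derivative_eq_intros)
    show "((\<lambda>t::real. (1 + t) powr (1 - p) / (1 - p)) \<longlongrightarrow> 0) at_top"
    proof -
      have "((\<lambda>t::real. (1 + t) powr (1 - p)) \<longlongrightarrow> 0) at_top"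
        using assms by (intro tendsto_neg_powr) (auto intro!: filterlim_tendsto_add_at_top[OF tendsto_const filterlim_ident])
      from tendsto_divide[OF this tendsto_const[of "1 - p"]] show ?thesis using assms by simp
    qed
  qed auto
  then show ?thesis by simp
qed

text \<open>Since 1 + t^2 is at least (1 + |t|)^2 / 2, each half-line reduces to the power with an
  explicit primitive.\<close>

lemma nn_integral_japanese_real:
  assumes "p > 1/2" shows "(\<integral>\<^sup>+(t::real). ennreal ((1 + t\<^sup>2) powr (- p)) \<partial>lborel) < \<infinity>"
proof -
  let ?g = "\<lambda>t. ennreal ((1 + t) powr (- (2 * p))) * indicator {0..} t"
  have fin: "(\<integral>\<^sup>+t. ?g t \<partial>lborel) < \<infinity>" using assms by (intro nn_integral_powr_finite) simp
  have fin': "(\<integral>\<^sup>+t. ?g (0 - t) \<partial>lborel) < \<infinity>"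
    by (subst nn_integral_reflect[of ?g 0]) (use fin in auto)
  have "(\<integral>\<^sup>+(t::real). ennreal ((1 + t\<^sup>2) powr (- p)) \<partial>lborel) \<le> (\<integral>\<^sup>+t. ennreal (2 powr p) * (?g t + ?g (0 - t)) \<partial>lborel)"
  proof (rule nn_integral_mono)
    fix t :: real
    have "0 \<le> (1 - \<bar>t\<bar>)\<^sup>2" by simp
    then have "(1 + \<bar>t\<bar>)\<^sup>2 / 2 \<le> 1 + t\<^sup>2" by (simp add: power2_eq_square algebra_simps abs_mult_self_eq)
    then have "(1 + t\<^sup>2) powr (- p) \<le> ((1 + \<bar>t\<bar>)\<^sup>2 / 2) powr (- p)"
      using assms by (intro powr_mono2') (auto simp: add_pos_nonneg)
    also have "\<dots> = 2 powr p * (1 + \<bar>t\<bar>) powr (- (2 * p))"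
    proof -
      have "((1 + \<bar>t\<bar>)\<^sup>2 / 2) powr (- p) = ((1 + \<bar>t\<bar>)\<^sup>2) powr (- p) / 2 powr (- p)"
        by (subst powr_divide) auto
      also have "(1 + \<bar>t\<bar>)\<^sup>2 = (1 + \<bar>t\<bar>) powr 2"
        using powr_numeral[of "1 + \<bar>t\<bar>"] by simp
      also have "((1 + \<bar>t\<bar>) powr 2) powr (- p) = (1 + \<bar>t\<bar>) powr (- (2 * p))"
        by (simp only: powr_powr) simp
      also have "(1 + \<bar>t\<bar>) powr (- (2 * p)) / 2 powr (- p) = 2 powr p * (1 + \<bar>t\<bar>) powr (- (2 * p))"
        by (simp add: powr_minus_divide)
      finally show ?thesis by simp
    qed
    finally have "ennreal ((1 + t\<^sup>2) powr (- p)) \<le> ennreal (2 powr p) * ennreal ((1 + \<bar>t\<bar>) powr (- (2 * p)))"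
      by (simp add: ennreal_leI flip: ennreal_mult)
    also have "\<dots> \<le> ennreal (2 powr p) * (?g t + ?g (0 - t))"
      by (intro mult_left_mono) (auto simp: indicator_def)
    finally show "ennreal ((1 + t\<^sup>2) powr (- p)) \<le> ennreal (2 powr p) * (?g t + ?g (0 - t))" .
  qed
  also have "\<dots> = ennreal (2 powr p) * ((\<integral>\<^sup>+t. ?g t \<partial>lborel) + (\<integral>\<^sup>+t. ?g (0 - t) \<partial>lborel))"
    by (subst nn_integral_cmult) (auto simp: nn_integral_add)
  also have "\<dots> < \<infinity>" using fin fin' by (simp add: ennreal_mult_less_top)
  finally show ?thesis .
qed

text \<open>Here s > n/2 becomes integrability. The squared weight is a product of n equal powers
  with exponent s/n, each bounded by the same power of one coordinate, and s/n > 1/2 makes every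
  one-dimensional factor finite.\<close>

lemma sqi_wt_neg:
  assumes "s > real CARD('n) / 2"
  shows "sqi (\<lambda>\<xi>::real^'n. complex_of_real (wt (- s) \<xi>))"
proof (rule sqi_nn_integral)
  let ?n = "real CARD('n)" and ?f = "\<lambda>(b::real^'n) t::real. ennreal ((1 + t\<^sup>2) powr (- (s / real CARD('n))))"
  have n: "?n > 0" by simp
  then have s: "s > 0" using assms by (meson divide_pos_pos less_trans zero_less_numeral)
  have "(\<integral>\<^sup>+(\<xi>::real^'n). ennreal ((cmod (complex_of_real (wt (- s) \<xi>)))\<^sup>2) \<partial>lborel)
     \<le> (\<integral>\<^sup>+(\<xi>::real^'n). (\<Prod>b\<in>Basis. ?f b (\<xi> \<bullet> b)) \<partial>lborel)"
  proof (rule nn_integral_mono)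
    fix \<xi> :: "real^'n"
    have "(cmod (complex_of_real (wt (- s) \<xi>)))\<^sup>2 = (1 + (norm \<xi>)\<^sup>2) powr (- s)"
      by (simp add: wt_sq)
    also have "(1 + (norm \<xi>)\<^sup>2) powr (- s) = (\<Prod>b\<in>(Basis::(real^'n) set). (1 + (norm \<xi>)\<^sup>2) powr (- (s / ?n)))"
    proof -
      have "1 + (norm \<xi>)\<^sup>2 > 0" by (simp add: add_pos_nonneg)
      then show ?thesis by (simp add: powr_powr flip: powr_realpow)
    qed
    also have "\<dots> \<le> (\<Prod>b\<in>Basis. (1 + (\<xi> \<bullet> b)\<^sup>2) powr (- (s / ?n)))"
    proof (rule prod_mono)
      fix b :: "real^'n" assume "b \<in> Basis"
      then have "(\<xi> \<bullet> b)\<^sup>2 \<le> (norm \<xi>)\<^sup>2" using Basis_le_norm[of b \<xi>] abs_le_square_iff[of "\<xi> \<bullet> b" "norm \<xi>"] by simp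
      then show "0 \<le> (1 + (norm \<xi>)\<^sup>2) powr (- (s / ?n)) \<and> (1 + (norm \<xi>)\<^sup>2) powr (- (s / ?n)) \<le> (1 + (\<xi> \<bullet> b)\<^sup>2) powr (- (s / ?n))"
        using s n by (intro conjI powr_mono2') (auto simp: add_pos_nonneg)
    qed
    finally show "ennreal ((cmod (complex_of_real (wt (- s) \<xi>)))\<^sup>2) \<le> (\<Prod>b\<in>Basis. ?f b (\<xi> \<bullet> b))"
      by (simp add: prod_ennreal ennreal_leI)
  qed
  also have "\<dots> = (\<Prod>b\<in>(Basis::(real^'n) set). \<integral>\<^sup>+t. ?f b t \<partial>lborel)"
    by (rule nn_integral_lborel_prod) auto
  also have "\<dots> < \<infinity>"
    using nn_integral_japanese_real[of "s / ?n"] assms n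
    by (simp add: less_top[symmetric] power_eq_top_ennreal less_divide_eq)
  finally show "(\<integral>\<^sup>+(\<xi>::real^'n). ennreal ((cmod (complex_of_real (wt (- s) \<xi>)))\<^sup>2) \<partial>lborel) < \<infinity>" .
qed measurable

lemma ennreal_norm_integral_le:
  fixes f :: "'a \<Rightarrow> complex"
  shows "ennreal (cmod (integral\<^sup>L M f)) \<le> (\<integral>\<^sup>+x. ennreal (cmod (f x)) \<partial>M)"
proof (cases "integrable M f")
  case True
  then show ?thesis by (rule integral_norm_bound_ennreal)
qed (simp add: not_integrable_integral_eq)

text \<open>Convolution of an L1 with an L2 function: Cauchy-Schwarz with respect to the measure of
  density \<open>q\<close>, then Tonelli and translation invariance.\<close>

lemma nn_integral_Young:
  fixes a q :: "'a::euclidean_space \<Rightarrow> ennreal"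
  assumes [measurable]: "a \<in> borel_measurable borel" "q \<in> borel_measurable borel"
  shows "(\<integral>\<^sup>+\<xi>. (\<integral>\<^sup>+\<eta>. a (\<xi> - \<eta>) * q \<eta> \<partial>lborel)\<^sup>2 \<partial>lborel) \<le> (\<integral>\<^sup>+\<eta>. q \<eta> \<partial>lborel)\<^sup>2 * (\<integral>\<^sup>+\<xi>. (a \<xi>)\<^sup>2 \<partial>lborel)"
proof -
  let ?Q = "\<integral>\<^sup>+\<eta>. q \<eta> \<partial>lborel"
  have cs: "(\<integral>\<^sup>+\<eta>. a (\<xi> - \<eta>) * q \<eta> \<partial>lborel)\<^sup>2 \<le> (\<integral>\<^sup>+\<eta>. (a (\<xi> - \<eta>))\<^sup>2 * q \<eta> \<partial>lborel) * ?Q" for \<xi>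
  proof -
    have "(\<integral>\<^sup>+\<eta>. a (\<xi> - \<eta>) * 1 \<partial>density lborel q)\<^sup>2 \<le> (\<integral>\<^sup>+\<eta>. (a (\<xi> - \<eta>))\<^sup>2 \<partial>density lborel q) * (\<integral>\<^sup>+\<eta>. 1\<^sup>2 \<partial>density lborel q)"
      by (rule Cauchy_Schwarz_nn_integral) measurable
    moreover have "(\<integral>\<^sup>+\<eta>. g \<eta> \<partial>density lborel q) = (\<integral>\<^sup>+\<eta>. g \<eta> * q \<eta> \<partial>lborel)" if [measurable]: "g \<in> borel_measurable borel" for g
      by (subst nn_integral_density) (auto simp: mult.commute)
    ultimately show ?thesis by (simp add: emeasure_density)
  qed
  have "(\<integral>\<^sup>+\<xi>. (\<integral>\<^sup>+\<eta>. a (\<xi> - \<eta>) * q \<eta> \<partial>lborel)\<^sup>2 \<partial>lborel) \<le> (\<integral>\<^sup>+\<xi>. (\<integral>\<^sup>+\<eta>. (a (\<xi> - \<eta>))\<^sup>2 * q \<eta> \<partial>lborel) * ?Q \<partial>lborel)"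
    by (rule nn_integral_mono) (rule cs)
  also have "\<dots> = (\<integral>\<^sup>+\<xi>. (\<integral>\<^sup>+\<eta>. (a (\<xi> - \<eta>))\<^sup>2 * q \<eta> \<partial>lborel) \<partial>lborel) * ?Q"
    by (rule nn_integral_multc) measurable
  also have "(\<integral>\<^sup>+\<xi>. (\<integral>\<^sup>+\<eta>. (a (\<xi> - \<eta>))\<^sup>2 * q \<eta> \<partial>lborel) \<partial>lborel) = (\<integral>\<^sup>+\<eta>. (\<integral>\<^sup>+\<xi>. (a (\<xi> - \<eta>))\<^sup>2 * q \<eta> \<partial>lborel) \<partial>lborel)"
    by (rule lborel_pair.Fubini') measurable
  also have "\<dots> = (\<integral>\<^sup>+\<eta>. (\<integral>\<^sup>+\<xi>. (a \<xi>)\<^sup>2 \<partial>lborel) * q \<eta> \<partial>lborel)"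
  proof (rule nn_integral_cong)
    fix \<eta>
    have "(\<integral>\<^sup>+\<xi>. (a (\<xi> - \<eta>))\<^sup>2 * q \<eta> \<partial>lborel) = (\<integral>\<^sup>+\<xi>. (a (\<xi> - \<eta>))\<^sup>2 \<partial>lborel) * q \<eta>"
      by (rule nn_integral_multc) measurable
    also have "(\<integral>\<^sup>+\<xi>. (a (\<xi> - \<eta>))\<^sup>2 \<partial>lborel) = (\<integral>\<^sup>+\<xi>. (a \<xi>)\<^sup>2 \<partial>lborel)"
      by (rule nn_integral_translate[of "\<lambda>\<xi>. (a \<xi>)\<^sup>2"]) measurable
    finally show "(\<integral>\<^sup>+\<xi>. (a (\<xi> - \<eta>))\<^sup>2 * q \<eta> \<partial>lborel) = (\<integral>\<^sup>+\<xi>. (a \<xi>)\<^sup>2 \<partial>lborel) * q \<eta>" .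
  qed
  also have "\<dots> = (\<integral>\<^sup>+\<xi>. (a \<xi>)\<^sup>2 \<partial>lborel) * ?Q" by (rule nn_integral_cmult) measurable
  finally show ?thesis by (simp add: power2_eq_square mult_ac)
qed

lemma ennreal_sum_sq_le: "(x + y)\<^sup>2 \<le> 2 * (x\<^sup>2 + y\<^sup>2)" for x y :: ennreal
proof -
  have "2 * x * y \<le> x\<^sup>2 + y\<^sup>2" by (rule sum_of_squares_ge_ennreal)
  then have "(x\<^sup>2 + y\<^sup>2) + 2 * x * y \<le> (x\<^sup>2 + y\<^sup>2) + (x\<^sup>2 + y\<^sup>2)" by (rule add_left_mono)
  then show ?thesis by (simp only: power2_sum mult_2)
qed

definition conv :: "('a::euclidean_space \<Rightarrow> complex) \<Rightarrow> ('a \<Rightarrow> complex) \<Rightarrow> 'a \<Rightarrow> complex" where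
  "conv g h \<xi> = (LINT \<eta>|lborel. g (\<xi> - \<eta>) * h \<eta>)"

lemma conv_measurable:
  assumes [measurable]: "g \<in> borel_measurable borel" "h \<in> borel_measurable borel"
  shows "conv g h \<in> borel_measurable borel"
  unfolding conv_def[abs_def] by measurable

lemma integrable_conv_pair:
  fixes g h :: "'a::euclidean_space \<Rightarrow> complex"
  assumes g: "integrable lborel g" and h: "integrable lborel h"
  shows "integrable (lborel \<Otimes>\<^sub>M lborel) (\<lambda>(\<xi>, \<eta>). g (\<xi> - \<eta>) * h \<eta>)"
proof (rule integrableI_bounded)
  have [measurable]: "g \<in> borel_measurable borel" "h \<in> borel_measurable borel"
    using g[THEN borel_measurable_integrable] h[THEN borel_measurable_integrable] by simp_all
  show "(\<lambda>(\<xi>, \<eta>). g (\<xi> - \<eta>) * h \<eta>) \<in> borel_measurable (lborel \<Otimes>\<^sub>M lborel)" by measurable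
  let ?f = "\<lambda>\<xi> \<eta>. ennreal (cmod (g (\<xi> - \<eta>))) * ennreal (cmod (h \<eta>))"
  have "(\<integral>\<^sup>+p. ennreal (norm (case p of (\<xi>, \<eta>) \<Rightarrow> g (\<xi> - \<eta>) * h \<eta>)) \<partial>(lborel \<Otimes>\<^sub>M lborel)) =
     (\<integral>\<^sup>+p. (case p of (\<xi>, \<eta>) \<Rightarrow> ?f \<xi> \<eta>) \<partial>(lborel \<Otimes>\<^sub>M lborel))"
    by (intro nn_integral_cong) (auto simp: norm_mult ennreal_mult)
  also have "\<dots> = (\<integral>\<^sup>+\<eta>. (\<integral>\<^sup>+\<xi>. ?f \<xi> \<eta> \<partial>lborel) \<partial>lborel)"
    by (subst lborel_pair.nn_integral_snd[symmetric]) auto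
  also have "\<dots> = (\<integral>\<^sup>+\<eta>. (\<integral>\<^sup>+\<xi>. ennreal (cmod (g \<xi>)) \<partial>lborel) * ennreal (cmod (h \<eta>)) \<partial>lborel)"
  proof (rule nn_integral_cong)
    fix \<eta>
    have "(\<integral>\<^sup>+\<xi>. ?f \<xi> \<eta> \<partial>lborel) = (\<integral>\<^sup>+\<xi>. ennreal (cmod (g (\<xi> - \<eta>))) \<partial>lborel) * ennreal (cmod (h \<eta>))"
      by (rule nn_integral_multc) measurable
    also have "(\<integral>\<^sup>+\<xi>. ennreal (cmod (g (\<xi> - \<eta>))) \<partial>lborel) = (\<integral>\<^sup>+\<xi>. ennreal (cmod (g \<xi>)) \<partial>lborel)"
      by (rule nn_integral_translate[of "\<lambda>\<xi>. ennreal (cmod (g \<xi>))"]) measurable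
    finally show "(\<integral>\<^sup>+\<xi>. ?f \<xi> \<eta> \<partial>lborel) = (\<integral>\<^sup>+\<xi>. ennreal (cmod (g \<xi>)) \<partial>lborel) * ennreal (cmod (h \<eta>))" .
  qed
  also have "\<dots> = (\<integral>\<^sup>+\<xi>. ennreal (cmod (g \<xi>)) \<partial>lborel) * (\<integral>\<^sup>+\<eta>. ennreal (cmod (h \<eta>)) \<partial>lborel)"
    by (rule nn_integral_cmult) measurable
  also have "\<dots> < \<infinity>"
    using g h by (simp add: integrable_iff_bounded ennreal_mult_less_top)
  finally show "(\<integral>\<^sup>+p. ennreal (norm (case p of (\<xi>, \<eta>) \<Rightarrow> g (\<xi> - \<eta>) * h \<eta>)) \<partial>(lborel \<Otimes>\<^sub>M lborel)) < \<infinity>" .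
qed

lemma fourier1_conv:
  fixes g h :: "real^'n \<Rightarrow> complex"
  assumes g: "integrable lborel g" and h: "integrable lborel h"
  shows "fourier1 (conv g h) x = fourier1 g x * fourier1 h x"
proof -
  have [measurable]: "g \<in> borel_measurable borel" "h \<in> borel_measurable borel"
    using g[THEN borel_measurable_integrable] h[THEN borel_measurable_integrable] by simp_all
  have int: "integrable (lborel \<Otimes>\<^sub>M lborel) (\<lambda>(\<xi>, \<eta>). g (\<xi> - \<eta>) * h \<eta> * cis (- (\<xi> \<bullet> x)))"
  proof (rule Bochner_Integration.integrable_bound[OF integrable_conv_pair[OF g h]])
    show "AE p in lborel \<Otimes>\<^sub>M lborel. norm (case p of (\<xi>, \<eta>) \<Rightarrow> g (\<xi> - \<eta>) * h \<eta> * cis (- (\<xi> \<bullet> x)))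
       \<le> norm (case p of (\<xi>, \<eta>) \<Rightarrow> g (\<xi> - \<eta>) * h \<eta>)"
      by (intro AE_I2) (auto simp: norm_mult)
  qed measurable
  have "fourier1 (conv g h) x = (LINT \<xi>|lborel. (LINT \<eta>|lborel. g (\<xi> - \<eta>) * h \<eta> * cis (- (\<xi> \<bullet> x))))"
    unfolding fourier1_def conv_def by simp
  also have "\<dots> = (LINT \<eta>|lborel. (LINT \<xi>|lborel. g (\<xi> - \<eta>) * h \<eta> * cis (- (\<xi> \<bullet> x))))"
    by (rule lborel_pair.Fubini_integral[OF int, symmetric])
  also have "\<dots> = (LINT \<eta>|lborel. fourier1 g x * (h \<eta> * cis (- (\<eta> \<bullet> x))))"
  proof (rule Bochner_Integration.integral_cong[OF refl])
    fix \<eta> :: "real^'n"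
    have "(LINT \<xi>|lborel. g (\<xi> - \<eta>) * h \<eta> * cis (- (\<xi> \<bullet> x))) = (LINT \<xi>|lborel. (g (\<xi> - \<eta>) * cis (- ((\<xi> - \<eta>) \<bullet> x))) * (h \<eta> * cis (- (\<eta> \<bullet> x))))"
    proof (rule Bochner_Integration.integral_cong[OF refl])
      fix \<xi>
      have "cis (- (\<xi> \<bullet> x)) = cis (- ((\<xi> - \<eta>) \<bullet> x)) * cis (- (\<eta> \<bullet> x))"
        by (simp add: cis_mult inner_diff_left)
      then show "g (\<xi> - \<eta>) * h \<eta> * cis (- (\<xi> \<bullet> x)) = (g (\<xi> - \<eta>) * cis (- ((\<xi> - \<eta>) \<bullet> x))) * (h \<eta> * cis (- (\<eta> \<bullet> x)))"
        by simp
    qed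
    also have "\<dots> = (LINT \<xi>|lborel. g (\<xi> - \<eta>) * cis (- ((\<xi> - \<eta>) \<bullet> x))) * (h \<eta> * cis (- (\<eta> \<bullet> x)))"
      by (rule integral_mult_left_zero)
    also have "(LINT \<xi>|lborel. g (\<xi> - \<eta>) * cis (- ((\<xi> - \<eta>) \<bullet> x))) = fourier1 g x"
      unfolding fourier1_def by (rule integral_translate[of "\<lambda>\<xi>. g \<xi> * cis (- (\<xi> \<bullet> x))"]) measurable
    finally show "(LINT \<xi>|lborel. g (\<xi> - \<eta>) * h \<eta> * cis (- (\<xi> \<bullet> x))) = fourier1 g x * (h \<eta> * cis (- (\<eta> \<bullet> x)))" .
  qed
  also have "\<dots> = fourier1 g x * fourier1 h x" unfolding fourier1_def by (rule integral_mult_right_zero)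
  finally show ?thesis .
qed

text \<open>The dummy type argument fixes the dimension, which constants such as
  \<open>L2_const\<close> would otherwise not mention in their types.\<close>

locale sobolev_space =
  fixes s :: real and n_type :: "'n::finite itself"
  assumes s_gt: "s > real CARD('n) / 2"
begin

lemma s_pos: "s > 0"
proof -
  have "0 \<le> real CARD('n) / 2" by simp
  then show ?thesis using s_gt by (rule le_less_trans)
qed

definition L2_const :: real where
  "L2_const = norm (abs_lsq (\<lambda>\<xi>::real^'n. complex_of_real (wt (- s) \<xi>)))"

text \<open>An H^s function is encoded by the class of \<open>wt s\<close> times its transform, so
  that its H^s norm is the norm of the class. \<open>fhat\<close> strips the weight off again and is
  the transform itself.\<close>

definition fhat :: "(real^'n) lsq \<Rightarrow> real^'n \<Rightarrow> complex" where
  "fhat U \<xi> = of_real (wt (- s) \<xi>) * rep_lsq U \<xi>"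

lemma fhat_measurable [measurable]: "fhat U \<in> borel_measurable borel"
  unfolding fhat_def[abs_def] by measurable

lemma cmod_wt_neg_le: "cmod (complex_of_real (wt (- s) \<xi>)) \<le> 1"
  using wt_neg_le_1[of s \<xi>] s_pos by simp

lemma sqi_fhat: "sqi (fhat U)"
  unfolding fhat_def[abs_def] by (rule sqi_mult_bounded[OF sqi_rep _ cmod_wt_neg_le]) measurable

lemma integrable_fhat: "integrable lborel (fhat U)"
  unfolding fhat_def[abs_def] by (rule sqi_mult_integrable[OF sqi_wt_neg[OF s_gt] sqi_rep])

lemma abs_fhat: "abs_lsq (fhat U) = lmult (\<lambda>\<xi>. of_real (wt (- s) \<xi>)) U"
  unfolding lmult_def fhat_def[abs_def] by simp

text \<open>Cauchy-Schwarz against the square-integrable weight \<open>wt (- s)\<close>: transforms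
  of H^s functions are integrable. This yields pointwise values by inversion and the L1 factor in
  the product estimate.\<close>

lemma nn_integral_fhat_sq: "(\<integral>\<^sup>+\<xi>. ennreal (cmod (fhat U \<xi>)) \<partial>lborel)\<^sup>2 \<le> ennreal (L2_const\<^sup>2) * ennreal ((norm U)\<^sup>2)"
proof -
  have "(\<integral>\<^sup>+\<xi>. ennreal (cmod (fhat U \<xi>)) \<partial>lborel) = (\<integral>\<^sup>+(\<xi>::real^'n). ennreal (cmod (complex_of_real (wt (- s) \<xi>))) * ennreal (cmod (rep_lsq U \<xi>)) \<partial>lborel)"
    by (intro nn_integral_cong) (simp add: fhat_def norm_mult ennreal_mult)
  also have "\<dots>\<^sup>2 \<le> (\<integral>\<^sup>+(\<xi>::real^'n). (ennreal (cmod (complex_of_real (wt (- s) \<xi>))))\<^sup>2 \<partial>lborel) * (\<integral>\<^sup>+\<xi>. (ennreal (cmod (rep_lsq U \<xi>)))\<^sup>2 \<partial>lborel)"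
    by (rule Cauchy_Schwarz_nn_integral) measurable
  also have "(\<integral>\<^sup>+(\<xi>::real^'n). (ennreal (cmod (complex_of_real (wt (- s) \<xi>))))\<^sup>2 \<partial>lborel) = ennreal (L2_const\<^sup>2)"
    unfolding L2_const_def nn_integral_abs_lsq[OF sqi_wt_neg[OF s_gt], symmetric] by (simp add: ennreal_power)
  also have "(\<integral>\<^sup>+\<xi>. (ennreal (cmod (rep_lsq U \<xi>)))\<^sup>2 \<partial>lborel) = ennreal ((norm U)\<^sup>2)"
    unfolding nn_integral_rep_lsq[symmetric] by (simp add: ennreal_power)
  finally show ?thesis .
qed

text \<open>The factor 2 to the power s comes from splitting the weight. The other 2 is the square
  root of 4: one 2 from squaring a sum, one from two terms with the same bound.\<close>

definition mul_const :: real where "mul_const = 2 * 2 powr s * L2_const"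

text \<open>The algebra property on the Fourier side. The weight falls on one factor of the
  convolution, which is then in L2, while the other factor is in L1; Young's inequality bounds both
  distributions of the weight.\<close>

lemma conv_fhat_bound:
  "(\<integral>\<^sup>+\<xi>. ennreal ((cmod (of_real (wt s \<xi>) * conv (fhat U) (fhat V) \<xi>))\<^sup>2) \<partial>lborel) \<le> ennreal ((mul_const * norm U * norm V)\<^sup>2)"
proof -
  let ?A = "\<lambda>\<xi>. ennreal (cmod (rep_lsq U \<xi>))" and ?B = "\<lambda>\<xi>. ennreal (cmod (rep_lsq V \<xi>))"
  let ?P = "\<lambda>\<xi>. ennreal (cmod (fhat U \<xi>))" and ?Q = "\<lambda>\<xi>. ennreal (cmod (fhat V \<xi>))"
  let ?I1 = "\<lambda>\<xi>. \<integral>\<^sup>+\<eta>. ?A (\<xi> - \<eta>) * ?Q \<eta> \<partial>lborel" and ?I2 = "\<lambda>\<xi>. \<integral>\<^sup>+\<eta>. ?B (\<xi> - \<eta>) * ?P \<eta> \<partial>lborel"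
  let ?c = "ennreal (2 powr s)"
  have pt: "ennreal (wt s \<xi>) * (?P (\<xi> - \<eta>) * ?Q \<eta>) \<le> ?c * (?A (\<xi> - \<eta>) * ?Q \<eta> + ?P (\<xi> - \<eta>) * ?B \<eta>)" for \<xi> \<eta> :: "real^'n"
  proof -
    have A: "cmod (rep_lsq W \<xi>) = wt s \<xi> * cmod (fhat W \<xi>)" for W and \<xi> :: "real^'n"
      by (simp add: fhat_def norm_mult flip: mult.assoc)
    let ?x = "cmod (fhat U (\<xi> - \<eta>))" and ?y = "cmod (fhat V \<eta>)"
    have "wt s \<xi> * (?x * ?y) \<le> 2 powr s * (wt s (\<xi> - \<eta>) + wt s \<eta>) * (?x * ?y)"
      using s_pos by (intro mult_right_mono wt_subadd) auto
    also have "\<dots> = 2 powr s * ((wt s (\<xi> - \<eta>) * ?x) * ?y + ?x * (wt s \<eta> * ?y))"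
      by (simp add: algebra_simps)
    finally have "wt s \<xi> * (?x * ?y) \<le> 2 powr s * (cmod (rep_lsq U (\<xi> - \<eta>)) * ?y + ?x * cmod (rep_lsq V \<eta>))"
      by (simp only: A)
    from ennreal_leI[OF this] show ?thesis
      by (simp add: ennreal_mult ennreal_plus)
  qed
  have "(\<integral>\<^sup>+\<xi>. ennreal ((cmod (of_real (wt s \<xi>) * conv (fhat U) (fhat V) \<xi>))\<^sup>2) \<partial>lborel)
     \<le> (\<integral>\<^sup>+\<xi>. ?c\<^sup>2 * (2 * ((?I1 \<xi>)\<^sup>2 + (?I2 \<xi>)\<^sup>2)) \<partial>lborel)"
  proof (rule nn_integral_mono)
    fix \<xi> :: "real^'n"
    have "ennreal (cmod (of_real (wt s \<xi>) * conv (fhat U) (fhat V) \<xi>)) = ennreal (wt s \<xi>) * ennreal (cmod (conv (fhat U) (fhat V) \<xi>))"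
      by (simp add: norm_mult ennreal_mult)
    also have "\<dots> \<le> ennreal (wt s \<xi>) * (\<integral>\<^sup>+\<eta>. ennreal (cmod (fhat U (\<xi> - \<eta>) * fhat V \<eta>)) \<partial>lborel)"
      unfolding conv_def by (intro mult_left_mono ennreal_norm_integral_le) simp
    also have "\<dots> = ennreal (wt s \<xi>) * (\<integral>\<^sup>+\<eta>. ?P (\<xi> - \<eta>) * ?Q \<eta> \<partial>lborel)"
      by (simp add: norm_mult ennreal_mult)
    also have "\<dots> = (\<integral>\<^sup>+\<eta>. ennreal (wt s \<xi>) * (?P (\<xi> - \<eta>) * ?Q \<eta>) \<partial>lborel)"
      by (rule nn_integral_cmult[symmetric]) measurable
    also have "\<dots> \<le> (\<integral>\<^sup>+\<eta>. ?c * (?A (\<xi> - \<eta>) * ?Q \<eta> + ?P (\<xi> - \<eta>) * ?B \<eta>) \<partial>lborel)"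
      by (rule nn_integral_mono) (rule pt)
    also have "\<dots> = ?c * (\<integral>\<^sup>+\<eta>. ?A (\<xi> - \<eta>) * ?Q \<eta> + ?P (\<xi> - \<eta>) * ?B \<eta> \<partial>lborel)"
      by (rule nn_integral_cmult) measurable
    also have "(\<integral>\<^sup>+\<eta>. ?A (\<xi> - \<eta>) * ?Q \<eta> + ?P (\<xi> - \<eta>) * ?B \<eta> \<partial>lborel) = ?I1 \<xi> + (\<integral>\<^sup>+\<eta>. ?P (\<xi> - \<eta>) * ?B \<eta> \<partial>lborel)"
      by (rule nn_integral_add) measurable
    \<comment> \<open>Reflection exchanges the two arguments of the convolution, so that again the
      L2 factor carries \<xi> - \<eta>, as Young's inequality is stated.\<close>
    also have "(\<integral>\<^sup>+\<eta>. ?P (\<xi> - \<eta>) * ?B \<eta> \<partial>lborel) = ?I2 \<xi>"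
    proof -
      have "(\<integral>\<^sup>+\<eta>. ?P (\<xi> - (\<xi> - \<eta>)) * ?B (\<xi> - \<eta>) \<partial>lborel) = (\<integral>\<^sup>+\<eta>. ?P (\<xi> - \<eta>) * ?B \<eta> \<partial>lborel)"
        by (rule nn_integral_reflect[of "\<lambda>\<eta>. ?P (\<xi> - \<eta>) * ?B \<eta>" \<xi>]) measurable
      then show ?thesis by (simp add: mult.commute)
    qed
    finally have "(ennreal (cmod (of_real (wt s \<xi>) * conv (fhat U) (fhat V) \<xi>)))\<^sup>2 \<le> (?c * (?I1 \<xi> + ?I2 \<xi>))\<^sup>2"
      by (intro power_mono) auto
    also have "\<dots> = ?c\<^sup>2 * (?I1 \<xi> + ?I2 \<xi>)\<^sup>2" by (rule power_mult_distrib)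
    also have "\<dots> \<le> ?c\<^sup>2 * (2 * ((?I1 \<xi>)\<^sup>2 + (?I2 \<xi>)\<^sup>2))"
      by (intro mult_left_mono ennreal_sum_sq_le) simp
    finally show "ennreal ((cmod (of_real (wt s \<xi>) * conv (fhat U) (fhat V) \<xi>))\<^sup>2) \<le> ?c\<^sup>2 * (2 * ((?I1 \<xi>)\<^sup>2 + (?I2 \<xi>)\<^sup>2))"
      by (simp only: ennreal_power[OF norm_ge_zero, symmetric])
  qed
  also have "\<dots> = ?c\<^sup>2 * (2 * ((\<integral>\<^sup>+\<xi>. (?I1 \<xi>)\<^sup>2 \<partial>lborel) + (\<integral>\<^sup>+\<xi>. (?I2 \<xi>)\<^sup>2 \<partial>lborel)))"
    by (subst nn_integral_cmult, measurable, subst nn_integral_cmult, measurable, subst nn_integral_add, measurable)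
  also have "\<dots> \<le> ?c\<^sup>2 * (2 * (ennreal (L2_const\<^sup>2) * ennreal ((norm V)\<^sup>2) * ennreal ((norm U)\<^sup>2) + ennreal (L2_const\<^sup>2) * ennreal ((norm U)\<^sup>2) * ennreal ((norm V)\<^sup>2)))"
  proof (intro mult_left_mono add_mono)
    have sq: "(\<integral>\<^sup>+\<xi>. (ennreal (cmod (rep_lsq W \<xi>)))\<^sup>2 \<partial>lborel) = ennreal ((norm W)\<^sup>2)" for W :: "(real^'n) lsq"
      unfolding nn_integral_rep_lsq[symmetric] by (simp add: ennreal_power)
    show "(\<integral>\<^sup>+\<xi>. (?I1 \<xi>)\<^sup>2 \<partial>lborel) \<le> ennreal (L2_const\<^sup>2) * ennreal ((norm V)\<^sup>2) * ennreal ((norm U)\<^sup>2)"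
      unfolding sq[symmetric] by (rule order_trans[OF nn_integral_Young]) (measurable, intro mult_right_mono order_trans[OF nn_integral_fhat_sq], auto simp: sq)
    show "(\<integral>\<^sup>+\<xi>. (?I2 \<xi>)\<^sup>2 \<partial>lborel) \<le> ennreal (L2_const\<^sup>2) * ennreal ((norm U)\<^sup>2) * ennreal ((norm V)\<^sup>2)"
      unfolding sq[symmetric] by (rule order_trans[OF nn_integral_Young]) (measurable, intro mult_right_mono order_trans[OF nn_integral_fhat_sq], auto simp: sq)
  qed simp_all
  also have "\<dots> = ennreal ((mul_const * norm U * norm V)\<^sup>2)"
  proof -
    have conv: "(ennreal c)\<^sup>2 * (2 * (ennreal l * ennreal v * ennreal u + ennreal l * ennreal u * ennreal v)) = ennreal (c\<^sup>2 * (2 * (l * v * u + l * u * v)))"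
      if "0 \<le> c" "0 \<le> l" "0 \<le> u" "0 \<le> v" for c l u v
    proof -
      have "(ennreal c)\<^sup>2 * (ennreal 2 * (ennreal l * ennreal v * ennreal u + ennreal l * ennreal u * ennreal v)) = ennreal (c\<^sup>2 * (2 * (l * v * u + l * u * v)))"
        using that by (simp only: ennreal_mult[symmetric] ennreal_plus[symmetric] ennreal_power mult_nonneg_nonneg add_nonneg_nonneg zero_le_power2 zero_le_numeral)
      then show ?thesis by simp
    qed
    have "(mul_const * norm U * norm V)\<^sup>2 = (2 powr s)\<^sup>2 * (2 * (L2_const\<^sup>2 * (norm V)\<^sup>2 * (norm U)\<^sup>2 + L2_const\<^sup>2 * (norm U)\<^sup>2 * (norm V)\<^sup>2))"
      unfolding mul_const_def by (simp add: power_mult_distrib algebra_simps)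
    then show ?thesis by (subst conv) simp_all
  qed
  finally show ?thesis .
qed

end

section \<open>Pointwise representatives and the algebra structure\<close>

lemma fourier1_cong_AE:
  assumes [measurable]: "f \<in> borel_measurable borel" "g \<in> borel_measurable borel"
    and "AE x in lborel. f x = g x"
  shows "fourier1 f \<xi> = fourier1 g \<xi>"
  unfolding fourier1_def
proof (rule integral_cong_AE)
  show "AE x in lborel. f x * cis (- (x \<bullet> \<xi>)) = g x * cis (- (x \<bullet> \<xi>))"
    using assms(3) by eventually_elim simp
qed measurable

lemma integrable_mult_cis:
  fixes f :: "'a::euclidean_space \<Rightarrow> complex"
  assumes "integrable lborel f" and [measurable]: "g \<in> borel_measurable borel"
  shows "integrable lborel (\<lambda>x. f x * cis (g x))"
proof (rule Bochner_Integration.integrable_bound[OF assms(1)])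
  have [measurable]: "f \<in> borel_measurable borel" using borel_measurable_integrable[OF assms(1)] by simp
  show "(\<lambda>x. f x * cis (g x)) \<in> borel_measurable lborel" by measurable
qed (auto simp: norm_mult)

lemma fourier1_add:
  assumes "integrable lborel f" "integrable lborel g"
  shows "fourier1 (\<lambda>x. f x + g x) \<xi> = fourier1 f \<xi> + fourier1 g \<xi>"
  unfolding fourier1_def distrib_right
  by (rule Bochner_Integration.integral_add) (intro integrable_mult_cis assms, measurable)+

lemma fourier1_cmult: "fourier1 (\<lambda>x. c * f x) \<xi> = c * fourier1 f \<xi>"
  unfolding fourier1_def mult.assoc by (rule integral_mult_right_zero)

context sobolev_space
begin

definition cn :: complex where "cn = of_real (1 / (2 * pi) ^ CARD('n))"

text \<open>The inversion integral evaluated at every point, not a class. It depends only on the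
  class, so sums, products and conjugates of encoded functions obey their identities at every x
  instead of almost everywhere.\<close>

definition emb :: "(real^'n) lsq \<Rightarrow> real^'n \<Rightarrow> complex" where
  "emb U x = cn * fourier1 (fhat U) (- x)"

lemma emb_measurable [measurable]: "emb U \<in> borel_measurable borel"
proof -
  have [measurable]: "fourier1 (fhat U) \<in> borel_measurable borel" by measurable
  show ?thesis unfolding emb_def[abs_def] by measurable
qed

lemma emb_AE: "AE x in lborel. rep_lsq (Finv (abs_lsq (fhat U))) x = emb U x"
  unfolding emb_def cn_def by (rule Finv_fourier1[OF integrable_fhat sqi_fhat])

lemma sqi_emb: "sqi (emb U)"
  by (rule sqi_cong_AE[OF sqi_rep _ emb_AE]) simp

lemma abs_emb: "abs_lsq (emb U) = Finv (abs_lsq (fhat U))"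
  by (rule lsq_eqI_abs[OF sqi_emb emb_AE, symmetric])

lemma rep_eq_fhat: "rep_lsq U \<xi> = of_real (wt s \<xi>) * fhat U \<xi>"
  by (simp add: fhat_def flip: mult.assoc of_real_mult)

lemma fhat_cong: "AE \<xi> in lborel. fhat U \<xi> = fhat V \<xi> \<Longrightarrow> U = V"
  by (rule lsq_eqI) (erule eventually_mono, simp add: rep_eq_fhat)

lemma fhat_abs:
  assumes "sqi f" shows "AE \<xi> in lborel. fhat (abs_lsq f) \<xi> = of_real (wt (- s) \<xi>) * f \<xi>"
  using rep_abs_lsq[OF assms] by eventually_elim (simp add: fhat_def)

text \<open>Identities between encoded functions can therefore be read off from their values in
  physical space. Bilinearity of \<open>smul\<close> and linearity of \<open>sconj\<close> are
  proved this way.\<close>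

lemma emb_inj:
  assumes "AE x in lborel. emb U x = emb V x" shows "U = V"
proof -
  have "Finv (abs_lsq (fhat U)) = Finv (abs_lsq (fhat V))"
    unfolding abs_emb[symmetric] by (rule abs_lsq_eqI[OF sqi_emb sqi_emb assms])
  then have "Fou (Finv (abs_lsq (fhat U))) = Fou (Finv (abs_lsq (fhat V)))" by simp
  then have eq: "abs_lsq (fhat U) = abs_lsq (fhat V)" by (simp only: Fou_Finv)
  have "AE \<xi> in lborel. fhat U \<xi> = fhat V \<xi>"
    using rep_abs_lsq[OF sqi_fhat[of U]] rep_abs_lsq[OF sqi_fhat[of V]] unfolding eq by eventually_elim simp
  then show ?thesis by (rule fhat_cong)
qed

lemma emb_fhatI:
  assumes [measurable]: "g \<in> borel_measurable borel" and "AE \<xi> in lborel. fhat U \<xi> = g \<xi>"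
  shows "emb U x = cn * fourier1 g (- x)"
  unfolding emb_def using fourier1_cong_AE[OF fhat_measurable assms] by simp

lemma emb_add: "emb (U + V) x = emb U x + emb V x"
proof -
  have "emb (U + V) x = cn * fourier1 (\<lambda>\<xi>. fhat U \<xi> + fhat V \<xi>) (- x)"
  proof (rule emb_fhatI)
    show "AE \<xi> in lborel. fhat (U + V) \<xi> = fhat U \<xi> + fhat V \<xi>"
      using rep_add[of U V] by eventually_elim (simp add: fhat_def algebra_simps)
  qed measurable
  then show ?thesis by (simp add: fourier1_add integrable_fhat emb_def algebra_simps)
qed

lemma emb_lmult_const: "emb (lmult (\<lambda>_. c) U) x = c * emb U x"
proof -
  have "emb (lmult (\<lambda>_. c) U) x = cn * fourier1 (\<lambda>\<xi>. c * fhat U \<xi>) (- x)"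
  proof (rule emb_fhatI)
    show "AE \<xi> in lborel. fhat (lmult (\<lambda>_. c) U) \<xi> = c * fhat U \<xi>"
      using rep_lmult[of "\<lambda>_. c" "cmod c" U] by simp (erule eventually_mono, simp add: fhat_def)
  qed measurable
  then show ?thesis by (simp add: fourier1_cmult emb_def)
qed

lemma lmult_of_real: "lmult (\<lambda>_. of_real c) U = c *\<^sub>R U"
  unfolding lmult_def scaleR_lsq_def by simp

lemma emb_scaleR: "emb (c *\<^sub>R U) x = of_real c * emb U x"
  using emb_lmult_const[of "of_real c" U x] by (simp add: lmult_of_real)

lemma emb_zero: "emb 0 x = 0" using emb_scaleR[of 0 0 x] by simp

lemma emb_diff: "emb (U - V) x = emb U x - emb V x"
  using emb_add[of U "(-1) *\<^sub>R V" x] emb_scaleR[of "-1" V x] by simp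

text \<open>The encoding of the pointwise product. With this normalisation the transform of a
  product is \<open>cn\<close> times the convolution of the transforms, which explains the outer
  factor.\<close>

definition smul :: "(real^'n) lsq \<Rightarrow> (real^'n) lsq \<Rightarrow> (real^'n) lsq" where
  "smul U V = lmult (\<lambda>_. cn) (abs_lsq (\<lambda>\<xi>. of_real (wt s \<xi>) * conv (fhat U) (fhat V) \<xi>))"

lemma L2_const_nonneg: "L2_const \<ge> 0" by (simp add: L2_const_def)

lemma mul_const_nonneg: "mul_const \<ge> 0" unfolding mul_const_def using L2_const_nonneg by simp

lemma conv_fhat:
  shows sqi_wt_conv: "sqi (\<lambda>\<xi>. of_real (wt s \<xi>) * conv (fhat U) (fhat V) \<xi>)"
    and norm_wt_conv: "norm (abs_lsq (\<lambda>\<xi>. of_real (wt s \<xi>) * conv (fhat U) (fhat V) \<xi>)) \<le> mul_const * norm U * norm V"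
proof -
  have [measurable]: "conv (fhat U) (fhat V) \<in> borel_measurable borel" by (rule conv_measurable) measurable
  have m: "(\<lambda>\<xi>. of_real (wt s \<xi>) * conv (fhat U) (fhat V) \<xi>) \<in> borel_measurable lborel" by measurable
  have c: "0 \<le> mul_const * norm U * norm V" using mul_const_nonneg by simp
  show "sqi (\<lambda>\<xi>. of_real (wt s \<xi>) * conv (fhat U) (fhat V) \<xi>)"
    "norm (abs_lsq (\<lambda>\<xi>. of_real (wt s \<xi>) * conv (fhat U) (fhat V) \<xi>)) \<le> mul_const * norm U * norm V"
    using norm_abs_lsq_le[OF m c conv_fhat_bound] by auto
qed

lemma norm_smul: "norm (smul U V) \<le> (cmod cn * mul_const) * norm U * norm V"
proof -
  have "norm (smul U V) \<le> cmod cn * norm (abs_lsq (\<lambda>\<xi>. of_real (wt s \<xi>) * conv (fhat U) (fhat V) \<xi>))"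
    unfolding smul_def by (rule norm_lmult_le) auto
  also have "\<dots> \<le> cmod cn * (mul_const * norm U * norm V)" by (intro mult_left_mono norm_wt_conv) simp
  finally show ?thesis by (simp add: mult_ac)
qed

lemma emb_smul: "emb (smul U V) x = emb U x * emb V x"
proof -
  have [measurable]: "conv (fhat U) (fhat V) \<in> borel_measurable borel" by (rule conv_measurable) measurable
  have "emb (abs_lsq (\<lambda>\<xi>. of_real (wt s \<xi>) * conv (fhat U) (fhat V) \<xi>)) x = cn * fourier1 (conv (fhat U) (fhat V)) (- x)"
  proof (rule emb_fhatI)
    show "AE \<xi> in lborel. fhat (abs_lsq (\<lambda>\<xi>. of_real (wt s \<xi>) * conv (fhat U) (fhat V) \<xi>)) \<xi> = conv (fhat U) (fhat V) \<xi>"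
      using fhat_abs[OF sqi_wt_conv[of U V]]
    proof eventually_elim
      case (elim \<xi>)
      have "complex_of_real (wt (- s) \<xi>) * of_real (wt s \<xi>) = 1"
        using wt_mult_inverse[of s \<xi>] by (simp only: mult.commute of_real_mult[symmetric] of_real_1)
      then show ?case unfolding elim mult.assoc[symmetric] by simp
    qed
  qed measurable
  then have eq: "emb (abs_lsq (\<lambda>\<xi>. of_real (wt s \<xi>) * conv (fhat U) (fhat V) \<xi>)) x = cn * (fourier1 (fhat U) (- x) * fourier1 (fhat V) (- x))"
    by (simp only: fourier1_conv[OF integrable_fhat integrable_fhat])
  show ?thesis unfolding smul_def emb_lmult_const eq by (simp add: emb_def)
qed

lemma bounded_bilinear_smul: "bounded_bilinear smul"
proof
  show "smul (U + U') V = smul U V + smul U' V" for U U' V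
    by (rule emb_inj) (simp add: emb_add emb_smul algebra_simps)
  show "smul U (V + V') = smul U V + smul U V'" for U V V'
    by (rule emb_inj) (simp add: emb_add emb_smul algebra_simps)
  show "smul (r *\<^sub>R U) V = r *\<^sub>R smul U V" for r U V
    by (rule emb_inj) (simp add: emb_scaleR emb_smul algebra_simps)
  show "smul U (r *\<^sub>R V) = r *\<^sub>R smul U V" for r U V
    by (rule emb_inj) (simp add: emb_scaleR emb_smul algebra_simps)
  show "\<exists>K. \<forall>U V. norm (smul U V) \<le> norm U * norm V * K"
    using norm_smul by (intro exI[of _ "cmod cn * mul_const"]) (simp add: mult_ac)
qed

text \<open>The encoding of complex conjugation in physical space: on the Fourier side it is
  conjugation combined with reflection, and the weight is even.\<close>

definition sconj :: "(real^'n) lsq \<Rightarrow> (real^'n) lsq" where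
  "sconj U = abs_lsq (\<lambda>\<xi>. cnj (rep_lsq U (- \<xi>)))"

lemma nn_integral_sconj: "(\<integral>\<^sup>+\<xi>. ennreal ((cmod (cnj (rep_lsq U (- \<xi>))))\<^sup>2) \<partial>lborel) = ennreal ((norm U)\<^sup>2)"
  for U :: "(real^'n) lsq"
  using nn_integral_reflect[of "\<lambda>\<xi>. ennreal ((cmod (rep_lsq U \<xi>))\<^sup>2)" 0] by (simp add: nn_integral_rep_lsq)

lemma sqi_sconj: "sqi (\<lambda>\<xi>. cnj (rep_lsq U (- \<xi>)))" for U :: "(real^'n) lsq"
proof (rule sqi_nn_integral)
  show "(\<integral>\<^sup>+\<xi>. ennreal ((cmod (cnj (rep_lsq U (- \<xi>))))\<^sup>2) \<partial>lborel) < \<infinity>"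
    unfolding nn_integral_sconj by simp
qed measurable

lemma norm_sconj: "norm (sconj U) = norm U"
proof -
  have "ennreal ((norm (sconj U))\<^sup>2) = ennreal ((norm U)\<^sup>2)"
    unfolding sconj_def nn_integral_abs_lsq[OF sqi_sconj, symmetric] by (rule nn_integral_sconj)
  then show ?thesis by simp
qed

lemma emb_sconj: "emb (sconj U) x = cnj (emb U x)"
proof -
  have "emb (sconj U) x = cn * fourier1 (\<lambda>\<xi>. cnj (fhat U (- \<xi>))) (- x)"
  proof (rule emb_fhatI)
    show "AE \<xi> in lborel. fhat (sconj U) \<xi> = cnj (fhat U (- \<xi>))"
      unfolding sconj_def using fhat_abs[OF sqi_sconj] by eventually_elim (simp add: fhat_def)
  qed measurable
  also have "fourier1 (\<lambda>\<xi>. cnj (fhat U (- \<xi>))) (- x) = (LINT \<xi>|lborel. cnj (fhat U (0 - \<xi>)) * cis (- ((0 - \<xi>) \<bullet> x)))"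
    unfolding fourier1_def by simp
  also have "\<dots> = (LINT \<xi>|lborel. cnj (fhat U \<xi>) * cis (- (\<xi> \<bullet> x)))"
    by (rule integral_reflect[of "\<lambda>\<xi>. cnj (fhat U \<xi>) * cis (- (\<xi> \<bullet> x))"]) measurable
  also have "\<dots> = cnj (fourier1 (fhat U) (- x))"
    unfolding fourier1_def Bochner_Integration.integral_cnj[symmetric] by (simp add: cis_cnj)
  finally show ?thesis by (simp add: emb_def cn_def)
qed

lemma bounded_linear_sconj: "bounded_linear sconj"
proof (rule bounded_linear_intro[where K=1])
  show "sconj (U + V) = sconj U + sconj V" for U V
    by (rule emb_inj) (simp add: emb_add emb_sconj)
  show "sconj (r *\<^sub>R U) = r *\<^sub>R sconj U" for r U
    by (rule emb_inj) (simp add: emb_scaleR emb_sconj)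
qed (simp add: norm_sconj)

text \<open>Because |u|^2 is u times its conjugate, the nonlinearity with even exponent is a
  polynomial in u and its conjugate. It is thus built from \<open>smul\<close> and
  \<open>sconj\<close>, starting from u itself at k = 0.\<close>

fun npow :: "nat \<Rightarrow> (real^'n) lsq \<Rightarrow> (real^'n) lsq" where
  "npow 0 U = U"
| "npow (Suc k) U = smul (npow k U) (smul U (sconj U))"

lemma emb_npow: "emb (npow k U) x = nonlin k (emb U) x"
proof (induction k)
  case (Suc k)
  have "complex_of_real (cmod z ^ (2 * Suc k)) = complex_of_real (cmod z ^ (2 * k)) * (z * cnj z)" for z
    by (simp add: complex_norm_square[symmetric] power2_eq_square mult_ac)
  then show ?case using Suc[unfolded nonlin_def]
    by (simp only: npow.simps emb_smul emb_sconj nonlin_def mult.assoc)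
qed (simp add: nonlin_def)

text \<open>Size and Lipschitz constant are controlled together, which makes the class closed under
  \<open>smul\<close> and permits induction on the power.\<close>

definition lip_on_balls :: "((real^'n) lsq \<Rightarrow> (real^'n) lsq) \<Rightarrow> bool" where
  "lip_on_balls f \<longleftrightarrow> (\<forall>M. \<exists>B. \<forall>U V. norm U \<le> M \<longrightarrow> norm V \<le> M \<longrightarrow> norm (f U) \<le> B \<and> norm (f U - f V) \<le> B * norm (U - V))"

lemma lip_on_ballsD:
  assumes "lip_on_balls f"
  obtains B where "B \<ge> 0" "\<And>U. norm U \<le> M \<Longrightarrow> norm (f U) \<le> B"
    "\<And>U V. norm U \<le> M \<Longrightarrow> norm V \<le> M \<Longrightarrow> norm (f U - f V) \<le> B * norm (U - V)"
proof -
  obtain B where B: "\<forall>U V. norm U \<le> M \<longrightarrow> norm V \<le> M \<longrightarrow> norm (f U) \<le> B \<and> norm (f U - f V) \<le> B * norm (U - V)"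
    using assms unfolding lip_on_balls_def by (elim allE[of _ M] exE)
  show ?thesis
  proof (rule that[of "max B 0"])
    show "norm (f U) \<le> max B 0" if "norm U \<le> M" for U
      using B[rule_format, OF that that] by simp
    show "norm (f U - f V) \<le> max B 0 * norm (U - V)" if "norm U \<le> M" "norm V \<le> M" for U V
    proof -
      have "norm (f U - f V) \<le> B * norm (U - V)" using B[rule_format, OF that] by simp
      also have "\<dots> \<le> max B 0 * norm (U - V)" by (intro mult_right_mono) auto
      finally show ?thesis .
    qed
  qed simp
qed

lemma lip_on_balls_smul:
  assumes f: "lip_on_balls f" and g: "lip_on_balls g"
  shows "lip_on_balls (\<lambda>U. smul (f U) (g U))"
  unfolding lip_on_balls_def
proof (rule allI)
  fix M :: real
  interpret b: bounded_bilinear smul by (rule bounded_bilinear_smul)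
  obtain K where K: "K > 0" "\<And>U V. norm (smul U V) \<le> norm U * norm V * K" using b.pos_bounded by blast
  obtain B where B: "B \<ge> 0" "\<And>U. norm U \<le> M \<Longrightarrow> norm (f U) \<le> B"
    "\<And>U V. norm U \<le> M \<Longrightarrow> norm V \<le> M \<Longrightarrow> norm (f U - f V) \<le> B * norm (U - V)"
    using lip_on_ballsD[OF f, of M] by metis
  obtain C where C: "C \<ge> 0" "\<And>U. norm U \<le> M \<Longrightarrow> norm (g U) \<le> C"
    "\<And>U V. norm U \<le> M \<Longrightarrow> norm V \<le> M \<Longrightarrow> norm (g U - g V) \<le> C * norm (U - V)"
    using lip_on_ballsD[OF g, of M] by metis
  show "\<exists>D. \<forall>U V. norm U \<le> M \<longrightarrow> norm V \<le> M \<longrightarrow> norm (smul (f U) (g U)) \<le> D \<and> norm (smul (f U) (g U) - smul (f V) (g V)) \<le> D * norm (U - V)"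
  proof (intro exI allI impI conjI)
    fix U V :: "(real^'n) lsq" assume U: "norm U \<le> M" and V: "norm V \<le> M"
    have "norm (smul (f U) (g U)) \<le> norm (f U) * norm (g U) * K" by (rule K)
    also have "\<dots> \<le> B * C * K" using K B C U by (intro mult_right_mono mult_mono) auto
    also have "\<dots> \<le> 2 * B * C * K" using K B C by simp
    finally show "norm (smul (f U) (g U)) \<le> 2 * B * C * K" .
    have "smul (f U) (g U) - smul (f V) (g V) = smul (f U - f V) (g U) + smul (f V) (g U - g V)"
      by (simp add: b.diff_left b.diff_right)
    then have "norm (smul (f U) (g U) - smul (f V) (g V)) \<le> norm (smul (f U - f V) (g U)) + norm (smul (f V) (g U - g V))"
      by (simp add: norm_triangle_ineq)
    also have "\<dots> \<le> norm (f U - f V) * norm (g U) * K + norm (f V) * norm (g U - g V) * K"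
      by (intro add_mono K)
    also have "\<dots> \<le> (B * norm (U - V)) * C * K + B * (C * norm (U - V)) * K"
      using K B C U V by (intro add_mono mult_right_mono mult_mono) auto
    also have "\<dots> = 2 * B * C * K * norm (U - V)" by (simp add: algebra_simps)
    finally show "norm (smul (f U) (g U) - smul (f V) (g V)) \<le> 2 * B * C * K * norm (U - V)" .
  qed
qed

lemma lip_on_balls_linear:
  assumes "bounded_linear f" shows "lip_on_balls f"
  unfolding lip_on_balls_def
proof (rule allI)
  fix M :: real
  interpret f: bounded_linear f by fact
  obtain K where K: "K > 0" "\<And>U. norm (f U) \<le> norm U * K" using f.pos_bounded by blast
  show "\<exists>B. \<forall>U V. norm U \<le> M \<longrightarrow> norm V \<le> M \<longrightarrow> norm (f U) \<le> B \<and> norm (f U - f V) \<le> B * norm (U - V)"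
  proof (intro exI allI impI conjI)
    fix U V :: "(real^'n) lsq" assume U: "norm U \<le> M" and V: "norm V \<le> M"
    have "norm (f U) \<le> M * K" using K(2)[of U] mult_right_mono[OF U, of K] K(1) by linarith
    also have "\<dots> \<le> \<bar>M\<bar> * K + K" using K(1) by (simp add: add_increasing2 mult_right_mono)
    finally show "norm (f U) \<le> \<bar>M\<bar> * K + K" .
    have "norm (f U - f V) \<le> K * norm (U - V)" using K(2)[of "U - V"] by (simp add: f.diff mult.commute)
    also have "\<dots> \<le> (\<bar>M\<bar> * K + K) * norm (U - V)" using K(1) by (intro mult_right_mono) auto
    finally show "norm (f U - f V) \<le> (\<bar>M\<bar> * K + K) * norm (U - V)" .
  qed
qed

lemma lip_on_balls_npow: "lip_on_balls (npow k)"
proof (induction k)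
  case 0
  have "npow 0 = (\<lambda>U. U)" by (rule ext) simp
  then show ?case using lip_on_balls_linear[OF bounded_linear_ident] by simp
next
  case (Suc k)
  have "npow (Suc k) = (\<lambda>U. smul (npow k U) (smul U (sconj U)))" by (rule ext) simp
  then show ?case
    using lip_on_balls_smul[OF Suc lip_on_balls_smul[OF lip_on_balls_linear[OF bounded_linear_ident] lip_on_balls_linear[OF bounded_linear_sconj]]] by simp
qed

end

section \<open>The interaction picture\<close>

definition phase :: "real \<Rightarrow> real \<Rightarrow> real" where "phase \<alpha> t = t powr (\<alpha> + 1) / (\<alpha> + 1)"

text \<open>The sign is chosen for the interaction picture: \<open>W\<close> from \<tau> to t acts
  on encodings as \<open>evol (phase \<alpha> \<tau> - phase \<alpha> t)\<close>, so a positive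
  argument undoes the propagation.\<close>

definition evol :: "real \<Rightarrow> (real^'n) lsq \<Rightarrow> (real^'n) lsq" where
  "evol \<theta> = lmult (\<lambda>\<xi>. cis (\<theta> * (norm \<xi>)\<^sup>2))"

lemma evol_mult_measurable: "(\<lambda>\<xi>::real^'n. cis (\<theta> * (norm \<xi>)\<^sup>2)) \<in> borel_measurable borel"
  by measurable

lemma cmod_cis_le: "cmod (cis x) \<le> 1" by simp

lemma bounded_linear_evol: "bounded_linear (evol \<theta>)"
  unfolding evol_def by (rule bounded_linear_lmult[OF evol_mult_measurable cmod_cis_le])

lemma rep_evol: "AE \<xi> in lborel. rep_lsq (evol \<theta> U) \<xi> = cis (\<theta> * (norm \<xi>)\<^sup>2) * rep_lsq U \<xi>"
  unfolding evol_def by (rule rep_lmult[OF evol_mult_measurable cmod_cis_le])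

lemma evol_evol: "evol \<theta> (evol \<theta>' U) = evol (\<theta> + \<theta>') U"
  unfolding evol_def
  by (subst lmult_lmult[OF evol_mult_measurable cmod_cis_le evol_mult_measurable cmod_cis_le])
     (simp add: cis_mult distrib_right)

lemma evol_0 [simp]: "evol 0 U = U" by (simp add: evol_def lmult_one)

lemma evol_cancel [simp]: "evol \<theta> (evol (- \<theta>) U) = U" "evol (- \<theta>) (evol \<theta> U) = U"
  by (simp_all add: evol_evol)

lemma norm_evol_le: "norm (evol \<theta> U) \<le> norm U"
  using norm_lmult_le[OF evol_mult_measurable cmod_cis_le, of \<theta> U] by (simp add: evol_def)

lemma norm_evol [simp]: "norm (evol \<theta> U) = norm U"
  using norm_evol_le[of \<theta> U] norm_evol_le[of "- \<theta>" "evol \<theta> U"] by simp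

lemma evol_diff: "evol \<theta> (U - V) = evol \<theta> U - evol \<theta> V"
  by (rule linear_diff[OF bounded_linear.linear[OF bounded_linear_evol]])

lemma evol_add: "evol \<theta> (U + V) = evol \<theta> U + evol \<theta> V"
  by (rule linear_add[OF bounded_linear.linear[OF bounded_linear_evol]])

text \<open>Strong continuity in the angle comes from the pointwise convergence of symbols. Joint
  continuity follows because every \<open>evol\<close> is an isometry, so the error in
  \<open>U\<close> is not amplified.\<close>

lemma tendsto_evol:
  assumes "\<theta> \<longlonglongrightarrow> \<theta>0" "U \<longlonglongrightarrow> U0"
  shows "(\<lambda>n. evol (\<theta> n) (U n)) \<longlonglongrightarrow> evol \<theta>0 U0"
proof -
  have 1: "(\<lambda>n. evol (\<theta> n) U0) \<longlonglongrightarrow> evol \<theta>0 U0"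
    unfolding evol_def
  proof (rule tendsto_lmult[where C=1])
    fix \<xi> :: "real^'a"
    show "(\<lambda>n. cis (\<theta> n * (norm \<xi>)\<^sup>2)) \<longlonglongrightarrow> cis (\<theta>0 * (norm \<xi>)\<^sup>2)"
      unfolding cis_conv_exp by (intro tendsto_exp tendsto_mult tendsto_of_real tendsto_const assms(1))
  qed (rule evol_mult_measurable cmod_cis_le)+
  have "(\<lambda>n. U n - U0) \<longlonglongrightarrow> 0" using assms(2) by (simp add: LIM_zero_iff)
  then have "(\<lambda>n. norm (evol (\<theta> n) (U n - U0))) \<longlonglongrightarrow> 0" by (simp add: tendsto_norm_zero_iff)
  then have "(\<lambda>n. evol (\<theta> n) (U n - U0)) \<longlonglongrightarrow> 0" by (simp only: tendsto_norm_zero_iff)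
  from tendsto_add[OF this 1] show ?thesis by (simp add: evol_diff)
qed

lemma continuous_on_evol:
  fixes f :: "'b::metric_space \<Rightarrow> real"
  assumes "continuous_on S f" "continuous_on S g"
  shows "continuous_on S (\<lambda>t. evol (f t) (g t))"
  using assms unfolding continuous_on_sequentially comp_def by (auto intro!: tendsto_evol)

section \<open>Passage between functions and their encodings\<close>

context sobolev_space
begin

definition lift :: "(real^'n \<Rightarrow> complex) \<Rightarrow> (real^'n) lsq" where
  "lift f = abs_lsq (\<lambda>\<xi>. of_real (wt s \<xi>) * FT f \<xi>)"

lemma cmod_wt_sq: "(cmod (of_real (wt s \<xi>) * z))\<^sup>2 = (1 + (norm \<xi>)\<^sup>2) powr s * (cmod z)\<^sup>2"
  by (simp add: norm_mult power_mult_distrib wt_sq)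

lemma sobolev_iff: "f \<in> sobolev s \<longleftrightarrow> sqi f \<and> sqi (\<lambda>\<xi>::real^'n. of_real (wt s \<xi>) * FT f \<xi>)"
proof (cases "sqi f")
  case True
  have [measurable]: "FT f \<in> borel_measurable borel" by (rule sqi_measurable_borel[OF sqi_FT_abs(1)[OF True]])
  have "(\<lambda>\<xi>. of_real (wt s \<xi>) * FT f \<xi>) \<in> borel_measurable lborel" by measurable
  with True show ?thesis unfolding sobolev_def mem_Collect_eq L2_eq_sqi sqi_def[of "\<lambda>\<xi>. of_real (wt s \<xi>) * FT f \<xi>"] cmod_wt_sq by simp
qed (simp add: sobolev_def L2_eq_sqi)

lemma hs_norm_lift: "f \<in> sobolev s \<Longrightarrow> hs_norm s f = norm (lift f)"
proof -
  assume "f \<in> sobolev s"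
  then have "sqi (\<lambda>\<xi>. of_real (wt s \<xi>) * FT f \<xi>)" by (simp add: sobolev_iff)
  from norm_abs_lsq_sq[OF this] have "(norm (lift f))\<^sup>2 = (LINT \<xi>|lborel. (1 + (norm \<xi>)\<^sup>2) powr s * (cmod (FT f \<xi>))\<^sup>2)"
    by (simp only: lift_def cmod_wt_sq)
  then show ?thesis unfolding hs_norm_def by (metis norm_ge_zero real_sqrt_unique)
qed

text \<open>The tool for all closure properties of the Sobolev space: membership and encoding of a
  measurable function are obtained by exhibiting a class whose representative agrees with it almost
  everywhere.\<close>

lemma liftI:
  assumes f: "f \<in> borel_measurable borel" and AE: "AE x in lborel. f x = emb U x"
  shows lift_mem: "f \<in> sobolev s" and lift_eq: "lift f = U"
proof -
  have AE': "AE x in lborel. emb U x = f x" using AE by eventually_elim simp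
  have sf: "sqi f" using f by (intro sqi_cong_AE[OF sqi_emb _ AE']) simp
  have "abs_lsq f = Finv (abs_lsq (fhat U))"
    unfolding abs_emb[symmetric] by (rule abs_lsq_eqI[OF sf sqi_emb AE])
  then have "Fou (abs_lsq f) = abs_lsq (fhat U)" by (simp only: Fou_Finv)
  with FT_AE[OF sf] rep_abs_lsq[OF sqi_fhat[of U]] have "AE \<xi> in lborel. FT f \<xi> = fhat U \<xi>" by auto
  then have AE2: "AE \<xi> in lborel. rep_lsq U \<xi> = of_real (wt s \<xi>) * FT f \<xi>"
    by eventually_elim (simp add: rep_eq_fhat)
  have [measurable]: "FT f \<in> borel_measurable borel" by (rule sqi_measurable_borel[OF sqi_FT_abs(1)[OF sf]])
  have "(\<lambda>\<xi>. of_real (wt s \<xi>) * FT f \<xi>) \<in> borel_measurable lborel" by measurable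
  then have s2: "sqi (\<lambda>\<xi>. of_real (wt s \<xi>) * FT f \<xi>)" by (rule sqi_cong_AE[OF sqi_rep _ AE2])
  show "f \<in> sobolev s" using sf s2 by (simp add: sobolev_iff)
  show "lift f = U" unfolding lift_def by (rule lsq_eqI_abs[OF s2 AE2, symmetric])
qed

lemma sobolev_emb: "emb U \<in> sobolev s" and lift_emb [simp]: "lift (emb U) = U"
  using liftI[of "emb U" U] by simp_all

lemma rep_lift: "f \<in> sobolev s \<Longrightarrow> AE \<xi> in lborel. rep_lsq (lift f) \<xi> = of_real (wt s \<xi>) * FT f \<xi>"
  unfolding lift_def by (rule rep_abs_lsq) (simp add: sobolev_iff)

lemma fhat_lift:
  assumes "f \<in> sobolev s" shows "AE \<xi> in lborel. fhat (lift f) \<xi> = FT f \<xi>"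
  using rep_lift[OF assms]
proof eventually_elim
  case (elim \<xi>)
  have "complex_of_real (wt (- s) \<xi>) * of_real (wt s \<xi>) = 1"
    using wt_mult_inverse[of s \<xi>] by (simp only: mult.commute of_real_mult[symmetric] of_real_1)
  then show ?case unfolding fhat_def elim mult.assoc[symmetric] by simp
qed

lemma sobolev_measurable: "f \<in> sobolev s \<Longrightarrow> f \<in> borel_measurable borel" for f :: "real^'n \<Rightarrow> complex"
  by (rule sqi_measurable_borel) (simp add: sobolev_iff)

lemma emb_lift_AE:
  assumes "f \<in> sobolev s" shows "AE x in lborel. f x = emb (lift f) x"
proof -
  have sf: "sqi f" using assms by (simp add: sobolev_iff)
  have "abs_lsq f = Finv (abs_lsq (FT f))" by (simp add: sqi_FT_abs(2)[OF sf] Finv_Fou)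
  also have "abs_lsq (FT f) = abs_lsq (fhat (lift f))"
    by (rule abs_lsq_eqI[OF sqi_FT_abs(1)[OF sf] sqi_fhat]) (use fhat_lift[OF assms] in auto)
  also have "Finv \<dots> = abs_lsq (emb (lift f))" by (rule abs_emb[symmetric])
  finally have "abs_lsq f = abs_lsq (emb (lift f))" .
  with rep_abs_lsq[OF sf] rep_abs_lsq[OF sqi_emb[of "lift f"]] show ?thesis by auto
qed

lemma sobolev_add:
  assumes "f \<in> sobolev s" "g \<in> sobolev s"
  shows "(\<lambda>x. f x + g x) \<in> sobolev s" "lift (\<lambda>x. f x + g x) = lift f + lift g"
proof -
  have m: "(\<lambda>x. f x + g x) \<in> borel_measurable borel"
    using assms[THEN sobolev_measurable] by measurable
  have "AE x in lborel. f x + g x = emb (lift f + lift g) x"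
    using emb_lift_AE[OF assms(1)] emb_lift_AE[OF assms(2)] by eventually_elim (simp add: emb_add)
  from liftI[OF m this] show "(\<lambda>x. f x + g x) \<in> sobolev s" "lift (\<lambda>x. f x + g x) = lift f + lift g" by auto
qed

lemma sobolev_cmult:
  assumes "f \<in> sobolev s"
  shows "(\<lambda>x. c * f x) \<in> sobolev s" "lift (\<lambda>x. c * f x) = lmult (\<lambda>_. c) (lift f)"
proof -
  have m: "(\<lambda>x. c * f x) \<in> borel_measurable borel"
    using assms[THEN sobolev_measurable] by measurable
  have "AE x in lborel. c * f x = emb (lmult (\<lambda>_. c) (lift f)) x"
    using emb_lift_AE[OF assms(1)] by eventually_elim (simp add: emb_lmult_const)
  from liftI[OF m this] show "(\<lambda>x. c * f x) \<in> sobolev s" "lift (\<lambda>x. c * f x) = lmult (\<lambda>_. c) (lift f)" by auto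
qed

lemma sobolev_diff:
  assumes "f \<in> sobolev s" "g \<in> sobolev s"
  shows "(\<lambda>x. f x - g x) \<in> sobolev s" "lift (\<lambda>x. f x - g x) = lift f - lift g"
proof -
  have m: "(\<lambda>x. f x - g x) \<in> borel_measurable borel"
    using assms[THEN sobolev_measurable] by measurable
  have "AE x in lborel. f x - g x = emb (lift f - lift g) x"
    using emb_lift_AE[OF assms(1)] emb_lift_AE[OF assms(2)] by eventually_elim (simp add: emb_diff)
  from liftI[OF m this] show "(\<lambda>x. f x - g x) \<in> sobolev s" "lift (\<lambda>x. f x - g x) = lift f - lift g" by auto
qed

lemma sobolev_nonlin:
  assumes "f \<in> sobolev s"
  shows "nonlin k f \<in> sobolev s" "lift (nonlin k f) = npow k (lift f)"
proof -
  have [measurable]: "f \<in> borel_measurable borel" using assms by (rule sobolev_measurable)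
  have m: "nonlin k f \<in> borel_measurable borel" unfolding nonlin_def by measurable
  have "AE x in lborel. nonlin k f x = emb (npow k (lift f)) x"
    using emb_lift_AE[OF assms(1)] by eventually_elim (simp add: emb_npow nonlin_def)
  from liftI[OF m this] show "nonlin k f \<in> sobolev s" "lift (nonlin k f) = npow k (lift f)" by auto
qed

lemma hs_dist_lift: "f \<in> sobolev s \<Longrightarrow> g \<in> sobolev s \<Longrightarrow> hs_dist s f g = norm (lift f - lift g)"
  by (simp add: hs_dist_def hs_norm_lift sobolev_diff)

lemma hs_inner_lift:
  assumes "f \<in> sobolev s" "g \<in> sobolev s"
  shows "hs_inner s f g = pair (\<lambda>\<xi>. cnj (rep_lsq (lift g) \<xi>)) (lift f)"
  unfolding hs_inner_def pair_def
proof (rule integral_cong_AE)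
  have [measurable]: "FT f \<in> borel_measurable borel" "FT g \<in> borel_measurable borel"
    using assms by (auto intro!: sqi_measurable_borel sqi_FT_abs(1) simp: sobolev_iff)
  show "(\<lambda>\<xi>. of_real ((1 + (norm \<xi>)\<^sup>2) powr s) * FT f \<xi> * cnj (FT g \<xi>)) \<in> borel_measurable lborel" by measurable
  show "AE \<xi> in lborel. of_real ((1 + (norm \<xi>)\<^sup>2) powr s) * FT f \<xi> * cnj (FT g \<xi>) = cnj (rep_lsq (lift g) \<xi>) * rep_lsq (lift f) \<xi>"
    using rep_lift[OF assms(1)] rep_lift[OF assms(2)]
  proof eventually_elim
    case (elim \<xi>)
    have "complex_of_real ((1 + (norm \<xi>)\<^sup>2) powr s) = of_real (wt s \<xi>) * of_real (wt s \<xi>)"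
      by (subst wt_sq[symmetric]) (simp add: power2_eq_square)
    then show ?case unfolding elim by simp
  qed
qed measurable

text \<open>The function \<open>W\<close> is known only through its transform, so the two sides are
  compared as transforms and then inverted; the conclusion can hold only almost everywhere.\<close>

lemma W_lift:
  assumes "F \<in> sobolev s"
  shows W_measurable: "W \<alpha> t \<tau> F \<in> borel_measurable borel"
    and W_AE: "AE x in lborel. W \<alpha> t \<tau> F x = emb (evol (phase \<alpha> \<tau> - phase \<alpha> t) (lift F)) x"
proof -
  let ?\<theta> = "phase \<alpha> \<tau> - phase \<alpha> t"
  let ?g = "\<lambda>\<xi>. cis (- ((t powr (\<alpha>+1) - \<tau> powr (\<alpha>+1)) / (\<alpha>+1)) * (norm \<xi>)\<^sup>2) * FT F \<xi>"
  have sF: "sqi F" using assms by (simp add: sobolev_iff)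
  have th: "- ((t powr (\<alpha>+1) - \<tau> powr (\<alpha>+1)) / (\<alpha>+1)) = ?\<theta>" by (simp add: phase_def diff_divide_distrib)
  have g: "sqi ?g" unfolding th by (rule sqi_mult_bounded[OF sqi_FT_abs(1)[OF sF] evol_mult_measurable cmod_cis_le])
  have "abs_lsq ?g = abs_lsq (fhat (evol ?\<theta> (lift F)))"
  proof (rule abs_lsq_eqI[OF g sqi_fhat])
    show "AE \<xi> in lborel. ?g \<xi> = fhat (evol ?\<theta> (lift F)) \<xi>"
      unfolding th using rep_evol[of ?\<theta> "lift F"] fhat_lift[OF assms]
      by eventually_elim (simp add: fhat_def mult_ac)
  qed
  then have "abs_lsq (W \<alpha> t \<tau> F) = abs_lsq (emb (evol ?\<theta> (lift F)))"
    unfolding W_def SOME_is_fourier_L2(2)[OF g] abs_emb by simp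
  moreover have sW: "sqi (W \<alpha> t \<tau> F)" unfolding W_def by (rule SOME_is_fourier_L2(1)[OF g])
  ultimately show "AE x in lborel. W \<alpha> t \<tau> F x = emb (evol ?\<theta> (lift F)) x"
    using rep_abs_lsq[OF sW] rep_abs_lsq[OF sqi_emb[of "evol ?\<theta> (lift F)"]] by auto
  show "W \<alpha> t \<tau> F \<in> borel_measurable borel" by (rule sqi_measurable_borel[OF sW])
qed

text \<open>The box test of \<open>solves\<close>, transported to encodings. There it is a bounded
  linear functional and so commutes with vector-valued integrals, and these functionals separate
  classes.\<close>

definition bp :: "real^'n \<Rightarrow> real^'n \<Rightarrow> (real^'n) lsq \<Rightarrow> complex" where
  "bp a b U = pair (indicator (cbox a b)) (abs_lsq (emb U))"

lemma boxpair_AE: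
  assumes [measurable]: "f \<in> borel_measurable borel" and "AE x in lborel. f x = emb U x"
  shows "boxpair f a b = bp a b U"
proof -
  have "boxpair f a b = (LINT x|lborel. indicator (cbox a b) x * emb U x)"
    unfolding boxpair_def
  proof (rule integral_cong_AE)
    show "AE x in lborel. f x * indicator (cbox a b) x = indicator (cbox a b) x * emb U x"
      using assms(2) by eventually_elim simp
  qed measurable
  then show ?thesis by (simp add: bp_def pair_abs sqi_cbox sqi_emb)
qed

lemma bounded_linear_bp: "bounded_linear (bp a b)"
proof -
  have "bounded_linear (\<lambda>U. pair (indicator (cbox a b)) (Finv (lmult (\<lambda>\<xi>. of_real (wt (- s) \<xi>)) U)))"
    by (intro bounded_linear_compose[OF bounded_linear_pair[OF sqi_cbox]] bounded_linear_compose[OF bounded_linear_Finv]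
        bounded_linear_lmult[OF _ cmod_wt_neg_le]) measurable
  then show ?thesis unfolding bp_def[abs_def] abs_emb abs_fhat .
qed

lemma bp_inj: "(\<And>a b. bp a b U = bp a b V) \<Longrightarrow> U = V"
proof -
  assume "\<And>a b. bp a b U = bp a b V"
  then have "abs_lsq (emb U) = abs_lsq (emb V)" unfolding bp_def by (rule lsq_eq_boxI)
  with rep_abs_lsq[OF sqi_emb[of U]] rep_abs_lsq[OF sqi_emb[of V]] have "AE x in lborel. emb U x = emb V x" by auto
  then show "U = V" by (rule emb_inj)
qed

text \<open>The right-hand side of the equation in the interaction picture, where the linear part is removed by \<open>evol\<close>.\<close>

definition NN :: "real \<Rightarrow> real \<Rightarrow> nat \<Rightarrow> real \<Rightarrow> (real^'n) lsq \<Rightarrow> (real^'n) lsq" where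
  "NN \<alpha> \<sigma> k \<tau> V = evol (phase \<alpha> \<tau>) (lmult (\<lambda>_. - \<i> * of_real \<sigma>) (npow k (evol (- phase \<alpha> \<tau>) V)))"

lemma continuous_on_npow: "continuous_on S (npow k)"
proof -
  interpret b: bounded_bilinear smul by (rule bounded_bilinear_smul)
  have sc: "continuous_on S sconj" by (rule linear_continuous_on[OF bounded_linear_sconj])
  show ?thesis
  proof (induction k)
    case 0
    have "npow 0 = (\<lambda>U. U)" by (rule ext) simp
    then show ?case by simp
  next
    case (Suc k)
    have "npow (Suc k) = (\<lambda>U. smul (npow k U) (smul U (sconj U)))" by (rule ext) simp
    then show ?case by (simp only:) (intro b.continuous_on Suc continuous_on_id sc)
  qed
qed

lemma bounded_linear_lmult_const: "bounded_linear (lmult (\<lambda>_. c))"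
  by (rule bounded_linear_lmult[where C="cmod c"]) auto

lemma continuous_on_phase: "\<alpha> > 0 \<Longrightarrow> continuous_on {0..} (phase \<alpha>)"
  unfolding phase_def[abs_def] by (intro continuous_intros continuous_on_powr') auto

lemma continuous_on_NN:
  assumes "\<alpha> > 0" "continuous_on {0..T} V"
  shows "continuous_on {0..T} (\<lambda>\<tau>. NN \<alpha> \<sigma> k \<tau> (V \<tau>))"
proof -
  have ph: "continuous_on {0..T} (phase \<alpha>)" by (rule continuous_on_subset[OF continuous_on_phase[OF assms(1)]]) auto
  have 1: "continuous_on {0..T} (\<lambda>\<tau>. evol (- phase \<alpha> \<tau>) (V \<tau>))"
    by (intro continuous_on_evol continuous_on_minus ph assms)
  have 2: "continuous_on {0..T} (\<lambda>\<tau>. npow k (evol (- phase \<alpha> \<tau>) (V \<tau>)))"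
    by (rule continuous_on_compose2[OF continuous_on_npow 1]) auto
  have 3: "continuous_on {0..T} (\<lambda>\<tau>. lmult (\<lambda>_. - \<i> * of_real \<sigma>) (npow k (evol (- phase \<alpha> \<tau>) (V \<tau>))))"
    by (rule bounded_linear.continuous_on[OF bounded_linear_lmult_const 2])
  show ?thesis unfolding NN_def by (intro continuous_on_evol ph 3)
qed

text \<open>The constant does not depend on \<tau>: the two evolutions around the nonlinearity are
  isometries, so only the bound for \<open>npow\<close> and the size of \<sigma> enter.\<close>

lemma NN_lipschitz:
  obtains B where "B \<ge> 0" "\<And>\<tau> U. norm U \<le> M \<Longrightarrow> norm (NN \<alpha> \<sigma> k \<tau> U) \<le> B"
    "\<And>\<tau> U V. norm U \<le> M \<Longrightarrow> norm V \<le> M \<Longrightarrow> norm (NN \<alpha> \<sigma> k \<tau> U - NN \<alpha> \<sigma> k \<tau> V) \<le> B * norm (U - V)"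
proof -
  let ?c = "- \<i> * of_real \<sigma> :: complex"
  interpret l: bounded_linear "lmult (\<lambda>_::real^'n. ?c)" by (rule bounded_linear_lmult_const)
  obtain B where B: "B \<ge> 0" "\<And>U. norm U \<le> M \<Longrightarrow> norm (npow k U) \<le> B"
    "\<And>U V. norm U \<le> M \<Longrightarrow> norm V \<le> M \<Longrightarrow> norm (npow k U - npow k V) \<le> B * norm (U - V)"
    using lip_on_ballsD[OF lip_on_balls_npow] by metis
  have n: "norm (lmult (\<lambda>_::real^'n. ?c) U) \<le> \<bar>\<sigma>\<bar> * norm U" for U
    by (rule norm_lmult_le) (auto simp: norm_mult)
  show ?thesis
  proof (rule that[of "\<bar>\<sigma>\<bar> * B"])
    show "0 \<le> \<bar>\<sigma>\<bar> * B" using B by simp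
    show "norm (NN \<alpha> \<sigma> k \<tau> U) \<le> \<bar>\<sigma>\<bar> * B" if "norm U \<le> M" for \<tau> U
    proof -
      have "norm (NN \<alpha> \<sigma> k \<tau> U) \<le> \<bar>\<sigma>\<bar> * norm (npow k (evol (- phase \<alpha> \<tau>) U))"
        unfolding NN_def norm_evol by (rule n)
      also have "\<dots> \<le> \<bar>\<sigma>\<bar> * B" using that by (intro mult_left_mono B) auto
      finally show ?thesis .
    qed
    show "norm (NN \<alpha> \<sigma> k \<tau> U - NN \<alpha> \<sigma> k \<tau> V) \<le> \<bar>\<sigma>\<bar> * B * norm (U - V)" if "norm U \<le> M" "norm V \<le> M" for \<tau> U V
    proof -
      have "norm (NN \<alpha> \<sigma> k \<tau> U - NN \<alpha> \<sigma> k \<tau> V) = norm (lmult (\<lambda>_. ?c) (npow k (evol (- phase \<alpha> \<tau>) U) - npow k (evol (- phase \<alpha> \<tau>) V)))"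
        unfolding NN_def evol_diff[symmetric] norm_evol l.diff ..
      also have "\<dots> \<le> \<bar>\<sigma>\<bar> * norm (npow k (evol (- phase \<alpha> \<tau>) U) - npow k (evol (- phase \<alpha> \<tau>) V))" by (rule n)
      also have "\<dots> \<le> \<bar>\<sigma>\<bar> * (B * norm (evol (- phase \<alpha> \<tau>) U - evol (- phase \<alpha> \<tau>) V))"
        using that by (intro mult_left_mono B) auto
      finally show ?thesis by (simp add: mult.assoc flip: evol_diff)
    qed
  qed
qed

lemma cont_Hs_iff: "cont_Hs s T u \<longleftrightarrow> (\<forall>t\<in>{0..T}. u t \<in> sobolev s) \<and> continuous_on {0..T} (\<lambda>t. lift (u t))"
  unfolding cont_Hs_def continuous_on_iff
  by (auto simp: dist_norm hs_dist_lift)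

text \<open>The weak equation, tested against boxes with scalar Lebesgue integrals, is equivalent to
  one Hilbert space identity. Continuity of \<open>u\<close> makes the integrand a continuous curve,
  the functionals \<open>bp\<close> pass through its integral, and \<open>bp_inj\<close> removes
  them.\<close>

lemma solves_iff:
  assumes "\<alpha> > 0" "u0 \<in> sobolev s" "cont_Hs s T u"
  defines "V \<equiv> \<lambda>t. evol (phase \<alpha> t) (lift (u t))"
  shows "solves \<alpha> \<sigma> k T u0 u \<longleftrightarrow> (\<forall>t\<in>{0..T}. V t = lift u0 + integral {0..t} (\<lambda>\<tau>. NN \<alpha> \<sigma> k \<tau> (V \<tau>)))"
proof -
  have u: "u t \<in> sobolev s" if "t \<in> {0..T}" for t using assms(3) that by (simp add: cont_Hs_iff)
  have contV: "continuous_on {0..T} V" unfolding V_def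
    by (intro continuous_on_evol continuous_on_subset[OF continuous_on_phase[OF assms(1)]]) (use assms(3) in \<open>auto simp: cont_Hs_iff\<close>)
  have "(\<forall>a b. boxpair (u t) a b = boxpair (W \<alpha> t 0 u0) a b
       + (LINT \<tau>:{0..t}|lborel. boxpair (W \<alpha> t \<tau> (\<lambda>x. - \<i> * of_real \<sigma> * nonlin k (u \<tau>) x)) a b))
     \<longleftrightarrow> V t = lift u0 + integral {0..t} (\<lambda>\<tau>. NN \<alpha> \<sigma> k \<tau> (V \<tau>))" if t: "t \<in> {0..T}" for t
  proof -
    let ?I = "integral {0..t} (\<lambda>\<tau>. NN \<alpha> \<sigma> k \<tau> (V \<tau>))"
    have contN: "continuous_on {0..t} (\<lambda>\<tau>. NN \<alpha> \<sigma> k \<tau> (V \<tau>))"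
      by (rule continuous_on_NN[OF assms(1)], rule continuous_on_subset[OF contV]) (use t in auto)
    have e1: "boxpair (u t) a b = bp a b (lift (u t))" for a b
      using u[OF t] by (intro boxpair_AE emb_lift_AE sobolev_measurable)
    have e2: "boxpair (W \<alpha> t 0 u0) a b = bp a b (evol (- phase \<alpha> t) (lift u0))" for a b
      using boxpair_AE[OF W_measurable W_AE, OF assms(2) assms(2), of \<alpha> t 0 a b] by (simp add: phase_def)
    have e3: "boxpair (W \<alpha> t \<tau> (\<lambda>x. - \<i> * of_real \<sigma> * nonlin k (u \<tau>) x)) a b = bp a b (evol (- phase \<alpha> t) (NN \<alpha> \<sigma> k \<tau> (V \<tau>)))"
      if "\<tau> \<in> {0..t}" for a b \<tau>
    proof -
      have "u \<tau> \<in> sobolev s" using that t by (intro u) auto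
      then have n: "nonlin k (u \<tau>) \<in> sobolev s" "lift (nonlin k (u \<tau>)) = npow k (lift (u \<tau>))"
        by (rule sobolev_nonlin)+
      have m: "(\<lambda>x. - \<i> * of_real \<sigma> * nonlin k (u \<tau>) x) \<in> sobolev s"
        and l: "lift (\<lambda>x. - \<i> * of_real \<sigma> * nonlin k (u \<tau>) x) = lmult (\<lambda>_. - \<i> * of_real \<sigma>) (npow k (lift (u \<tau>)))"
        using sobolev_cmult[OF n(1), of "- \<i> * of_real \<sigma>"] n(2) by simp_all
      have "boxpair (W \<alpha> t \<tau> (\<lambda>x. - \<i> * of_real \<sigma> * nonlin k (u \<tau>) x)) a b = bp a b (evol (phase \<alpha> \<tau> - phase \<alpha> t) (lift (\<lambda>x. - \<i> * of_real \<sigma> * nonlin k (u \<tau>) x)))"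
        by (rule boxpair_AE[OF W_measurable[OF m] W_AE[OF m]])
      also have "evol (phase \<alpha> \<tau> - phase \<alpha> t) (lift (\<lambda>x. - \<i> * of_real \<sigma> * nonlin k (u \<tau>) x)) = evol (- phase \<alpha> t) (NN \<alpha> \<sigma> k \<tau> (V \<tau>))"
        unfolding NN_def V_def l by (simp add: evol_evol)
      finally show ?thesis .
    qed
    \<comment> \<open>For a continuous scalar integrand the Lebesgue and Henstock integrals agree,
      and the bounded functional can be pulled out of the latter.\<close>
    have e4: "(LINT \<tau>:{0..t}|lborel. boxpair (W \<alpha> t \<tau> (\<lambda>x. - \<i> * of_real \<sigma> * nonlin k (u \<tau>) x)) a b) = bp a b (evol (- phase \<alpha> t) ?I)" for a b
    proof -
      have bl: "bounded_linear (\<lambda>U. bp a b (evol (- phase \<alpha> t) U))"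
        by (rule bounded_linear_compose[OF bounded_linear_bp bounded_linear_evol])
      have cont: "continuous_on {0..t} (\<lambda>\<tau>. bp a b (evol (- phase \<alpha> t) (NN \<alpha> \<sigma> k \<tau> (V \<tau>))))"
        by (rule bounded_linear.continuous_on[OF bl contN])
      have "(LINT \<tau>:{0..t}|lborel. boxpair (W \<alpha> t \<tau> (\<lambda>x. - \<i> * of_real \<sigma> * nonlin k (u \<tau>) x)) a b) = (LINT \<tau>:{0..t}|lborel. bp a b (evol (- phase \<alpha> t) (NN \<alpha> \<sigma> k \<tau> (V \<tau>))))"
        by (rule set_lebesgue_integral_cong) (simp, intro allI impI, rule e3)
      also have "\<dots> = integral {0..t} (\<lambda>\<tau>. bp a b (evol (- phase \<alpha> t) (NN \<alpha> \<sigma> k \<tau> (V \<tau>))))"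
        by (rule set_borel_integral_eq_integral(2)[OF borel_integrable_atLeastAtMost'[OF cont]])
      also have "\<dots> = bp a b (evol (- phase \<alpha> t) ?I)"
        using integral_linear[OF integrable_continuous_interval[OF contN] bl] by (simp add: comp_def)
      finally show ?thesis .
    qed
    interpret bpl: bounded_linear "bp a b" for a b by (rule bounded_linear_bp)
    have "(\<forall>a b. boxpair (u t) a b = boxpair (W \<alpha> t 0 u0) a b
       + (LINT \<tau>:{0..t}|lborel. boxpair (W \<alpha> t \<tau> (\<lambda>x. - \<i> * of_real \<sigma> * nonlin k (u \<tau>) x)) a b))
       \<longleftrightarrow> (\<forall>a b. bp a b (lift (u t)) = bp a b (evol (- phase \<alpha> t) (lift u0 + ?I)))"
      unfolding e1 e2 e4 evol_add bpl.add ..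
    also have "\<dots> \<longleftrightarrow> lift (u t) = evol (- phase \<alpha> t) (lift u0 + ?I)"
    proof
      assume *: "\<forall>a b. bp a b (lift (u t)) = bp a b (evol (- phase \<alpha> t) (lift u0 + ?I))"
      show "lift (u t) = evol (- phase \<alpha> t) (lift u0 + ?I)" by (rule bp_inj) (rule *[rule_format])
    qed simp
    also have "\<dots> \<longleftrightarrow> V t = lift u0 + ?I"
    proof
      assume "lift (u t) = evol (- phase \<alpha> t) (lift u0 + ?I)"
      then have "evol (phase \<alpha> t) (lift (u t)) = lift u0 + ?I" by (simp only: evol_cancel)
      then show "V t = lift u0 + ?I" by (simp only: V_def)
    next
      assume "V t = lift u0 + ?I"
      then have "evol (- phase \<alpha> t) (evol (phase \<alpha> t) (lift (u t))) = evol (- phase \<alpha> t) (lift u0 + ?I)" by (simp only: V_def)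
      then show "lift (u t) = evol (- phase \<alpha> t) (lift u0 + ?I)" by (simp only: evol_cancel)
    qed
    finally show ?thesis .
  qed
  then show ?thesis unfolding solves_def by (rule ball_cong[OF refl])
qed

end

section \<open>Local well-posedness\<close>

text \<open>Data lie in the ball of radius R and iterates in that of radius 2R.
  \<open>small1\<close> keeps the iterates in the larger ball, \<open>small2\<close> makes the
  integral operator a contraction with factor 1/2.\<close>

locale picard =
  fixes F :: "real \<Rightarrow> 'b::banach \<Rightarrow> 'b" and R T B :: real
  assumes R: "R > 0" and T: "T > 0" and B: "B \<ge> 0"
    and cont: "\<And>V. continuous_on {0..T} V \<Longrightarrow> continuous_on {0..T} (\<lambda>\<tau>. F \<tau> (V \<tau>))"
    and bound: "\<And>\<tau> U. norm U \<le> 2 * R \<Longrightarrow> norm (F \<tau> U) \<le> B"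
    and lip: "\<And>\<tau> U V. norm U \<le> 2 * R \<Longrightarrow> norm V \<le> 2 * R \<Longrightarrow> norm (F \<tau> U - F \<tau> V) \<le> B * norm (U - V)"
    and small1: "B * T \<le> R" and small2: "B * T \<le> 1/2"
begin

definition admissible :: "(real \<Rightarrow> 'b) \<Rightarrow> bool" where
  "admissible V \<longleftrightarrow> continuous_on {0..T} V \<and> (\<forall>t\<in>{0..T}. norm (V t) \<le> 2 * R)"

lemma cont_sub:
  assumes "admissible V" "t \<in> {0..T}" shows "continuous_on {0..t} (\<lambda>\<tau>. F \<tau> (V \<tau>))"
  by (rule continuous_on_subset[OF cont]) (use assms in \<open>auto simp: admissible_def\<close>)

lemma integral_diff_bound:
  assumes V: "admissible V" and V': "admissible V'" and t: "t \<in> {0..T}"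
    and d: "\<And>\<tau>. \<tau> \<in> {0..T} \<Longrightarrow> norm (V \<tau> - V' \<tau>) \<le> d"
  shows "norm (integral {0..t} (\<lambda>\<tau>. F \<tau> (V \<tau>)) - integral {0..t} (\<lambda>\<tau>. F \<tau> (V' \<tau>))) \<le> d / 2"
proof -
  have d0: "0 \<le> d" using d[OF t] norm_ge_zero order_trans by blast
  have "integral {0..t} (\<lambda>\<tau>. F \<tau> (V \<tau>)) - integral {0..t} (\<lambda>\<tau>. F \<tau> (V' \<tau>)) = integral {0..t} (\<lambda>\<tau>. F \<tau> (V \<tau>) - F \<tau> (V' \<tau>))"
    by (rule Henstock_Kurzweil_Integration.integral_diff[symmetric]; rule integrable_continuous_interval) (rule cont_sub[OF V t] cont_sub[OF V' t])+
  also have "norm \<dots> \<le> (B * d) * (t - 0)"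
  proof (rule integral_bound)
    show "norm (F \<tau> (V \<tau>) - F \<tau> (V' \<tau>)) \<le> B * d" if "\<tau> \<in> {0..t}" for \<tau>
    proof -
      have \<tau>: "\<tau> \<in> {0..T}" using that t by auto
      have "norm (F \<tau> (V \<tau>) - F \<tau> (V' \<tau>)) \<le> B * norm (V \<tau> - V' \<tau>)"
        using V V' \<tau> by (intro lip) (auto simp: admissible_def)
      also have "\<dots> \<le> B * d" using d[OF \<tau>] B by (rule mult_left_mono)
      finally show ?thesis .
    qed
    show "continuous_on {0..t} (\<lambda>\<tau>. F \<tau> (V \<tau>) - F \<tau> (V' \<tau>))"
      by (intro continuous_on_diff cont_sub V V' t)
  qed (use t in auto)
  also have "\<dots> \<le> (B * d) * T" using t B d0 by (intro mult_left_mono) auto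
  also have "\<dots> = (B * T) * d" by simp
  also have "\<dots> \<le> (1/2) * d" using small2 d0 by (rule mult_right_mono)
  finally show ?thesis by simp
qed

definition Phi :: "'b \<Rightarrow> (real \<Rightarrow> 'b) \<Rightarrow> real \<Rightarrow> 'b" where
  "Phi U0 V t = U0 + integral {0..t} (\<lambda>\<tau>. F \<tau> (V \<tau>))"

lemma Phi_dist:
  assumes "norm U0 \<le> R" and V: "admissible V" and t: "t \<in> {0..T}"
  shows "norm (Phi U0 V t - U0) \<le> R"
proof -
  have "norm (Phi U0 V t - U0) = norm (integral {0..t} (\<lambda>\<tau>. F \<tau> (V \<tau>)))" by (simp add: Phi_def)
  also have "\<dots> \<le> B * (t - 0)"
    by (rule integral_bound[OF _ cont_sub[OF V t]]) (use V t in \<open>auto intro!: bound simp: admissible_def\<close>)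
  also have "\<dots> \<le> B * T" using t B by (intro mult_left_mono) auto
  finally show ?thesis using small1 by simp
qed

lemma admissible_Phi:
  assumes U0: "norm U0 \<le> R" and V: "admissible V"
  shows "admissible (Phi U0 V)"
  unfolding admissible_def
proof
  have T': "T \<in> {0..T}" using T by simp
  show "continuous_on {0..T} (Phi U0 V)"
    unfolding Phi_def[abs_def]
    by (intro continuous_on_add continuous_on_const indefinite_integral_continuous_1 integrable_continuous_interval cont_sub[OF V T'])
  show "\<forall>t\<in>{0..T}. norm (Phi U0 V t) \<le> 2 * R"
  proof
    fix t assume "t \<in> {0..T}"
    from Phi_dist[OF U0 V this] U0 norm_triangle_sub[of "Phi U0 V t" U0] show "norm (Phi U0 V t) \<le> 2 * R" by linarith
  qed
qed

primrec iter :: "'b \<Rightarrow> nat \<Rightarrow> real \<Rightarrow> 'b" where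
  "iter U0 0 = (\<lambda>_. U0)"
| "iter U0 (Suc n) = Phi U0 (iter U0 n)"

lemma admissible_iter: "norm U0 \<le> R \<Longrightarrow> admissible (iter U0 n)"
proof (induction n)
  case 0
  then show ?case using R by (simp add: admissible_def)
next
  case (Suc n)
  then show ?case by (simp add: admissible_Phi)
qed

lemma iter_step:
  assumes "norm U0 \<le> R" "t \<in> {0..T}"
  shows "norm (iter U0 (Suc n) t - iter U0 n t) \<le> R * (1/2) ^ n"
  using assms(2)
proof (induction n arbitrary: t)
  case 0
  then show ?case using Phi_dist[OF assms(1) admissible_iter[OF assms(1), of 0]] by simp
next
  case (Suc n)
  have "norm (iter U0 (Suc (Suc n)) t - iter U0 (Suc n) t) =
     norm (integral {0..t} (\<lambda>\<tau>. F \<tau> (iter U0 (Suc n) \<tau>)) - integral {0..t} (\<lambda>\<tau>. F \<tau> (iter U0 n \<tau>)))"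
    unfolding iter.simps(2)[of U0 "Suc n"] iter.simps(2)[of U0 n] Phi_def[of U0 "iter U0 n" t] Phi_def[of U0 "Phi U0 (iter U0 n)" t] by simp
  also have "\<dots> \<le> (R * (1/2) ^ n) / 2"
    by (rule integral_diff_bound[OF admissible_iter[OF assms(1)] admissible_iter[OF assms(1)] Suc.prems Suc.IH])
  finally show ?case by simp
qed

text \<open>The limit of the iterates, written as a telescoping series so that the Weierstrass test
  gives uniform convergence at once.\<close>

definition psol :: "'b \<Rightarrow> real \<Rightarrow> 'b" where
  "psol U0 t = U0 + (\<Sum>n. iter U0 (Suc n) t - iter U0 n t)"

lemma uniform_limit_iter:
  assumes "norm U0 \<le> R"
  shows "uniform_limit {0..T} (iter U0) (psol U0) sequentially"
proof -
  have "uniform_limit {0..T} (\<lambda>n t. \<Sum>i<n. iter U0 (Suc i) t - iter U0 i t) (\<lambda>t. \<Sum>i. iter U0 (Suc i) t - iter U0 i t) sequentially"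
  proof (rule Weierstrass_m_test)
    show "norm (iter U0 (Suc n) t - iter U0 n t) \<le> R * (1/2) ^ n" if "t \<in> {0..T}" for n t
      by (rule iter_step[OF assms that])
    show "summable (\<lambda>n. R * (1/2) ^ n)" by (intro summable_mult summable_geometric) simp
  qed
  moreover have "(\<Sum>i<n. iter U0 (Suc i) t - iter U0 i t) = iter U0 n t - U0" for n t
    using sum_lessThan_telescope[of "\<lambda>n. iter U0 n t" n] by simp
  ultimately have "uniform_limit {0..T} (\<lambda>n t. iter U0 n t - U0) (\<lambda>t. \<Sum>i. iter U0 (Suc i) t - iter U0 i t) sequentially"
    by (simp only:)
  moreover have "uniform_limit {0..T} (\<lambda>n t. U0) (\<lambda>t. U0) sequentially" by (rule uniform_limit_const)
  ultimately
  have "uniform_limit {0..T} (\<lambda>n t. U0 + (iter U0 n t - U0)) (psol U0) sequentially"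
    unfolding psol_def[abs_def] by (intro uniform_limit_add)
  then show ?thesis by simp
qed

lemma iter_tendsto: "norm U0 \<le> R \<Longrightarrow> t \<in> {0..T} \<Longrightarrow> (\<lambda>n. iter U0 n t) \<longlonglongrightarrow> psol U0 t"
  by (rule tendsto_uniform_limitI[OF uniform_limit_iter])

lemma admissible_psol:
  assumes "norm U0 \<le> R" shows "admissible (psol U0)"
  unfolding admissible_def
proof
  show "continuous_on {0..T} (psol U0)"
    by (rule uniform_limit_theorem[OF _ uniform_limit_iter[OF assms]])
       (use admissible_iter[OF assms] in \<open>auto simp: admissible_def\<close>)
  show "\<forall>t\<in>{0..T}. norm (psol U0 t) \<le> 2 * R"
  proof
    fix t assume t: "t \<in> {0..T}"
    show "norm (psol U0 t) \<le> 2 * R"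
      by (rule LIMSEQ_le_const2[OF tendsto_norm[OF iter_tendsto[OF assms t]]])
         (use admissible_iter[OF assms] t in \<open>auto simp: admissible_def\<close>)
  qed
qed

lemma psol_eq:
  assumes U0: "norm U0 \<le> R" and t: "t \<in> {0..T}"
  shows "psol U0 t = U0 + integral {0..t} (\<lambda>\<tau>. F \<tau> (psol U0 \<tau>))"
proof -
  have "(\<lambda>n. Phi U0 (iter U0 n) t) \<longlonglongrightarrow> Phi U0 (psol U0) t"
  proof (rule LIMSEQ_I)
    fix e :: real assume "e > 0"
    then obtain N where N: "\<And>n \<tau>. n \<ge> N \<Longrightarrow> \<tau> \<in> {0..T} \<Longrightarrow> dist (iter U0 n \<tau>) (psol U0 \<tau>) < e"
      using uniform_limit_iter[OF U0] unfolding uniform_limit_sequentially_iff by metis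
    show "\<exists>no. \<forall>n\<ge>no. norm (Phi U0 (iter U0 n) t - Phi U0 (psol U0) t) < e"
    proof (intro exI allI impI)
      fix n assume n: "n \<ge> N"
      have "norm (Phi U0 (iter U0 n) t - Phi U0 (psol U0) t) \<le> e / 2"
        unfolding Phi_def add_diff_cancel_left
        by (rule integral_diff_bound[OF admissible_iter[OF U0] admissible_psol[OF U0] t])
           (use N[OF n] in \<open>auto simp: dist_norm less_imp_le\<close>)
      then show "norm (Phi U0 (iter U0 n) t - Phi U0 (psol U0) t) < e" using \<open>e > 0\<close> by linarith
    qed
  qed
  moreover have "(\<lambda>n. Phi U0 (iter U0 n) t) \<longlonglongrightarrow> psol U0 t"
    using LIMSEQ_Suc[OF iter_tendsto[OF U0 t]] by simp
  ultimately show ?thesis using LIMSEQ_unique unfolding Phi_def by blast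
qed

text \<open>At a time where the distance of the two solutions is maximal, the integral terms
  contribute at most half of that maximum; absorbing it on the left gives the factor 2.\<close>

lemma psol_dependence:
  assumes U: "norm U0 \<le> R" and V: "norm V0 \<le> R" and t: "t \<in> {0..T}"
  shows "norm (psol U0 t - psol V0 t) \<le> 2 * norm (U0 - V0)"
proof -
  have cont': "continuous_on {0..T} (\<lambda>t. norm (psol U0 t - psol V0 t))"
    using admissible_psol[OF U] admissible_psol[OF V] by (intro continuous_on_norm continuous_on_diff) (auto simp: admissible_def)
  obtain t0 where t0: "t0 \<in> {0..T}" "\<And>\<tau>. \<tau> \<in> {0..T} \<Longrightarrow> norm (psol U0 \<tau> - psol V0 \<tau>) \<le> norm (psol U0 t0 - psol V0 t0)"
    using continuous_attains_sup[OF compact_Icc _ cont'] t by auto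
  let ?m = "norm (psol U0 t0 - psol V0 t0)"
  have "psol U0 t0 - psol V0 t0 = (U0 - V0) + (integral {0..t0} (\<lambda>\<tau>. F \<tau> (psol U0 \<tau>)) - integral {0..t0} (\<lambda>\<tau>. F \<tau> (psol V0 \<tau>)))"
    by (subst psol_eq[OF U t0(1)], subst psol_eq[OF V t0(1)]) simp
  also have "norm \<dots> \<le> norm (U0 - V0) + norm (integral {0..t0} (\<lambda>\<tau>. F \<tau> (psol U0 \<tau>)) - integral {0..t0} (\<lambda>\<tau>. F \<tau> (psol V0 \<tau>)))"
    by (rule norm_triangle_ineq)
  also have "norm (integral {0..t0} (\<lambda>\<tau>. F \<tau> (psol U0 \<tau>)) - integral {0..t0} (\<lambda>\<tau>. F \<tau> (psol V0 \<tau>))) \<le> ?m / 2"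
    by (rule integral_diff_bound[OF admissible_psol[OF U] admissible_psol[OF V] t0])
  finally have "?m \<le> 2 * norm (U0 - V0)" by simp
  with t0(2)[OF t] show ?thesis by linarith
qed

end

text \<open>Gronwall: at a maximum of \<open>exp (- 2 L t) * norm (V1 t - V2 t)\<close> the integral equation halves the value.\<close>

lemma volterra_unique:
  fixes F :: "real \<Rightarrow> 'b::banach \<Rightarrow> 'b"
  assumes T: "T \<ge> 0" and c1: "continuous_on {0..T} V1" and c2: "continuous_on {0..T} V2"
    and f1: "continuous_on {0..T} (\<lambda>\<tau>. F \<tau> (V1 \<tau>))" and f2: "continuous_on {0..T} (\<lambda>\<tau>. F \<tau> (V2 \<tau>))"
    and L: "L > 0" "\<And>\<tau>. \<tau> \<in> {0..T} \<Longrightarrow> norm (F \<tau> (V1 \<tau>) - F \<tau> (V2 \<tau>)) \<le> L * norm (V1 \<tau> - V2 \<tau>)"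
    and e1: "\<And>t. t \<in> {0..T} \<Longrightarrow> V1 t = U0 + integral {0..t} (\<lambda>\<tau>. F \<tau> (V1 \<tau>))"
    and e2: "\<And>t. t \<in> {0..T} \<Longrightarrow> V2 t = U0 + integral {0..t} (\<lambda>\<tau>. F \<tau> (V2 \<tau>))"
    and t: "t \<in> {0..T}"
  shows "V1 t = V2 t"
proof -
  let ?g = "\<lambda>t. exp (- (2 * L * t)) * norm (V1 t - V2 t)"
  have "continuous_on {0..T} ?g" by (intro continuous_intros c1 c2)
  then obtain t0 where t0: "t0 \<in> {0..T}" "\<And>\<tau>. \<tau> \<in> {0..T} \<Longrightarrow> ?g \<tau> \<le> ?g t0"
    using continuous_attains_sup[of "{0..T}" ?g] t by auto
  define m where "m = ?g t0"
  have m0: "m \<ge> 0" by (simp add: m_def)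
  have D: "norm (V1 \<tau> - V2 \<tau>) \<le> m * exp (2 * L * \<tau>)" if "\<tau> \<in> {0..T}" for \<tau>
  proof -
    have "norm (V1 \<tau> - V2 \<tau>) = exp (2 * L * \<tau>) * ?g \<tau>" by (simp add: exp_minus)
    also have "\<dots> \<le> exp (2 * L * \<tau>) * m" unfolding m_def by (intro mult_left_mono t0(2)[OF that]) simp
    finally show ?thesis by (simp add: mult.commute)
  qed
  have sub: "{0..t0} \<subseteq> {0..T}" using t0 by auto
  have "V1 t0 - V2 t0 = integral {0..t0} (\<lambda>\<tau>. F \<tau> (V1 \<tau>)) - integral {0..t0} (\<lambda>\<tau>. F \<tau> (V2 \<tau>))"
    by (subst e1[OF t0(1)], subst e2[OF t0(1)]) simp
  also have "\<dots> = integral {0..t0} (\<lambda>\<tau>. F \<tau> (V1 \<tau>) - F \<tau> (V2 \<tau>))"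
    by (rule Henstock_Kurzweil_Integration.integral_diff[symmetric]; rule integrable_continuous_interval)
       (rule continuous_on_subset[OF f1 sub] continuous_on_subset[OF f2 sub])+
  finally have eq: "V1 t0 - V2 t0 = integral {0..t0} (\<lambda>\<tau>. F \<tau> (V1 \<tau>) - F \<tau> (V2 \<tau>))" .
  have hi: "((\<lambda>\<tau>. L * (m * exp (2 * L * \<tau>))) has_integral (m / 2 * exp (2 * L * t0) - m / 2 * exp (2 * L * 0))) {0..t0}"
  proof (rule fundamental_theorem_of_calculus)
    show "0 \<le> t0" using t0 by simp
    show "((\<lambda>\<tau>. m / 2 * exp (2 * L * \<tau>)) has_vector_derivative L * (m * exp (2 * L * \<tau>))) (at \<tau> within {0..t0})" for \<tau>
      unfolding has_real_derivative_iff_has_vector_derivative[symmetric]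
      by (auto intro!: derivative_eq_intros)
  qed
  have "norm (integral {0..t0} (\<lambda>\<tau>. F \<tau> (V1 \<tau>) - F \<tau> (V2 \<tau>))) \<le> integral {0..t0} (\<lambda>\<tau>. L * (m * exp (2 * L * \<tau>)))"
  proof (rule integral_norm_bound_integral)
    show "(\<lambda>\<tau>. F \<tau> (V1 \<tau>) - F \<tau> (V2 \<tau>)) integrable_on {0..t0}"
      by (intro integrable_continuous_interval continuous_on_diff continuous_on_subset[OF f1 sub] continuous_on_subset[OF f2 sub])
    show "(\<lambda>\<tau>. L * (m * exp (2 * L * \<tau>))) integrable_on {0..t0}" using hi by (rule has_integral_integrable)
    show "norm (F \<tau> (V1 \<tau>) - F \<tau> (V2 \<tau>)) \<le> L * (m * exp (2 * L * \<tau>))" if "\<tau> \<in> {0..t0}" for \<tau>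
    proof -
      have \<tau>: "\<tau> \<in> {0..T}" using that sub by auto
      have "L * norm (V1 \<tau> - V2 \<tau>) \<le> L * (m * exp (2 * L * \<tau>))"
        using D[OF \<tau>] L(1) by (intro mult_left_mono) auto
      with L(2)[OF \<tau>] show ?thesis by linarith
    qed
  qed
  also have "\<dots> = m / 2 * exp (2 * L * t0) - m / 2" using integral_unique[OF hi] by simp
  finally have "norm (V1 t0 - V2 t0) \<le> m / 2 * exp (2 * L * t0)" using m0 eq by simp
  moreover have "norm (V1 t0 - V2 t0) = m * exp (2 * L * t0)"
    by (simp add: m_def exp_minus)
  ultimately have "m * exp (2 * L * t0) \<le> m / 2 * exp (2 * L * t0)" by simp
  then have "m \<le> m / 2" by (rule mult_right_le_imp_le) simp
  then have "m = 0" using m0 by simp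
  then show ?thesis using D[OF t] by simp
qed

section \<open>The space of continuous curves and the solution map\<close>

context sobolev_space
begin

text \<open>The Banach space X of the theorem is taken to be C([0,T]; H^s) itself, so uniqueness
  holds among all continuous H^s-valued curves. Values outside [0,T] are unconstrained, and
  \<open>CHs_norm\<close> is accordingly only a seminorm.\<close>

definition CHs :: "real \<Rightarrow> (real \<Rightarrow> real^'n \<Rightarrow> complex) set" where
  "CHs T = {u. cont_Hs s T u}"

definition CHs_norm :: "real \<Rightarrow> (real \<Rightarrow> real^'n \<Rightarrow> complex) \<Rightarrow> real" where
  "CHs_norm T u = (SUP t\<in>{0..T}. norm (lift (u t)))"

lemma CHs_iff: "u \<in> CHs T \<longleftrightarrow> (\<forall>t\<in>{0..T}. u t \<in> sobolev s) \<and> continuous_on {0..T} (\<lambda>t. lift (u t))"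
  by (simp add: CHs_def cont_Hs_iff)

lemma CHs_norm_ge:
  assumes "u \<in> CHs T" "t \<in> {0..T}" shows "norm (lift (u t)) \<le> CHs_norm T u"
  unfolding CHs_norm_def
proof (rule cSUP_upper[OF assms(2)])
  have "compact ((\<lambda>t. norm (lift (u t))) ` {0..T})"
    using assms(1) by (intro compact_continuous_image continuous_on_norm) (auto simp: CHs_iff)
  then show "bdd_above ((\<lambda>t. norm (lift (u t))) ` {0..T})" by (intro bounded_imp_bdd_above compact_imp_bounded)
qed

lemma CHs_norm_le:
  assumes "T \<ge> 0" "\<And>t. t \<in> {0..T} \<Longrightarrow> norm (lift (u t)) \<le> C" shows "CHs_norm T u \<le> C"
  unfolding CHs_norm_def using assms by (intro cSUP_least) auto

lemma CHs_add:
  assumes "u \<in> CHs T" "v \<in> CHs T" shows "(\<lambda>t x. u t x + v t x) \<in> CHs T"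
proof -
  have "continuous_on {0..T} (\<lambda>t. lift (u t) + lift (v t))"
    using assms by (intro continuous_on_add) (auto simp: CHs_iff)
  then have "continuous_on {0..T} (\<lambda>t. lift (\<lambda>x. u t x + v t x))"
    by (rule continuous_on_eq) (use assms in \<open>simp add: CHs_iff sobolev_add\<close>)
  then show ?thesis using assms by (simp add: CHs_iff sobolev_add)
qed

lemma CHs_diff:
  assumes "u \<in> CHs T" "v \<in> CHs T" shows "(\<lambda>t x. u t x - v t x) \<in> CHs T"
proof -
  have "continuous_on {0..T} (\<lambda>t. lift (u t) - lift (v t))"
    using assms by (intro continuous_on_diff) (auto simp: CHs_iff)
  then have "continuous_on {0..T} (\<lambda>t. lift (\<lambda>x. u t x - v t x))"
    by (rule continuous_on_eq) (use assms in \<open>simp add: CHs_iff sobolev_diff\<close>)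
  then show ?thesis using assms by (simp add: CHs_iff sobolev_diff)
qed

lemma CHs_cmult:
  assumes "u \<in> CHs T" shows "(\<lambda>t x. c * u t x) \<in> CHs T"
proof -
  have "continuous_on {0..T} (\<lambda>t. lmult (\<lambda>_. c) (lift (u t)))"
    using assms by (intro bounded_linear.continuous_on[OF bounded_linear_lmult_const]) (auto simp: CHs_iff)
  then have "continuous_on {0..T} (\<lambda>t. lift (\<lambda>x. c * u t x))"
    by (rule continuous_on_eq) (use assms in \<open>simp add: CHs_iff sobolev_cmult\<close>)
  then show ?thesis using assms by (simp add: CHs_iff sobolev_cmult)
qed

lemma CHs_norm_cmult_le:
  assumes "T \<ge> 0" "u \<in> CHs T" shows "CHs_norm T (\<lambda>t x. c * u t x) \<le> cmod c * CHs_norm T u"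
proof (rule CHs_norm_le[OF assms(1)])
  fix t assume t: "t \<in> {0..T}"
  have "norm (lift (\<lambda>x. c * u t x)) = norm (lmult (\<lambda>_. c) (lift (u t)))"
    using assms t by (simp add: CHs_iff sobolev_cmult)
  also have "\<dots> \<le> cmod c * norm (lift (u t))" by (rule norm_lmult_le) auto
  also have "\<dots> \<le> cmod c * CHs_norm T u" by (intro mult_left_mono CHs_norm_ge assms t) simp
  finally show "norm (lift (\<lambda>x. c * u t x)) \<le> cmod c * CHs_norm T u" .
qed

lemma CHs_norm_nonneg:
  assumes "T \<ge> 0" "u \<in> CHs T" shows "CHs_norm T u \<ge> 0"
proof -
  have "0 \<in> {0..T}" using assms by simp
  from CHs_norm_ge[OF assms(2) this] show ?thesis using norm_ge_zero order_trans by blast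
qed

text \<open>Equality follows from the inequality by applying it a second time with the inverse
  scalar.\<close>

lemma CHs_norm_cmult:
  assumes "T \<ge> 0" "u \<in> CHs T" shows "CHs_norm T (\<lambda>t x. c * u t x) = cmod c * CHs_norm T u"
proof (cases "c = 0")
  case True
  then show ?thesis using CHs_norm_cmult_le[OF assms, of c] CHs_norm_nonneg[OF assms(1) CHs_cmult[OF assms(2), of c]] by simp
next
  case False
  have "CHs_norm T (\<lambda>t x. inverse c * (c * u t x)) \<le> cmod (inverse c) * CHs_norm T (\<lambda>t x. c * u t x)"
    by (rule CHs_norm_cmult_le[OF assms(1) CHs_cmult[OF assms(2)]])
  moreover have "(\<lambda>t x. inverse c * (c * u t x)) = u" using False by (simp add: field_simps)
  ultimately have "CHs_norm T u \<le> inverse (cmod c) * CHs_norm T (\<lambda>t x. c * u t x)"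
    by (simp only: norm_inverse)
  then have "cmod c * CHs_norm T u \<le> cmod c * (inverse (cmod c) * CHs_norm T (\<lambda>t x. c * u t x))"
    by (rule mult_left_mono) simp
  moreover have "cmod c * (inverse (cmod c) * X) = X" for X using False by simp
  ultimately have "cmod c * CHs_norm T u \<le> CHs_norm T (\<lambda>t x. c * u t x)" by (simp only:)
  then show ?thesis using CHs_norm_cmult_le[OF assms, of c] by simp
qed

text \<open>The encodings converge uniformly to a continuous curve in the Hilbert space;
  \<open>emb\<close> turns its values back into functions.\<close>

lemma CHs_complete:
  assumes T: "T \<ge> 0" and f: "\<And>n. f n \<in> CHs T"
    and C: "\<And>\<epsilon>. \<epsilon> > 0 \<Longrightarrow> \<exists>M. \<forall>m\<ge>M. \<forall>n\<ge>M. CHs_norm T (\<lambda>t x. f m t x - f n t x) < \<epsilon>"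
  shows "\<exists>v\<in>CHs T. (\<lambda>n. CHs_norm T (\<lambda>t x. f n t x - v t x)) \<longlonglongrightarrow> 0"
proof -
  have lift_f: "lift (\<lambda>x. f m t x - f n t x) = lift (f m t) - lift (f n t)" if "t \<in> {0..T}" for m n t
    using f that by (simp add: CHs_iff sobolev_diff)
  have "uniformly_Cauchy_on {0..T} (\<lambda>n t. lift (f n t))"
    unfolding uniformly_Cauchy_on_def
  proof (intro allI impI)
    fix e :: real assume "e > 0"
    then obtain M where M: "\<And>m n. m \<ge> M \<Longrightarrow> n \<ge> M \<Longrightarrow> CHs_norm T (\<lambda>t x. f m t x - f n t x) < e"
      using C by meson
    show "\<exists>M. \<forall>t\<in>{0..T}. \<forall>m\<ge>M. \<forall>n\<ge>M. dist (lift (f m t)) (lift (f n t)) < e"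
    proof (intro exI ballI allI impI)
      fix t m n assume t: "t \<in> {0..T}" and m: "m \<ge> M" and n: "n \<ge> M"
      have "dist (lift (f m t)) (lift (f n t)) \<le> CHs_norm T (\<lambda>t x. f m t x - f n t x)"
        using CHs_norm_ge[OF CHs_diff[OF f f] t, of m n] by (simp add: dist_norm lift_f[OF t])
      with M[OF m n] show "dist (lift (f m t)) (lift (f n t)) < e" by simp
    qed
  qed
  then have "uniformly_convergent_on {0..T} (\<lambda>n t. lift (f n t))" by (rule Cauchy_uniformly_convergent)
  then obtain L where L: "uniform_limit {0..T} (\<lambda>n t. lift (f n t)) L sequentially"
    unfolding uniformly_convergent_on_def by blast
  have contL: "continuous_on {0..T} L"
    by (rule uniform_limit_theorem[OF _ L]) (use f in \<open>auto simp: CHs_iff\<close>)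
  let ?v = "\<lambda>t. emb (L t)"
  have v: "?v \<in> CHs T" using contL by (simp add: CHs_iff sobolev_emb)
  have "(\<lambda>n. CHs_norm T (\<lambda>t x. f n t x - ?v t x)) \<longlonglongrightarrow> 0"
  proof (rule LIMSEQ_I)
    fix e :: real assume "e > 0"
    then have "e / 2 > 0" by simp
    with L obtain M where M: "\<And>n t. n \<ge> M \<Longrightarrow> t \<in> {0..T} \<Longrightarrow> dist (lift (f n t)) (L t) < e / 2"
      unfolding uniform_limit_sequentially_iff by meson
    show "\<exists>no. \<forall>n\<ge>no. norm (CHs_norm T (\<lambda>t x. f n t x - ?v t x) - 0) < e"
    proof (intro exI allI impI)
      fix n assume n: "n \<ge> M"
      have "CHs_norm T (\<lambda>t x. f n t x - ?v t x) \<le> e / 2"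
      proof (rule CHs_norm_le[OF T])
        fix t assume t: "t \<in> {0..T}"
        have "lift (\<lambda>x. f n t x - ?v t x) = lift (f n t) - L t"
          using f t by (simp add: CHs_iff sobolev_diff sobolev_emb)
        then show "norm (lift (\<lambda>x. f n t x - ?v t x)) \<le> e / 2" using M[OF n t] by (simp add: dist_norm)
      qed
      moreover have "CHs_norm T (\<lambda>t x. f n t x - ?v t x) \<ge> 0" by (rule CHs_norm_nonneg[OF T CHs_diff[OF f v]])
      ultimately show "norm (CHs_norm T (\<lambda>t x. f n t x - ?v t x) - 0) < e" using \<open>e > 0\<close> by simp
    qed
  qed
  then show ?thesis by (rule bexI[OF _ v])
qed

lemma CHs_hs_inner_measurable:
  assumes u: "u \<in> CHs T" and v: "v \<in> sobolev s"
  shows "(\<lambda>t. hs_inner s (u t) v) \<in> borel_measurable (restrict_space lborel {0..T})"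
proof -
  let ?g = "\<lambda>t. pair (\<lambda>\<xi>. cnj (rep_lsq (lift v) \<xi>)) (lift (u t))"
  have "continuous_on {0..T} ?g"
    using u by (intro bounded_linear.continuous_on[OF bounded_linear_pair] sqi_cnj sqi_rep) (simp add: CHs_iff)
  then have "?g \<in> borel_measurable (restrict_space borel {0..T})"
    by (rule borel_measurable_continuous_on_restrict)
  moreover have "sets (restrict_space lborel {0..T}) = sets (restrict_space borel {0..T})"
    by (rule sets_restrict_space_cong) simp
  ultimately have g: "?g \<in> borel_measurable (restrict_space lborel {0..T})"
    using measurable_cong_sets by blast
  have "hs_inner s (u t) v = ?g t" if "t \<in> space (restrict_space lborel {0..T})" for t
    using that u v by (intro hs_inner_lift) (auto simp: CHs_iff space_restrict_space)
  then show ?thesis using g measurable_cong[of "restrict_space lborel {0..T}" "\<lambda>t. hs_inner s (u t) v" ?g] by blast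
qed

lemma banach_Linf_CHs:
  assumes T: "T > 0"
  shows "banach_Linf s T (CHs T) (CHs_norm T)"
  unfolding banach_Linf_def
proof (intro conjI ballI allI impI)
  have T0: "T \<ge> 0" using T by simp
  have "(\<lambda>_::real^'n. 0) \<in> sobolev s \<and> lift (\<lambda>_. 0) = 0" using liftI[of "\<lambda>_. 0" 0] by (simp add: emb_zero)
  then show "(\<lambda>_ _. 0) \<in> CHs T" by (simp add: CHs_iff)
  show "(\<lambda>t x. u t x + v t x) \<in> CHs T" if "u \<in> CHs T" "v \<in> CHs T" for u v using that by (rule CHs_add)
  show "(\<lambda>t x. c * u t x) \<in> CHs T" if "u \<in> CHs T" for u and c :: complex using that by (rule CHs_cmult)
  show "CHs_norm T u \<ge> 0" if "u \<in> CHs T" for u using CHs_norm_nonneg[OF T0 that] .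
  show "CHs_norm T (\<lambda>t x. u t x + v t x) \<le> CHs_norm T u + CHs_norm T v" if u: "u \<in> CHs T" and v: "v \<in> CHs T" for u v
  proof (rule CHs_norm_le[OF T0])
    fix t assume t: "t \<in> {0..T}"
    have "norm (lift (\<lambda>x. u t x + v t x)) = norm (lift (u t) + lift (v t))"
      using u v t by (simp add: CHs_iff sobolev_add)
    also have "\<dots> \<le> norm (lift (u t)) + norm (lift (v t))" by (rule norm_triangle_ineq)
    also have "\<dots> \<le> CHs_norm T u + CHs_norm T v" by (intro add_mono CHs_norm_ge u v t)
    finally show "norm (lift (\<lambda>x. u t x + v t x)) \<le> CHs_norm T u + CHs_norm T v" .
  qed
  show "CHs_norm T (\<lambda>t x. c * u t x) = cmod c * CHs_norm T u" if "u \<in> CHs T" for u c using CHs_norm_cmult[OF T0 that] .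
  show "AE t in lborel. t \<in> {0..T} \<longrightarrow> hs_norm s (u t) = 0" if u: "u \<in> CHs T" "CHs_norm T u = 0" for u
  proof (intro AE_I2 impI)
    fix t assume "t \<in> {0..T}"
    then show "hs_norm s (u t) = 0" using CHs_norm_ge[OF u(1)] u by (simp add: CHs_iff hs_norm_lift)
  qed
  show "\<exists>v\<in>CHs T. (\<lambda>n. CHs_norm T (\<lambda>t x. f n t x - v t x)) \<longlonglongrightarrow> 0"
    if "\<forall>n. f n \<in> CHs T" "\<forall>\<epsilon>>0. \<exists>M. \<forall>m\<ge>M. \<forall>n\<ge>M. CHs_norm T (\<lambda>t x. f m t x - f n t x) < \<epsilon>" for f
    using CHs_complete[OF T0, of f] that by blast
  show "AE t in lborel. t \<in> {0..T} \<longrightarrow> u t \<in> sobolev s" if "u \<in> CHs T" for u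
    using that by (auto simp: CHs_iff)
  show "(\<lambda>t. hs_inner s (u t) v) \<in> borel_measurable (restrict_space lborel {0..T})" if "u \<in> CHs T" "v \<in> sobolev s" for u v
    using that by (rule CHs_hs_inner_measurable)
  show "\<exists>C. AE t in lborel. t \<in> {0..T} \<longrightarrow> hs_norm s (u t) \<le> C" if u: "u \<in> CHs T" for u
    using CHs_norm_ge[OF u] u by (intro exI[of _ "CHs_norm T u"] AE_I2) (simp add: CHs_iff hs_norm_lift)
qed

text \<open>Leaves the interaction picture and realises each class by its pointwise representative,
  so that a solution is an actual function at every time.\<close>

definition Hsol :: "real \<Rightarrow> (real \<Rightarrow> (real^'n) lsq) \<Rightarrow> real \<Rightarrow> real^'n \<Rightarrow> complex" where
  "Hsol \<alpha> V t = emb (evol (- phase \<alpha> t) (V t))"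

lemma lift_Hsol [simp]: "lift (Hsol \<alpha> V t) = evol (- phase \<alpha> t) (V t)"
  by (simp add: Hsol_def)

lemma cont_Hsol:
  assumes "\<alpha> > 0" "continuous_on {0..T} V" shows "cont_Hs s T (Hsol \<alpha> V)"
  unfolding cont_Hs_iff
proof
  show "\<forall>t\<in>{0..T}. Hsol \<alpha> V t \<in> sobolev s" by (simp add: Hsol_def sobolev_emb)
  show "continuous_on {0..T} (\<lambda>t. lift (Hsol \<alpha> V t))"
    unfolding lift_Hsol
    by (intro continuous_on_evol continuous_on_minus continuous_on_subset[OF continuous_on_phase[OF assms(1)]] assms) auto
qed

text \<open>The existence time is fixed by R and the Lipschitz constant on the ball of radius 2R, so
  one T serves all data in the ball.\<close>

lemma local_wellposedness:
  assumes \<alpha>: "\<alpha> > 0" and R: "R > 0"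
  obtains T and S :: "(real^'n) lsq \<Rightarrow> real \<Rightarrow> (real^'n) lsq" where "T > 0"
    "\<And>U. norm U \<le> R \<Longrightarrow> continuous_on {0..T} (S U)"
    "\<And>U t. norm U \<le> R \<Longrightarrow> t \<in> {0..T} \<Longrightarrow> S U t = U + integral {0..t} (\<lambda>\<tau>. NN \<alpha> \<sigma> k \<tau> (S U \<tau>))"
    "\<And>U V t. norm U \<le> R \<Longrightarrow> norm V \<le> R \<Longrightarrow> t \<in> {0..T} \<Longrightarrow> norm (S U t - S V t) \<le> 2 * norm (U - V)"
proof -
  obtain B where B: "B \<ge> 0" "\<And>\<tau> U. norm U \<le> 2 * R \<Longrightarrow> norm (NN \<alpha> \<sigma> k \<tau> U) \<le> B"
    "\<And>\<tau> U V. norm U \<le> 2 * R \<Longrightarrow> norm V \<le> 2 * R \<Longrightarrow> norm (NN \<alpha> \<sigma> k \<tau> U - NN \<alpha> \<sigma> k \<tau> V) \<le> B * norm (U - V)"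
    using NN_lipschitz[of "2 * R" \<alpha> \<sigma> k] by blast
  \<comment> \<open>Dividing by B + 1 instead of B makes both smallness conditions hold and avoids
    division by zero.\<close>
  define T where "T = min R (1/2) / (B + 1)"
  have T: "T > 0" unfolding T_def using R B(1) by simp
  have BT: "B * T \<le> min R (1/2)"
  proof -
    have "B * T = B / (B + 1) * min R (1/2)" by (simp add: T_def)
    also have "\<dots> \<le> 1 * min R (1/2)" using B(1) R by (intro mult_right_mono) (auto simp: divide_le_eq_1)
    finally show ?thesis by simp
  qed
  interpret picard "NN \<alpha> \<sigma> k" R T B
    by standard (use R T B BT continuous_on_NN[OF \<alpha>] in auto)
  show ?thesis
  proof (rule that[OF T, of psol])
    show "continuous_on {0..T} (psol U)" if "norm U \<le> R" for U using admissible_psol[OF that] by (simp add: admissible_def)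
  qed (rule psol_eq psol_dependence; assumption)+
qed

text \<open>No size restriction on the competitor is required: both curves are bounded on the
  compact interval by some M, and the Lipschitz constant is taken on the ball of that
  radius.\<close>

lemma solution_unique:
  fixes u v :: "real \<Rightarrow> real^'n \<Rightarrow> complex"
  assumes \<alpha>: "\<alpha> > 0" and T: "T > 0" and u0: "u0 \<in> sobolev s"
    and u: "cont_Hs s T u" "solves \<alpha> \<sigma> k T u0 u" and v: "cont_Hs s T v" "solves \<alpha> \<sigma> k T u0 v"
    and t: "t \<in> {0..T}"
  shows "hs_dist s (v t) (u t) = 0"
proof -
  define V where "V w t = evol (phase \<alpha> t) (lift (w t))" for w :: "real \<Rightarrow> real^'n \<Rightarrow> complex" and t
  have c: "continuous_on {0..T} (V w)" if "cont_Hs s T w" for w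
    unfolding V_def using that
    by (intro continuous_on_evol continuous_on_subset[OF continuous_on_phase[OF \<alpha>]]) (auto simp: cont_Hs_iff)
  have "\<exists>M. \<forall>t\<in>{0..T}. norm (V u t) \<le> M \<and> norm (V v t) \<le> M"
  proof -
    have "bounded (V u ` {0..T} \<union> V v ` {0..T})"
      by (intro compact_imp_bounded compact_Un compact_continuous_image c u v compact_Icc)
    then show ?thesis unfolding bounded_iff by blast
  qed
  then obtain M where M: "\<And>t. t \<in> {0..T} \<Longrightarrow> norm (V u t) \<le> M" "\<And>t. t \<in> {0..T} \<Longrightarrow> norm (V v t) \<le> M" by blast
  obtain B where B: "B \<ge> 0"
    "\<And>\<tau> U V. norm U \<le> M \<Longrightarrow> norm V \<le> M \<Longrightarrow> norm (NN \<alpha> \<sigma> k \<tau> U - NN \<alpha> \<sigma> k \<tau> V) \<le> B * norm (U - V)"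
    using NN_lipschitz[of M \<alpha> \<sigma> k] by metis
  have "V v t = V u t"
  proof (rule volterra_unique[where F="NN \<alpha> \<sigma> k" and T=T and L="B + 1" and ?U0.0="lift u0"])
    show "continuous_on {0..T} (V u)" "continuous_on {0..T} (V v)" by (rule c u v)+
    show "continuous_on {0..T} (\<lambda>\<tau>. NN \<alpha> \<sigma> k \<tau> (V u \<tau>))" "continuous_on {0..T} (\<lambda>\<tau>. NN \<alpha> \<sigma> k \<tau> (V v \<tau>))"
      by (rule continuous_on_NN[OF \<alpha>], rule c, rule u v)+
    show "norm (NN \<alpha> \<sigma> k \<tau> (V v \<tau>) - NN \<alpha> \<sigma> k \<tau> (V u \<tau>)) \<le> (B + 1) * norm (V v \<tau> - V u \<tau>)" if "\<tau> \<in> {0..T}" for \<tau>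
      using B(2)[OF M(2) M(1), OF that that, of \<tau>] by (simp add: distrib_right add_increasing2)
    show "V v t = lift u0 + integral {0..t} (\<lambda>\<tau>. NN \<alpha> \<sigma> k \<tau> (V v \<tau>))" if "t \<in> {0..T}" for t
      using v(2) that unfolding solves_iff[OF \<alpha> u0 v(1)] V_def by blast
    show "V u t = lift u0 + integral {0..t} (\<lambda>\<tau>. NN \<alpha> \<sigma> k \<tau> (V u \<tau>))" if "t \<in> {0..T}" for t
      using u(2) that unfolding solves_iff[OF \<alpha> u0 u(1)] V_def by blast
  qed (use T t B in auto)
  then have "evol (- phase \<alpha> t) (V v t) = evol (- phase \<alpha> t) (V u t)" by simp
  then have "lift (v t) = lift (u t)" unfolding V_def by simp
  moreover have "v t \<in> sobolev s" "u t \<in> sobolev s" using u v t by (simp_all add: cont_Hs_iff)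
  ultimately show ?thesis by (simp add: hs_dist_lift)
qed

end

section \<open>Kato smoothing for the free evolution\<close>

definition cauchy_mass :: real where "cauchy_mass = (LINT t|lborel. inverse (1 + t\<^sup>2))"

lemma nn_integral_cauchy: "(\<integral>\<^sup>+t. ennreal (inverse (1 + t\<^sup>2)) \<partial>lborel) = ennreal cauchy_mass"
  unfolding cauchy_mass_def
  by (rule nn_integral_eq_integral[OF integrable_inverse_1_plus_square_real]) (auto simp: add_nonneg_nonneg)

lemma cauchy_mass_nonneg: "cauchy_mass \<ge> 0"
  unfolding cauchy_mass_def by (rule integral_nonneg_AE) (auto simp: add_nonneg_nonneg)

lemma exp_neg_le_inverse: "y \<ge> 0 \<Longrightarrow> exp (- y) \<le> inverse (1 + y)" for y :: real
  unfolding exp_minus by (rule le_imp_inverse_le[OF exp_ge_add_one_self]) simp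

text \<open>The Gaussian in |\<xi>|^2 - |\<eta>|^2 is exchanged for a Cauchy kernel, whose primitive
  is an arctangent; this gives explicit bounds after a change of variables.\<close>

lemma exp_sq_le_cauchy: "exp (- (v\<^sup>2 / 2)) \<le> 2 * inverse (1 + v\<^sup>2)" for v :: real
proof -
  have "exp (- (v\<^sup>2 / 2)) \<le> inverse (1 + v\<^sup>2 / 2)" by (rule exp_neg_le_inverse) simp
  also have "\<dots> \<le> inverse ((1/2) * (1 + v\<^sup>2))"
  proof (rule le_imp_inverse_le)
    show "(1/2) * (1 + v\<^sup>2) \<le> 1 + v\<^sup>2 / 2" by (simp add: distrib_left)
    show "0 < (1/2) * (1 + v\<^sup>2)" by (intro mult_pos_pos add_pos_nonneg) simp_all
  qed
  also have "\<dots> = inverse (1/2) * inverse (1 + v\<^sup>2)" by (rule inverse_mult_distrib)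
  finally show ?thesis by (simp only: inverse_eq_divide) simp
qed

lemma nn_integral_abs_shift:
  fixes g :: "real \<Rightarrow> ennreal"
  assumes [measurable]: "g \<in> borel_measurable borel"
  shows "(\<integral>\<^sup>+t. g (\<bar>t\<bar> - b) \<partial>lborel) \<le> 2 * (\<integral>\<^sup>+t. g t \<partial>lborel)"
proof -
  have "(\<integral>\<^sup>+t. g (\<bar>t\<bar> - b) \<partial>lborel) \<le> (\<integral>\<^sup>+t. g (t - b) + g (- b - t) \<partial>lborel)"
  proof (rule nn_integral_mono)
    fix t :: real
    have "\<bar>t\<bar> - b = t - b \<or> \<bar>t\<bar> - b = - b - t" by auto
    then show "g (\<bar>t\<bar> - b) \<le> g (t - b) + g (- b - t)"
    proof
      assume "\<bar>t\<bar> - b = t - b"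
      then show ?thesis by (simp only:) (rule add_increasing2[OF zero_le order_refl])
    next
      assume "\<bar>t\<bar> - b = - b - t"
      then show ?thesis by (simp only:) (rule add_increasing[OF zero_le order_refl])
    qed
  qed
  also have "\<dots> = (\<integral>\<^sup>+t. g (t - b) \<partial>lborel) + (\<integral>\<^sup>+t. g (- b - t) \<partial>lborel)"
    by (rule nn_integral_add) measurable
  also have "\<dots> = 2 * (\<integral>\<^sup>+t. g t \<partial>lborel)"
    unfolding nn_integral_translate[OF assms] nn_integral_reflect[OF assms] by (simp add: mult_2)
  finally show ?thesis .
qed

text \<open>With d = ||t| - |a|| and w = |t| + |a| the difference of squares has modulus d w, and
  the square root is at most |a| + d. The |a| part becomes a rescaled Cauchy kernel in d, whose
  integral is independent of a; the d part is bounded by 1 / (1 + d^2) because w \<ge> d. Each part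
  has mass 2 \<open>cauchy_mass\<close>, doubled for the two signs of t.\<close>

lemma schur_1d:
  "(\<integral>\<^sup>+t. ennreal (sqrt (\<bar>a\<bar> * \<bar>t\<bar>) * (2 * inverse (1 + (a\<^sup>2 - t\<^sup>2)\<^sup>2))) \<partial>lborel) \<le> ennreal (8 * cauchy_mass)"
proof -
  let ?g = "\<lambda>u. ennreal (2 * (\<bar>a\<bar> * inverse (1 + (a * u)\<^sup>2))) + ennreal (2 * inverse (1 + u\<^sup>2))"
  have pt: "sqrt (\<bar>a\<bar> * \<bar>t\<bar>) * (2 * inverse (1 + (a\<^sup>2 - t\<^sup>2)\<^sup>2)) \<le> 2 * (\<bar>a\<bar> * inverse (1 + (a * (\<bar>t\<bar> - \<bar>a\<bar>))\<^sup>2)) + 2 * inverse (1 + (\<bar>t\<bar> - \<bar>a\<bar>)\<^sup>2)" for t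
  proof -
    define d where "d = \<bar>\<bar>t\<bar> - \<bar>a\<bar>\<bar>"
    define w where "w = \<bar>t\<bar> + \<bar>a\<bar>"
    have d0: "d \<ge> 0" and dw: "d \<le> w" and aw: "\<bar>a\<bar> \<le> w" by (auto simp: d_def w_def)
    have ta: "\<bar>t\<bar> \<le> \<bar>a\<bar> + d" by (auto simp: d_def)
    have "\<bar>a\<bar> * \<bar>t\<bar> \<le> (\<bar>a\<bar> + d) * (\<bar>a\<bar> + d)" using d0 ta by (intro mult_mono) auto
    then have "sqrt (\<bar>a\<bar> * \<bar>t\<bar>) \<le> sqrt ((\<bar>a\<bar> + d)\<^sup>2)" by (intro real_sqrt_le_mono) (simp add: power2_eq_square)
    then have s: "sqrt (\<bar>a\<bar> * \<bar>t\<bar>) \<le> \<bar>a\<bar> + d" using d0 by simp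
    have lam: "(a\<^sup>2 - t\<^sup>2)\<^sup>2 = (d * w)\<^sup>2"
    proof -
      have "d * w = \<bar>(\<bar>t\<bar> - \<bar>a\<bar>) * (\<bar>t\<bar> + \<bar>a\<bar>)\<bar>" by (simp add: d_def w_def abs_mult)
      also have "(\<bar>t\<bar> - \<bar>a\<bar>) * (\<bar>t\<bar> + \<bar>a\<bar>) = t\<^sup>2 - a\<^sup>2" by (simp add: algebra_simps power2_eq_square)
      finally show ?thesis by (simp add: power2_commute)
    qed
    have pos: "1 + x\<^sup>2 > 0" for x :: real by (simp add: add_pos_nonneg)
    have 1: "\<bar>a\<bar> * inverse (1 + (d * w)\<^sup>2) \<le> \<bar>a\<bar> * inverse (1 + (a * (\<bar>t\<bar> - \<bar>a\<bar>))\<^sup>2)"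
    proof (intro mult_left_mono le_imp_inverse_le add_left_mono)
      have "(a * (\<bar>t\<bar> - \<bar>a\<bar>))\<^sup>2 = (d * \<bar>a\<bar>)\<^sup>2" by (simp add: d_def power_mult_distrib)
      also have "\<dots> \<le> (d * w)\<^sup>2" using d0 aw by (intro power_mono mult_left_mono) auto
      finally show "(a * (\<bar>t\<bar> - \<bar>a\<bar>))\<^sup>2 \<le> (d * w)\<^sup>2" .
    qed (auto simp: pos)
    have 2: "d * inverse (1 + (d * w)\<^sup>2) \<le> inverse (1 + (\<bar>t\<bar> - \<bar>a\<bar>)\<^sup>2)"
    proof -
      have "d * (1 + d\<^sup>2) \<le> 1 + (d * d)\<^sup>2"
      proof -
        \<comment> \<open>The difference of the two sides is exactly half the sum of these three
          squares.\<close>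
        have "0 \<le> (1 - d)\<^sup>2" "0 \<le> (d - d * d)\<^sup>2" "0 \<le> (1 - d * d)\<^sup>2" by simp_all
        then show ?thesis by (simp add: power2_eq_square algebra_simps)
      qed
      also have "\<dots> \<le> 1 + (d * w)\<^sup>2" using d0 dw by (intro add_left_mono power_mono mult_left_mono) auto
      finally have "d * (1 + d\<^sup>2) \<le> 1 + (d * w)\<^sup>2" .
      then have "d / (1 + (d * w)\<^sup>2) \<le> 1 / (1 + d\<^sup>2)" using pos[of d] pos[of "d * w"] by (simp add: field_simps)
      moreover have "d\<^sup>2 = (\<bar>t\<bar> - \<bar>a\<bar>)\<^sup>2" by (simp add: d_def)
      ultimately show ?thesis by (simp only: divide_inverse mult_1)
    qed
    have "sqrt (\<bar>a\<bar> * \<bar>t\<bar>) * (2 * inverse (1 + (d * w)\<^sup>2)) \<le> (\<bar>a\<bar> + d) * (2 * inverse (1 + (d * w)\<^sup>2))"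
      using pos[of "d * w"] by (intro mult_right_mono s) auto
    also have "\<dots> = 2 * (\<bar>a\<bar> * inverse (1 + (d * w)\<^sup>2)) + 2 * (d * inverse (1 + (d * w)\<^sup>2))" by (simp add: algebra_simps)
    also have "\<dots> \<le> 2 * (\<bar>a\<bar> * inverse (1 + (a * (\<bar>t\<bar> - \<bar>a\<bar>))\<^sup>2)) + 2 * inverse (1 + (\<bar>t\<bar> - \<bar>a\<bar>)\<^sup>2)" using 1 2 by linarith
    finally show ?thesis unfolding lam .
  qed
  have pos: "1 + x\<^sup>2 > 0" for x :: real by (simp add: add_pos_nonneg)
  have "(\<integral>\<^sup>+t. ennreal (sqrt (\<bar>a\<bar> * \<bar>t\<bar>) * (2 * inverse (1 + (a\<^sup>2 - t\<^sup>2)\<^sup>2))) \<partial>lborel) \<le> (\<integral>\<^sup>+t. ?g (\<bar>t\<bar> - \<bar>a\<bar>) \<partial>lborel)"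
  proof (rule nn_integral_mono)
    fix t :: real
    show "ennreal (sqrt (\<bar>a\<bar> * \<bar>t\<bar>) * (2 * inverse (1 + (a\<^sup>2 - t\<^sup>2)\<^sup>2))) \<le> ?g (\<bar>t\<bar> - \<bar>a\<bar>)"
    proof -
      have i: "0 \<le> inverse (1 + x\<^sup>2)" for x :: real using pos[of x] by simp
      have n: "0 \<le> 2 * (\<bar>a\<bar> * inverse (1 + (a * (\<bar>t\<bar> - \<bar>a\<bar>))\<^sup>2))" "0 \<le> 2 * inverse (1 + (\<bar>t\<bar> - \<bar>a\<bar>)\<^sup>2)"
        by (intro mult_nonneg_nonneg i; simp)+
      from ennreal_leI[OF pt[of t]] show ?thesis unfolding ennreal_plus[OF n] .
    qed
  qed
  also have "\<dots> \<le> 2 * (\<integral>\<^sup>+u. ?g u \<partial>lborel)" by (rule nn_integral_abs_shift) measurable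
  also have "(\<integral>\<^sup>+u. ?g u \<partial>lborel) = (\<integral>\<^sup>+u. ennreal (2 * (\<bar>a\<bar> * inverse (1 + (a * u)\<^sup>2))) \<partial>lborel) + (\<integral>\<^sup>+u. ennreal (2 * inverse (1 + u\<^sup>2)) \<partial>lborel)"
    by (rule nn_integral_add) measurable
  also have "(\<integral>\<^sup>+u. ennreal (2 * inverse (1 + u\<^sup>2)) \<partial>lborel) = ennreal (2 * cauchy_mass)"
    using nn_integral_cmult[of "\<lambda>u. ennreal (inverse (1 + u\<^sup>2))" lborel "ennreal 2"] cauchy_mass_nonneg
    by (simp add: ennreal_mult nn_integral_cauchy pos less_imp_le)
  also have "(\<integral>\<^sup>+u. ennreal (2 * (\<bar>a\<bar> * inverse (1 + (a * u)\<^sup>2))) \<partial>lborel) \<le> ennreal (2 * cauchy_mass)"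
  proof (cases "a = 0")
    case False
    have "(\<integral>\<^sup>+u. ennreal (2 * inverse (1 + u\<^sup>2)) \<partial>lborel) = \<bar>a\<bar> * (\<integral>\<^sup>+u. ennreal (2 * inverse (1 + (0 + a * u)\<^sup>2)) \<partial>lborel)"
      by (rule nn_integral_real_affine[OF _ False]) measurable
    also have "\<dots> = (\<integral>\<^sup>+u. ennreal (2 * (\<bar>a\<bar> * inverse (1 + (a * u)\<^sup>2))) \<partial>lborel)"
      by (subst nn_integral_cmult[symmetric]) (auto intro!: nn_integral_cong simp: ennreal_mult[symmetric] pos less_imp_le mult_ac)
    finally show ?thesis using \<open>(\<integral>\<^sup>+u. ennreal (2 * inverse (1 + u\<^sup>2)) \<partial>lborel) = ennreal (2 * cauchy_mass)\<close> by simp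
  qed simp
  finally have "(\<integral>\<^sup>+t. ennreal (sqrt (\<bar>a\<bar> * \<bar>t\<bar>) * (2 * inverse (1 + (a\<^sup>2 - t\<^sup>2)\<^sup>2))) \<partial>lborel) \<le> 2 * (ennreal (2 * cauchy_mass) + ennreal (2 * cauchy_mass))"
    by (simp add: mult_left_mono)
  also have "\<dots> = ennreal 2 * ennreal (4 * cauchy_mass)"
    using cauchy_mass_nonneg by (subst ennreal_plus[symmetric]) auto
  also have "\<dots> = ennreal (8 * cauchy_mass)"
    using cauchy_mass_nonneg by (subst ennreal_mult[symmetric]) auto
  finally show ?thesis .
qed

text \<open>The condition on b forces the derivative 2 (y + b) of the quadratic to keep its sign on
  [0,1] with modulus at least |c|; the summand 1 compensates y \<le> 1. The integrand is then below
  the derivative of twice an arctangent, up to sign, whose total change is at most 2 pi.\<close>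

lemma quadratic_arctan_bound:
  fixes b c c0 :: real
  assumes "\<bar>b\<bar> \<ge> 1 + \<bar>c\<bar> / 2"
  shows "(\<integral>\<^sup>+y. ennreal (\<bar>c\<bar> * (2 * inverse (1 + (y\<^sup>2 + 2 * b * y + c0)\<^sup>2))) * indicator {0..1} y \<partial>lborel) \<le> ennreal (2 * pi)"
proof -
  let ?q = "\<lambda>y. y\<^sup>2 + 2 * b * y + c0"
  let ?f = "\<lambda>y. sgn b * (2 * (y + b)) * (2 * inverse (1 + (?q y)\<^sup>2))" and ?F = "\<lambda>y. sgn b * (2 * arctan (?q y))"
  have pos: "1 + x\<^sup>2 > 0" for x :: real by (simp add: add_pos_nonneg)
  have b0: "b \<noteq> 0" using assms by auto
  have sg: "\<bar>c\<bar> \<le> sgn b * (2 * (y + b))" if "0 \<le> y" "y \<le> 1" for y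
    using assms that b0 by (cases "b > 0") (auto simp: sgn_if)
  have "(\<integral>\<^sup>+y. ennreal (\<bar>c\<bar> * (2 * inverse (1 + (?q y)\<^sup>2))) * indicator {0..1} y \<partial>lborel) \<le> (\<integral>\<^sup>+y. ennreal (?f y) * indicator {0..1} y \<partial>lborel)"
  proof (rule nn_integral_mono)
    fix y :: real
    show "ennreal (\<bar>c\<bar> * (2 * inverse (1 + (?q y)\<^sup>2))) * indicator {0..1} y \<le> ennreal (?f y) * indicator {0..1} y"
    proof (cases "y \<in> {0..1}")
      case True
      have "\<bar>c\<bar> * (2 * inverse (1 + (?q y)\<^sup>2)) \<le> ?f y"
        using pos[of "?q y"] True by (intro mult_right_mono sg) auto
      then show ?thesis using True by (simp add: ennreal_leI)
    qed simp
  qed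
  also have "\<dots> = ennreal (?F 1 - ?F 0)"
  proof (rule nn_integral_FTC_Icc)
    show "?f \<in> borel_measurable borel" by measurable
    show "0 \<le> ?f y" if "y \<in> {0..1}" for y
    proof (rule mult_nonneg_nonneg)
      show "0 \<le> sgn b * (2 * (y + b))" using order_trans[OF abs_ge_zero sg[of y]] that by simp
      show "0 \<le> 2 * inverse (1 + (?q y)\<^sup>2)" using pos[of "?q y"] by simp
    qed
    show "DERIV ?F y :> ?f y" if "y \<in> {0..1}" for y
      by (auto intro!: derivative_eq_intros simp: algebra_simps)
  qed simp
  also have "\<dots> \<le> ennreal (2 * pi)"
  proof (rule ennreal_leI)
    have "- (pi / 2) < arctan (?q 1)" "arctan (?q 1) < pi / 2" "- (pi / 2) < arctan (?q 0)" "arctan (?q 0) < pi / 2"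
      using arctan_bounded by auto
    then show "?F 1 - ?F 0 \<le> 2 * pi" by (auto simp: sgn_if)
  qed
  finally show ?thesis .
qed

text \<open>The exponent 1/4 instead of 1/2 and the linear factor are what remains after averaging
  over unit shifts and absorbing stray powers of |\<zeta>|.\<close>

definition gauss_mass :: "'n::finite itself \<Rightarrow> ennreal" where
  "gauss_mass _ = (\<integral>\<^sup>+(\<zeta>::real^'n). ennreal ((1 + norm \<zeta>) * exp (- ((norm \<zeta>)\<^sup>2 / 4))) \<partial>lborel)"

lemma gauss_mass_finite: "gauss_mass TYPE('n::finite) < \<infinity>"
proof -
  let ?f = "\<lambda>(b::real^'n) t::real. ennreal (exp (- (t\<^sup>2 / 8)))"
  have 1: "(1 + norm \<zeta>) * exp (- ((norm \<zeta>)\<^sup>2 / 4)) \<le> 3 * exp (- ((norm \<zeta>)\<^sup>2 / 8))" for \<zeta> :: "real^'n"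
  proof -
    let ?x = "norm \<zeta>"
    have "(1 + ?x) * exp (- (?x\<^sup>2 / 8)) \<le> (1 + ?x) * inverse (1 + ?x\<^sup>2 / 8)"
      by (intro mult_left_mono exp_neg_le_inverse) auto
    also have "\<dots> \<le> 3"
    proof -
      \<comment> \<open>Three eighths of this square is 3x^2/8 - x + 2/3, which is below the
        difference of the two sides of the next inequality.\<close>
      have "0 \<le> (?x - 4/3)\<^sup>2" by simp
      then have "1 + ?x \<le> 3 * (1 + ?x\<^sup>2 / 8)" by (simp add: power2_eq_square algebra_simps)
      moreover have "1 + ?x\<^sup>2 / 8 > 0" by (simp add: add_pos_nonneg)
      ultimately show ?thesis by (simp only: divide_inverse[symmetric]) (simp add: divide_le_eq)
    qed
    finally have "(1 + ?x) * exp (- (?x\<^sup>2 / 8)) * exp (- (?x\<^sup>2 / 8)) \<le> 3 * exp (- (?x\<^sup>2 / 8))"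
      by (rule mult_right_mono) simp
    moreover have "exp (- (?x\<^sup>2 / 8)) * exp (- (?x\<^sup>2 / 8)) = exp (- (?x\<^sup>2 / 4))"
      by (simp flip: exp_add)
    ultimately show ?thesis by (simp add: mult.assoc)
  qed
  have 2: "exp (- ((norm \<zeta>)\<^sup>2 / 8)) = (\<Prod>b\<in>Basis. exp (- ((\<zeta> \<bullet> b)\<^sup>2 / 8)))" for \<zeta> :: "real^'n"
  proof -
    have "(norm \<zeta>)\<^sup>2 = (\<Sum>b\<in>Basis. (\<zeta> \<bullet> b)\<^sup>2)"
      unfolding power2_norm_eq_inner by (subst euclidean_inner) (simp add: power2_eq_square)
    then have "- ((norm \<zeta>)\<^sup>2 / 8) = (\<Sum>b\<in>Basis. - ((\<zeta> \<bullet> b)\<^sup>2 / 8))"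
      by (simp add: sum_negf sum_divide_distrib)
    then show ?thesis by (simp only: exp_sum[OF finite_Basis])
  qed
  have 3: "(\<integral>\<^sup>+t. ennreal (exp (- (t\<^sup>2 / 8))) \<partial>lborel) < \<infinity>"
  proof -
    have "(\<integral>\<^sup>+t. ennreal (exp (- (t\<^sup>2 / 8))) \<partial>lborel) \<le> (\<integral>\<^sup>+t. ennreal 8 * ennreal (inverse (1 + t\<^sup>2)) \<partial>lborel)"
    proof (rule nn_integral_mono)
      fix t :: real
      have p: "1 + t\<^sup>2 > 0" by (simp add: add_pos_nonneg)
      have "exp (- (t\<^sup>2 / 8)) \<le> inverse (1 + t\<^sup>2 / 8)" by (rule exp_neg_le_inverse) simp
      also have "\<dots> \<le> inverse ((1/8) * (1 + t\<^sup>2))"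
        using p by (intro le_imp_inverse_le mult_pos_pos) simp_all
      also have "\<dots> = inverse (1/8) * inverse (1 + t\<^sup>2)" by (rule inverse_mult_distrib)
      finally have "exp (- (t\<^sup>2 / 8)) \<le> 8 * inverse (1 + t\<^sup>2)" by simp
      then show "ennreal (exp (- (t\<^sup>2 / 8))) \<le> ennreal 8 * ennreal (inverse (1 + t\<^sup>2))"
        using p by (subst ennreal_mult[symmetric]) (auto intro: ennreal_leI)
    qed
    also have "\<dots> = ennreal 8 * ennreal cauchy_mass"
      unfolding nn_integral_cauchy[symmetric] by (rule nn_integral_cmult) measurable
    also have "\<dots> < \<infinity>" by (simp add: ennreal_mult_less_top)
    finally show ?thesis .
  qed
  have "gauss_mass TYPE('n) \<le> (\<integral>\<^sup>+(\<zeta>::real^'n). ennreal 3 * (\<Prod>b\<in>Basis. ?f b (\<zeta> \<bullet> b)) \<partial>lborel)"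
    unfolding gauss_mass_def
  proof (rule nn_integral_mono)
    fix \<zeta> :: "real^'n"
    have "ennreal ((1 + norm \<zeta>) * exp (- ((norm \<zeta>)\<^sup>2 / 4))) \<le> ennreal (3 * exp (- ((norm \<zeta>)\<^sup>2 / 8)))"
      by (rule ennreal_leI[OF 1])
    also have "\<dots> = ennreal 3 * (\<Prod>b\<in>Basis. ?f b (\<zeta> \<bullet> b))"
      unfolding 2 by (subst ennreal_mult) (auto simp: prod_ennreal prod_nonneg)
    finally show "ennreal ((1 + norm \<zeta>) * exp (- ((norm \<zeta>)\<^sup>2 / 4))) \<le> ennreal 3 * (\<Prod>b\<in>Basis. ?f b (\<zeta> \<bullet> b))" .
  qed
  also have "\<dots> = ennreal 3 * (\<integral>\<^sup>+(\<zeta>::real^'n). (\<Prod>b\<in>Basis. ?f b (\<zeta> \<bullet> b)) \<partial>lborel)"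
    by (rule nn_integral_cmult) measurable
  also have "(\<integral>\<^sup>+(\<zeta>::real^'n). (\<Prod>b\<in>Basis. ?f b (\<zeta> \<bullet> b)) \<partial>lborel) = (\<Prod>b\<in>(Basis::(real^'n) set). \<integral>\<^sup>+t. ?f b t \<partial>lborel)"
    by (rule nn_integral_lborel_prod) auto
  also have "ennreal 3 * \<dots> < \<infinity>"
    using 3 by (simp add: ennreal_mult_less_top power_less_top_ennreal)
  finally show ?thesis .
qed

text \<open>Selects a coordinate direction in which \<xi> is comparable to its full length, so that
  |\<xi> + \<zeta>|^2 changes along it at a rate comparable to |\<xi>| unless \<zeta> is
  large.\<close>

lemma exists_large_coordinate: "\<exists>i\<in>Basis. norm \<xi> \<le> real DIM('a) * \<bar>\<xi> \<bullet> i\<bar>" for \<xi> :: "'a::euclidean_space"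
proof -
  let ?K = "Max ((\<lambda>b. \<bar>\<xi> \<bullet> b\<bar>) ` Basis)"
  have "?K \<in> (\<lambda>b. \<bar>\<xi> \<bullet> b\<bar>) ` Basis" by (intro Max_in) auto
  then obtain i where i: "i \<in> Basis" "?K = \<bar>\<xi> \<bullet> i\<bar>" by (rule imageE) (rule that)
  have "norm \<xi> \<le> (\<Sum>b\<in>Basis. \<bar>\<xi> \<bullet> b\<bar>)" by (rule norm_le_l1)
  also have "\<dots> \<le> real DIM('a) * ?K" by (rule sum_bounded_above) auto
  finally have "norm \<xi> \<le> real DIM('a) * \<bar>\<xi> \<bullet> i\<bar>" unfolding i(2) .
  then show ?thesis using i(1) by (rule bexI)
qed

text \<open>By translation invariance, averaging over the shifts y i with y in [0,1] changes
  nothing, yet it provides an inner integral along the good direction without rotating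
  coordinates.\<close>

lemma nn_integral_average:
  fixes F :: "'a::euclidean_space \<Rightarrow> ennreal"
  assumes [measurable]: "F \<in> borel_measurable borel"
  shows "(\<integral>\<^sup>+\<zeta>. F \<zeta> \<partial>lborel) = (\<integral>\<^sup>+\<zeta>. (\<integral>\<^sup>+y. F (\<zeta> + y *\<^sub>R i) * indicator {0..1::real} y \<partial>lborel) \<partial>lborel)"
proof -
  have tr: "(\<integral>\<^sup>+\<zeta>. F (\<zeta> + y *\<^sub>R i) * indicator {0..1} y \<partial>lborel) = (\<integral>\<^sup>+\<zeta>. F \<zeta> \<partial>lborel) * indicator {0..1} y" for y :: real
  proof -
    have "(\<integral>\<^sup>+\<zeta>. F (\<zeta> + y *\<^sub>R i) * indicator {0..1} y \<partial>lborel) = (\<integral>\<^sup>+\<zeta>. F (\<zeta> + y *\<^sub>R i) \<partial>lborel) * indicator {0..1} y"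
      by (rule nn_integral_multc) measurable
    then show ?thesis using nn_integral_translate[of F "- (y *\<^sub>R i)"] by simp
  qed
  have "(\<integral>\<^sup>+\<zeta>. (\<integral>\<^sup>+y. F (\<zeta> + y *\<^sub>R i) * indicator {0..1::real} y \<partial>lborel) \<partial>lborel) = (\<integral>\<^sup>+y. (\<integral>\<^sup>+\<zeta>. F (\<zeta> + y *\<^sub>R i) * indicator {0..1::real} y \<partial>lborel) \<partial>lborel)"
    by (rule lborel_pair.Fubini') measurable
  also have "\<dots> = (\<integral>\<^sup>+y. (\<integral>\<^sup>+\<zeta>. F \<zeta> \<partial>lborel) * indicator {0..1::real} y \<partial>lborel)" by (simp only: tr)
  also have "\<dots> = (\<integral>\<^sup>+\<zeta>. F \<zeta> \<partial>lborel)" by (simp add: nn_integral_cmult)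
  finally show ?thesis by simp
qed

text \<open>Along the segment, |\<xi> + \<zeta> + y i|^2 - |\<xi>|^2 is a quadratic in y with linear
  coefficient 2 b. Either b is large and the arctangent bound applies, or \<xi> itself is controlled
  by |\<zeta>| and the Gaussian absorbs it.\<close>

lemma schur_gauss_inner:
  fixes \<xi> \<zeta> :: "real^'n"
  assumes i: "i \<in> Basis" and c: "norm \<xi> \<le> real CARD('n) * \<bar>\<xi> \<bullet> i\<bar>"
  shows "(\<integral>\<^sup>+y. ennreal (norm \<xi> * (exp (- ((norm (\<zeta> + y *\<^sub>R i))\<^sup>2 / 2)) * (2 * inverse (1 + ((norm \<xi>)\<^sup>2 - (norm (\<xi> + (\<zeta> + y *\<^sub>R i)))\<^sup>2)\<^sup>2)))) * indicator {0..1::real} y \<partial>lborel)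
    \<le> ennreal (real CARD('n) * exp (1/2) * 8) * ennreal ((1 + norm \<zeta>) * exp (- ((norm \<zeta>)\<^sup>2 / 4)))"
proof -
  define b where "b = (\<xi> + \<zeta>) \<bullet> i"
  define c0 where "c0 = (norm (\<xi> + \<zeta>))\<^sup>2 - (norm \<xi>)\<^sup>2"
  let ?c = "\<xi> \<bullet> i" and ?N = "real CARD('n) * exp (1/2) * exp (- ((norm \<zeta>)\<^sup>2 / 4))"
  let ?h = "\<lambda>y. \<bar>?c\<bar> * (2 * inverse (1 + (y\<^sup>2 + 2 * b * y + c0)\<^sup>2))"
  have pos: "1 + x\<^sup>2 > 0" for x :: real by (simp add: add_pos_nonneg)
  have hpos: "0 \<le> 2 * inverse (1 + x\<^sup>2)" for x :: real using pos[of x] by simp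
  have ii: "i \<bullet> i = 1" using i by (simp add: inner_Basis)
  have pt: "norm \<xi> * (exp (- ((norm (\<zeta> + y *\<^sub>R i))\<^sup>2 / 2)) * (2 * inverse (1 + ((norm \<xi>)\<^sup>2 - (norm (\<xi> + (\<zeta> + y *\<^sub>R i)))\<^sup>2)\<^sup>2))) \<le> ?N * ?h y"
    if y: "y \<in> {0..1}" for y
  proof -
    have e1: "(norm (\<xi> + (\<zeta> + y *\<^sub>R i)))\<^sup>2 = (norm (\<xi> + \<zeta>))\<^sup>2 + 2 * b * y + y\<^sup>2"
      unfolding add.assoc[symmetric] power2_norm_eq_inner b_def
      by (simp add: inner_add_left inner_add_right inner_commute[of i \<xi>] inner_commute[of i \<zeta>] ii power2_eq_square algebra_simps)
    have e2: "((norm \<xi>)\<^sup>2 - (norm (\<xi> + (\<zeta> + y *\<^sub>R i)))\<^sup>2)\<^sup>2 = (y\<^sup>2 + 2 * b * y + c0)\<^sup>2"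
    proof -
      have "(norm \<xi>)\<^sup>2 - (norm (\<xi> + (\<zeta> + y *\<^sub>R i)))\<^sup>2 = - (y\<^sup>2 + 2 * b * y + c0)" unfolding e1 c0_def by simp
      then show ?thesis by (simp only: power2_minus)
    qed
    \<comment> \<open>A shift of length at most 1 gives |\<zeta>|^2 \<le> 2 |\<zeta> + y i|^2 + 2.
      This halves the rate of the Gaussian from 1/2 to 1/4 and costs the factor exp (1/2).\<close>
    have "norm \<zeta> \<le> norm (\<zeta> + y *\<^sub>R i) + norm (y *\<^sub>R i)" using norm_triangle_ineq4[of "\<zeta> + y *\<^sub>R i" "y *\<^sub>R i"] by simp
    also have "norm (y *\<^sub>R i) \<le> 1" using i y by simp
    finally have "(norm \<zeta>)\<^sup>2 \<le> (norm (\<zeta> + y *\<^sub>R i) + 1)\<^sup>2" by (intro power_mono) auto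
    also have "\<dots> \<le> 2 * (norm (\<zeta> + y *\<^sub>R i))\<^sup>2 + 2"
      using zero_le_power2[of "norm (\<zeta> + y *\<^sub>R i) - 1"] by (simp add: power2_eq_square algebra_simps)
    finally have "exp (- ((norm (\<zeta> + y *\<^sub>R i))\<^sup>2 / 2)) \<le> exp (1/2 + - ((norm \<zeta>)\<^sup>2 / 4))" by simp
    then have e3: "exp (- ((norm (\<zeta> + y *\<^sub>R i))\<^sup>2 / 2)) \<le> exp (1/2) * exp (- ((norm \<zeta>)\<^sup>2 / 4))" by (simp only: exp_add)
    have "norm \<xi> * (exp (- ((norm (\<zeta> + y *\<^sub>R i))\<^sup>2 / 2)) * (2 * inverse (1 + (y\<^sup>2 + 2 * b * y + c0)\<^sup>2)))
       \<le> (real CARD('n) * \<bar>?c\<bar>) * ((exp (1/2) * exp (- ((norm \<zeta>)\<^sup>2 / 4))) * (2 * inverse (1 + (y\<^sup>2 + 2 * b * y + c0)\<^sup>2)))"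
      by (intro mult_mono c e3 order_refl mult_nonneg_nonneg hpos) auto
    also have "\<dots> = ?N * ?h y" by (simp only: mult_ac)
    finally show ?thesis unfolding e2 .
  qed
  have "(\<integral>\<^sup>+y. ennreal (norm \<xi> * (exp (- ((norm (\<zeta> + y *\<^sub>R i))\<^sup>2 / 2)) * (2 * inverse (1 + ((norm \<xi>)\<^sup>2 - (norm (\<xi> + (\<zeta> + y *\<^sub>R i)))\<^sup>2)\<^sup>2)))) * indicator {0..1::real} y \<partial>lborel)
     \<le> (\<integral>\<^sup>+y. ennreal ?N * (ennreal (?h y) * indicator {0..1} y) \<partial>lborel)"
  proof (rule nn_integral_mono)
    fix y :: real
    show "ennreal (norm \<xi> * (exp (- ((norm (\<zeta> + y *\<^sub>R i))\<^sup>2 / 2)) * (2 * inverse (1 + ((norm \<xi>)\<^sup>2 - (norm (\<xi> + (\<zeta> + y *\<^sub>R i)))\<^sup>2)\<^sup>2)))) * indicator {0..1::real} y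
       \<le> ennreal ?N * (ennreal (?h y) * indicator {0..1} y)"
    proof (cases "y \<in> {0..1}")
      case True
      have "0 \<le> ?N" "0 \<le> ?h y" using hpos by simp_all
      then have "ennreal ?N * ennreal (?h y) = ennreal (?N * ?h y)" by (rule ennreal_mult[symmetric])
      with True ennreal_leI[OF pt[OF True]] show ?thesis by simp
    qed simp
  qed
  also have "\<dots> = ennreal ?N * (\<integral>\<^sup>+y. ennreal (?h y) * indicator {0..1} y \<partial>lborel)"
    by (rule nn_integral_cmult) measurable
  also have "(\<integral>\<^sup>+y. ennreal (?h y) * indicator {0..1} y \<partial>lborel) \<le> ennreal (8 * (1 + norm \<zeta>))"
  proof (cases "\<bar>b\<bar> \<ge> 1 + \<bar>?c\<bar> / 2")
    case True
    from quadratic_arctan_bound[OF True, of c0]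
    have "(\<integral>\<^sup>+y. ennreal (?h y) * indicator {0..1} y \<partial>lborel) \<le> ennreal (2 * pi)" .
    also have "\<dots> \<le> ennreal (8 * (1 + norm \<zeta>))"
    proof (rule ennreal_leI)
      have "2 * pi \<le> 8 * 1" using pi_less_4 by simp
      also have "8 * 1 \<le> 8 * (1 + norm \<zeta>)" by (intro mult_left_mono) auto
      finally show "2 * pi \<le> 8 * (1 + norm \<zeta>)" .
    qed
    finally show ?thesis .
  next
    case False
    \<comment> \<open>Since b differs from the component c by at most |\<zeta>|, the failure of the
      largeness condition forces |c| \<le> 2 + 2 |\<zeta>|.\<close>
    have "b = ?c + \<zeta> \<bullet> i" by (simp add: b_def inner_add_left)
    moreover have "\<bar>\<zeta> \<bullet> i\<bar> \<le> norm \<zeta>" by (rule Basis_le_norm[OF i])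
    ultimately have cb: "\<bar>?c\<bar> \<le> 2 + 2 * norm \<zeta>" using False by linarith
    have "(\<integral>\<^sup>+y. ennreal (?h y) * indicator {0..1} y \<partial>lborel) \<le> (\<integral>\<^sup>+y. ennreal (8 * (1 + norm \<zeta>)) * indicator {0..1::real} y \<partial>lborel)"
    proof (intro nn_integral_mono mult_right_mono ennreal_leI)
      fix y :: real
      have "inverse (1 + (y\<^sup>2 + 2 * b * y + c0)\<^sup>2) \<le> 1" using le_imp_inverse_le[of 1 "1 + (y\<^sup>2 + 2 * b * y + c0)\<^sup>2"] by simp
      then have "?h y \<le> \<bar>?c\<bar> * (2 * 1)" by (intro mult_left_mono) auto
      also have "\<dots> \<le> (2 + 2 * norm \<zeta>) * (2 * 1)" using cb by (rule mult_right_mono) simp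
      also have "\<dots> \<le> 8 * (1 + norm \<zeta>)" by (simp add: algebra_simps)
      finally show "?h y \<le> 8 * (1 + norm \<zeta>)" .
    qed simp
    also have "\<dots> = ennreal (8 * (1 + norm \<zeta>))" by (simp add: nn_integral_cmult)
    finally show ?thesis .
  qed
  also have "ennreal ?N * ennreal (8 * (1 + norm \<zeta>)) = ennreal (?N * (8 * (1 + norm \<zeta>)))"
    by (rule ennreal_mult[symmetric]) auto
  also have "?N * (8 * (1 + norm \<zeta>)) = (real CARD('n) * exp (1/2) * 8) * ((1 + norm \<zeta>) * exp (- ((norm \<zeta>)\<^sup>2 / 4)))"
    by (simp only: mult_ac)
  also have "ennreal \<dots> = ennreal (real CARD('n) * exp (1/2) * 8) * ennreal ((1 + norm \<zeta>) * exp (- ((norm \<zeta>)\<^sup>2 / 4)))"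
    by (rule ennreal_mult) auto
  finally show ?thesis by (simp add: mult_left_mono)
qed

text \<open>With \<eta> = \<xi> + \<zeta> the square root is at most |\<xi>| + |\<zeta>|. The second
  summand is absorbed by the Gaussian at once, the first is treated by averaging in a direction
  where \<xi> is large.\<close>

lemma schur_gauss:
  "\<exists>C\<ge>0. \<forall>\<xi>::real^'n. (\<integral>\<^sup>+\<eta>. ennreal (sqrt (norm \<xi> * norm \<eta>) * (exp (- ((norm (\<xi> - \<eta>))\<^sup>2 / 2)) * (2 * inverse (1 + ((norm \<xi>)\<^sup>2 - (norm \<eta>)\<^sup>2)\<^sup>2)))) \<partial>lborel) \<le> ennreal C"
proof -
  define D where "D = ennreal (real CARD('n) * exp (1/2) * 8) * gauss_mass TYPE('n) + ennreal 2 * gauss_mass TYPE('n)"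
  have D: "D < \<infinity>" unfolding D_def using gauss_mass_finite[where 'n='n] by (simp add: ennreal_mult_less_top)
  have "(\<integral>\<^sup>+\<eta>. ennreal (sqrt (norm \<xi> * norm \<eta>) * (exp (- ((norm (\<xi> - \<eta>))\<^sup>2 / 2)) * (2 * inverse (1 + ((norm \<xi>)\<^sup>2 - (norm \<eta>)\<^sup>2)\<^sup>2)))) \<partial>lborel) \<le> D" for \<xi> :: "real^'n"
  proof -
    let ?f = "\<lambda>\<eta>. ennreal (sqrt (norm \<xi> * norm \<eta>) * (exp (- ((norm (\<xi> - \<eta>))\<^sup>2 / 2)) * (2 * inverse (1 + ((norm \<xi>)\<^sup>2 - (norm \<eta>)\<^sup>2)\<^sup>2))))"
    let ?F = "\<lambda>\<zeta>. ennreal (norm \<xi> * (exp (- ((norm \<zeta>)\<^sup>2 / 2)) * (2 * inverse (1 + ((norm \<xi>)\<^sup>2 - (norm (\<xi> + \<zeta>))\<^sup>2)\<^sup>2))))"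
    let ?H = "\<lambda>\<zeta>::real^'n. ennreal ((1 + norm \<zeta>) * exp (- ((norm \<zeta>)\<^sup>2 / 4)))"
    have pos: "1 + x\<^sup>2 > 0" for x :: real by (simp add: add_pos_nonneg)
    have pt: "?f (\<zeta> - - \<xi>) \<le> ?F \<zeta> + ennreal 2 * ?H \<zeta>" for \<zeta>
    proof -
      let ?k = "2 * inverse (1 + ((norm \<xi>)\<^sup>2 - (norm (\<xi> + \<zeta>))\<^sup>2)\<^sup>2)" and ?e = "exp (- ((norm \<zeta>)\<^sup>2 / 2))"
      have k0: "0 \<le> ?k" using pos by (simp add: less_imp_le)
      have k2: "?k \<le> 2" using le_imp_inverse_le[of 1 "1 + ((norm \<xi>)\<^sup>2 - (norm (\<xi> + \<zeta>))\<^sup>2)\<^sup>2"] by simp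
      have "norm \<xi> * norm (\<xi> + \<zeta>) \<le> (norm \<xi> + norm \<zeta>) * (norm \<xi> + norm \<zeta>)"
        by (intro mult_mono norm_triangle_ineq) auto
      then have "sqrt (norm \<xi> * norm (\<xi> + \<zeta>)) \<le> sqrt ((norm \<xi> + norm \<zeta>)\<^sup>2)" by (intro real_sqrt_le_mono) (simp add: power2_eq_square)
      then have s: "sqrt (norm \<xi> * norm (\<xi> + \<zeta>)) \<le> norm \<xi> + norm \<zeta>" by simp
      have "sqrt (norm \<xi> * norm (\<xi> + \<zeta>)) * (?e * ?k) \<le> (norm \<xi> + norm \<zeta>) * (?e * ?k)"
        using k0 by (intro mult_right_mono s) auto
      also have "\<dots> = norm \<xi> * (?e * ?k) + (norm \<zeta> * ?e) * ?k" by (simp add: algebra_simps)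
      also have "(norm \<zeta> * ?e) * ?k \<le> ((1 + norm \<zeta>) * exp (- ((norm \<zeta>)\<^sup>2 / 4))) * 2"
        using k0 k2 by (intro mult_mono) auto
      finally have "sqrt (norm \<xi> * norm (\<xi> + \<zeta>)) * (?e * ?k) \<le> norm \<xi> * (?e * ?k) + 2 * ((1 + norm \<zeta>) * exp (- ((norm \<zeta>)\<^sup>2 / 4)))"
        by simp
      from ennreal_leI[OF this] have "ennreal (sqrt (norm \<xi> * norm (\<xi> + \<zeta>)) * (?e * ?k)) \<le> ?F \<zeta> + ennreal (2 * ((1 + norm \<zeta>) * exp (- ((norm \<zeta>)\<^sup>2 / 4))))"
        by (subst (asm) ennreal_plus) (use k0 in auto)
      also have "ennreal (2 * ((1 + norm \<zeta>) * exp (- ((norm \<zeta>)\<^sup>2 / 4)))) = ennreal 2 * ?H \<zeta>" by (rule ennreal_mult) auto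
      finally show ?thesis by (simp add: add.commute[of \<zeta>] norm_minus_commute)
    qed
    obtain i where i: "i \<in> Basis" "norm \<xi> \<le> real CARD('n) * \<bar>\<xi> \<bullet> i\<bar>"
      using exists_large_coordinate[of \<xi>] by auto
    have "(\<integral>\<^sup>+\<eta>. ?f \<eta> \<partial>lborel) = (\<integral>\<^sup>+\<zeta>. ?f (\<zeta> - - \<xi>) \<partial>lborel)"
      by (rule nn_integral_translate[symmetric]) measurable
    also have "\<dots> \<le> (\<integral>\<^sup>+\<zeta>. ?F \<zeta> + ennreal 2 * ?H \<zeta> \<partial>lborel)" by (rule nn_integral_mono) (rule pt)
    also have "\<dots> = (\<integral>\<^sup>+\<zeta>. ?F \<zeta> \<partial>lborel) + (\<integral>\<^sup>+\<zeta>. ennreal 2 * ?H \<zeta> \<partial>lborel)" by (rule nn_integral_add) measurable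
    also have "(\<integral>\<^sup>+\<zeta>. ennreal 2 * ?H \<zeta> \<partial>lborel) = ennreal 2 * gauss_mass TYPE('n)"
      unfolding gauss_mass_def by (rule nn_integral_cmult) measurable
    also have "(\<integral>\<^sup>+\<zeta>. ?F \<zeta> \<partial>lborel) = (\<integral>\<^sup>+\<zeta>. (\<integral>\<^sup>+y. ?F (\<zeta> + y *\<^sub>R i) * indicator {0..1::real} y \<partial>lborel) \<partial>lborel)"
      by (rule nn_integral_average) measurable
    also have "\<dots> \<le> (\<integral>\<^sup>+\<zeta>. ennreal (real CARD('n) * exp (1/2) * 8) * ?H \<zeta> \<partial>lborel)"
      by (rule nn_integral_mono) (rule schur_gauss_inner[OF i])
    also have "\<dots> = ennreal (real CARD('n) * exp (1/2) * 8) * gauss_mass TYPE('n)"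
      unfolding gauss_mass_def by (rule nn_integral_cmult) measurable
    finally show ?thesis unfolding D_def by (simp add: add_right_mono)
  qed
  moreover have "D = ennreal (enn2real D)" using D by simp
  ultimately show ?thesis by (intro exI[of _ "enn2real D"]) auto
qed

section \<open>The quadratic form behind the smoothing estimate\<close>

lemma
  shows integrable_gauss_real: "integrable lborel (\<lambda>r::real. exp (- (r\<^sup>2 / 2)))"
    and gauss_FT_real: "(LINT r|lborel. complex_of_real (exp (- (r\<^sup>2 / 2))) * cis (l * r)) = of_real (sqrt (2 * pi) * exp (- (l\<^sup>2 / 2)))"
proof -
  have d: "exp (- (r\<^sup>2 / 2)) = sqrt (2 * pi) * std_normal_density r" for r
    by (simp add: std_normal_density_def)
  show "integrable lborel (\<lambda>r::real. exp (- (r\<^sup>2 / 2)))"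
    unfolding d using integrable_normal_density[of 1 0] by simp
  have "char std_normal_distribution l = (LINT r|lborel. std_normal_density r *\<^sub>R iexp (l * r))"
    unfolding char_def by (subst integral_density) auto
  then have c: "(LINT r|lborel. std_normal_density r *\<^sub>R iexp (l * r)) = of_real (exp (- (l\<^sup>2) / 2))"
    by (simp add: char_std_normal_distribution)
  have "(LINT r|lborel. complex_of_real (exp (- (r\<^sup>2 / 2))) * cis (l * r)) = (LINT r|lborel. of_real (sqrt (2 * pi)) * (std_normal_density r *\<^sub>R iexp (l * r)))"
    by (intro Bochner_Integration.integral_cong refl) (simp only: d cis_conv_exp scaleR_conv_of_real of_real_mult mult.assoc)
  also have "\<dots> = of_real (sqrt (2 * pi)) * of_real (exp (- (l\<^sup>2) / 2))"
    unfolding c[symmetric] by (rule integral_mult_right_zero)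
  finally show "(LINT r|lborel. complex_of_real (exp (- (r\<^sup>2 / 2))) * cis (l * r)) = of_real (sqrt (2 * pi) * exp (- (l\<^sup>2 / 2)))"
    by simp
qed

lemma
  fixes f :: "'a::euclidean_space \<Rightarrow> complex" and g :: "'b::euclidean_space \<Rightarrow> complex"
  assumes "integrable lborel f" "integrable lborel g"
  shows integrable_lborel_pair: "integrable lborel (\<lambda>p. f (fst p) * g (snd p))"
    and integral_lborel_pair: "(LINT p|lborel. f (fst p) * g (snd p)) = (LINT x|lborel. f x) * (LINT y|lborel. g y)"
proof -
  have i: "integrable (lborel \<Otimes>\<^sub>M lborel) (\<lambda>p. f (fst p) * g (snd p))"
    using integrable_mult_pair[OF assms, of "\<lambda>_. 1" 1] by simp
  then show "integrable lborel (\<lambda>p. f (fst p) * g (snd p))" unfolding lborel_prod .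
  have "(LINT p|(lborel \<Otimes>\<^sub>M lborel). f (fst p) * g (snd p)) = (LINT x|lborel. LINT y|lborel. f x * g y)"
    using lborel_pair.integral_fst'[OF i] by simp
  then show "(LINT p|lborel. f (fst p) * g (snd p)) = (LINT x|lborel. f x) * (LINT y|lborel. g y)"
    unfolding lborel_prod by simp
qed

text \<open>The squared modulus is a double integral over \<xi> and \<eta>. After exchanging the
  order, the r integral is the transform of a Gaussian at the difference of squared frequencies and
  the x integral is the transform of \<rho> at \<xi> - \<eta>.\<close>

lemma smoothing_core:
  fixes a :: "real^'n \<Rightarrow> complex" and \<rho> \<kappa> :: "real^'n \<Rightarrow> real"
  assumes a: "integrable lborel a" and \<rho>: "integrable lborel \<rho>" "\<And>x. \<rho> x \<ge> 0"
    and [measurable]: "\<kappa> \<in> borel_measurable borel"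
    and \<kappa>: "\<And>\<zeta>. cmod (LINT x|lborel. of_real (\<rho> x) * cis (x \<bullet> \<zeta>)) \<le> \<kappa> \<zeta>"
  shows "(\<integral>\<^sup>+q. ennreal (exp (- ((fst q)\<^sup>2 / 2)) * \<rho> (snd q) * (cmod (LINT \<xi>|lborel. a \<xi> * cis (snd q \<bullet> \<xi> - fst q * (norm \<xi>)\<^sup>2)))\<^sup>2) \<partial>lborel)
    \<le> (\<integral>\<^sup>+\<xi>. (\<integral>\<^sup>+\<eta>. ennreal (cmod (a \<xi>) * cmod (a \<eta>) * (sqrt (2 * pi) * exp (- (((norm \<xi>)\<^sup>2 - (norm \<eta>)\<^sup>2)\<^sup>2 / 2)) * \<kappa> (\<xi> - \<eta>))) \<partial>lborel) \<partial>lborel)"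
proof -
  have am [measurable]: "a \<in> borel_measurable borel" using borel_measurable_integrable[OF a] by simp
  have \<rho>m [measurable]: "\<rho> \<in> borel_measurable borel" using borel_measurable_integrable[OF \<rho>(1)] by simp
  define f where "f q = complex_of_real (exp (- ((fst q)\<^sup>2 / 2))) * complex_of_real (\<rho> (snd q))" for q :: "real \<times> (real^'n)"
  define g where "g p = a (fst p) * cnj (a (snd p))" for p :: "(real^'n) \<times> (real^'n)"
  define h where "h z = cis (snd (fst z) \<bullet> (fst (snd z) - snd (snd z)) - fst (fst z) * ((norm (fst (snd z)))\<^sup>2 - (norm (snd (snd z)))\<^sup>2))"
    for z :: "(real \<times> (real^'n)) \<times> ((real^'n) \<times> (real^'n))"
  define k where "k q = (LINT \<xi>|lborel. a \<xi> * cis (snd q \<bullet> \<xi> - fst q * (norm \<xi>)\<^sup>2))" for q :: "real \<times> (real^'n)"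
  have gi: "integrable lborel (\<lambda>r. complex_of_real (exp (- (r\<^sup>2 / 2))))"
    by (rule integrable_of_real[OF integrable_gauss_real])
  have \<rho>i: "integrable lborel (\<lambda>x. complex_of_real (\<rho> x))" by (rule integrable_of_real[OF \<rho>(1)])
  have fi: "integrable lborel f" unfolding f_def[abs_def] by (rule integrable_lborel_pair[OF gi \<rho>i])
  have cai: "integrable lborel (\<lambda>\<eta>. cnj (a \<eta>))" using a by simp
  have gint: "integrable lborel g" unfolding g_def[abs_def] by (rule integrable_lborel_pair[OF a cai])
  have hm: "h \<in> borel_measurable (lborel \<Otimes>\<^sub>M lborel)"
  proof -
    have "h \<in> borel_measurable borel" unfolding h_def[abs_def]
      by (intro borel_measurable_continuous_onI) (auto simp: cis_conv_exp intro!: continuous_intros)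
    then show ?thesis by (simp add: lborel_prod)
  qed
  \<comment> \<open>Absolute convergence of the fourfold integral: the Gaussian and \<rho> are
    integrable, \<open>a\<close> is integrable, and \<open>h\<close> is unimodular.\<close>
  have int: "integrable (lborel \<Otimes>\<^sub>M lborel) (\<lambda>(q, p). f q * g p * h (q, p))"
    using integrable_mult_pair[OF fi gint hm, of 1] by (simp add: split_def h_def)
  have inner_p: "(LINT p|lborel. f q * g p * h (q, p)) = of_real (exp (- ((fst q)\<^sup>2 / 2)) * \<rho> (snd q) * (cmod (k q))\<^sup>2)" for q
  proof -
    let ?u = "\<lambda>\<xi>. a \<xi> * cis (snd q \<bullet> \<xi> - fst q * (norm \<xi>)\<^sup>2)"
    have ui: "integrable lborel ?u" by (rule integrable_mult_cis[OF a]) measurable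
    have cui: "integrable lborel (\<lambda>\<eta>. cnj (?u \<eta>))" by (rule integrable_bounded_linear[OF bounded_linear_cnj ui])
    have gh: "g p * h (q, p) = ?u (fst p) * cnj (?u (snd p))" for p
    proof -
      have "h (q, p) = cis (snd q \<bullet> fst p - fst q * (norm (fst p))\<^sup>2) * cnj (cis (snd q \<bullet> snd p - fst q * (norm (snd p))\<^sup>2))"
        unfolding h_def cis_cnj cis_mult by (simp add: inner_diff_right algebra_simps)
      then show ?thesis by (simp add: g_def mult_ac)
    qed
    have "(LINT p|lborel. f q * g p * h (q, p)) = (LINT p|lborel. f q * (?u (fst p) * cnj (?u (snd p))))"
      by (simp only: mult.assoc gh)
    also have "\<dots> = f q * (LINT p|lborel. ?u (fst p) * cnj (?u (snd p)))" by (rule integral_mult_right_zero)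
    also have "(LINT p|lborel. ?u (fst p) * cnj (?u (snd p))) = k q * (LINT \<eta>|lborel. cnj (?u \<eta>))"
      unfolding integral_lborel_pair[OF ui cui] k_def ..
    also have "(LINT \<eta>|lborel. cnj (?u \<eta>)) = cnj (k q)" unfolding k_def by (rule Bochner_Integration.integral_cnj)
    also have "f q * (k q * cnj (k q)) = of_real (exp (- ((fst q)\<^sup>2 / 2)) * \<rho> (snd q) * (cmod (k q))\<^sup>2)"
      unfolding f_def by (simp add: complex_norm_square[symmetric])
    finally show ?thesis .
  qed
  have inner_q: "(LINT q|lborel. f q * g p * h (q, p)) = g p * (of_real (sqrt (2 * pi) * exp (- (((norm (fst p))\<^sup>2 - (norm (snd p))\<^sup>2)\<^sup>2 / 2))) * (LINT x|lborel. of_real (\<rho> x) * cis (x \<bullet> (fst p - snd p))))" for p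
  proof -
    let ?l = "- ((norm (fst p))\<^sup>2 - (norm (snd p))\<^sup>2)"
    let ?u = "\<lambda>r. complex_of_real (exp (- (r\<^sup>2 / 2))) * cis (?l * r)" and ?v = "\<lambda>x. of_real (\<rho> x) * cis (x \<bullet> (fst p - snd p))"
    have ui: "integrable lborel ?u" by (rule integrable_mult_cis[OF gi]) measurable
    have vi: "integrable lborel ?v" by (rule integrable_mult_cis[OF \<rho>i]) measurable
    have fh: "f q * g p * h (q, p) = g p * (?u (fst q) * ?v (snd q))" for q
    proof -
      have "h (q, p) = cis (?l * fst q) * cis (snd q \<bullet> (fst p - snd p))"
        unfolding h_def cis_mult by (simp add: algebra_simps)
      then show ?thesis by (simp add: f_def mult_ac)
    qed
    have "(LINT q|lborel. f q * g p * h (q, p)) = g p * (LINT q|lborel. ?u (fst q) * ?v (snd q))"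
      unfolding fh by (rule integral_mult_right_zero)
    also have "(LINT q|lborel. ?u (fst q) * ?v (snd q)) = (LINT r|lborel. ?u r) * (LINT x|lborel. ?v x)"
      by (rule integral_lborel_pair[OF ui vi])
    also have "(LINT r|lborel. ?u r) = of_real (sqrt (2 * pi) * exp (- (?l\<^sup>2 / 2)))" by (rule gauss_FT_real)
    finally show ?thesis by (simp only: power2_minus)
  qed
  define I where "I = (LINT q|lborel. exp (- ((fst q)\<^sup>2 / 2)) * \<rho> (snd q) * (cmod (k q))\<^sup>2)"
  have Iint: "integrable lborel (\<lambda>q. exp (- ((fst q)\<^sup>2 / 2)) * \<rho> (snd q) * (cmod (k q))\<^sup>2)"
  proof -
    have "integrable lborel (\<lambda>q. (LINT p|lborel. f q * g p * h (q, p)))" by (rule lborel_pair.integrable_fst[OF int])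
    then have "integrable lborel (\<lambda>q. complex_of_real (exp (- ((fst q)\<^sup>2 / 2)) * \<rho> (snd q) * (cmod (k q))\<^sup>2))" unfolding inner_p .
    from integrable_Re[OF this] show ?thesis by (simp only: Re_complex_of_real)
  qed
  \<comment> \<open>The left-hand side is real and nonnegative, so it may be replaced by its
    modulus, and the triangle inequality is applied only after the oscillating integrals in r and x
    have been evaluated.\<close>
  have "complex_of_real I = (LINT q|lborel. (LINT p|lborel. f q * g p * h (q, p)))"
    unfolding inner_p I_def by (rule integral_complex_of_real[symmetric])
  also have "\<dots> = (LINT p|lborel. (LINT q|lborel. f q * g p * h (q, p)))"
    by (rule lborel_pair.Fubini_integral[OF int, symmetric])
  finally have "ennreal (cmod (complex_of_real I)) \<le> (\<integral>\<^sup>+p. ennreal (cmod (LINT q|lborel. f q * g p * h (q, p))) \<partial>lborel)"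
    by (simp only: ennreal_norm_integral_le)
  also have "\<dots> \<le> (\<integral>\<^sup>+p. (case p of (\<xi>, \<eta>) \<Rightarrow> ennreal (cmod (a \<xi>) * cmod (a \<eta>) * (sqrt (2 * pi) * exp (- (((norm \<xi>)\<^sup>2 - (norm \<eta>)\<^sup>2)\<^sup>2 / 2)) * \<kappa> (\<xi> - \<eta>)))) \<partial>lborel)"
  proof (rule nn_integral_mono)
    fix p :: "(real^'n) \<times> (real^'n)"
    obtain \<xi> \<eta> where p: "p = (\<xi>, \<eta>)" by (cases p)
    have "cmod (LINT q|lborel. f q * g p * h (q, p)) = cmod (a \<xi>) * cmod (a \<eta>) * (sqrt (2 * pi) * exp (- (((norm \<xi>)\<^sup>2 - (norm \<eta>)\<^sup>2)\<^sup>2 / 2)) * cmod (LINT x|lborel. of_real (\<rho> x) * cis (x \<bullet> (\<xi> - \<eta>))))"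
      by (simp only: inner_q) (simp add: p g_def norm_mult)
    also have "\<dots> \<le> cmod (a \<xi>) * cmod (a \<eta>) * (sqrt (2 * pi) * exp (- (((norm \<xi>)\<^sup>2 - (norm \<eta>)\<^sup>2)\<^sup>2 / 2)) * \<kappa> (\<xi> - \<eta>))"
      by (intro mult_left_mono \<kappa>) auto
    finally show "ennreal (cmod (LINT q|lborel. f q * g p * h (q, p))) \<le> (case p of (\<xi>, \<eta>) \<Rightarrow> ennreal (cmod (a \<xi>) * cmod (a \<eta>) * (sqrt (2 * pi) * exp (- (((norm \<xi>)\<^sup>2 - (norm \<eta>)\<^sup>2)\<^sup>2 / 2)) * \<kappa> (\<xi> - \<eta>))))"
      unfolding p by (simp add: ennreal_leI)
  qed
  also have "\<dots> = (\<integral>\<^sup>+\<xi>. (\<integral>\<^sup>+\<eta>. ennreal (cmod (a \<xi>) * cmod (a \<eta>) * (sqrt (2 * pi) * exp (- (((norm \<xi>)\<^sup>2 - (norm \<eta>)\<^sup>2)\<^sup>2 / 2)) * \<kappa> (\<xi> - \<eta>))) \<partial>lborel) \<partial>lborel)"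
    unfolding lborel_prod[symmetric] by (subst lborel.nn_integral_fst[symmetric]) auto
  also have "ennreal (cmod (complex_of_real I)) = (\<integral>\<^sup>+q. ennreal (exp (- ((fst q)\<^sup>2 / 2)) * \<rho> (snd q) * (cmod (k q))\<^sup>2) \<partial>lborel)"
  proof -
    have nn: "0 \<le> exp (- ((fst q)\<^sup>2 / 2)) * \<rho> (snd q) * (cmod (k q))\<^sup>2" for q using \<rho>(2) by simp
    have "I \<ge> 0" unfolding I_def by (rule integral_nonneg_AE) (use nn in simp)
    then have "cmod (complex_of_real I) = I" by simp
    then show ?thesis unfolding I_def using nn_integral_eq_integral[OF Iint] nn by simp
  qed
  finally show ?thesis unfolding k_def .
qed

text \<open>The product of two values of \<open>A\<close> is bounded by the sum of their squares;
  symmetry of the kernel makes the two resulting integrals equal, whence the factor 2.\<close>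

lemma schur_test:
  fixes A :: "'a::euclidean_space \<Rightarrow> real" and k :: "'a \<Rightarrow> 'a \<Rightarrow> real"
  assumes [measurable]: "A \<in> borel_measurable borel" "case_prod k \<in> borel_measurable (borel \<Otimes>\<^sub>M borel)"
    and nn: "\<And>\<xi>. A \<xi> \<ge> 0" "\<And>\<xi> \<eta>. k \<xi> \<eta> \<ge> 0" and sym: "\<And>\<xi> \<eta>. k \<xi> \<eta> = k \<eta> \<xi>"
    and C: "\<And>\<xi>. (\<integral>\<^sup>+\<eta>. ennreal (k \<xi> \<eta>) \<partial>lborel) \<le> ennreal C"
  shows "(\<integral>\<^sup>+\<xi>. (\<integral>\<^sup>+\<eta>. ennreal (A \<xi> * A \<eta> * k \<xi> \<eta>) \<partial>lborel) \<partial>lborel) \<le> 2 * (ennreal C * (\<integral>\<^sup>+\<xi>. ennreal ((A \<xi>)\<^sup>2) \<partial>lborel))"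
proof -
  let ?f = "\<lambda>\<xi> \<eta>. ennreal ((A \<xi>)\<^sup>2) * ennreal (k \<xi> \<eta>)"
  have fm [measurable]: "case_prod ?f \<in> borel_measurable (lborel \<Otimes>\<^sub>M lborel)" by measurable
  have "(\<integral>\<^sup>+\<xi>. (\<integral>\<^sup>+\<eta>. ennreal (A \<xi> * A \<eta> * k \<xi> \<eta>) \<partial>lborel) \<partial>lborel) \<le> (\<integral>\<^sup>+\<xi>. (\<integral>\<^sup>+\<eta>. ?f \<xi> \<eta> + ?f \<eta> \<xi> \<partial>lborel) \<partial>lborel)"
  proof (intro nn_integral_mono)
    fix \<xi> \<eta>
    have "2 * (A \<xi> * A \<eta>) \<le> (A \<xi>)\<^sup>2 + (A \<eta>)\<^sup>2" using zero_le_power2[of "A \<xi> - A \<eta>"] by (simp add: power2_eq_square algebra_simps)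
    moreover have "0 \<le> A \<xi> * A \<eta>" using nn by simp
    ultimately have "A \<xi> * A \<eta> \<le> (A \<xi>)\<^sup>2 + (A \<eta>)\<^sup>2" by linarith
    then have "A \<xi> * A \<eta> * k \<xi> \<eta> \<le> ((A \<xi>)\<^sup>2 + (A \<eta>)\<^sup>2) * k \<xi> \<eta>" by (rule mult_right_mono) (rule nn)
    also have "\<dots> = (A \<xi>)\<^sup>2 * k \<xi> \<eta> + (A \<eta>)\<^sup>2 * k \<eta> \<xi>" by (simp add: distrib_right sym[of \<eta> \<xi>])
    finally have "ennreal (A \<xi> * A \<eta> * k \<xi> \<eta>) \<le> ennreal ((A \<xi>)\<^sup>2 * k \<xi> \<eta> + (A \<eta>)\<^sup>2 * k \<eta> \<xi>)" by (rule ennreal_leI)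
    also have "\<dots> = ennreal ((A \<xi>)\<^sup>2 * k \<xi> \<eta>) + ennreal ((A \<eta>)\<^sup>2 * k \<eta> \<xi>)" using nn by (intro ennreal_plus) auto
    also have "\<dots> = ?f \<xi> \<eta> + ?f \<eta> \<xi>" using nn by (simp add: ennreal_mult)
    finally show "ennreal (A \<xi> * A \<eta> * k \<xi> \<eta>) \<le> ?f \<xi> \<eta> + ?f \<eta> \<xi>" .
  qed
  also have "\<dots> = (\<integral>\<^sup>+\<xi>. (\<integral>\<^sup>+\<eta>. ?f \<xi> \<eta> \<partial>lborel) + (\<integral>\<^sup>+\<eta>. ?f \<eta> \<xi> \<partial>lborel) \<partial>lborel)"
    by (intro nn_integral_cong nn_integral_add) measurable
  also have "\<dots> = (\<integral>\<^sup>+\<xi>. (\<integral>\<^sup>+\<eta>. ?f \<xi> \<eta> \<partial>lborel) \<partial>lborel) + (\<integral>\<^sup>+\<xi>. (\<integral>\<^sup>+\<eta>. ?f \<eta> \<xi> \<partial>lborel) \<partial>lborel)"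
    by (rule nn_integral_add) measurable
  also have "(\<integral>\<^sup>+\<xi>. (\<integral>\<^sup>+\<eta>. ?f \<eta> \<xi> \<partial>lborel) \<partial>lborel) = (\<integral>\<^sup>+\<xi>. (\<integral>\<^sup>+\<eta>. ?f \<xi> \<eta> \<partial>lborel) \<partial>lborel)"
    by (rule lborel_pair.Fubini'[OF fm])
  also have "(\<integral>\<^sup>+\<xi>. (\<integral>\<^sup>+\<eta>. ?f \<xi> \<eta> \<partial>lborel) \<partial>lborel) \<le> (\<integral>\<^sup>+\<xi>. ennreal C * ennreal ((A \<xi>)\<^sup>2) \<partial>lborel)"
  proof (rule nn_integral_mono)
    fix \<xi>
    have "(\<integral>\<^sup>+\<eta>. ?f \<xi> \<eta> \<partial>lborel) = ennreal ((A \<xi>)\<^sup>2) * (\<integral>\<^sup>+\<eta>. ennreal (k \<xi> \<eta>) \<partial>lborel)" by (rule nn_integral_cmult) measurable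
    also have "\<dots> \<le> ennreal ((A \<xi>)\<^sup>2) * ennreal C" by (intro mult_left_mono C) simp
    finally show "(\<integral>\<^sup>+\<eta>. ?f \<xi> \<eta> \<partial>lborel) \<le> ennreal C * ennreal ((A \<xi>)\<^sup>2)" by (simp add: mult.commute)
  qed
  also have "\<dots> = ennreal C * (\<integral>\<^sup>+\<xi>. ennreal ((A \<xi>)\<^sup>2) \<partial>lborel)" by (rule nn_integral_cmult) measurable
  finally show ?thesis by (simp add: mult_2 add_mono)
qed

section \<open>Truncated derivatives and admissible weights\<close>

context sobolev_space
begin

text \<open>The symbol of the derivative of order s + 1/2 acting on encodings, that is, with the
  Sobolev weight divided out. It grows like the square root of |\<xi>|: the half derivative to be
  gained.\<close>

definition dsym :: "real^'n \<Rightarrow> real" where "dsym \<xi> = norm \<xi> powr (s + 1/2) * wt (- s) \<xi>"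

lemma dsym_nonneg: "dsym \<xi> \<ge> 0" by (simp add: dsym_def)

lemma dsym_measurable [measurable]: "dsym \<in> borel_measurable borel"
  unfolding dsym_def[abs_def] by measurable

lemma dsym_le: "dsym \<xi> \<le> sqrt (norm \<xi>)"
proof (cases "\<xi> = 0")
  case False
  have "norm \<xi> powr s = ((norm \<xi>)\<^sup>2) powr (s / 2)"
  proof -
    have "(norm \<xi>)\<^sup>2 = norm \<xi> powr 2" using False powr_numeral[of "norm \<xi>"] by simp
    then show ?thesis by (simp only: powr_powr) simp
  qed
  also have "\<dots> \<le> wt s \<xi>" unfolding wt_def using s_pos by (intro powr_mono2) auto
  finally have "norm \<xi> powr s * wt (- s) \<xi> \<le> wt s \<xi> * wt (- s) \<xi>" by (rule mult_right_mono) simp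
  then have 1: "norm \<xi> powr s * wt (- s) \<xi> \<le> 1" by simp
  have "dsym \<xi> = norm \<xi> powr (1/2) * (norm \<xi> powr s * wt (- s) \<xi>)"
    unfolding dsym_def powr_add by (simp only: mult_ac)
  also have "\<dots> \<le> norm \<xi> powr (1/2) * 1" by (intro mult_left_mono 1) simp
  also have "\<dots> = sqrt (norm \<xi>)" by (simp add: powr_half_sqrt)
  finally show ?thesis .
qed (simp add: dsym_def)

text \<open>Truncation makes the symbol bounded with bounded support, hence square-integrable, so
  that the derivative has a value at every point.\<close>

definition mm :: "real \<Rightarrow> real^'n \<Rightarrow> real" where "mm M \<xi> = indicator (cball 0 M) \<xi> * dsym \<xi>"

lemma mm_nonneg: "mm M \<xi> \<ge> 0" by (simp add: mm_def dsym_nonneg)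

lemma mm_measurable [measurable]: "mm M \<in> borel_measurable borel"
  unfolding mm_def[abs_def]
  by (intro borel_measurable_times borel_measurable_indicator borel_closed closed_cball dsym_measurable)

lemma mm_le: "mm M \<xi> \<le> sqrt (norm \<xi>)"
  unfolding mm_def using dsym_le[of \<xi>] by (simp add: indicator_def)

lemma mm_bounded: "mm M \<xi> \<le> sqrt \<bar>M\<bar>"
proof (cases "norm \<xi> \<le> M")
  case True
  then show ?thesis using mm_le[of M \<xi>] real_sqrt_le_mono[of "norm \<xi>" "\<bar>M\<bar>"] by linarith
qed (simp add: mm_def)

definition kf :: "real \<Rightarrow> real \<Rightarrow> real^'n \<Rightarrow> real^'n \<Rightarrow> complex" where
  "kf M r x \<xi> = cn * (of_real (mm M \<xi>) * cis (x \<bullet> \<xi> - r * (norm \<xi>)\<^sup>2))"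

lemma cmod_kf: "cmod (kf M r x \<xi>) = cmod cn * mm M \<xi>"
  by (simp add: kf_def norm_mult mm_nonneg)

lemma sqi_kf: "sqi (kf M r x)"
proof -
  have fin: "emeasure lborel (cball (0::real^'n) M) < \<infinity>" by (rule emeasure_bounded_finite[OF bounded_cball])
  have "sqi (\<lambda>\<xi>. kf M r x \<xi> * indicator (cball 0 M) \<xi>)"
  proof (rule sqi_mult_bounded[OF sqi_indicator[OF _ fin], where C="cmod cn * sqrt \<bar>M\<bar>"])
    show "kf M r x \<in> borel_measurable borel" unfolding kf_def[abs_def] by measurable
    show "cmod (kf M r x \<xi>) \<le> cmod cn * sqrt \<bar>M\<bar>" for \<xi>
      unfolding cmod_kf by (intro mult_left_mono mm_bounded) simp
  qed simp
  moreover have "kf M r x \<xi> * indicator (cball 0 M) \<xi> = kf M r x \<xi>" for \<xi>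
    by (simp add: kf_def mm_def indicator_def)
  ultimately show ?thesis by simp
qed

text \<open>\<open>Kop M r x U\<close> is the value at \<open>x\<close> of \<open>D\<^sub>x\<close> to the power \<open>s + 1/2\<close> applied to the free evolution at phase \<open>r\<close> of
  the \<open>H\<^sup>s\<close> function encoded by \<open>U\<close>, restricted to frequencies \<open>|\<xi>| \<le> M\<close>.\<close>

definition Kop :: "real \<Rightarrow> real \<Rightarrow> real^'n \<Rightarrow> (real^'n) lsq \<Rightarrow> complex" where
  "Kop M r x U = pair (kf M r x) U"

lemma bounded_linear_Kop: "bounded_linear (Kop M r x)"
  unfolding Kop_def[abs_def] by (rule bounded_linear_pair[OF sqi_kf])

lemma norm_kf: "norm (abs_lsq (kf M r x)) = norm (abs_lsq (kf M 0 0))"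
  by (rule power2_eq_imp_eq, unfold norm_abs_lsq_sq[OF sqi_kf] cmod_kf) (rule refl norm_ge_zero)+

lemma norm_Kop_le: "cmod (Kop M r x U) \<le> norm (abs_lsq (kf M 0 0)) * norm U"
  using norm_pair_le[OF sqi_kf, of M r x U] unfolding Kop_def norm_kf[of M r x] .

text \<open>The modulus of \<open>kf M r x\<close> does not depend on r and x. It therefore
  dominates the integrand for fixed \<open>U0\<close> and bounds the functional uniformly. Joint
  continuity is the source of all measurability below.\<close>

lemma tendsto_Kop:
  assumes r: "r \<longlonglongrightarrow> r0" and x: "x \<longlonglongrightarrow> x0" and U: "U \<longlonglongrightarrow> U0"
  shows "(\<lambda>n. Kop M (r n) (x n) (U n)) \<longlonglongrightarrow> Kop M r0 x0 U0"
proof -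
  have 1: "(\<lambda>n. Kop M (r n) (x n) U0) \<longlonglongrightarrow> Kop M r0 x0 U0"
    unfolding Kop_def pair_def
  proof (rule integral_dominated_convergence[where w="\<lambda>\<xi>. cmod (kf M 0 0 \<xi> * rep_lsq U0 \<xi>)"])
    show "integrable lborel (\<lambda>\<xi>. cmod (kf M 0 0 \<xi> * rep_lsq U0 \<xi>))"
      by (intro integrable_norm sqi_mult_integrable sqi_kf sqi_rep)
    show "AE \<xi> in lborel. (\<lambda>n. kf M (r n) (x n) \<xi> * rep_lsq U0 \<xi>) \<longlonglongrightarrow> kf M r0 x0 \<xi> * rep_lsq U0 \<xi>"
      unfolding kf_def cis_conv_exp
      by (intro AE_I2 tendsto_mult tendsto_const tendsto_exp tendsto_of_real tendsto_diff tendsto_inner r x)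
    show "AE \<xi> in lborel. norm (kf M (r n) (x n) \<xi> * rep_lsq U0 \<xi>) \<le> cmod (kf M 0 0 \<xi> * rep_lsq U0 \<xi>)" for n
      by (simp add: norm_mult cmod_kf)
  qed (rule borel_measurable_integrable, intro sqi_mult_integrable sqi_kf sqi_rep)+
  have 2: "(\<lambda>n. Kop M (r n) (x n) (U n - U0)) \<longlonglongrightarrow> 0"
  proof (rule Lim_null_comparison)
    show "\<forall>\<^sub>F n in sequentially. norm (Kop M (r n) (x n) (U n - U0)) \<le> norm (abs_lsq (kf M 0 0)) * norm (U n - U0)"
      by (intro always_eventually allI norm_Kop_le)
    have "(\<lambda>n. norm (U n - U0)) \<longlonglongrightarrow> 0" using U by (simp add: tendsto_norm_zero_iff LIM_zero_iff)
    then show "(\<lambda>n. norm (abs_lsq (kf M 0 0)) * norm (U n - U0)) \<longlonglongrightarrow> 0" by (rule tendsto_mult_right_zero)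
  qed
  have "Kop M (r n) (x n) (U n) = Kop M (r n) (x n) (U n - U0) + Kop M (r n) (x n) U0" for n
    by (simp add: linear_diff[OF bounded_linear.linear[OF bounded_linear_Kop]])
  then show ?thesis using tendsto_add[OF 2 1] by simp
qed

lemma continuous_on_Kop:
  fixes f :: "'c::metric_space \<Rightarrow> real"
  assumes "continuous_on S f" "continuous_on S g" "continuous_on S h"
  shows "continuous_on S (\<lambda>p. Kop M (f p) (g p) (h p))"
  using assms unfolding continuous_on_sequentially comp_def by (auto intro!: tendsto_Kop)

text \<open>The space-time weight \<open>\<rho>\<close> enters only through a majorant \<open>\<kappa>\<close> of its Fourier transform;
  \<open>smoothing_weight\<close> is the Schur condition for the resulting kernel.\<close>

definition smoothing_weight :: "(real^'n \<Rightarrow> real) \<Rightarrow> real \<Rightarrow> bool" where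
  "smoothing_weight \<rho> C \<longleftrightarrow> integrable lborel \<rho> \<and> (\<forall>x. \<rho> x \<ge> 0) \<and> C \<ge> 0 \<and>
     (\<exists>\<kappa>. \<kappa> \<in> borel_measurable borel \<and> (\<forall>\<zeta>. \<kappa> (- \<zeta>) = \<kappa> \<zeta>) \<and>
        (\<forall>\<zeta>. cmod (LINT x|lborel. of_real (\<rho> x) * cis (x \<bullet> \<zeta>)) \<le> \<kappa> \<zeta>) \<and>
        (\<forall>\<xi>. (\<integral>\<^sup>+\<eta>. ennreal (sqrt (norm \<xi> * norm \<eta>) * (\<kappa> (\<xi> - \<eta>) * (2 * inverse (1 + ((norm \<xi>)\<^sup>2 - (norm \<eta>)\<^sup>2)\<^sup>2)))) \<partial>lborel) \<le> ennreal C))"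

text \<open>The factors come from Schur's test (2), the two copies of the inversion constant, and
  the Gaussian integral in r.\<close>

definition smc :: real where "smc = 2 * ((cmod cn)\<^sup>2 * sqrt (2 * pi))"

lemma smc_nonneg: "smc \<ge> 0" by (simp add: smc_def)

text \<open>The truncation enters only through \<open>mm_le\<close>, which bounds the symbol by the
  square root of the frequency. Hence the constant does not depend on M, as the later limit
  requires.\<close>

lemma Kop_smoothing:
  assumes "smoothing_weight \<rho> C"
  shows "(\<integral>\<^sup>+q. ennreal (exp (- ((fst q)\<^sup>2 / 2)) * \<rho> (snd q) * (cmod (Kop M (fst q) (snd q) U))\<^sup>2) \<partial>lborel) \<le> ennreal (smc * C * (norm U)\<^sup>2)"
proof -
  have \<rho>: "integrable lborel \<rho>" "\<And>x. \<rho> x \<ge> 0" and C0: "C \<ge> 0" using assms by (auto simp: smoothing_weight_def)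
  obtain \<kappa> where \<kappa>m [measurable]: "\<kappa> \<in> borel_measurable borel" and \<kappa>e: "\<And>\<zeta>. \<kappa> (- \<zeta>) = \<kappa> \<zeta>"
    and \<kappa>: "\<And>\<zeta>. cmod (LINT x|lborel. of_real (\<rho> x) * cis (x \<bullet> \<zeta>)) \<le> \<kappa> \<zeta>"
    and C: "\<And>\<xi>. (\<integral>\<^sup>+\<eta>. ennreal (sqrt (norm \<xi> * norm \<eta>) * (\<kappa> (\<xi> - \<eta>) * (2 * inverse (1 + ((norm \<xi>)\<^sup>2 - (norm \<eta>)\<^sup>2)\<^sup>2)))) \<partial>lborel) \<le> ennreal C"
    using assms unfolding smoothing_weight_def by blast
  have \<rho>m [measurable]: "\<rho> \<in> borel_measurable borel" using borel_measurable_integrable[OF \<rho>(1)] by simp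
  have \<kappa>0: "\<kappa> \<zeta> \<ge> 0" for \<zeta> using order_trans[OF norm_ge_zero \<kappa>] .
  define a where "a \<xi> = of_real (mm M \<xi>) * rep_lsq U \<xi>" for \<xi>
  have ac: "cn * a \<xi> = kf M 0 0 \<xi> * rep_lsq U \<xi>" for \<xi> by (simp add: a_def kf_def)
  have cn0: "cn \<noteq> 0" by (simp add: cn_def)
  have ai: "integrable lborel a"
  proof -
    have "integrable lborel (\<lambda>\<xi>. cn * a \<xi>)" unfolding ac by (intro sqi_mult_integrable sqi_kf sqi_rep)
    then have "integrable lborel (\<lambda>\<xi>. inverse cn * (cn * a \<xi>))" by (rule integrable_mult_right)
    moreover have "inverse cn * (cn * a \<xi>) = a \<xi>" for \<xi> using cn0 by (simp flip: mult.assoc)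
    ultimately show ?thesis by simp
  qed
  have Kop_a: "Kop M r x U = cn * (LINT \<xi>|lborel. a \<xi> * cis (x \<bullet> \<xi> - r * (norm \<xi>)\<^sup>2))" for r x
    unfolding Kop_def pair_def kf_def a_def integral_mult_right_zero[symmetric] by (simp only: mult_ac)
  let ?k = "\<lambda>\<xi> \<eta>. sqrt (norm \<xi> * norm \<eta>) * (\<kappa> (\<xi> - \<eta>) * (2 * inverse (1 + ((norm \<xi>)\<^sup>2 - (norm \<eta>)\<^sup>2)\<^sup>2)))"
  let ?A = "\<lambda>\<xi>. cmod (rep_lsq U \<xi>)"
  have pos: "0 \<le> 2 * inverse (1 + x\<^sup>2)" for x :: real by (simp add: add_nonneg_nonneg)
  let ?L = "\<integral>\<^sup>+q. ennreal (exp (- ((fst q)\<^sup>2 / 2)) * \<rho> (snd q) * (cmod (LINT \<xi>|lborel. a \<xi> * cis (snd q \<bullet> \<xi> - fst q * (norm \<xi>)\<^sup>2)))\<^sup>2) \<partial>lborel"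
  have "?L \<le> (\<integral>\<^sup>+\<xi>. (\<integral>\<^sup>+\<eta>. ennreal (cmod (a \<xi>) * cmod (a \<eta>) * (sqrt (2 * pi) * exp (- (((norm \<xi>)\<^sup>2 - (norm \<eta>)\<^sup>2)\<^sup>2 / 2)) * \<kappa> (\<xi> - \<eta>))) \<partial>lborel) \<partial>lborel)"
    by (rule smoothing_core[OF ai \<rho> \<kappa>m \<kappa>])
  also have "\<dots> \<le> (\<integral>\<^sup>+\<xi>. (\<integral>\<^sup>+\<eta>. ennreal (sqrt (2 * pi)) * ennreal (?A \<xi> * ?A \<eta> * ?k \<xi> \<eta>) \<partial>lborel) \<partial>lborel)"
  proof (intro nn_integral_mono)
    fix \<xi> \<eta> :: "real^'n"
    have am: "cmod (a \<xi>) \<le> sqrt (norm \<xi>) * ?A \<xi>" for \<xi>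
      unfolding a_def norm_mult using mm_le[of M \<xi>] mm_nonneg[of M \<xi>] by (intro mult_right_mono) auto
    have "cmod (a \<xi>) * cmod (a \<eta>) * (sqrt (2 * pi) * exp (- (((norm \<xi>)\<^sup>2 - (norm \<eta>)\<^sup>2)\<^sup>2 / 2)) * \<kappa> (\<xi> - \<eta>))
       \<le> (sqrt (norm \<xi>) * ?A \<xi>) * (sqrt (norm \<eta>) * ?A \<eta>) * (sqrt (2 * pi) * (2 * inverse (1 + ((norm \<xi>)\<^sup>2 - (norm \<eta>)\<^sup>2)\<^sup>2)) * \<kappa> (\<xi> - \<eta>))"
      by (intro mult_mono am exp_sq_le_cauchy order_refl mult_nonneg_nonneg \<kappa>0 pos) auto
    also have "\<dots> = sqrt (2 * pi) * (?A \<xi> * ?A \<eta> * ?k \<xi> \<eta>)"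
      unfolding real_sqrt_mult by (simp only: mult_ac)
    finally have "ennreal (cmod (a \<xi>) * cmod (a \<eta>) * (sqrt (2 * pi) * exp (- (((norm \<xi>)\<^sup>2 - (norm \<eta>)\<^sup>2)\<^sup>2 / 2)) * \<kappa> (\<xi> - \<eta>))) \<le> ennreal (sqrt (2 * pi) * (?A \<xi> * ?A \<eta> * ?k \<xi> \<eta>))"
      by (rule ennreal_leI)
    also have "\<dots> = ennreal (sqrt (2 * pi)) * ennreal (?A \<xi> * ?A \<eta> * ?k \<xi> \<eta>)"
      by (rule ennreal_mult) (auto intro!: mult_nonneg_nonneg \<kappa>0 pos)
    finally show "ennreal (cmod (a \<xi>) * cmod (a \<eta>) * (sqrt (2 * pi) * exp (- (((norm \<xi>)\<^sup>2 - (norm \<eta>)\<^sup>2)\<^sup>2 / 2)) * \<kappa> (\<xi> - \<eta>))) \<le> ennreal (sqrt (2 * pi)) * ennreal (?A \<xi> * ?A \<eta> * ?k \<xi> \<eta>)" .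
  qed
  also have "\<dots> = (\<integral>\<^sup>+\<xi>. ennreal (sqrt (2 * pi)) * (\<integral>\<^sup>+\<eta>. ennreal (?A \<xi> * ?A \<eta> * ?k \<xi> \<eta>) \<partial>lborel) \<partial>lborel)"
    by (intro nn_integral_cong nn_integral_cmult) measurable
  also have "\<dots> = ennreal (sqrt (2 * pi)) * (\<integral>\<^sup>+\<xi>. (\<integral>\<^sup>+\<eta>. ennreal (?A \<xi> * ?A \<eta> * ?k \<xi> \<eta>) \<partial>lborel) \<partial>lborel)"
    by (rule nn_integral_cmult) measurable
  also have "(\<integral>\<^sup>+\<xi>. (\<integral>\<^sup>+\<eta>. ennreal (?A \<xi> * ?A \<eta> * ?k \<xi> \<eta>) \<partial>lborel) \<partial>lborel) \<le> 2 * (ennreal C * (\<integral>\<^sup>+\<xi>. ennreal ((?A \<xi>)\<^sup>2) \<partial>lborel))"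
  proof (rule schur_test)
    show "?A \<in> borel_measurable borel" by measurable
    show "case_prod ?k \<in> borel_measurable (borel \<Otimes>\<^sub>M borel)" by measurable
    show "?k \<xi> \<eta> = ?k \<eta> \<xi>" for \<xi> \<eta> using \<kappa>e[of "\<xi> - \<eta>"] by (simp add: mult.commute power2_commute)
    show "?k \<xi> \<eta> \<ge> 0" for \<xi> \<eta> by (intro mult_nonneg_nonneg \<kappa>0 pos) auto
  qed (auto intro: C)
  also have "(\<integral>\<^sup>+\<xi>. ennreal ((?A \<xi>)\<^sup>2) \<partial>lborel) = ennreal ((norm U)\<^sup>2)" by (rule nn_integral_rep_lsq)
  also have "ennreal (sqrt (2 * pi)) * (2 * (ennreal C * ennreal ((norm U)\<^sup>2))) = ennreal (sqrt (2 * pi) * (2 * (C * (norm U)\<^sup>2)))"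
  proof -
    have "ennreal (sqrt (2 * pi) * (2 * (C * (norm U)\<^sup>2))) = ennreal (sqrt (2 * pi)) * (ennreal 2 * (ennreal C * ennreal ((norm U)\<^sup>2)))"
      using C0 by (subst ennreal_mult, simp, simp, subst ennreal_mult, simp, simp, subst ennreal_mult) auto
    then show ?thesis by simp
  qed
  finally have L: "?L \<le> ennreal (sqrt (2 * pi) * (2 * (C * (norm U)\<^sup>2)))" by (simp add: mult_left_mono)
  have "(\<integral>\<^sup>+q. ennreal (exp (- ((fst q)\<^sup>2 / 2)) * \<rho> (snd q) * (cmod (Kop M (fst q) (snd q) U))\<^sup>2) \<partial>lborel)
     = (\<integral>\<^sup>+q. ennreal ((cmod cn)\<^sup>2) * ennreal (exp (- ((fst q)\<^sup>2 / 2)) * \<rho> (snd q) * (cmod (LINT \<xi>|lborel. a \<xi> * cis (snd q \<bullet> \<xi> - fst q * (norm \<xi>)\<^sup>2)))\<^sup>2) \<partial>lborel)"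
  proof (rule nn_integral_cong)
    fix q :: "real \<times> (real^'n)"
    have "exp (- ((fst q)\<^sup>2 / 2)) * \<rho> (snd q) * (cmod (Kop M (fst q) (snd q) U))\<^sup>2 = (cmod cn)\<^sup>2 * (exp (- ((fst q)\<^sup>2 / 2)) * \<rho> (snd q) * (cmod (LINT \<xi>|lborel. a \<xi> * cis (snd q \<bullet> \<xi> - fst q * (norm \<xi>)\<^sup>2)))\<^sup>2)"
      unfolding Kop_a norm_mult power_mult_distrib by (simp only: mult_ac)
    then show "ennreal (exp (- ((fst q)\<^sup>2 / 2)) * \<rho> (snd q) * (cmod (Kop M (fst q) (snd q) U))\<^sup>2) = ennreal ((cmod cn)\<^sup>2) * ennreal (exp (- ((fst q)\<^sup>2 / 2)) * \<rho> (snd q) * (cmod (LINT \<xi>|lborel. a \<xi> * cis (snd q \<bullet> \<xi> - fst q * (norm \<xi>)\<^sup>2)))\<^sup>2)"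
      using \<rho>(2) by (simp only: ennreal_mult zero_le_power2 mult_nonneg_nonneg exp_ge_zero)
  qed
  also have "\<dots> = ennreal ((cmod cn)\<^sup>2) * ?L"
  proof (rule nn_integral_cmult)
    have [measurable]: "a \<in> borel_measurable borel" unfolding a_def[abs_def] by measurable
    show "(\<lambda>q. ennreal (exp (- ((fst q)\<^sup>2 / 2)) * \<rho> (snd q) * (cmod (LINT \<xi>|lborel. a \<xi> * cis (snd q \<bullet> \<xi> - fst q * (norm \<xi>)\<^sup>2)))\<^sup>2)) \<in> borel_measurable lborel"
      by (simp only: lborel_prod[symmetric]) measurable
  qed
  also have "\<dots> \<le> ennreal ((cmod cn)\<^sup>2) * ennreal (sqrt (2 * pi) * (2 * (C * (norm U)\<^sup>2)))" by (intro mult_left_mono L) simp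
  also have "\<dots> = ennreal ((cmod cn)\<^sup>2 * (sqrt (2 * pi) * (2 * (C * (norm U)\<^sup>2))))" using C0 by (intro ennreal_mult[symmetric]) auto
  also have "(cmod cn)\<^sup>2 * (sqrt (2 * pi) * (2 * (C * (norm U)\<^sup>2))) = smc * C * (norm U)\<^sup>2" unfolding smc_def by (simp only: mult_ac)
  finally show ?thesis .
qed

end

text \<open>Moving the centre multiplies the transform by a phase, so its modulus does not depend on
  \<open>b\<close>; the smoothing constant is therefore uniform over all centres.\<close>

lemma
  fixes b \<zeta> :: "real^'n"
  shows integrable_gauss: "integrable lborel (\<lambda>x. exp (- ((norm (x - b))\<^sup>2 / 2)))"
    and cmod_gauss_FT: "cmod (LINT x|lborel. complex_of_real (exp (- ((norm (x - b))\<^sup>2 / 2))) * cis (x \<bullet> \<zeta>)) = sqrt (2 * pi) ^ CARD('n) * exp (- ((norm \<zeta>)\<^sup>2 / 2))"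
proof -
  have sq: "- ((norm x)\<^sup>2 / 2) = (\<Sum>i\<in>Basis. - ((x \<bullet> i)\<^sup>2 / 2))" for x :: "real^'n"
  proof -
    have "(norm x)\<^sup>2 = (\<Sum>i\<in>Basis. (x \<bullet> i)\<^sup>2)"
      unfolding power2_norm_eq_inner by (subst euclidean_inner) (simp add: power2_eq_square)
    then show ?thesis by (simp add: sum_negf sum_divide_distrib)
  qed
  let ?f = "\<lambda>\<zeta> (i::real^'n) t. complex_of_real (exp (- (t\<^sup>2 / 2))) * cis ((\<zeta> \<bullet> i) * t)"
  have fi: "integrable lborel (?f \<zeta> i)" for \<zeta> i
    by (rule integrable_mult_cis[OF integrable_of_real[OF integrable_gauss_real]]) measurable
  have eq: "complex_of_real (exp (- ((norm x)\<^sup>2 / 2))) * cis (x \<bullet> \<zeta>) = (\<Prod>i\<in>Basis. ?f \<zeta> i (x \<bullet> i))" for x \<zeta> :: "real^'n"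
  proof -
    have "x \<bullet> \<zeta> = (\<Sum>i\<in>Basis. (\<zeta> \<bullet> i) * (x \<bullet> i))" by (subst euclidean_inner) (simp add: mult.commute)
    then have c: "cis (x \<bullet> \<zeta>) = (\<Prod>i\<in>Basis. cis ((\<zeta> \<bullet> i) * (x \<bullet> i)))" by (simp only: cis_sum[OF finite_Basis])
    have e: "complex_of_real (exp (- ((norm x)\<^sup>2 / 2))) = (\<Prod>i\<in>Basis. complex_of_real (exp (- ((x \<bullet> i)\<^sup>2 / 2))))"
      unfolding sq exp_sum[OF finite_Basis] by (rule of_real_prod)
    show ?thesis unfolding c e by (rule prod.distrib[symmetric])
  qed
  have int0: "integrable lborel (\<lambda>x::real^'n. complex_of_real (exp (- ((norm x)\<^sup>2 / 2))) * cis (x \<bullet> \<zeta>))" for \<zeta> :: "real^'n"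
    unfolding eq using integrable_lborel_prod[of "?f \<zeta>"] fi by blast
  have "integrable lborel (\<lambda>x::real^'n. Re (complex_of_real (exp (- ((norm x)\<^sup>2 / 2))) * cis (x \<bullet> 0)))" by (rule integrable_Re[OF int0])
  then have g0: "integrable lborel (\<lambda>x::real^'n. exp (- ((norm x)\<^sup>2 / 2)))" by simp
  then have "integrable (distr lborel borel (\<lambda>x::real^'n. x - b)) (\<lambda>x::real^'n. exp (- ((norm x)\<^sup>2 / 2)))"
    by (simp only: distr_lborel_translate)
  then show "integrable lborel (\<lambda>x. exp (- ((norm (x - b))\<^sup>2 / 2)))"
    by (subst (asm) integrable_distr_eq) auto
  have F: "(LINT x::real^'n|lborel. complex_of_real (exp (- ((norm x)\<^sup>2 / 2))) * cis (x \<bullet> \<zeta>)) = of_real (sqrt (2 * pi) ^ CARD('n) * exp (- ((norm \<zeta>)\<^sup>2 / 2)))"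
  proof -
    have "(LINT x::real^'n|lborel. complex_of_real (exp (- ((norm x)\<^sup>2 / 2))) * cis (x \<bullet> \<zeta>)) = (\<Prod>i\<in>(Basis::(real^'n) set). LINT t|lborel. ?f \<zeta> i t)"
      unfolding eq using integral_lborel_prod[of "?f \<zeta>"] fi by blast
    also have "\<dots> = (\<Prod>i\<in>(Basis::(real^'n) set). of_real (sqrt (2 * pi) * exp (- ((\<zeta> \<bullet> i)\<^sup>2 / 2))))"
      by (simp only: gauss_FT_real)
    also have "\<dots> = of_real (sqrt (2 * pi) ^ CARD('n) * (\<Prod>i\<in>Basis. exp (- ((\<zeta> \<bullet> i)\<^sup>2 / 2))))"
      unfolding of_real_prod[symmetric] prod.distrib by simp
    also have "(\<Prod>i\<in>Basis. exp (- ((\<zeta> \<bullet> i)\<^sup>2 / 2))) = exp (- ((norm \<zeta>)\<^sup>2 / 2))"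
      unfolding sq exp_sum[OF finite_Basis] ..
    finally show ?thesis .
  qed
  have "(LINT x|lborel. complex_of_real (exp (- ((norm (x - b))\<^sup>2 / 2))) * cis (x \<bullet> \<zeta>)) = (LINT x|lborel. cis (b \<bullet> \<zeta>) * (complex_of_real (exp (- ((norm (x - b))\<^sup>2 / 2))) * cis ((x - b) \<bullet> \<zeta>)))"
  proof (rule Bochner_Integration.integral_cong[OF refl])
    fix x :: "real^'n"
    have "cis (x \<bullet> \<zeta>) = cis (b \<bullet> \<zeta>) * cis ((x - b) \<bullet> \<zeta>)" by (simp add: cis_mult inner_diff_left)
    then show "complex_of_real (exp (- ((norm (x - b))\<^sup>2 / 2))) * cis (x \<bullet> \<zeta>) = cis (b \<bullet> \<zeta>) * (complex_of_real (exp (- ((norm (x - b))\<^sup>2 / 2))) * cis ((x - b) \<bullet> \<zeta>))"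
      by (simp only: mult_ac)
  qed
  also have "\<dots> = cis (b \<bullet> \<zeta>) * (LINT x|lborel. complex_of_real (exp (- ((norm (x - b))\<^sup>2 / 2))) * cis ((x - b) \<bullet> \<zeta>))"
    by (rule integral_mult_right_zero)
  also have "(LINT x|lborel. complex_of_real (exp (- ((norm (x - b))\<^sup>2 / 2))) * cis ((x - b) \<bullet> \<zeta>)) = (LINT x|lborel. complex_of_real (exp (- ((norm x)\<^sup>2 / 2))) * cis (x \<bullet> \<zeta>))"
    by (rule integral_translate[of "\<lambda>x. complex_of_real (exp (- ((norm x)\<^sup>2 / 2))) * cis (x \<bullet> \<zeta>)"]) measurable
  finally show "cmod (LINT x|lborel. complex_of_real (exp (- ((norm (x - b))\<^sup>2 / 2))) * cis (x \<bullet> \<zeta>)) = sqrt (2 * pi) ^ CARD('n) * exp (- ((norm \<zeta>)\<^sup>2 / 2))"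
    unfolding F by (simp add: norm_mult norm_power abs_mult power_abs)
qed

text \<open>Dimension one is known only through \<open>CARD('n)\<close>, so the space is identified
  with the line by means of its single basis vector.\<close>

lemma nn_integral_norm_1d:
  fixes F :: "real \<Rightarrow> ennreal"
  assumes "CARD('n) = 1" and [measurable]: "F \<in> borel_measurable borel"
  shows "(\<integral>\<^sup>+(\<eta>::real^'n). F (norm \<eta>) \<partial>lborel) = (\<integral>\<^sup>+t. F \<bar>t\<bar> \<partial>lborel)"
proof -
  have "card (Basis :: (real^'n) set) = 1" using assms(1) by simp
  then obtain b where b: "(Basis :: (real^'n) set) = {b}" by (rule card_1_singletonE)
  have nb: "norm \<eta> = \<bar>\<eta> \<bullet> b\<bar>" for \<eta> :: "real^'n"
  proof -
    have "(norm \<eta>)\<^sup>2 = (\<eta> \<bullet> b)\<^sup>2"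
      unfolding power2_norm_eq_inner by (subst euclidean_inner) (simp add: b power2_eq_square)
    then show ?thesis by (metis abs_norm_cancel power2_eq_iff_nonneg abs_ge_zero power2_abs)
  qed
  have "(\<integral>\<^sup>+(\<eta>::real^'n). (\<Prod>i\<in>Basis. F \<bar>\<eta> \<bullet> i\<bar>) \<partial>lborel) = (\<Prod>i\<in>(Basis::(real^'n) set). \<integral>\<^sup>+t. F \<bar>t\<bar> \<partial>lborel)"
    by (rule nn_integral_lborel_prod[where f="\<lambda>_ t. F \<bar>t\<bar>"]) auto
  then show ?thesis unfolding b by (simp add: nb)
qed

text \<open>The substitution r = \<open>phase \<alpha> t\<close> is made on intervals away from 0,
  where \<open>powr\<close> is differentiable; Fatou's lemma then recovers the whole
  interval.\<close>

lemma nn_integral_phase_le: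
  fixes h :: "real \<Rightarrow> ennreal"
  assumes \<alpha>: "\<alpha> > 0" and T: "T > 0" and [measurable]: "h \<in> borel_measurable borel"
  shows "(\<integral>\<^sup>+t. h (phase \<alpha> t) * ennreal (t powr \<alpha>) * indicator {0..T} t \<partial>lborel) \<le> (\<integral>\<^sup>+r. h r * indicator {0..phase \<alpha> T} r \<partial>lborel)"
proof -
  have [measurable]: "phase \<alpha> \<in> borel_measurable borel" unfolding phase_def[abs_def] by measurable
  \<comment> \<open>Adding 2 keeps the left end strictly between 0 and T already for n = 0.\<close>
  let ?e = "\<lambda>n::nat. T / (real n + 2)"
  let ?f = "\<lambda>n t. h (phase \<alpha> t) * ennreal (t powr \<alpha>) * indicator {?e n..T} t"
  have step: "(\<integral>\<^sup>+t. ?f n t \<partial>lborel) \<le> (\<integral>\<^sup>+r. h r * indicator {0..phase \<alpha> T} r \<partial>lborel)" for n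
  proof -
    have e0: "?e n > 0" using T by simp
    have "(\<integral>\<^sup>+r. h r * indicator {phase \<alpha> (?e n)..phase \<alpha> T} r \<partial>lborel) = (\<integral>\<^sup>+t. ?f n t \<partial>lborel)"
    proof (rule nn_integral_substitution_aux)
      show "(phase \<alpha> has_real_derivative t powr \<alpha>) (at t)" if "t \<in> {?e n..T}" for t
      proof -
        have "t > 0" using that e0 by (simp add: less_le_trans)
        then show ?thesis unfolding phase_def[abs_def] using \<alpha> by (auto intro!: derivative_eq_intros)
      qed
      show "continuous_on {?e n..T} (\<lambda>t. t powr \<alpha>)"
        using e0 by (intro continuous_on_powr continuous_intros) (auto dest: less_le_trans)
      show "?e n < T" using T by (simp add: divide_less_eq)
    qed auto
    moreover have "(\<integral>\<^sup>+r. h r * indicator {phase \<alpha> (?e n)..phase \<alpha> T} r \<partial>lborel) \<le> (\<integral>\<^sup>+r. h r * indicator {0..phase \<alpha> T} r \<partial>lborel)"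
    proof (intro nn_integral_mono mult_left_mono)
      fix r :: real
      have "0 \<le> phase \<alpha> (?e n)" using \<alpha> by (simp add: phase_def)
      then show "indicator {phase \<alpha> (?e n)..phase \<alpha> T} r \<le> (indicator {0..phase \<alpha> T} r :: ennreal)" by (auto simp: indicator_def)
    qed simp
    ultimately show ?thesis by simp
  qed
  have "(\<integral>\<^sup>+t. h (phase \<alpha> t) * ennreal (t powr \<alpha>) * indicator {0..T} t \<partial>lborel) = (\<integral>\<^sup>+t. liminf (\<lambda>n. ?f n t) \<partial>lborel)"
  proof (rule nn_integral_cong)
    fix t :: real
    have "\<forall>\<^sub>F n in sequentially. ?f n t = h (phase \<alpha> t) * ennreal (t powr \<alpha>) * indicator {0..T} t"
    proof (cases "t > 0")
      case True
      have "(\<lambda>n. ?e n) \<longlonglongrightarrow> 0" by real_asymp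
      then have "\<forall>\<^sub>F n in sequentially. ?e n < t" using True by (rule order_tendstoD)
      then show ?thesis by eventually_elim (use True in \<open>auto simp: indicator_def\<close>)
    next
      case False
      \<comment> \<open>The endpoint t = 0, missed by all these intervals, contributes nothing
        because \<open>0 powr \<alpha>\<close> is 0.\<close>
      have "?f n t = h (phase \<alpha> t) * ennreal (t powr \<alpha>) * indicator {0..T} t" for n
      proof (cases "t = 0")
        case f: False
        have "?e n > 0" using T by simp
        with False f show ?thesis by (auto simp: indicator_def)
      qed (use \<alpha> in simp)
      then show ?thesis by simp
    qed
    then have "(\<lambda>n. ?f n t) \<longlonglongrightarrow> h (phase \<alpha> t) * ennreal (t powr \<alpha>) * indicator {0..T} t" by (rule tendsto_eventually)
    then show "h (phase \<alpha> t) * ennreal (t powr \<alpha>) * indicator {0..T} t = liminf (\<lambda>n. ?f n t)"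
      by (rule lim_imp_Liminf[OF sequentially_bot, symmetric])
  qed
  also have "\<dots> \<le> liminf (\<lambda>n. \<integral>\<^sup>+t. ?f n t \<partial>lborel)" by (rule nn_integral_liminf) measurable
  also have "\<dots> \<le> liminf (\<lambda>n::nat. \<integral>\<^sup>+r. h r * indicator {0..phase \<alpha> T} r \<partial>lborel)"
    by (intro Liminf_mono always_eventually allI step)
  also have "\<dots> = (\<integral>\<^sup>+r. h r * indicator {0..phase \<alpha> T} r \<partial>lborel)" by (simp add: Liminf_const)
  finally show ?thesis .
qed

text \<open>Cauchy-Schwarz against the constant 1. Enlarging the range from {0..t} to {0..T} makes
  the bound independent of t, so that time and \<tau> later run over a product domain.\<close>

lemma integral_sq_le:
  fixes g :: "real \<Rightarrow> complex"
  assumes g: "continuous_on UNIV g" and t: "0 \<le> t" "t \<le> T"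
  shows "ennreal ((cmod (integral {0..t} g))\<^sup>2) \<le> ennreal T * (\<integral>\<^sup>+\<tau>. ennreal ((cmod (g \<tau>))\<^sup>2) * indicator {0..T} \<tau> \<partial>lborel)"
proof -
  have [measurable]: "g \<in> borel_measurable borel" by (rule borel_measurable_continuous_onI[OF g])
  have "integral {0..t} g = (LINT \<tau>:{0..t}|lborel. g \<tau>)"
    by (rule set_borel_integral_eq_integral(2)[symmetric]) (rule borel_integrable_atLeastAtMost', rule continuous_on_subset[OF g], simp)
  then have "ennreal (cmod (integral {0..t} g)) \<le> (\<integral>\<^sup>+\<tau>. ennreal (cmod (indicator {0..t} \<tau> *\<^sub>R g \<tau>)) \<partial>lborel)"
    unfolding set_lebesgue_integral_def by (simp only: ennreal_norm_integral_le)
  also have "\<dots> = (\<integral>\<^sup>+\<tau>. (ennreal (cmod (g \<tau>)) * indicator {0..t} \<tau>) * indicator {0..t} \<tau> \<partial>lborel)"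
    by (intro nn_integral_cong) (auto simp: indicator_def)
  finally have "(ennreal (cmod (integral {0..t} g)))\<^sup>2 \<le> (\<integral>\<^sup>+\<tau>. (ennreal (cmod (g \<tau>)) * indicator {0..t} \<tau>) * indicator {0..t} \<tau> \<partial>lborel)\<^sup>2"
    by (rule power_mono) simp
  also have "\<dots> \<le> (\<integral>\<^sup>+\<tau>. (ennreal (cmod (g \<tau>)) * indicator {0..t} \<tau>)\<^sup>2 \<partial>lborel) * (\<integral>\<^sup>+\<tau>. (indicator {0..t} \<tau>)\<^sup>2 \<partial>lborel)"
    by (rule Cauchy_Schwarz_nn_integral) measurable
  also have "(\<integral>\<^sup>+\<tau>. (indicator {0..t} \<tau> :: ennreal)\<^sup>2 \<partial>lborel) = (\<integral>\<^sup>+\<tau>. indicator {0..t} \<tau> \<partial>lborel)"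
    by (intro nn_integral_cong) (auto simp: indicator_def)
  also have "\<dots> = ennreal t" using t by simp
  also have "(\<integral>\<^sup>+\<tau>. (ennreal (cmod (g \<tau>)) * indicator {0..t} \<tau>)\<^sup>2 \<partial>lborel) \<le> (\<integral>\<^sup>+\<tau>. ennreal ((cmod (g \<tau>))\<^sup>2) * indicator {0..T} \<tau> \<partial>lborel)"
    by (intro nn_integral_mono) (use t in \<open>auto simp: indicator_def ennreal_power\<close>)
  also have "ennreal t \<le> ennreal T" using t by (intro ennreal_leI)
  finally show ?thesis by (simp add: ennreal_power mult.commute mult_mono)
qed

section \<open>Weighted estimates in the original time variable\<close>

context sobolev_space
begin

lemma smoothing_weight_gauss: "\<exists>C. \<forall>b. smoothing_weight (\<lambda>x. exp (- ((norm (x - b))\<^sup>2 / 2))) C"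
proof -
  obtain C where C: "C \<ge> 0" "\<And>\<xi>::real^'n. (\<integral>\<^sup>+\<eta>. ennreal (sqrt (norm \<xi> * norm \<eta>) * (exp (- ((norm (\<xi> - \<eta>))\<^sup>2 / 2)) * (2 * inverse (1 + ((norm \<xi>)\<^sup>2 - (norm \<eta>)\<^sup>2)\<^sup>2)))) \<partial>lborel) \<le> ennreal C"
    using schur_gauss[where 'n='n] by blast
  let ?D = "sqrt (2 * pi) ^ CARD('n)"
  let ?\<kappa> = "\<lambda>\<zeta>::real^'n. ?D * exp (- ((norm \<zeta>)\<^sup>2 / 2))"
  have "smoothing_weight (\<lambda>x. exp (- ((norm (x - b))\<^sup>2 / 2))) (?D * C)" for b
    unfolding smoothing_weight_def
  proof (intro conjI exI[of _ ?\<kappa>] allI)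
    show "integrable lborel (\<lambda>x. exp (- ((norm (x - b))\<^sup>2 / 2)))" by (rule integrable_gauss)
    show "cmod (LINT x|lborel. complex_of_real (exp (- ((norm (x - b))\<^sup>2 / 2))) * cis (x \<bullet> \<zeta>)) \<le> ?\<kappa> \<zeta>" for \<zeta>
      by (rule eq_refl[OF cmod_gauss_FT])
    fix \<xi> :: "real^'n"
    let ?k = "\<lambda>\<eta>. sqrt (norm \<xi> * norm \<eta>) * (exp (- ((norm (\<xi> - \<eta>))\<^sup>2 / 2)) * (2 * inverse (1 + ((norm \<xi>)\<^sup>2 - (norm \<eta>)\<^sup>2)\<^sup>2)))"
    have "(\<integral>\<^sup>+\<eta>. ennreal (sqrt (norm \<xi> * norm \<eta>) * (?\<kappa> (\<xi> - \<eta>) * (2 * inverse (1 + ((norm \<xi>)\<^sup>2 - (norm \<eta>)\<^sup>2)\<^sup>2)))) \<partial>lborel) = (\<integral>\<^sup>+\<eta>. ennreal ?D * ennreal (?k \<eta>) \<partial>lborel)"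
    proof (rule nn_integral_cong)
      fix \<eta> :: "real^'n"
      have "sqrt (norm \<xi> * norm \<eta>) * (?\<kappa> (\<xi> - \<eta>) * (2 * inverse (1 + ((norm \<xi>)\<^sup>2 - (norm \<eta>)\<^sup>2)\<^sup>2))) = ?D * ?k \<eta>" by (simp only: mult_ac)
      moreover have "ennreal (?D * ?k \<eta>) = ennreal ?D * ennreal (?k \<eta>)" by (rule ennreal_mult) (auto intro!: mult_nonneg_nonneg add_nonneg_nonneg)
      ultimately show "ennreal (sqrt (norm \<xi> * norm \<eta>) * (?\<kappa> (\<xi> - \<eta>) * (2 * inverse (1 + ((norm \<xi>)\<^sup>2 - (norm \<eta>)\<^sup>2)\<^sup>2)))) = ennreal ?D * ennreal (?k \<eta>)" by (simp only:)
    qed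
    also have "\<dots> = ennreal ?D * (\<integral>\<^sup>+\<eta>. ennreal (?k \<eta>) \<partial>lborel)" by (rule nn_integral_cmult) measurable
    also have "\<dots> \<le> ennreal ?D * ennreal C" by (intro mult_left_mono C) simp
    also have "\<dots> = ennreal (?D * C)" using C by (intro ennreal_mult[symmetric]) auto
    finally show "(\<integral>\<^sup>+\<eta>. ennreal (sqrt (norm \<xi> * norm \<eta>) * (?\<kappa> (\<xi> - \<eta>) * (2 * inverse (1 + ((norm \<xi>)\<^sup>2 - (norm \<eta>)\<^sup>2)\<^sup>2)))) \<partial>lborel) \<le> ennreal (?D * C)" .
  qed (use C in auto)
  then show ?thesis by blast
qed

text \<open>The transform of the indicator is bounded only by the constant |A|, without decay in
  \<xi> - \<eta>; in dimension one the Cauchy kernel alone is integrable enough. The linear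
  dependence on |A| is what later gives a bound at almost every point.\<close>

lemma smoothing_weight_indicator:
  assumes n: "CARD('n) = 1" and A: "A \<in> sets borel" "emeasure lborel A < \<infinity>"
  shows "smoothing_weight (indicator A) (measure lborel A * (8 * cauchy_mass))"
  unfolding smoothing_weight_def
proof (intro conjI exI[of _ "\<lambda>_. measure lborel A"] allI)
  show "integrable lborel (indicator A :: real^'n \<Rightarrow> real)" using A by (simp add: integrable_indicator_iff)
  show "0 \<le> measure lborel A * (8 * cauchy_mass)" using cauchy_mass_nonneg by simp
  show "cmod (LINT x|lborel. complex_of_real (indicator A x) * cis (x \<bullet> \<zeta>)) \<le> measure lborel A" for \<zeta>
  proof -
    have "cmod (LINT x|lborel. complex_of_real (indicator A x) * cis (x \<bullet> \<zeta>)) \<le> (LINT x|lborel. cmod (complex_of_real (indicator A x) * cis (x \<bullet> \<zeta>)))"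
      by (rule integral_norm_bound)
    also have "\<dots> = (LINT x|lborel. indicator A x)" by (simp add: norm_mult)
    finally show ?thesis using A by simp
  qed
  fix \<xi> :: "real^'n"
  let ?k = "\<lambda>\<eta>::real^'n. sqrt (norm \<xi> * norm \<eta>) * (2 * inverse (1 + ((norm \<xi>)\<^sup>2 - (norm \<eta>)\<^sup>2)\<^sup>2))"
  have "(\<integral>\<^sup>+(\<eta>::real^'n). ennreal (sqrt (norm \<xi> * norm \<eta>) * (measure lborel A * (2 * inverse (1 + ((norm \<xi>)\<^sup>2 - (norm \<eta>)\<^sup>2)\<^sup>2)))) \<partial>lborel) = (\<integral>\<^sup>+\<eta>. ennreal (measure lborel A) * ennreal (?k \<eta>) \<partial>lborel)"
  proof (rule nn_integral_cong)
    fix \<eta> :: "real^'n"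
    have "sqrt (norm \<xi> * norm \<eta>) * (measure lborel A * (2 * inverse (1 + ((norm \<xi>)\<^sup>2 - (norm \<eta>)\<^sup>2)\<^sup>2))) = measure lborel A * ?k \<eta>" by (simp only: mult_ac)
    moreover have "ennreal (measure lborel A * ?k \<eta>) = ennreal (measure lborel A) * ennreal (?k \<eta>)" by (rule ennreal_mult) (auto intro!: mult_nonneg_nonneg add_nonneg_nonneg)
    ultimately show "ennreal (sqrt (norm \<xi> * norm \<eta>) * (measure lborel A * (2 * inverse (1 + ((norm \<xi>)\<^sup>2 - (norm \<eta>)\<^sup>2)\<^sup>2)))) = ennreal (measure lborel A) * ennreal (?k \<eta>)" by (simp only:)
  qed
  also have "\<dots> = ennreal (measure lborel A) * (\<integral>\<^sup>+\<eta>. ennreal (?k \<eta>) \<partial>lborel)" by (rule nn_integral_cmult) measurable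
  also have "(\<integral>\<^sup>+\<eta>. ennreal (?k \<eta>) \<partial>lborel) = (\<integral>\<^sup>+t. ennreal (sqrt (\<bar>norm \<xi>\<bar> * \<bar>t\<bar>) * (2 * inverse (1 + ((norm \<xi>)\<^sup>2 - t\<^sup>2)\<^sup>2))) \<partial>lborel)"
    using nn_integral_norm_1d[OF n, of "\<lambda>u. ennreal (sqrt (norm \<xi> * u) * (2 * inverse (1 + ((norm \<xi>)\<^sup>2 - u\<^sup>2)\<^sup>2)))"] by simp
  also have "\<dots> \<le> ennreal (8 * cauchy_mass)" by (rule schur_1d)
  also have "ennreal (measure lborel A) * ennreal (8 * cauchy_mass) = ennreal (measure lborel A * (8 * cauchy_mass))"
    using cauchy_mass_nonneg by (intro ennreal_mult[symmetric]) auto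
  finally show "(\<integral>\<^sup>+(\<eta>::real^'n). ennreal (sqrt (norm \<xi> * norm \<eta>) * (measure lborel A * (2 * inverse (1 + ((norm \<xi>)\<^sup>2 - (norm \<eta>)\<^sup>2)\<^sup>2)))) \<partial>lborel) \<le> ennreal (measure lborel A * (8 * cauchy_mass))"
    by (simp add: mult_left_mono)
qed auto

lemma Kop_measurable:
  assumes f: "f \<in> borel_measurable M'" and g: "g \<in> borel_measurable M'" and k: "k \<in> borel_measurable M'"
    and U: "continuous_on UNIV (U :: real \<Rightarrow> (real^'n) lsq)"
  shows "(\<lambda>p. Kop M (f p) (g p) (U (k p))) \<in> borel_measurable M'"
proof -
  let ?F = "\<lambda>z::real \<times> (real^'n) \<times> real. Kop M (fst z) (fst (snd z)) (U (snd (snd z)))"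
  have "continuous_on UNIV ?F"
    by (intro continuous_on_Kop continuous_on_compose2[OF U] continuous_intros) auto
  then have F: "?F \<in> borel_measurable borel" by (rule borel_measurable_continuous_onI)
  have "(\<lambda>p. (f p, g p, k p)) \<in> borel_measurable M'" by (intro borel_measurable_Pair f g k)
  from measurable_compose[OF this F] show ?thesis by simp
qed

lemma phase_measurable [measurable]: "phase \<alpha> \<in> borel_measurable borel"
  unfolding phase_def[abs_def] by measurable

text \<open>The exponential is the reciprocal of the smallest value on
  [0, \<open>phase \<alpha> T\<close>] of the Gaussian inserted in r.\<close>

definition smE :: "real \<Rightarrow> real \<Rightarrow> real" where "smE \<alpha> T = exp ((phase \<alpha> T)\<^sup>2 / 2) * smc"

lemma smE_nonneg: "smE \<alpha> T \<ge> 0" using smc_nonneg by (simp add: smE_def)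

lemma linear_smoothing:
  assumes \<alpha>: "\<alpha> > 0" and T: "T > 0" and w: "smoothing_weight \<rho> C"
  shows "(\<integral>\<^sup>+q. ennreal (fst q powr \<alpha> * \<rho> (snd q) * (cmod (Kop M (phase \<alpha> (fst q)) (snd q) U))\<^sup>2) * indicator {0..T} (fst q) \<partial>lborel)
    \<le> ennreal (smE \<alpha> T * C) * ennreal ((norm U)\<^sup>2)"
proof -
  have \<rho>: "integrable lborel \<rho>" "\<And>x. \<rho> x \<ge> 0" and C0: "C \<ge> 0" using w by (auto simp: smoothing_weight_def)
  have [measurable]: "\<rho> \<in> borel_measurable borel" using borel_measurable_integrable[OF \<rho>(1)] by simp
  have Km [measurable]: "(\<lambda>q. Kop M (fst q) (snd q) U) \<in> borel_measurable (borel \<Otimes>\<^sub>M borel)"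
    by (rule Kop_measurable[where k="\<lambda>_. 0" and U="\<lambda>_. U"]) measurable
  let ?g = "\<lambda>r x. ennreal (\<rho> x * (cmod (Kop M r x U))\<^sup>2)"
  have gm [measurable]: "(\<lambda>(r, x). ?g r x) \<in> borel_measurable (borel \<Otimes>\<^sub>M lborel)"
  proof -
    have "(\<lambda>(r, x). ?g r x) \<in> borel_measurable (borel \<Otimes>\<^sub>M borel)" using Km by measurable
    moreover have "sets (borel \<Otimes>\<^sub>M lborel) = sets (borel \<Otimes>\<^sub>M (borel :: (real^'n) measure) :: (real \<times> (real^'n)) measure)"
      by (rule sets_pair_measure_cong) auto
    ultimately show ?thesis by (simp cong: measurable_cong_sets)
  qed
  define h where "h r = (\<integral>\<^sup>+x. ?g r x \<partial>lborel)" for r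
  have hm [measurable]: "h \<in> borel_measurable borel" unfolding h_def[abs_def] by (rule lborel.borel_measurable_nn_integral[OF gm])
  have "(\<integral>\<^sup>+q. ennreal (fst q powr \<alpha> * \<rho> (snd q) * (cmod (Kop M (phase \<alpha> (fst q)) (snd q) U))\<^sup>2) * indicator {0..T} (fst q) \<partial>lborel)
     = (\<integral>\<^sup>+t. (\<integral>\<^sup>+x. ennreal (t powr \<alpha>) * indicator {0..T} t * ?g (phase \<alpha> t) x \<partial>lborel) \<partial>lborel)"
  proof -
    have "(\<integral>\<^sup>+q. ennreal (fst q powr \<alpha> * \<rho> (snd q) * (cmod (Kop M (phase \<alpha> (fst q)) (snd q) U))\<^sup>2) * indicator {0..T} (fst q) \<partial>lborel)
      = (\<integral>\<^sup>+q. (case q of (t, x) \<Rightarrow> ennreal (t powr \<alpha>) * indicator {0..T} t * ?g (phase \<alpha> t) x) \<partial>lborel)"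
      using \<rho>(2) by (intro nn_integral_cong) (auto simp: ennreal_mult mult_ac split: prod.split)
    also have "\<dots> = (\<integral>\<^sup>+t. (\<integral>\<^sup>+x. ennreal (t powr \<alpha>) * indicator {0..T} t * ?g (phase \<alpha> t) x \<partial>lborel) \<partial>lborel)"
    proof -
      have m: "(\<lambda>q. Kop M (phase \<alpha> (fst q)) (snd q) U) \<in> borel_measurable (lborel \<Otimes>\<^sub>M lborel)"
        by (rule Kop_measurable[where k="\<lambda>_. 0" and U="\<lambda>_. U"]) measurable
      have "(\<lambda>(t, x). ennreal (t powr \<alpha>) * indicator {0..T} t * ?g (phase \<alpha> t) x) \<in> borel_measurable (lborel \<Otimes>\<^sub>M lborel)"
        using m unfolding split_def by measurable
      from lborel.nn_integral_fst[OF this] show ?thesis unfolding lborel_prod by simp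
    qed
    finally show ?thesis .
  qed
  also have "\<dots> = (\<integral>\<^sup>+t. h (phase \<alpha> t) * ennreal (t powr \<alpha>) * indicator {0..T} t \<partial>lborel)"
  proof (rule nn_integral_cong)
    fix t :: real
    have "(\<lambda>x. Kop M (phase \<alpha> t) x U) \<in> borel_measurable lborel"
      by (rule Kop_measurable[where k="\<lambda>_. 0" and U="\<lambda>_. U"]) measurable
    then have "?g (phase \<alpha> t) \<in> borel_measurable lborel" by measurable
    from nn_integral_cmult[OF this, of "ennreal (t powr \<alpha>) * indicator {0..T} t"]
    show "(\<integral>\<^sup>+x. ennreal (t powr \<alpha>) * indicator {0..T} t * ?g (phase \<alpha> t) x \<partial>lborel) = h (phase \<alpha> t) * ennreal (t powr \<alpha>) * indicator {0..T} t"
      unfolding h_def by (simp only: mult_ac)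
  qed
  also have "\<dots> \<le> (\<integral>\<^sup>+r. h r * indicator {0..phase \<alpha> T} r \<partial>lborel)" by (rule nn_integral_phase_le[OF \<alpha> T hm])
  also have "\<dots> \<le> (\<integral>\<^sup>+r. ennreal (exp ((phase \<alpha> T)\<^sup>2 / 2)) * (ennreal (exp (- (r\<^sup>2 / 2))) * h r) \<partial>lborel)"
  proof (rule nn_integral_mono)
    fix r :: real
    show "h r * indicator {0..phase \<alpha> T} r \<le> ennreal (exp ((phase \<alpha> T)\<^sup>2 / 2)) * (ennreal (exp (- (r\<^sup>2 / 2))) * h r)"
    proof (cases "r \<in> {0..phase \<alpha> T}")
      case True
      then have "r\<^sup>2 \<le> (phase \<alpha> T)\<^sup>2" by (intro power_mono) auto
      then have "1 \<le> exp ((phase \<alpha> T)\<^sup>2 / 2 + - (r\<^sup>2 / 2))" by simp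
      then have "1 \<le> exp ((phase \<alpha> T)\<^sup>2 / 2) * exp (- (r\<^sup>2 / 2))" by (simp only: exp_add)
      then have "ennreal 1 \<le> ennreal (exp ((phase \<alpha> T)\<^sup>2 / 2) * exp (- (r\<^sup>2 / 2)))" by (rule ennreal_leI)
      then have "1 * h r \<le> (ennreal (exp ((phase \<alpha> T)\<^sup>2 / 2)) * ennreal (exp (- (r\<^sup>2 / 2)))) * h r"
        by (intro mult_right_mono) (simp_all add: ennreal_mult)
      then show ?thesis using True by (simp add: mult.assoc)
    qed simp
  qed
  also have "\<dots> = ennreal (exp ((phase \<alpha> T)\<^sup>2 / 2)) * (\<integral>\<^sup>+r. ennreal (exp (- (r\<^sup>2 / 2))) * h r \<partial>lborel)"
    by (rule nn_integral_cmult) measurable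
  also have "(\<integral>\<^sup>+r. ennreal (exp (- (r\<^sup>2 / 2))) * h r \<partial>lborel) = (\<integral>\<^sup>+r. (\<integral>\<^sup>+x. ennreal (exp (- (r\<^sup>2 / 2))) * ?g r x \<partial>lborel) \<partial>lborel)"
  proof (rule nn_integral_cong)
    fix r :: real
    have "(\<lambda>x. Kop M r x U) \<in> borel_measurable lborel"
      by (rule Kop_measurable[where k="\<lambda>_. 0" and U="\<lambda>_. U"]) measurable
    then have "?g r \<in> borel_measurable lborel" by measurable
    from nn_integral_cmult[OF this, of "ennreal (exp (- (r\<^sup>2 / 2)))"]
    show "ennreal (exp (- (r\<^sup>2 / 2))) * h r = (\<integral>\<^sup>+x. ennreal (exp (- (r\<^sup>2 / 2))) * ?g r x \<partial>lborel)"
      unfolding h_def by (rule sym)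
  qed
  also have "\<dots> = (\<integral>\<^sup>+q. (case q of (r, x) \<Rightarrow> ennreal (exp (- (r\<^sup>2 / 2))) * ?g r x) \<partial>lborel)"
  proof -
    have m: "(\<lambda>q. Kop M (fst q) (snd q) U) \<in> borel_measurable (lborel \<Otimes>\<^sub>M lborel)"
      by (rule Kop_measurable[where k="\<lambda>_. 0" and U="\<lambda>_. U"]) measurable
    have "(\<lambda>(r, x). ennreal (exp (- (r\<^sup>2 / 2))) * ?g r x) \<in> borel_measurable (lborel \<Otimes>\<^sub>M lborel)"
      using m unfolding split_def by measurable
    from lborel.nn_integral_fst[OF this] show ?thesis unfolding lborel_prod by simp
  qed
  also have "\<dots> = (\<integral>\<^sup>+q. ennreal (exp (- ((fst q)\<^sup>2 / 2)) * \<rho> (snd q) * (cmod (Kop M (fst q) (snd q) U))\<^sup>2) \<partial>lborel)"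
    using \<rho>(2) by (intro nn_integral_cong) (auto simp: ennreal_mult mult_ac split: prod.split)
  also have "\<dots> \<le> ennreal (smc * C * (norm U)\<^sup>2)" by (rule Kop_smoothing[OF w])
  also have "ennreal (exp ((phase \<alpha> T)\<^sup>2 / 2)) * ennreal (smc * C * (norm U)\<^sup>2) = ennreal (exp ((phase \<alpha> T)\<^sup>2 / 2) * (smc * C * (norm U)\<^sup>2))"
    using C0 smc_nonneg by (intro ennreal_mult[symmetric]) auto
  also have "exp ((phase \<alpha> T)\<^sup>2 / 2) * (smc * C * (norm U)\<^sup>2) = smE \<alpha> T * C * (norm U)\<^sup>2" unfolding smE_def by (simp only: mult_ac)
  also have "ennreal (smE \<alpha> T * C * (norm U)\<^sup>2) = ennreal (smE \<alpha> T * C) * ennreal ((norm U)\<^sup>2)"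
    using C0 smE_nonneg by (intro ennreal_mult) auto
  finally show ?thesis by (simp add: mult_left_mono)
qed

text \<open>The 2 comes from squaring a sum of two terms, the T from Cauchy-Schwarz in
  \<tau>.\<close>

definition duh_bound :: "real \<Rightarrow> (real^'n) lsq \<Rightarrow> (real \<Rightarrow> (real^'n) lsq) \<Rightarrow> ennreal" where
  "duh_bound T U0 G = 2 * (ennreal ((norm U0)\<^sup>2) + ennreal T * (\<integral>\<^sup>+\<tau>. ennreal ((norm (G \<tau>))\<^sup>2) * indicator {0..T} \<tau> \<partial>lborel))"

text \<open>In the interaction picture t acts on the integrand only through the functional at phase
  t, so for each fixed \<tau> the vector \<open>G \<tau>\<close> is evolved freely over the whole
  interval. After Cauchy-Schwarz and Tonelli the linear estimate applies to every
  \<open>G \<tau>\<close> separately.\<close>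

lemma duhamel_smoothing:
  assumes \<alpha>: "\<alpha> > 0" and T: "T > 0" and w: "smoothing_weight \<rho> C"
    and G: "continuous_on UNIV G"
    and V: "\<And>t. t \<in> {0..T} \<Longrightarrow> V t = U0 + integral {0..t} G"
  shows "(\<integral>\<^sup>+q. ennreal (fst q powr \<alpha> * \<rho> (snd q) * (cmod (Kop M (phase \<alpha> (fst q)) (snd q) (V (fst q))))\<^sup>2) * indicator {0..T} (fst q) \<partial>lborel)
    \<le> ennreal (smE \<alpha> T * C) * duh_bound T U0 G"
proof -
  have \<rho>: "integrable lborel \<rho>" "\<And>x. \<rho> x \<ge> 0" and C0: "C \<ge> 0" using w by (auto simp: smoothing_weight_def)
  have \<rho>m [measurable]: "\<rho> \<in> borel_measurable borel" using borel_measurable_integrable[OF \<rho>(1)] by simp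
  let ?c = "\<lambda>q::real \<times> (real^'n). ennreal (fst q powr \<alpha> * \<rho> (snd q)) * indicator {0..T} (fst q)"
  let ?K = "\<lambda>U q. ennreal ((cmod (Kop M (phase \<alpha> (fst q)) (snd q) U))\<^sup>2)"
  have c0: "0 \<le> fst q powr \<alpha> * \<rho> (snd q)" for q using \<rho>(2) by simp
  have S: "(\<integral>\<^sup>+q. ?c q * ?K U q \<partial>lborel) \<le> ennreal (smE \<alpha> T * C) * ennreal ((norm U)\<^sup>2)" for U
  proof -
    have "(\<integral>\<^sup>+q. ?c q * ?K U q \<partial>lborel) = (\<integral>\<^sup>+q. ennreal (fst q powr \<alpha> * \<rho> (snd q) * (cmod (Kop M (phase \<alpha> (fst q)) (snd q) U))\<^sup>2) * indicator {0..T} (fst q) \<partial>lborel)"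
      by (intro nn_integral_cong) (subst ennreal_mult[OF c0 zero_le_power2], simp only: mult_ac)
    then show ?thesis using linear_smoothing[OF \<alpha> T w] by simp
  qed
  have cm: "?c \<in> borel_measurable lborel" unfolding lborel_prod[symmetric] by measurable
  have Km: "?K U \<in> borel_measurable lborel" for U
  proof -
    have "(\<lambda>q. Kop M (phase \<alpha> (fst q)) (snd q) U) \<in> borel_measurable (lborel \<Otimes>\<^sub>M lborel)"
      by (rule Kop_measurable[where k="\<lambda>_. 0" and U="\<lambda>_. U"]) measurable
    then show ?thesis unfolding lborel_prod by measurable
  qed
  have KGm: "(\<lambda>(q, \<tau>). ?K (G \<tau>) q) \<in> borel_measurable (lborel \<Otimes>\<^sub>M lborel)"
  proof -
    have 1: "(\<lambda>p::(real \<times> (real^'n)) \<times> real. fst (fst p)) \<in> borel_measurable (lborel \<Otimes>\<^sub>M lborel)"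
      "(\<lambda>p::(real \<times> (real^'n)) \<times> real. snd (fst p)) \<in> borel_measurable (lborel \<Otimes>\<^sub>M lborel)"
      unfolding lborel_prod by (auto intro!: borel_measurable_continuous_onI continuous_intros)
    have "(\<lambda>p. Kop M (phase \<alpha> (fst (fst p))) (snd (fst p)) (G (snd p))) \<in> borel_measurable (lborel \<Otimes>\<^sub>M lborel)"
      by (rule Kop_measurable[OF _ 1(2) _ G]) (use 1(1) in measurable)
    then show ?thesis unfolding split_def by measurable
  qed
  let ?J = "\<lambda>q. (\<integral>\<^sup>+\<tau>. ?K (G \<tau>) q * indicator {0..T} \<tau> \<partial>lborel)"
  have KGm': "(\<lambda>(q, \<tau>). ?K (G \<tau>) q * indicator {0..T} \<tau>) \<in> borel_measurable (lborel \<Otimes>\<^sub>M lborel)"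
    using KGm unfolding split_def by measurable
  have Jm: "?J \<in> borel_measurable lborel" by (rule lborel.borel_measurable_nn_integral[OF KGm'])
  have pt: "ennreal (fst q powr \<alpha> * \<rho> (snd q) * (cmod (Kop M (phase \<alpha> (fst q)) (snd q) (V (fst q))))\<^sup>2) * indicator {0..T} (fst q) \<le> 2 * (?c q * ?K U0 q) + 2 * (ennreal T * (?c q * ?J q))" for q :: "real \<times> (real^'n)"
  proof (cases "fst q \<in> {0..T}")
    case True
    let ?k = "Kop M (phase \<alpha> (fst q)) (snd q)"
    interpret k: bounded_linear ?k by (rule bounded_linear_Kop)
    have G': "continuous_on {0..fst q} G" by (rule continuous_on_subset[OF G]) simp
    have "?k (V (fst q)) = ?k U0 + integral {0..fst q} (\<lambda>\<tau>. ?k (G \<tau>))"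
      unfolding V[OF True] k.add
      using integral_linear[OF integrable_continuous_interval[OF G'] bounded_linear_Kop] by (simp add: comp_def)
    then have "cmod (?k (V (fst q))) \<le> cmod (?k U0) + cmod (integral {0..fst q} (\<lambda>\<tau>. ?k (G \<tau>)))" by (simp add: norm_triangle_ineq)
    then have "(ennreal (cmod (?k (V (fst q)))))\<^sup>2 \<le> (ennreal (cmod (?k U0)) + ennreal (cmod (integral {0..fst q} (\<lambda>\<tau>. ?k (G \<tau>)))))\<^sup>2"
      by (intro power_mono) (simp_all add: ennreal_leI flip: ennreal_plus)
    also have "\<dots> \<le> 2 * ((ennreal (cmod (?k U0)))\<^sup>2 + (ennreal (cmod (integral {0..fst q} (\<lambda>\<tau>. ?k (G \<tau>)))))\<^sup>2)" by (rule ennreal_sum_sq_le)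
    also have "(ennreal (cmod (integral {0..fst q} (\<lambda>\<tau>. ?k (G \<tau>)))))\<^sup>2 \<le> ennreal T * ?J q"
      unfolding ennreal_power[OF norm_ge_zero]
      by (rule integral_sq_le) (use True in \<open>auto intro!: k.continuous_on G\<close>)
    finally have main: "?K (V (fst q)) q \<le> 2 * (?K U0 q + ennreal T * ?J q)"
      by (simp add: ennreal_power add_left_mono mult_left_mono)
    have "ennreal (fst q powr \<alpha> * \<rho> (snd q) * (cmod (?k (V (fst q))))\<^sup>2) * indicator {0..T} (fst q) = ?c q * ?K (V (fst q)) q"
      by (subst ennreal_mult[OF c0 zero_le_power2]) (simp only: mult_ac)
    also have "\<dots> \<le> ?c q * (2 * (?K U0 q + ennreal T * ?J q))" by (intro mult_left_mono main) simp
    also have "\<dots> = 2 * (?c q * ?K U0 q) + 2 * (ennreal T * (?c q * ?J q))" by (simp only: distrib_left mult_ac)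
    finally show ?thesis .
  qed simp
  have "(\<integral>\<^sup>+q. ennreal (fst q powr \<alpha> * \<rho> (snd q) * (cmod (Kop M (phase \<alpha> (fst q)) (snd q) (V (fst q))))\<^sup>2) * indicator {0..T} (fst q) \<partial>lborel)
     \<le> (\<integral>\<^sup>+q. 2 * (?c q * ?K U0 q) + 2 * (ennreal T * (?c q * ?J q)) \<partial>lborel)"
    by (rule nn_integral_mono) (rule pt)
  also have "\<dots> = (\<integral>\<^sup>+q. 2 * (?c q * ?K U0 q) \<partial>lborel) + (\<integral>\<^sup>+q. 2 * (ennreal T * (?c q * ?J q)) \<partial>lborel)"
    by (rule nn_integral_add) (use cm Km Jm in measurable)
  also have "(\<integral>\<^sup>+q. 2 * (?c q * ?K U0 q) \<partial>lborel) = 2 * (\<integral>\<^sup>+q. ?c q * ?K U0 q \<partial>lborel)"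
    by (rule nn_integral_cmult) (use cm Km in measurable)
  also have "(\<integral>\<^sup>+q. 2 * (ennreal T * (?c q * ?J q)) \<partial>lborel) = 2 * (ennreal T * (\<integral>\<^sup>+q. ?c q * ?J q \<partial>lborel))"
    by (subst nn_integral_cmult, use cm Jm in measurable, subst nn_integral_cmult, use cm Jm in measurable)
  also have "(\<integral>\<^sup>+q. ?c q * ?J q \<partial>lborel) = (\<integral>\<^sup>+q. (\<integral>\<^sup>+\<tau>. ?c q * (?K (G \<tau>) q * indicator {0..T} \<tau>) \<partial>lborel) \<partial>lborel)"
  proof (rule nn_integral_cong)
    fix q :: "real \<times> (real^'n)"
    have "(\<lambda>\<tau>. ?K (G \<tau>) q * indicator {0..T} \<tau>) \<in> borel_measurable lborel"
      using measurable_Pair2[OF KGm', of q] by simp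
    from nn_integral_cmult[OF this, of "?c q"] show "?c q * ?J q = (\<integral>\<^sup>+\<tau>. ?c q * (?K (G \<tau>) q * indicator {0..T} \<tau>) \<partial>lborel)" by (rule sym)
  qed
  also have "\<dots> = (\<integral>\<^sup>+\<tau>. (\<integral>\<^sup>+q. ?c q * (?K (G \<tau>) q * indicator {0..T} \<tau>) \<partial>lborel) \<partial>lborel)"
    by (rule lborel_pair.Fubini'[symmetric]) (use KGm' cm in \<open>unfold split_def, measurable\<close>)
  also have "\<dots> \<le> (\<integral>\<^sup>+\<tau>. ennreal (smE \<alpha> T * C) * (ennreal ((norm (G \<tau>))\<^sup>2) * indicator {0..T} \<tau>) \<partial>lborel)"
  proof (rule nn_integral_mono)
    fix \<tau> :: real
    have "(\<integral>\<^sup>+q. ?c q * (?K (G \<tau>) q * indicator {0..T} \<tau>) \<partial>lborel) = (\<integral>\<^sup>+q. (?c q * ?K (G \<tau>) q) * indicator {0..T} \<tau> \<partial>lborel)" by (simp only: mult.assoc)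
    also have "\<dots> = (\<integral>\<^sup>+q. ?c q * ?K (G \<tau>) q \<partial>lborel) * indicator {0..T} \<tau>"
      by (rule nn_integral_multc) (use cm Km in measurable)
    also have "\<dots> \<le> (ennreal (smE \<alpha> T * C) * ennreal ((norm (G \<tau>))\<^sup>2)) * indicator {0..T} \<tau>" by (intro mult_right_mono S) simp
    finally show "(\<integral>\<^sup>+q. ?c q * (?K (G \<tau>) q * indicator {0..T} \<tau>) \<partial>lborel) \<le> ennreal (smE \<alpha> T * C) * (ennreal ((norm (G \<tau>))\<^sup>2) * indicator {0..T} \<tau>)" by (simp only: mult.assoc)
  qed
  also have "\<dots> = ennreal (smE \<alpha> T * C) * (\<integral>\<^sup>+\<tau>. ennreal ((norm (G \<tau>))\<^sup>2) * indicator {0..T} \<tau> \<partial>lborel)"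
  proof (rule nn_integral_cmult)
    have [measurable]: "(\<lambda>\<tau>. norm (G \<tau>)) \<in> borel_measurable borel"
      by (intro borel_measurable_continuous_onI continuous_on_norm G)
    show "(\<lambda>\<tau>. ennreal ((norm (G \<tau>))\<^sup>2) * indicator {0..T} \<tau>) \<in> borel_measurable lborel" by measurable
  qed
  finally have "(\<integral>\<^sup>+q. ennreal (fst q powr \<alpha> * \<rho> (snd q) * (cmod (Kop M (phase \<alpha> (fst q)) (snd q) (V (fst q))))\<^sup>2) * indicator {0..T} (fst q) \<partial>lborel)
    \<le> 2 * (\<integral>\<^sup>+q. ?c q * ?K U0 q \<partial>lborel) + 2 * (ennreal T * (ennreal (smE \<alpha> T * C) * (\<integral>\<^sup>+\<tau>. ennreal ((norm (G \<tau>))\<^sup>2) * indicator {0..T} \<tau> \<partial>lborel)))"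
    by (simp add: add_left_mono mult_left_mono)
  also have "\<dots> \<le> 2 * (ennreal (smE \<alpha> T * C) * ennreal ((norm U0)\<^sup>2)) + 2 * (ennreal T * (ennreal (smE \<alpha> T * C) * (\<integral>\<^sup>+\<tau>. ennreal ((norm (G \<tau>))\<^sup>2) * indicator {0..T} \<tau> \<partial>lborel)))"
    by (intro add_right_mono mult_left_mono S) simp
  also have "\<dots> = ennreal (smE \<alpha> T * C) * duh_bound T U0 G"
    unfolding duh_bound_def by (simp only: distrib_left mult_ac)
  finally show ?thesis .
qed

end

section \<open>Smoothing of the solution\<close>

text \<open>Continuity is imposed on the whole line so that \<open>Kop\<close> along these curves is
  measurable in all variables; the Duhamel formula is imposed on [0,T].\<close>

locale duhamel_curve = sobolev_space s n_type for s and n_type :: "'n::finite itself" +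
  fixes \<alpha> T :: real and U0 :: "(real^'n) lsq" and G V :: "real \<Rightarrow> (real^'n) lsq"
  assumes \<alpha>: "\<alpha> > 0" and T: "T > 0" and G: "continuous_on UNIV G" and Vc: "continuous_on UNIV V"
    and V: "\<And>t. t \<in> {0..T} \<Longrightarrow> V t = U0 + integral {0..t} G"
begin

text \<open>A reference weight that is positive everywhere, so the limit can be formed in one
  weighted L2 space and divided by the weight afterwards. It is written with x - 0 to be the
  instance b = 0 of the translated Gaussians.\<close>

definition gw :: "real^'n \<Rightarrow> real" where "gw x = exp (- ((norm (x - 0))\<^sup>2 / 2))"

definition gC :: real where "gC = (SOME C. \<forall>b. smoothing_weight (\<lambda>x. exp (- ((norm (x - b))\<^sup>2 / 2))) C)"

lemma gC: "smoothing_weight (\<lambda>x. exp (- ((norm (x - b))\<^sup>2 / 2))) gC"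
proof -
  have "\<forall>b. smoothing_weight (\<lambda>x. exp (- ((norm (x - b))\<^sup>2 / 2))) gC"
    unfolding gC_def by (rule someI_ex[OF smoothing_weight_gauss])
  then show ?thesis ..
qed

lemma gC_gw: "smoothing_weight gw gC" unfolding gw_def[abs_def] by (rule gC)

definition sw :: "real \<times> (real^'n) \<Rightarrow> real" where
  "sw q = sqrt (fst q powr \<alpha> * gw (snd q)) * indicator {0..T} (fst q)"

lemma fst_snd_measurable [measurable]:
  "(fst :: real \<times> (real^'n) \<Rightarrow> real) \<in> borel_measurable borel" "(snd :: real \<times> (real^'n) \<Rightarrow> real^'n) \<in> borel_measurable borel"
  by (auto intro!: borel_measurable_continuous_onI continuous_intros)

lemma gw_measurable [measurable]: "gw \<in> borel_measurable borel" unfolding gw_def[abs_def] by measurable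

lemma gw_pos: "gw x > 0" by (simp add: gw_def)

lemma sw_measurable [measurable]: "sw \<in> borel_measurable borel" unfolding sw_def[abs_def] by measurable

lemma sw_sq: "ennreal ((cmod (of_real (sw q) * z))\<^sup>2) = ennreal (fst q powr \<alpha> * gw (snd q) * (cmod z)\<^sup>2) * indicator {0..T} (fst q)"
proof (cases "fst q \<in> {0..T}")
  case True
  have "(sw q)\<^sup>2 = fst q powr \<alpha> * gw (snd q)" using True gw_pos[of "snd q"] by (simp add: sw_def)
  then show ?thesis using True by (simp add: norm_mult power_mult_distrib)
qed (simp add: sw_def)

definition wn :: "nat \<Rightarrow> real \<times> (real^'n) \<Rightarrow> complex" where
  "wn n q = Kop (real n) (phase \<alpha> (fst q)) (snd q) (V (fst q))"

lemma wn_measurable [measurable]: "wn n \<in> borel_measurable borel"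
  unfolding wn_def[abs_def] by (rule Kop_measurable[OF _ _ _ Vc]) measurable

definition Wn :: "nat \<Rightarrow> real \<times> (real^'n) \<Rightarrow> complex" where "Wn n q = of_real (sw q) * wn n q"

lemma Wn_measurable [measurable]: "Wn n \<in> borel_measurable borel"
  unfolding Wn_def[abs_def] by measurable

text \<open>Keeps the frequencies above n. The difference of two truncated derivatives is then a
  truncated derivative of cut data, by \<open>Kop_cut\<close>.\<close>

definition cut :: "nat \<Rightarrow> (real^'n) lsq \<Rightarrow> (real^'n) lsq" where
  "cut n = lmult (indicator (- cball 0 (real n)))"

lemma cut_mult: "(indicator (- cball 0 (real n)) :: real^'n \<Rightarrow> complex) \<in> borel_measurable borel"
  "cmod (indicator (- cball (0::real^'n) (real n)) x) \<le> 1"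
proof -
  have "- cball (0::real^'n) (real n) \<in> sets borel" by (intro borel_open open_Compl closed_cball)
  then show "(indicator (- cball 0 (real n)) :: real^'n \<Rightarrow> complex) \<in> borel_measurable borel" by simp
qed (simp add: indicator_def)

lemma bounded_linear_cut: "bounded_linear (cut n)"
  unfolding cut_def by (rule bounded_linear_lmult[OF cut_mult])

lemma norm_cut_le: "norm (cut n U) \<le> norm U"
  unfolding cut_def using norm_lmult_le[OF cut_mult, of n U] by simp

lemma cut_tendsto: "(\<lambda>n. cut n U) \<longlonglongrightarrow> 0"
proof -
  have "(\<lambda>n. cut n U) \<longlonglongrightarrow> lmult (\<lambda>_. 0) U"
    unfolding cut_def
  proof (rule tendsto_lmult[where C=1])
    fix x :: "real^'n"
    obtain k :: nat where k: "norm x \<le> real k" using real_arch_simple by blast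
    have "\<forall>\<^sub>F n in sequentially. indicator (- cball 0 (real n)) x = (0::complex)"
      using eventually_ge_at_top[of k]
    proof eventually_elim
      case (elim n)
      then have "norm x \<le> real n" using k by simp
      then show ?case by (simp add: indicator_def)
    qed
    then show "(\<lambda>n. indicator (- cball 0 (real n)) x) \<longlonglongrightarrow> (0::complex)" by (rule tendsto_eventually)
  qed (auto intro: cut_mult)
  moreover have "lmult (\<lambda>_. 0) U = 0" by (simp add: lmult_def zero_lsq_def)
  ultimately show ?thesis by simp
qed

lemma Kop_cut:
  assumes "n \<le> m" shows "Kop (real m) r x (cut n U) = Kop (real m) r x U - Kop (real n) r x U"
proof -
  have "Kop (real m) r x (cut n U) = (LINT \<xi>|lborel. kf (real m) r x \<xi> * (indicator (- cball 0 (real n)) \<xi> * rep_lsq U \<xi>))"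
    unfolding Kop_def cut_def lmult_def by (rule pair_abs[OF sqi_kf sqi_lmult[OF cut_mult]])
  also have "\<dots> = (LINT \<xi>|lborel. kf (real m) r x \<xi> * rep_lsq U \<xi> - kf (real n) r x \<xi> * rep_lsq U \<xi>)"
  proof (rule Bochner_Integration.integral_cong[OF refl])
    fix \<xi> :: "real^'n"
    show "kf (real m) r x \<xi> * (indicator (- cball 0 (real n)) \<xi> * rep_lsq U \<xi>) = kf (real m) r x \<xi> * rep_lsq U \<xi> - kf (real n) r x \<xi> * rep_lsq U \<xi>"
    proof (cases "norm \<xi> \<le> real n")
      case True
      then have "norm \<xi> \<le> real m" using assms by simp
      with True show ?thesis by (simp add: kf_def mm_def indicator_def)
    qed (simp add: kf_def mm_def indicator_def)
  qed
  also have "\<dots> = Kop (real m) r x U - Kop (real n) r x U"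
    unfolding Kop_def pair_def by (intro Bochner_Integration.integral_diff sqi_mult_integrable sqi_kf sqi_rep)
  finally show ?thesis .
qed

lemma cut_V: "t \<in> {0..T} \<Longrightarrow> cut n (V t) = cut n U0 + integral {0..t} (\<lambda>\<tau>. cut n (G \<tau>))"
proof -
  assume t: "t \<in> {0..T}"
  have "continuous_on {0..t} G" by (rule continuous_on_subset[OF G]) simp
  from integral_linear[OF integrable_continuous_interval[OF this] bounded_linear_cut, of n]
  show ?thesis unfolding V[OF t] by (simp add: comp_def linear_add[OF bounded_linear.linear[OF bounded_linear_cut]])
qed

lemma weighted_bound:
  assumes "continuous_on UNIV G'" "\<And>t. t \<in> {0..T} \<Longrightarrow> V' t = U' + integral {0..t} G'"
  shows "(\<integral>\<^sup>+q. ennreal ((cmod (of_real (sw q) * Kop M (phase \<alpha> (fst q)) (snd q) (V' (fst q))))\<^sup>2) \<partial>lborel) \<le> ennreal (smE \<alpha> T * gC) * duh_bound T U' G'"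
  unfolding sw_sq by (rule duhamel_smoothing[OF \<alpha> T gC_gw assms])

lemma nn_integral_G_finite: "(\<integral>\<^sup>+\<tau>. ennreal ((norm (G \<tau>))\<^sup>2) * indicator {0..T} \<tau> \<partial>lborel) < \<infinity>"
proof -
  have "compact (G ` {0..T})" by (rule compact_continuous_image[OF continuous_on_subset[OF G]]) auto
  then have "bounded (G ` {0..T})" by (rule compact_imp_bounded)
  then obtain B where "\<forall>v\<in>G ` {0..T}. norm v \<le> B" unfolding bounded_iff ..
  then have B: "norm (G \<tau>) \<le> B" if "\<tau> \<in> {0..T}" for \<tau> using that by simp
  have "(\<integral>\<^sup>+\<tau>. ennreal ((norm (G \<tau>))\<^sup>2) * indicator {0..T} \<tau> \<partial>lborel) \<le> (\<integral>\<^sup>+\<tau>. ennreal (B\<^sup>2) * indicator {0..T} \<tau> \<partial>lborel)"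
    by (intro nn_integral_mono) (auto simp: indicator_def intro!: ennreal_leI power_mono B)
  also have "\<dots> = ennreal (B\<^sup>2) * ennreal T" using T by (subst nn_integral_cmult) auto
  also have "\<dots> < \<infinity>" by (simp add: ennreal_mult_less_top)
  finally show ?thesis .
qed

lemma duh_bound_finite: "duh_bound T U0 G < \<infinity>"
  unfolding duh_bound_def using nn_integral_G_finite by (simp add: ennreal_mult_less_top)

lemma sqi_Wn: "sqi (Wn n)"
proof (rule sqi_nn_integral)
  have "(\<integral>\<^sup>+q. ennreal ((cmod (Wn n q))\<^sup>2) \<partial>lborel) \<le> ennreal (smE \<alpha> T * gC) * duh_bound T U0 G"
    unfolding Wn_def wn_def by (rule weighted_bound[OF G V])
  also have "\<dots> < \<infinity>" using duh_bound_finite by (simp add: ennreal_mult_less_top)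
  finally show "(\<integral>\<^sup>+q. ennreal ((cmod (Wn n q))\<^sup>2) \<partial>lborel) < \<infinity>" .
qed measurable

definition tailb :: "nat \<Rightarrow> ennreal" where
  "tailb n = ennreal (smE \<alpha> T * gC) * duh_bound T (cut n U0) (\<lambda>\<tau>. cut n (G \<tau>))"

text \<open>The cut curve satisfies the Duhamel formula with cut data and cut integrand, so the same
  estimate applies to it with a constant independent of m.\<close>

lemma Wn_diff: "n \<le> m \<Longrightarrow> ennreal ((norm (abs_lsq (Wn m) - abs_lsq (Wn n)))\<^sup>2) \<le> tailb n"
proof -
  assume nm: "n \<le> m"
  have "ennreal ((norm (abs_lsq (Wn m) - abs_lsq (Wn n)))\<^sup>2) = (\<integral>\<^sup>+q. ennreal ((cmod (Wn m q - Wn n q))\<^sup>2) \<partial>lborel)"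
    by (simp add: nn_integral_abs_lsq sqi_diff sqi_Wn abs_lsq_diff)
  also have "\<dots> = (\<integral>\<^sup>+q. ennreal ((cmod (of_real (sw q) * Kop (real m) (phase \<alpha> (fst q)) (snd q) (cut n (V (fst q)))))\<^sup>2) \<partial>lborel)"
    unfolding Wn_def wn_def Kop_cut[OF nm] right_diff_distrib ..
  also have "\<dots> \<le> tailb n" unfolding tailb_def
    by (rule weighted_bound[OF bounded_linear.continuous_on[OF bounded_linear_cut G] cut_V])
  finally show ?thesis .
qed

text \<open>The cut-offs tend strongly to 0; under the \<tau> integral this is dominated convergence
  with the uncut norm as majorant.\<close>

lemma tailb_tendsto: "tailb \<longlonglongrightarrow> 0"
proof -
  have a: "(\<lambda>n. ennreal ((norm (cut n U))\<^sup>2)) \<longlonglongrightarrow> 0" for U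
  proof -
    have "(\<lambda>n. (norm (cut n U))\<^sup>2) \<longlonglongrightarrow> (norm (0::(real^'n) lsq))\<^sup>2"
      by (intro tendsto_power tendsto_norm cut_tendsto)
    from tendsto_ennrealI[OF this] show ?thesis by simp
  qed
  have b: "(\<lambda>n. \<integral>\<^sup>+\<tau>. ennreal ((norm (cut n (G \<tau>)))\<^sup>2) * indicator {0..T} \<tau> \<partial>lborel) \<longlonglongrightarrow> (\<integral>\<^sup>+(\<tau>::real). 0 \<partial>lborel)"
  proof (rule nn_integral_dominated_convergence[where w="\<lambda>\<tau>. ennreal ((norm (G \<tau>))\<^sup>2) * indicator {0..T} \<tau>"])
    have [measurable]: "(\<lambda>\<tau>. norm (cut n (G \<tau>))) \<in> borel_measurable borel" for n
      by (intro borel_measurable_continuous_onI continuous_on_norm bounded_linear.continuous_on[OF bounded_linear_cut] G)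
    have [measurable]: "(\<lambda>\<tau>. norm (G \<tau>)) \<in> borel_measurable borel"
      by (intro borel_measurable_continuous_onI continuous_on_norm G)
    show "(\<lambda>\<tau>. ennreal ((norm (cut n (G \<tau>)))\<^sup>2) * indicator {0..T} \<tau>) \<in> borel_measurable lborel" for n by measurable
    show "(\<lambda>\<tau>. ennreal ((norm (G \<tau>))\<^sup>2) * indicator {0..T} \<tau>) \<in> borel_measurable lborel" by measurable
    show "AE \<tau> in lborel. ennreal ((norm (cut n (G \<tau>)))\<^sup>2) * indicator {0..T} \<tau> \<le> ennreal ((norm (G \<tau>))\<^sup>2) * indicator {0..T} \<tau>" for n
      by (intro AE_I2 mult_right_mono ennreal_leI power_mono norm_cut_le) auto
    show "AE \<tau> in lborel. (\<lambda>n. ennreal ((norm (cut n (G \<tau>)))\<^sup>2) * indicator {0..T} \<tau>) \<longlonglongrightarrow> 0"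
    proof (intro AE_I2)
      fix \<tau> :: real
      show "(\<lambda>n. ennreal ((norm (cut n (G \<tau>)))\<^sup>2) * indicator {0..T} \<tau>) \<longlonglongrightarrow> 0"
        using a[of "G \<tau>"] by (cases "\<tau> \<in> {0..T}") auto
    qed
  qed (use nn_integral_G_finite in auto)
  have c: "(\<lambda>n. ennreal T * (\<integral>\<^sup>+\<tau>. ennreal ((norm (cut n (G \<tau>)))\<^sup>2) * indicator {0..T} \<tau> \<partial>lborel)) \<longlonglongrightarrow> ennreal T * 0"
    using b by (intro ennreal_tendsto_cmult) auto
  have "(\<lambda>n. 2 * (ennreal ((norm (cut n U0))\<^sup>2) + ennreal T * (\<integral>\<^sup>+\<tau>. ennreal ((norm (cut n (G \<tau>)))\<^sup>2) * indicator {0..T} \<tau> \<partial>lborel))) \<longlonglongrightarrow> 2 * (0 + ennreal T * 0)"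
    by (intro ennreal_tendsto_cmult tendsto_add a c) simp
  then have "(\<lambda>n. ennreal (smE \<alpha> T * gC) * duh_bound T (cut n U0) (\<lambda>\<tau>. cut n (G \<tau>))) \<longlonglongrightarrow> ennreal (smE \<alpha> T * gC) * (2 * (0 + ennreal T * 0))"
    unfolding duh_bound_def by (rule ennreal_tendsto_cmult[rotated]) simp
  then show ?thesis unfolding tailb_def[abs_def] by simp
qed

lemma Cauchy_Wn: "Cauchy (\<lambda>n. abs_lsq (Wn n))"
  unfolding Cauchy_iff
proof (intro allI impI)
  fix e :: real assume e: "e > 0"
  have "ennreal ((e / 2)\<^sup>2) > 0" using e by simp
  then have "\<forall>\<^sub>F n in sequentially. tailb n < ennreal ((e / 2)\<^sup>2)" by (rule order_tendstoD(2)[OF tailb_tendsto])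
  then obtain N where N: "tailb N < ennreal ((e / 2)\<^sup>2)" unfolding eventually_sequentially by blast
  have d: "norm (abs_lsq (Wn m) - abs_lsq (Wn N)) < e / 2" if "m \<ge> N" for m
  proof -
    have "ennreal ((norm (abs_lsq (Wn m) - abs_lsq (Wn N)))\<^sup>2) < ennreal ((e / 2)\<^sup>2)"
      by (rule le_less_trans[OF Wn_diff[OF that] N])
    then have "(norm (abs_lsq (Wn m) - abs_lsq (Wn N)))\<^sup>2 < (e / 2)\<^sup>2" by (simp add: ennreal_less_iff)
    then show ?thesis by (rule power2_less_imp_less) (use e in simp)
  qed
  show "\<exists>M. \<forall>m\<ge>M. \<forall>n\<ge>M. norm (abs_lsq (Wn m) - abs_lsq (Wn n)) < e"
  proof (intro exI[of _ N] allI impI)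
    fix m n assume "m \<ge> N" "n \<ge> N"
    note d[OF this(1)] d[OF this(2)]
    moreover have "norm (abs_lsq (Wn m) - abs_lsq (Wn n)) \<le> norm (abs_lsq (Wn m) - abs_lsq (Wn N)) + norm (abs_lsq (Wn n) - abs_lsq (Wn N))"
      using norm_triangle_ineq4[of "abs_lsq (Wn m) - abs_lsq (Wn N)" "abs_lsq (Wn n) - abs_lsq (Wn N)"] by simp
    ultimately show "norm (abs_lsq (Wn m) - abs_lsq (Wn n)) < e" by linarith
  qed
qed

definition WL :: "(real \<times> (real^'n)) lsq" where "WL = lim (\<lambda>n. abs_lsq (Wn n))"

lemma Wn_tendsto: "(\<lambda>n. abs_lsq (Wn n)) \<longlonglongrightarrow> WL"
  unfolding WL_def using Cauchy_convergent[OF Cauchy_Wn] by (simp add: convergent_LIMSEQ_iff)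

text \<open>\<open>WL\<close> is the limit of the truncated derivatives multiplied by \<open>sw\<close>, so dividing by the weight recovers the
  derivative itself; at \<open>t \<le> 0\<close> the quotient is junk.\<close>

definition ww :: "real \<times> (real^'n) \<Rightarrow> complex" where
  "ww q = rep_lsq WL q / of_real (sqrt (fst q powr \<alpha> * gw (snd q)))"

lemma ww_measurable [measurable]: "ww \<in> borel_measurable borel"
  unfolding ww_def[abs_def] by measurable

definition err :: "nat \<Rightarrow> real \<times> (real^'n) \<Rightarrow> real" where "err n q = (cmod (Wn n q - rep_lsq WL q))\<^sup>2"

lemma err_integrable: "integrable lborel (err n)"
  unfolding err_def[abs_def] by (intro sqi_sq_integrable sqi_diff sqi_Wn sqi_rep)

lemma err_tendsto: "(\<lambda>n. LINT q|lborel. err n q) \<longlonglongrightarrow> 0"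
proof -
  have "(LINT q|lborel. err n q) = (norm (abs_lsq (Wn n) - WL))\<^sup>2" for n
  proof -
    have "abs_lsq (Wn n) - WL = abs_lsq (\<lambda>q. Wn n q - rep_lsq WL q)" by (simp add: abs_lsq_diff sqi_Wn sqi_rep abs_rep_lsq)
    then show ?thesis by (simp add: norm_abs_lsq_sq sqi_diff sqi_Wn sqi_rep err_def)
  qed
  moreover have "(\<lambda>n. (norm (abs_lsq (Wn n) - WL))\<^sup>2) \<longlonglongrightarrow> (norm (WL - WL))\<^sup>2"
    by (intro tendsto_power tendsto_norm tendsto_diff Wn_tendsto tendsto_const)
  ultimately show ?thesis by simp
qed

lemma sqrt_weight_pos: "t > 0 \<Longrightarrow> sqrt (t powr \<alpha> * gw x) > 0"
  using gw_pos[of x] by simp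

lemma Wn_eq: "t \<in> {0<..T} \<Longrightarrow> Wn n (t, x) = of_real (sqrt (t powr \<alpha> * gw x)) * wn n (t, x)"
  by (simp add: Wn_def sw_def)

lemma ww_pointwise_limit:
  obtains r :: "nat \<Rightarrow> nat" where "AE q in lborel. fst q \<in> {0<..T} \<longrightarrow> (\<lambda>n. wn (r n) q) \<longlonglongrightarrow> ww q"
proof -
  have "(\<lambda>n. LINT q|lborel. norm (err n q)) \<longlonglongrightarrow> 0" using err_tendsto by (simp add: err_def)
  from tendsto_L1_AE_subseq[OF err_integrable this]
  obtain r :: "nat \<Rightarrow> nat" where "AE q in lborel. (\<lambda>n. err (r n) q) \<longlonglongrightarrow> 0" by blast
  then have "AE q in lborel. fst q \<in> {0<..T} \<longrightarrow> (\<lambda>n. wn (r n) q) \<longlonglongrightarrow> ww q"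
  proof eventually_elim
    case (elim q)
    show ?case
    proof
      assume t: "fst q \<in> {0<..T}"
      let ?z = "complex_of_real (sqrt (fst q powr \<alpha> * gw (snd q)))"
      have z: "?z \<noteq> 0" using gw_pos[of "snd q"] t by simp
      have "(\<lambda>n. sqrt (err (r n) q)) \<longlonglongrightarrow> sqrt 0" by (rule tendsto_real_sqrt[OF elim])
      then have "(\<lambda>n. cmod (Wn (r n) q - rep_lsq WL q)) \<longlonglongrightarrow> 0" by (simp add: err_def)
      then have "(\<lambda>n. Wn (r n) q) \<longlonglongrightarrow> rep_lsq WL q" by (simp add: tendsto_norm_zero_iff LIM_zero_iff)
      then have "(\<lambda>n. Wn (r n) q / ?z) \<longlonglongrightarrow> ww q" unfolding ww_def by (intro tendsto_divide tendsto_const z)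
      moreover have "Wn (r n) q / ?z = wn (r n) q" for n
        using Wn_eq[OF t, of "r n" "snd q"] z by simp
      ultimately show "(\<lambda>n. wn (r n) q) \<longlonglongrightarrow> ww q" by simp
    qed
  qed
  then show ?thesis by (rule that)
qed

text \<open>The function \<open>ww\<close> was built with a single Gaussian weight, but it is an
  almost everywhere limit of truncated derivatives. Fatou's lemma therefore transfers the uniform
  bounds for every admissible weight to this one function.\<close>

lemma ww_bound:
  assumes w: "smoothing_weight \<rho> C"
  shows "(\<integral>\<^sup>+q. ennreal (fst q powr \<alpha> * \<rho> (snd q) * (cmod (ww q))\<^sup>2) * indicator {0..T} (fst q) \<partial>lborel) \<le> ennreal (smE \<alpha> T * C) * duh_bound T U0 G"
proof -
  have \<rho>: "integrable lborel \<rho>" using w by (auto simp: smoothing_weight_def)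
  have [measurable]: "\<rho> \<in> borel_measurable borel" using borel_measurable_integrable[OF \<rho>] by simp
  obtain r :: "nat \<Rightarrow> nat" where r: "AE q in lborel. fst q \<in> {0<..T} \<longrightarrow> (\<lambda>n. wn (r n) q) \<longlonglongrightarrow> ww q"
    by (rule ww_pointwise_limit)
  let ?f = "\<lambda>n q. ennreal (fst q powr \<alpha> * \<rho> (snd q) * (cmod (wn (r n) q))\<^sup>2) * indicator {0..T} (fst q)"
  have "(\<integral>\<^sup>+q. ennreal (fst q powr \<alpha> * \<rho> (snd q) * (cmod (ww q))\<^sup>2) * indicator {0..T} (fst q) \<partial>lborel) = (\<integral>\<^sup>+q. liminf (\<lambda>n. ?f n q) \<partial>lborel)"
  proof (rule nn_integral_cong_AE)
    show "AE q in lborel. ennreal (fst q powr \<alpha> * \<rho> (snd q) * (cmod (ww q))\<^sup>2) * indicator {0..T} (fst q) = liminf (\<lambda>n. ?f n q)"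
      using r
    proof eventually_elim
      case (elim q)
      have "(\<lambda>n. ?f n q) \<longlonglongrightarrow> ennreal (fst q powr \<alpha> * \<rho> (snd q) * (cmod (ww q))\<^sup>2) * indicator {0..T} (fst q)"
      proof (cases "fst q \<in> {0<..T}")
        case True
        then have "(\<lambda>n. wn (r n) q) \<longlonglongrightarrow> ww q" using elim by blast
        then have "(\<lambda>n. ennreal (fst q powr \<alpha> * \<rho> (snd q) * (cmod (wn (r n) q))\<^sup>2)) \<longlonglongrightarrow> ennreal (fst q powr \<alpha> * \<rho> (snd q) * (cmod (ww q))\<^sup>2)"
          by (intro tendsto_ennrealI tendsto_mult tendsto_const tendsto_power tendsto_norm)
        then show ?thesis using True by (simp add: indicator_def)
      next
        case False
        then have "fst q = 0 \<or> fst q \<notin> {0..T}" by auto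
        then show ?thesis using \<alpha> by auto
      qed
      then show ?case by (rule lim_imp_Liminf[OF sequentially_bot, symmetric])
    qed
  qed
  also have "\<dots> \<le> liminf (\<lambda>n. \<integral>\<^sup>+q. ?f n q \<partial>lborel)" by (rule nn_integral_liminf) measurable
  also have "\<dots> \<le> liminf (\<lambda>n::nat. ennreal (smE \<alpha> T * C) * duh_bound T U0 G)"
    unfolding wn_def by (intro Liminf_mono always_eventually allI duhamel_smoothing[OF \<alpha> T w G V])
  also have "\<dots> = ennreal (smE \<alpha> T * C) * duh_bound T U0 G" by (simp add: Liminf_const)
  finally show ?thesis .
qed

text \<open>The derivative is tested at fixed times, so convergence in space-time has to be turned
  into L2 convergence of sections. By Fubini the squared errors of the sections tend to 0 in L1 of
  time, hence along a subsequence for almost every t.\<close>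

lemma ww_section_limit:
  obtains r :: "nat \<Rightarrow> nat" where "strict_mono r"
    "AE t in lborel. sqi (\<lambda>x. rep_lsq WL (t, x)) \<and> (\<forall>n. sqi (\<lambda>x. Wn (r n) (t, x) - rep_lsq WL (t, x))) \<and>
       (\<lambda>n. norm (abs_lsq (\<lambda>x. Wn (r n) (t, x) - rep_lsq WL (t, x)))) \<longlonglongrightarrow> 0"
proof -
  have sec: "(\<lambda>x. f (t, x)) \<in> borel_measurable lborel" if "f \<in> borel_measurable borel" for f :: "real \<times> (real^'n) \<Rightarrow> complex" and t
  proof -
    have "(\<lambda>x. (t, x)) \<in> borel_measurable (borel :: (real^'n) measure)"
      by (intro borel_measurable_continuous_onI continuous_intros)
    from measurable_compose[OF this that] show ?thesis by simp
  qed
  have int: "integrable (lborel \<Otimes>\<^sub>M lborel) (err n)" for n unfolding lborel_prod by (rule err_integrable)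
  let ?D = "\<lambda>n t. LINT x|lborel. err n (t, x)"
  have Di: "integrable lborel (?D n)" for n by (rule lborel_pair.integrable_fst'[OF int])
  have D0: "?D n t \<ge> 0" for n t by (rule integral_nonneg_AE) (simp add: err_def)
  have "(LINT t|lborel. norm (?D n t)) = (LINT q|lborel. err n q)" for n
  proof -
    have "(LINT t|lborel. norm (?D n t)) = (LINT t|lborel. ?D n t)" using D0 by simp
    also have "\<dots> = integral\<^sup>L (lborel \<Otimes>\<^sub>M lborel) (err n)" by (rule lborel_pair.integral_fst'[OF int])
    finally show ?thesis unfolding lborel_prod .
  qed
  then have "(\<lambda>n. LINT t|lborel. norm (?D n t)) \<longlonglongrightarrow> 0" using err_tendsto by simp
  from tendsto_L1_AE_subseq[OF Di this]
  obtain r :: "nat \<Rightarrow> nat" where r: "strict_mono r" and lim: "AE t in lborel. (\<lambda>n. ?D (r n) t) \<longlonglongrightarrow> 0" by blast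
  have i1: "AE t in lborel. \<forall>n. integrable lborel (\<lambda>x. err (r n) (t, x))"
    unfolding AE_all_countable by (intro allI lborel_pair.AE_integrable_fst'[OF int])
  have "integrable (lborel \<Otimes>\<^sub>M lborel) (\<lambda>q. (cmod (rep_lsq WL q))\<^sup>2)" unfolding lborel_prod by (rule sqi_sq_integrable[OF sqi_rep])
  then have i2: "AE t in lborel. integrable lborel (\<lambda>x. (cmod (rep_lsq WL (t, x)))\<^sup>2)" by (rule lborel_pair.AE_integrable_fst')
  have "AE t in lborel. sqi (\<lambda>x. rep_lsq WL (t, x)) \<and> (\<forall>n. sqi (\<lambda>x. Wn (r n) (t, x) - rep_lsq WL (t, x))) \<and>
       (\<lambda>n. norm (abs_lsq (\<lambda>x. Wn (r n) (t, x) - rep_lsq WL (t, x)))) \<longlonglongrightarrow> 0"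
    using lim i1 i2
  proof eventually_elim
    case (elim t)
    have s1: "sqi (\<lambda>x. rep_lsq WL (t, x))" unfolding sqi_def using elim(3) sec[OF rep_measurable] by blast
    have s2: "sqi (\<lambda>x. Wn (r n) (t, x) - rep_lsq WL (t, x))" for n
      unfolding sqi_def using elim(2) sec[OF Wn_measurable[of "r n"], of t] sec[OF rep_measurable, of WL t] unfolding err_def by auto
    have "(\<lambda>n. sqrt (?D (r n) t)) \<longlonglongrightarrow> sqrt 0" by (rule tendsto_real_sqrt[OF elim(1)])
    moreover have "sqrt (?D (r n) t) = norm (abs_lsq (\<lambda>x. Wn (r n) (t, x) - rep_lsq WL (t, x)))" for n
      unfolding err_def norm_abs_lsq_sq[OF s2, symmetric] by simp
    ultimately show ?case using s1 s2 by simp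
  qed
  then show ?thesis by (rule that[OF r])
qed

end

section \<open>Identification of the limit with the fractional derivative\<close>

lemma
  fixes \<phi> :: "real^'n \<Rightarrow> complex"
  assumes [measurable]: "\<phi> \<in> borel_measurable borel" and B: "\<And>x. cmod (\<phi> x) \<le> B" and R: "\<And>x. norm x > R \<Longrightarrow> \<phi> x = 0"
  shows sqi_bounded_support: "sqi \<phi>" and integrable_bounded_support: "integrable lborel \<phi>"
proof -
  have fin: "emeasure lborel (cball (0::real^'n) R) < \<infinity>" by (rule emeasure_bounded_finite[OF bounded_cball])
  have si: "sqi (indicator (cball (0::real^'n) R) :: real^'n \<Rightarrow> complex)" by (rule sqi_indicator[OF _ fin]) simp
  have eq: "\<phi> x * indicator (cball 0 R) x = \<phi> x" for x using R[of x] by (cases "norm x \<le> R") (auto simp: indicator_def)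
  have "sqi (\<lambda>x. \<phi> x * indicator (cball 0 R) x)" by (rule sqi_mult_bounded[OF si assms(1) B])
  then show s: "sqi \<phi>" unfolding eq .
  from sqi_mult_integrable[OF s si] show "integrable lborel \<phi>" unfolding eq .
qed

lemma fourier1_reflect:
  fixes \<phi> :: "real^'n \<Rightarrow> complex"
  assumes [measurable]: "\<phi> \<in> borel_measurable borel"
  shows "fourier1 (\<lambda>x. \<phi> (- x)) \<xi> = fourier1 \<phi> (- \<xi>)"
proof -
  have "(LINT x|lborel. \<phi> (0 - x) * cis (- ((0 - x) \<bullet> - \<xi>))) = (LINT x|lborel. \<phi> x * cis (- (x \<bullet> - \<xi>)))"
    by (rule integral_reflect[of "\<lambda>x. \<phi> x * cis (- (x \<bullet> - \<xi>))" 0]) measurable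
  then show ?thesis by (simp add: fourier1_def)
qed

lemma wt_le_power: "wt (real d) \<xi> \<le> (1 + norm \<xi>) ^ d"
proof -
  have "wt (real d) \<xi> \<le> ((1 + norm \<xi>)\<^sup>2) powr (real d / 2)"
    unfolding wt_def by (intro powr_mono2) (auto simp: power2_eq_square algebra_simps)
  also have "(1 + norm \<xi>)\<^sup>2 = (1 + norm \<xi>) powr 2" by simp
  also have "((1 + norm \<xi>) powr 2) powr (real d / 2) = (1 + norm \<xi>) powr (real d)" by (simp only: powr_powr) simp
  also have "\<dots> = (1 + norm \<xi>) ^ d" by (rule powr_realpow) (simp add: add_pos_nonneg)
  finally show ?thesis .
qed

context sobolev_space
begin

text \<open>Up to reflection of x, the truncated derivative is the Fourier integral of an integrable
  function, so duality moves the transform onto the test function.\<close>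

lemma Kop_pairing:
  fixes \<phi> :: "real^'n \<Rightarrow> complex"
  assumes \<phi>: "test_fn \<phi>"
  shows "(LINT x|lborel. Kop M r x U * \<phi> x) = (LINT \<xi>|lborel. kf M r 0 \<xi> * rep_lsq U \<xi> * fourier1 \<phi> (- \<xi>))"
proof -
  obtain B R where m [measurable]: "\<phi> \<in> borel_measurable borel" and B: "\<And>x. cmod (\<phi> x) \<le> B" and R: "\<And>x. norm x > R \<Longrightarrow> \<phi> x = 0"
    using \<phi> unfolding test_fn_def bounded_iff by auto
  have pi: "integrable lborel (\<lambda>x. \<phi> (- x))"
    by (rule integrable_bounded_support[where B=B and R=R]) (use B R in auto)
  let ?a = "\<lambda>\<xi>. kf M r 0 \<xi> * rep_lsq U \<xi>"
  have ai: "integrable lborel ?a" by (rule sqi_mult_integrable[OF sqi_kf sqi_rep])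
  have am: "?a \<in> borel_measurable borel" using borel_measurable_integrable[OF ai] by simp
  have fm [measurable]: "fourier1 ?a \<in> borel_measurable borel" using am by (rule fourier1_measurable)
  have K: "Kop M r x U = fourier1 ?a (0 - x)" for x
    unfolding Kop_def pair_def fourier1_def
  proof (rule Bochner_Integration.integral_cong[OF refl])
    fix \<xi> :: "real^'n"
    have "cis (x \<bullet> \<xi> - r * (norm \<xi>)\<^sup>2) = cis (0 \<bullet> \<xi> - r * (norm \<xi>)\<^sup>2) * cis (- (\<xi> \<bullet> (0 - x)))"
      unfolding cis_mult by (simp add: inner_commute[of x \<xi>])
    then show "kf M r x \<xi> * rep_lsq U \<xi> = kf M r 0 \<xi> * rep_lsq U \<xi> * cis (- (\<xi> \<bullet> (0 - x)))"
      unfolding kf_def by (simp only: mult_ac)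
  qed
  have "(LINT x|lborel. Kop M r x U * \<phi> x) = (LINT x|lborel. fourier1 ?a (0 - x) * \<phi> (- (0 - x)))"
    unfolding K by simp
  also have "\<dots> = (LINT y|lborel. fourier1 ?a y * \<phi> (- y))"
    by (rule integral_reflect[of "\<lambda>y. fourier1 ?a y * \<phi> (- y)" 0]) measurable
  also have "\<dots> = (LINT \<xi>|lborel. ?a \<xi> * fourier1 (\<lambda>y. \<phi> (- y)) \<xi>)" by (rule fourier1_duality[OF ai pi])
  finally show ?thesis unfolding fourier1_reflect[OF m] .
qed

text \<open>Decay of order n + 1 is used: one power pays for the square root of |\<xi>|, the
  remaining n give the weight of order -n, which is square-integrable.\<close>

lemma test_fn_decay:
  fixes \<phi> :: "real^'n \<Rightarrow> complex"
  assumes "test_fn \<phi>"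
  obtains C where "\<And>\<xi>. sqrt (norm \<xi>) * cmod (fourier1 \<phi> (- \<xi>)) \<le> C * wt (- real CARD('n)) \<xi>"
proof -
  let ?d = "CARD('n)"
  obtain C where C: "\<And>\<xi>. (1 + norm \<xi>) ^ Suc ?d * cmod (fourier1 \<phi> \<xi>) \<le> C" using assms unfolding test_fn_def by blast
  have "sqrt (norm \<xi>) * cmod (fourier1 \<phi> (- \<xi>)) \<le> C * wt (- real ?d) \<xi>" for \<xi>
  proof -
    have s1: "sqrt (norm \<xi>) \<le> 1 + norm \<xi>"
      by (rule real_le_lsqrt) (auto simp: power2_eq_square algebra_simps)
    have "sqrt (norm \<xi>) * wt (real ?d) \<xi> \<le> (1 + norm \<xi>) * (1 + norm \<xi>) ^ ?d"
      by (rule mult_mono[OF s1 wt_le_power]) auto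
    then have "sqrt (norm \<xi>) * wt (real ?d) \<xi> * cmod (fourier1 \<phi> (- \<xi>)) \<le> (1 + norm (- \<xi>)) ^ Suc ?d * cmod (fourier1 \<phi> (- \<xi>))"
      by (intro mult_right_mono) auto
    also have "\<dots> \<le> C" by (rule C)
    finally have "sqrt (norm \<xi>) * wt (real ?d) \<xi> * cmod (fourier1 \<phi> (- \<xi>)) * wt (- real ?d) \<xi> \<le> C * wt (- real ?d) \<xi>"
      by (rule mult_right_mono) simp
    also have "sqrt (norm \<xi>) * wt (real ?d) \<xi> * cmod (fourier1 \<phi> (- \<xi>)) * wt (- real ?d) \<xi> = sqrt (norm \<xi>) * cmod (fourier1 \<phi> (- \<xi>)) * (wt (real ?d) \<xi> * wt (- real ?d) \<xi>)"
      by (simp only: mult_ac)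
    finally show ?thesis by simp
  qed
  then show ?thesis by (rule that)
qed

text \<open>Dominated convergence as the cut-off disappears: the majorant is a product of two
  square-integrable functions, the weight from \<open>test_fn_decay\<close> and the class
  \<open>U\<close>.\<close>

lemma Kop_pairing_limit:
  fixes \<phi> :: "real^'n \<Rightarrow> complex" and q :: "nat \<Rightarrow> nat"
  assumes \<phi>: "test_fn \<phi>" and q: "strict_mono q"
  shows "(\<lambda>n. LINT x|lborel. Kop (real (q n)) r x U * \<phi> x) \<longlonglongrightarrow>
    (LINT \<xi>|lborel. cn * (of_real (dsym \<xi>) * cis (- r * (norm \<xi>)\<^sup>2)) * rep_lsq U \<xi> * fourier1 \<phi> (- \<xi>))"
proof -
  have m [measurable]: "\<phi> \<in> borel_measurable borel" using \<phi> by (simp add: test_fn_def)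
  have fm [measurable]: "fourier1 \<phi> \<in> borel_measurable borel" by (rule fourier1_measurable[OF m])
  have Um [measurable]: "rep_lsq U \<in> borel_measurable borel" by (rule rep_measurable)
  have km [measurable]: "kf M r 0 \<in> borel_measurable borel" for M
    unfolding kf_def[abs_def] by measurable
  obtain C where C: "\<And>\<xi>. sqrt (norm \<xi>) * cmod (fourier1 \<phi> (- \<xi>)) \<le> C * wt (- real CARD('n)) \<xi>" using test_fn_decay[OF \<phi>] by blast
  have si: "sqi (\<lambda>\<xi>::real^'n. complex_of_real (wt (- real CARD('n)) \<xi>))" by (rule sqi_wt_neg) simp
  show ?thesis unfolding Kop_pairing[OF \<phi>]
  proof (rule integral_dominated_convergence[where w="\<lambda>\<xi>. cmod cn * C * cmod (of_real (wt (- real CARD('n)) \<xi>) * rep_lsq U \<xi>)"])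
    show "integrable lborel (\<lambda>\<xi>. cmod cn * C * cmod (of_real (wt (- real CARD('n)) \<xi>) * rep_lsq U \<xi>))"
      by (intro integrable_mult_right integrable_norm sqi_mult_integrable[OF si sqi_rep])
    show "AE \<xi> in lborel. (\<lambda>n. kf (real (q n)) r 0 \<xi> * rep_lsq U \<xi> * fourier1 \<phi> (- \<xi>)) \<longlonglongrightarrow>
      cn * (of_real (dsym \<xi>) * cis (- r * (norm \<xi>)\<^sup>2)) * rep_lsq U \<xi> * fourier1 \<phi> (- \<xi>)"
    proof (rule AE_I2, rule tendsto_eventually)
      fix \<xi> :: "real^'n"
      obtain k :: nat where k: "norm \<xi> \<le> real k" using real_arch_simple by blast
      show "\<forall>\<^sub>F n in sequentially. kf (real (q n)) r 0 \<xi> * rep_lsq U \<xi> * fourier1 \<phi> (- \<xi>) =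
        cn * (of_real (dsym \<xi>) * cis (- r * (norm \<xi>)\<^sup>2)) * rep_lsq U \<xi> * fourier1 \<phi> (- \<xi>)"
        using eventually_ge_at_top[of k]
      proof eventually_elim
        case (elim n)
        have "n \<le> q n" by (rule seq_suble[OF q])
        then have "norm \<xi> \<le> real (q n)" using k elim by simp
        then show ?case by (simp add: kf_def mm_def indicator_def)
      qed
    qed
    show "AE \<xi> in lborel. norm (kf (real (q n)) r 0 \<xi> * rep_lsq U \<xi> * fourier1 \<phi> (- \<xi>)) \<le> cmod cn * C * cmod (of_real (wt (- real CARD('n)) \<xi>) * rep_lsq U \<xi>)" for n
    proof (rule AE_I2)
      fix \<xi> :: "real^'n"
      have "mm (real (q n)) \<xi> * cmod (fourier1 \<phi> (- \<xi>)) \<le> C * wt (- real CARD('n)) \<xi>"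
        by (rule order_trans[OF mult_right_mono[OF mm_le] C]) simp
      then have "cmod cn * cmod (rep_lsq U \<xi>) * (mm (real (q n)) \<xi> * cmod (fourier1 \<phi> (- \<xi>))) \<le> cmod cn * cmod (rep_lsq U \<xi>) * (C * wt (- real CARD('n)) \<xi>)"
        by (rule mult_left_mono) simp
      then show "norm (kf (real (q n)) r 0 \<xi> * rep_lsq U \<xi> * fourier1 \<phi> (- \<xi>)) \<le> cmod cn * C * cmod (of_real (wt (- real CARD('n)) \<xi>) * rep_lsq U \<xi>)"
        unfolding norm_mult cmod_kf norm_of_real abs_of_nonneg[OF wt_nonneg] by (simp only: mult_ac)
    qed
  qed measurable
qed

lemma AE_FT_Hsol:
  "AE \<xi> in lborel. FT (Hsol \<alpha> V t) \<xi> = of_real (wt (- s) \<xi>) * (cis (- phase \<alpha> t * (norm \<xi>)\<^sup>2) * rep_lsq (V t) \<xi>)"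
proof -
  have "Hsol \<alpha> V t \<in> sobolev s" unfolding Hsol_def by (rule sobolev_emb)
  from fhat_lift[OF this] rep_evol[of "- phase \<alpha> t" "V t"] show ?thesis
  proof eventually_elim
    case (elim \<xi>)
    from elim(1)[symmetric] show ?case unfolding lift_Hsol fhat_def elim(2) .
  qed
qed

end

context duhamel_curve
begin

text \<open>For almost every t the pairing of the truncated derivatives with a test function has two
  limits: one on the frequency side by \<open>Kop_pairing_limit\<close>, one in physical space by
  convergence of the sections. Their equality is the defining identity.\<close>

lemma ww_is_Dx: "is_Dx (s + 1/2) T (Hsol \<alpha> V) ww"
  unfolding is_Dx_def
proof
  show "ww \<in> borel_measurable (lborel \<Otimes>\<^sub>M lborel)" by (simp add: lborel_prod)
  obtain q :: "nat \<Rightarrow> nat" where q: "strict_mono q"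
    and AE: "AE t in lborel. sqi (\<lambda>x. rep_lsq WL (t, x)) \<and> (\<forall>n. sqi (\<lambda>x. Wn (q n) (t, x) - rep_lsq WL (t, x))) \<and>
       (\<lambda>n. norm (abs_lsq (\<lambda>x. Wn (q n) (t, x) - rep_lsq WL (t, x)))) \<longlonglongrightarrow> 0"
    by (rule ww_section_limit)
  show "AE t in lborel. t \<in> {0..T} \<longrightarrow> (\<forall>\<phi>. test_fn \<phi> \<longrightarrow>
        integrable lborel (\<lambda>x. ww (t, x) * \<phi> x) \<and>
        (LINT x|lborel. ww (t, x) * \<phi> x) =
          of_real (1 / (2 * pi) ^ CARD('n)) *
          (LINT \<xi>|lborel. of_real (norm \<xi> powr (s + 1/2)) * FT (Hsol \<alpha> V t) \<xi> * fourier1 \<phi> (- \<xi>)))"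
    using AE AE_lborel_singleton[of 0]
  proof (eventually_elim, intro impI allI)
    case (elim t)
    fix \<phi> :: "real^'n \<Rightarrow> complex"
    assume "t \<in> {0..T}" and \<phi>: "test_fn \<phi>"
    then have t: "t \<in> {0<..T}" using elim(2) by simp
    have s1: "sqi (\<lambda>x. rep_lsq WL (t, x))" and s2: "\<And>n. sqi (\<lambda>x. Wn (q n) (t, x) - rep_lsq WL (t, x))"
      and lim: "(\<lambda>n. norm (abs_lsq (\<lambda>x. Wn (q n) (t, x) - rep_lsq WL (t, x)))) \<longlonglongrightarrow> 0" using elim(1) by auto
    obtain B R where m [measurable]: "\<phi> \<in> borel_measurable borel" and B: "\<And>x. cmod (\<phi> x) \<le> B" and R: "\<And>x. norm x > R \<Longrightarrow> \<phi> x = 0"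
      using \<phi> unfolding test_fn_def bounded_iff by auto
    define z where "z x = sqrt (t powr \<alpha> * gw x)" for x
    have z0: "z x > 0" for x unfolding z_def using sqrt_weight_pos t by simp
    \<comment> \<open>Dividing the test function by the weight, instead of the limit, turns the
      pairing into one between the L2 section of \<open>WL\<close> and an L2 function.\<close>
    define \<psi> where "\<psi> x = \<phi> x / of_real (z x)" for x
    have \<psi>: "sqi \<psi>"
    proof (rule sqi_bounded_support[where R=R and B="B / sqrt (t powr \<alpha> * exp (- (R\<^sup>2 / 2)))"])
      show "\<psi> \<in> borel_measurable borel" unfolding \<psi>_def[abs_def] z_def[abs_def] by measurable
      show "\<psi> x = 0" if "norm x > R" for x using R[OF that] by (simp add: \<psi>_def)
      \<comment> \<open>On the support |x| \<le> R the Gaussian is at least exp (- R^2 / 2), so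
        compact support is what keeps the quotient bounded.\<close>
      show "cmod (\<psi> x) \<le> B / sqrt (t powr \<alpha> * exp (- (R\<^sup>2 / 2)))" for x
      proof (cases "norm x > R")
        case True
        have "0 \<le> B" by (rule order_trans[OF norm_ge_zero B[of 0]])
        then show ?thesis using R[OF True] by (simp add: \<psi>_def)
      next
        case False
        then have "(norm x)\<^sup>2 \<le> R\<^sup>2" by (intro power_mono) auto
        then have "exp (- (R\<^sup>2 / 2)) \<le> gw x" by (simp add: gw_def)
        then have "sqrt (t powr \<alpha> * exp (- (R\<^sup>2 / 2))) \<le> z x" unfolding z_def by (intro real_sqrt_le_mono mult_left_mono) auto
        moreover have "0 < sqrt (t powr \<alpha> * exp (- (R\<^sup>2 / 2)))" using t by simp
        moreover have "cmod (\<psi> x) = cmod (\<phi> x) / z x" using z0[of x] by (simp add: \<psi>_def norm_divide)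
        ultimately show ?thesis using B[of x] by (simp only:) (rule frac_le, auto intro: order_trans[OF norm_ge_zero])
      qed
    qed
    have wwt: "ww (t, x) * \<phi> x = rep_lsq WL (t, x) * \<psi> x" for x
      by (simp add: ww_def \<psi>_def z_def)
    have wnt: "Kop (real (q n)) (phase \<alpha> t) x (V t) * \<phi> x = (Wn (q n) (t, x) - rep_lsq WL (t, x)) * \<psi> x + rep_lsq WL (t, x) * \<psi> x" for n x
    proof -
      have "Wn (q n) (t, x) = of_real (z x) * Kop (real (q n)) (phase \<alpha> t) x (V t)"
        unfolding Wn_eq[OF t] wn_def z_def by simp
      then show ?thesis using z0[of x] by (simp add: \<psi>_def field_simps)
    qed
    have i: "integrable lborel (\<lambda>x. ww (t, x) * \<phi> x)" unfolding wwt by (rule sqi_mult_integrable[OF s1 \<psi>])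
    let ?D = "\<lambda>n. pair \<psi> (abs_lsq (\<lambda>x. Wn (q n) (t, x) - rep_lsq WL (t, x)))"
    have eq: "(LINT x|lborel. Kop (real (q n)) (phase \<alpha> t) x (V t) * \<phi> x) = ?D n + (LINT x|lborel. ww (t, x) * \<phi> x)" for n
      unfolding wnt wwt pair_abs[OF \<psi> s2]
      by (subst Bochner_Integration.integral_add[OF sqi_mult_integrable[OF s2 \<psi>] sqi_mult_integrable[OF s1 \<psi>]]) (simp only: mult.commute)
    have "?D \<longlonglongrightarrow> 0"
    proof (rule Lim_null_comparison)
      show "\<forall>\<^sub>F n in sequentially. norm (?D n) \<le> norm (abs_lsq \<psi>) * norm (abs_lsq (\<lambda>x. Wn (q n) (t, x) - rep_lsq WL (t, x)))"
        by (intro always_eventually allI norm_pair_le \<psi>)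
      show "(\<lambda>n. norm (abs_lsq \<psi>) * norm (abs_lsq (\<lambda>x. Wn (q n) (t, x) - rep_lsq WL (t, x)))) \<longlonglongrightarrow> 0"
        by (rule tendsto_mult_right_zero[OF lim])
    qed
    from tendsto_add[OF this tendsto_const[of "LINT x|lborel. ww (t, x) * \<phi> x"]]
    have "(\<lambda>n. LINT x|lborel. Kop (real (q n)) (phase \<alpha> t) x (V t) * \<phi> x) \<longlonglongrightarrow> (LINT x|lborel. ww (t, x) * \<phi> x)"
      unfolding eq by simp
    from LIMSEQ_unique[OF this Kop_pairing_limit[OF \<phi> q]]
    have "(LINT x|lborel. ww (t, x) * \<phi> x) = (LINT \<xi>|lborel. cn * (of_real (dsym \<xi>) * cis (- phase \<alpha> t * (norm \<xi>)\<^sup>2)) * rep_lsq (V t) \<xi> * fourier1 \<phi> (- \<xi>))" .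
    also have "\<dots> = (LINT \<xi>|lborel. cn * (of_real (norm \<xi> powr (s + 1/2)) * FT (Hsol \<alpha> V t) \<xi> * fourier1 \<phi> (- \<xi>)))"
    proof (rule integral_cong_AE)
      have [measurable]: "fourier1 \<phi> \<in> borel_measurable borel" "rep_lsq (V t) \<in> borel_measurable borel"
        by (rule fourier1_measurable[OF m], rule rep_measurable)
      have "sqi (Hsol \<alpha> V t)" using sobolev_emb[of "evol (- phase \<alpha> t) (V t)"] unfolding Hsol_def sobolev_iff by blast
      from sqi_FT_abs(1)[OF this] have [measurable]: "FT (Hsol \<alpha> V t) \<in> borel_measurable borel" by (simp add: sqi_def)
      show "(\<lambda>\<xi>. cn * (of_real (dsym \<xi>) * cis (- phase \<alpha> t * (norm \<xi>)\<^sup>2)) * rep_lsq (V t) \<xi> * fourier1 \<phi> (- \<xi>)) \<in> borel_measurable lborel" by measurable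
      show "(\<lambda>\<xi>. cn * (of_real (norm \<xi> powr (s + 1/2)) * FT (Hsol \<alpha> V t) \<xi> * fourier1 \<phi> (- \<xi>))) \<in> borel_measurable lborel" by measurable
      show "AE \<xi> in lborel. cn * (of_real (dsym \<xi>) * cis (- phase \<alpha> t * (norm \<xi>)\<^sup>2)) * rep_lsq (V t) \<xi> * fourier1 \<phi> (- \<xi>) =
        cn * (of_real (norm \<xi> powr (s + 1/2)) * FT (Hsol \<alpha> V t) \<xi> * fourier1 \<phi> (- \<xi>))"
        using AE_FT_Hsol[of \<alpha> V t]
      proof eventually_elim
        case (elim \<xi>)
        show ?case unfolding elim dsym_def of_real_mult by (simp only: mult_ac)
      qed
    qed
    also have "\<dots> = cn * (LINT \<xi>|lborel. of_real (norm \<xi> powr (s + 1/2)) * FT (Hsol \<alpha> V t) \<xi> * fourier1 \<phi> (- \<xi>))"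
      by (rule integral_mult_right_zero)
    finally show "integrable lborel (\<lambda>x. ww (t, x) * \<phi> x) \<and> (LINT x|lborel. ww (t, x) * \<phi> x) =
          of_real (1 / (2 * pi) ^ CARD('n)) *
          (LINT \<xi>|lborel. of_real (norm \<xi> powr (s + 1/2)) * FT (Hsol \<alpha> V t) \<xi> * fourier1 \<phi> (- \<xi>))"
      using i unfolding cn_def by blast
  qed
qed

end

text \<open>The hypothesis is tested on the part of {F > K} inside a ball, a set of finite measure.
  There the nonnegative excess F - K integrates to 0, and countably many balls cover the
  space.\<close>

lemma AE_le_of_set_nn_integral_le:
  fixes F :: "'a::euclidean_space \<Rightarrow> ennreal"
  assumes [measurable]: "F \<in> borel_measurable borel" and K: "K < \<infinity>"
    and le: "\<And>A. A \<in> sets borel \<Longrightarrow> emeasure lborel A < \<infinity> \<Longrightarrow> (\<integral>\<^sup>+x. F x * indicator A x \<partial>lborel) \<le> K * emeasure lborel A"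
  shows "AE x in lborel. F x \<le> K"
proof -
  have "AE x in lborel. norm x \<le> real j \<longrightarrow> F x \<le> K" for j :: nat
  proof -
    define A where "A = {x. F x > K} \<inter> cball 0 (real j)"
    have A [measurable]: "A \<in> sets borel" unfolding A_def
      by (rule sets.Int[OF _ borel_closed[OF closed_cball]]) measurable
    have "emeasure lborel A \<le> emeasure lborel (cball (0::'a) (real j))" unfolding A_def by (rule emeasure_mono) auto
    also have "\<dots> < \<infinity>" by (rule emeasure_bounded_finite[OF bounded_cball])
    finally have fin: "emeasure lborel A < \<infinity>" .
    have KA: "(\<integral>\<^sup>+x. K * indicator A x \<partial>lborel) = K * emeasure lborel A" by (subst nn_integral_cmult) auto
    have Kfin: "K * emeasure lborel A < \<infinity>" using K fin by (simp add: ennreal_mult_less_top)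
    have "(\<integral>\<^sup>+x. F x * indicator A x - K * indicator A x \<partial>lborel) = (\<integral>\<^sup>+x. F x * indicator A x \<partial>lborel) - (\<integral>\<^sup>+x. K * indicator A x \<partial>lborel)"
    proof (rule nn_integral_diff)
      show "(\<integral>\<^sup>+x. K * indicator A x \<partial>lborel) \<noteq> \<infinity>" unfolding KA using Kfin by simp
      show "AE x in lborel. K * indicator A x \<le> F x * indicator A x" by (rule AE_I2) (auto simp: A_def indicator_def)
    qed measurable
    also have "\<dots> = 0" unfolding KA using le[OF A fin] Kfin by (simp add: diff_eq_0_iff_ennreal)
    finally have "AE x in lborel. F x * indicator A x - K * indicator A x = 0"
      by (subst (asm) nn_integral_0_iff_AE) auto
    then show ?thesis
    proof eventually_elim
      case (elim x)
      show ?case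
      proof (rule impI, rule ccontr)
        assume "norm x \<le> real j" and n: "\<not> F x \<le> K"
        then have "x \<in> A" by (simp add: A_def)
        then have "F x - K = 0" using elim by simp
        then show False using n K by (simp add: diff_eq_0_iff_ennreal)
      qed
    qed
  qed
  then have "AE x in lborel. \<forall>j::nat. norm x \<le> real j \<longrightarrow> F x \<le> K" unfolding AE_all_countable ..
  then show ?thesis
  proof eventually_elim
    case (elim x)
    obtain j :: nat where "norm x \<le> real j" using real_arch_simple by blast
    then show ?case using elim by blast
  qed
qed

text \<open>The Gaussian is centred at the lowest corner of the cube; every coordinate differs from
  it by at most 1, so the squared distance is at most the dimension.\<close>

lemma gauss_cube_bound:
  fixes \<beta> :: "'n::finite \<Rightarrow> int"
  assumes "x \<in> cube \<beta>"
  shows "1 \<le> exp (real CARD('n) / 2) * exp (- ((norm (x - (\<chi> i. of_int (\<beta> i))))\<^sup>2 / 2))"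
proof -
  let ?b = "(\<chi> i. of_int (\<beta> i)) :: real^'n"
  have "(norm (x - ?b))\<^sup>2 = (\<Sum>i\<in>UNIV. (x $ i - of_int (\<beta> i))\<^sup>2)"
    unfolding power2_norm_eq_inner inner_vec_def by (simp add: power2_eq_square)
  also have "\<dots> \<le> (\<Sum>i\<in>(UNIV::'n set). 1)"
  proof (rule sum_mono)
    fix i
    have "0 \<le> x $ i - of_int (\<beta> i)" "x $ i - of_int (\<beta> i) \<le> 1"
      using assms unfolding cube_def by (auto simp: less_imp_le algebra_simps dest!: spec[of _ i])
    then show "(x $ i - of_int (\<beta> i))\<^sup>2 \<le> 1" by (simp add: power_le_one)
  qed
  finally have "(norm (x - ?b))\<^sup>2 \<le> real CARD('n)" by simp
  then have "1 \<le> exp (real CARD('n) / 2 + - ((norm (x - ?b))\<^sup>2 / 2))" by simp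
  then show ?thesis unfolding exp_add .
qed

section \<open>Bounds on cubes and on lines\<close>

context duhamel_curve
begin

lemma ww_cube_bound:
  "\<exists>C::real. \<forall>\<beta>. (\<integral>\<^sup>+p. ennreal (fst p powr \<alpha> * (cmod (ww p))\<^sup>2) * indicator ({0..T} \<times> cube \<beta>) p \<partial>(lborel \<Otimes>\<^sub>M lborel)) \<le> ennreal C"
proof -
  let ?e = "exp (real CARD('n) / 2)"
  let ?K = "ennreal ?e * (ennreal (smE \<alpha> T * gC) * duh_bound T U0 G)"
  have K: "?K < \<infinity>" using duh_bound_finite by (simp add: ennreal_mult_less_top)
  have "(\<integral>\<^sup>+p. ennreal (fst p powr \<alpha> * (cmod (ww p))\<^sup>2) * indicator ({0..T} \<times> cube \<beta>) p \<partial>(lborel \<Otimes>\<^sub>M lborel)) \<le> ?K" for \<beta>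
  proof -
    let ?b = "(\<chi> i. of_int (\<beta> i)) :: real^'n"
    let ?g = "\<lambda>x. exp (- ((norm (x - ?b))\<^sup>2 / 2))"
    have "(\<integral>\<^sup>+p. ennreal (fst p powr \<alpha> * (cmod (ww p))\<^sup>2) * indicator ({0..T} \<times> cube \<beta>) p \<partial>lborel)
      \<le> (\<integral>\<^sup>+p. ennreal ?e * (ennreal (fst p powr \<alpha> * ?g (snd p) * (cmod (ww p))\<^sup>2) * indicator {0..T} (fst p)) \<partial>lborel)"
    proof (rule nn_integral_mono)
      fix p :: "real \<times> (real^'n)"
      let ?u = "fst p powr \<alpha> * (cmod (ww p))\<^sup>2"
      show "ennreal ?u * indicator ({0..T} \<times> cube \<beta>) p \<le> ennreal ?e * (ennreal (fst p powr \<alpha> * ?g (snd p) * (cmod (ww p))\<^sup>2) * indicator {0..T} (fst p))"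
      proof (cases "p \<in> {0..T} \<times> cube \<beta>")
        case True
        then have "snd p \<in> cube \<beta>" by auto
        from mult_right_mono[OF gauss_cube_bound[OF this], of ?u]
        have "?u \<le> ?e * ?g (snd p) * ?u" by simp
        also have "\<dots> = ?e * (fst p powr \<alpha> * ?g (snd p) * (cmod (ww p))\<^sup>2)" by (simp only: mult_ac)
        finally have "ennreal ?u \<le> ennreal ?e * ennreal (fst p powr \<alpha> * ?g (snd p) * (cmod (ww p))\<^sup>2)"
          by (subst ennreal_mult[symmetric]) (auto intro: ennreal_leI)
        moreover have "fst p \<in> {0..T}" using True by auto
        ultimately show ?thesis using True by simp
      qed simp
    qed
    also have "\<dots> = ennreal ?e * (\<integral>\<^sup>+p. ennreal (fst p powr \<alpha> * ?g (snd p) * (cmod (ww p))\<^sup>2) * indicator {0..T} (fst p) \<partial>lborel)"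
      by (rule nn_integral_cmult) measurable
    also have "\<dots> \<le> ?K" by (intro mult_left_mono ww_bound[OF gC]) simp
    finally show ?thesis unfolding lborel_prod .
  qed
  moreover have "?K = ennreal (enn2real ?K)" using K by simp
  ultimately show ?thesis by (intro exI[of _ "enn2real ?K"] allI) (simp only:)
qed

text \<open>A fixed x is a null set and cannot serve as a weight. The estimate is instead integrated
  over arbitrary sets A of finite measure, with a bound proportional to |A|, which forces the
  integrand to obey it at almost every x.\<close>

lemma ww_line_bound:
  assumes n: "CARD('n) = 1"
  shows "\<exists>C::real. AE x in lborel. (\<integral>\<^sup>+t. ennreal (t powr \<alpha> * (cmod (ww (t, x)))\<^sup>2) * indicator {0..T} t \<partial>lborel) \<le> ennreal C"
proof -
  let ?K = "ennreal (smE \<alpha> T * (8 * cauchy_mass)) * duh_bound T U0 G"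
  let ?F = "\<lambda>x. \<integral>\<^sup>+t. ennreal (t powr \<alpha> * (cmod (ww (t, x)))\<^sup>2) * indicator {0..T} t \<partial>lborel"
  have K: "?K < \<infinity>" using duh_bound_finite by (simp add: ennreal_mult_less_top)
  have m: "(\<lambda>(x, t). ennreal (t powr \<alpha> * (cmod (ww (t, x)))\<^sup>2) * indicator {0..T} t) \<in> borel_measurable (borel \<Otimes>\<^sub>M lborel)"
  proof -
    have sw: "(\<lambda>p::(real^'n) \<times> real. (snd p, fst p)) \<in> borel_measurable borel"
      by (intro borel_measurable_continuous_onI continuous_intros)
    have "(\<lambda>p. ww (snd p, fst p)) \<in> borel_measurable borel" using measurable_compose[OF sw ww_measurable] .
    moreover have "(snd :: (real^'n) \<times> real \<Rightarrow> real) \<in> borel_measurable borel"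
      by (intro borel_measurable_continuous_onI continuous_intros)
    ultimately have "(\<lambda>p. ennreal (snd p powr \<alpha> * (cmod (ww (snd p, fst p)))\<^sup>2) * indicator {0..T} (snd p)) \<in> borel_measurable (borel :: ((real^'n) \<times> real) measure)"
      by measurable
    moreover have "sets (borel \<Otimes>\<^sub>M lborel) = sets (borel :: ((real^'n) \<times> real) measure)"
      unfolding borel_prod[symmetric] by (rule sets_pair_measure_cong) auto
    ultimately show ?thesis unfolding split_def by (simp cong: measurable_cong_sets)
  qed
  have Fm: "?F \<in> borel_measurable borel"
    using lborel.borel_measurable_nn_integral[OF m] by simp
  have "AE x in lborel. ?F x \<le> ?K"
  proof (rule AE_le_of_set_nn_integral_le[OF Fm K])
    fix A :: "(real^'n) set" assume A: "A \<in> sets borel" "emeasure lborel A < \<infinity>"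
    note [measurable] = A(1)
    let ?h = "\<lambda>p. ennreal (fst p powr \<alpha> * indicator A (snd p) * (cmod (ww p))\<^sup>2) * indicator {0..T} (fst p)"
    have hm: "?h \<in> borel_measurable (lborel \<Otimes>\<^sub>M lborel)"
      unfolding lborel_prod by measurable
    have "(\<integral>\<^sup>+x. ?F x * indicator A x \<partial>lborel) = (\<integral>\<^sup>+x. (\<integral>\<^sup>+t. ?h (t, x) \<partial>lborel) \<partial>lborel)"
      by (intro nn_integral_cong) (auto simp: indicator_def intro!: nn_integral_cong)
    also have "\<dots> = (\<integral>\<^sup>+p. ?h p \<partial>(lborel \<Otimes>\<^sub>M lborel))" by (rule lborel_pair.nn_integral_snd[OF hm])
    also have "\<dots> \<le> ennreal (smE \<alpha> T * (measure lborel A * (8 * cauchy_mass))) * duh_bound T U0 G"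
      unfolding lborel_prod by (rule ww_bound[OF smoothing_weight_indicator[OF n A]])
    also have "smE \<alpha> T * (measure lborel A * (8 * cauchy_mass)) = smE \<alpha> T * (8 * cauchy_mass) * measure lborel A" by (simp only: mult_ac)
    also have "ennreal \<dots> = ennreal (smE \<alpha> T * (8 * cauchy_mass)) * ennreal (measure lborel A)"
      by (rule ennreal_mult) (use smE_nonneg cauchy_mass_nonneg in auto)
    also have "ennreal (measure lborel A) = emeasure lborel A" using A(2) by (simp add: emeasure_eq_ennreal_measure)
    finally show "(\<integral>\<^sup>+x. ?F x * indicator A x \<partial>lborel) \<le> ?K * emeasure lborel A" by (simp only: mult_ac)
  qed
  moreover have "?K = ennreal (enn2real ?K)" using K by simp
  ultimately have "AE x in lborel. ?F x \<le> ennreal (enn2real ?K)" by (simp only:)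
  then show ?thesis ..
qed

end

theorem theorem1p3:
  fixes \<alpha> s \<sigma> :: real and k :: nat
  assumes "\<alpha> > 0" and "k \<ge> 1" and "s > real CARD('n) / 2" and "\<sigma> = 1 \<or> \<sigma> = -1"
  shows "\<forall>R>0. \<exists>T>0. \<exists>X N. banach_Linf s T X N \<and>
    (\<exists>sol. (\<forall>u0 \<in> (Hball s R :: (real^'n \<Rightarrow> complex) set).
        sol u0 \<in> X \<and> cont_Hs s T (sol u0) \<and> solves \<alpha> \<sigma> k T u0 (sol u0)
      \<and> (\<forall>v\<in>X. cont_Hs s T v \<and> solves \<alpha> \<sigma> k T u0 v \<longrightarrow>
            (\<forall>t\<in>{0..T}. hs_dist s (v t) (sol u0 t) = 0))
      \<and> (\<forall>\<epsilon>>0. \<exists>\<delta>>0. \<forall>v0 \<in> Hball s R. hs_dist s v0 u0 < \<delta> \<longrightarrow>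
            (\<forall>t\<in>{0..T}. hs_dist s (sol v0 t) (sol u0 t) < \<epsilon>))
      \<and> (\<exists>w. is_Dx (s + 1/2) T (sol u0) w \<and>
            (CARD('n) = 1 \<longrightarrow> (\<exists>C::real. AE x in lborel.
               (\<integral>\<^sup>+ t. ennreal (t powr \<alpha> * (cmod (w (t, x)))^2) * indicator {0..T} t \<partial>lborel) \<le> ennreal C))
          \<and> (CARD('n) \<ge> 2 \<longrightarrow> (\<exists>C::real. \<forall>\<beta>.
               (\<integral>\<^sup>+ p. ennreal (fst p powr \<alpha> * (cmod (w p))^2) * indicator ({0..T} \<times> cube \<beta>) p
                  \<partial>(lborel \<Otimes>\<^sub>M lborel)) \<le> ennreal C)))))"
proof (intro allI impI, goal_cases)
  case R: (1 R)
  interpret sobolev_space s "TYPE('n)" by unfold_locales (rule assms(3))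
  obtain T and S :: "(real^'n) lsq \<Rightarrow> real \<Rightarrow> (real^'n) lsq" where T: "T > 0"
    and Sc: "\<And>U. norm U \<le> R \<Longrightarrow> continuous_on {0..T} (S U)"
    and SU: "\<And>U t. norm U \<le> R \<Longrightarrow> t \<in> {0..T} \<Longrightarrow> S U t = U + integral {0..t} (\<lambda>\<tau>. NN \<alpha> \<sigma> k \<tau> (S U \<tau>))"
    and Sd: "\<And>U V t. norm U \<le> R \<Longrightarrow> norm V \<le> R \<Longrightarrow> t \<in> {0..T} \<Longrightarrow> norm (S U t - S V t) \<le> 2 * norm (U - V)"
    by (rule local_wellposedness[OF assms(1) R, of \<sigma> k]) (rule that)
  \<comment> \<open>Clamping time to [0,T] extends the solution and its integrand to continuous
    curves on the whole line, as \<open>duhamel_curve\<close> demands, without changing them on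
    [0,T].\<close>
  define cl where "cl t = max 0 (min T t)" for t
  have cl: "cl t \<in> {0..T}" for t using T by (simp add: cl_def)
  have cl_id: "cl t = t" if "t \<in> {0..T}" for t using that by (simp add: cl_def)
  have clc: "continuous_on UNIV cl" unfolding cl_def[abs_def] by (intro continuous_intros)
  define P where "P U t = S U (cl t)" for U t
  define G where "G U \<tau> = NN \<alpha> \<sigma> k (cl \<tau>) (S U (cl \<tau>))" for U \<tau>
  have Pc: "continuous_on UNIV (P U)" if "norm U \<le> R" for U
    unfolding P_def[abs_def] by (rule continuous_on_compose2[OF Sc[OF that] clc]) (use cl in blast)
  have Gc: "continuous_on UNIV (G U)" if "norm U \<le> R" for U
    unfolding G_def[abs_def] by (rule continuous_on_compose2[OF continuous_on_NN[OF assms(1) Sc[OF that]] clc]) (use cl in blast)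
  have PG: "P U t = U + integral {0..t} (G U)" if "norm U \<le> R" "t \<in> {0..T}" for U t
  proof -
    have "integral {0..t} (G U) = integral {0..t} (\<lambda>\<tau>. NN \<alpha> \<sigma> k \<tau> (S U \<tau>))"
    proof (rule Henstock_Kurzweil_Integration.integral_cong)
      fix \<tau> assume "\<tau> \<in> {0..t}"
      then have "cl \<tau> = \<tau>" using that(2) by (intro cl_id) simp
      then show "G U \<tau> = NN \<alpha> \<sigma> k \<tau> (S U \<tau>)" by (simp add: G_def)
    qed
    then show ?thesis using SU[OF that] cl_id[OF that(2)] by (simp add: P_def)
  qed
  have PN: "P U t = U + integral {0..t} (\<lambda>\<tau>. NN \<alpha> \<sigma> k \<tau> (P U \<tau>))" if "norm U \<le> R" "t \<in> {0..T}" for U t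
  proof -
    have "integral {0..t} (G U) = integral {0..t} (\<lambda>\<tau>. NN \<alpha> \<sigma> k \<tau> (P U \<tau>))"
    proof (rule Henstock_Kurzweil_Integration.integral_cong)
      fix \<tau> assume "\<tau> \<in> {0..t}"
      then have "cl \<tau> = \<tau>" using that(2) by (intro cl_id) simp
      then show "G U \<tau> = NN \<alpha> \<sigma> k \<tau> (P U \<tau>)" by (simp add: G_def P_def)
    qed
    then show ?thesis using PG[OF that] by simp
  qed
  define sol where "sol u0 = Hsol \<alpha> (P (lift u0))" for u0
  have ball: "u0 \<in> sobolev s" "norm (lift u0) \<le> R" if "u0 \<in> Hball s R" for u0
    using that hs_norm_lift[of u0] by (auto simp: Hball_def)
  have Pc': "continuous_on {0..T} (P U)" if "norm U \<le> R" for U by (rule continuous_on_subset[OF Pc[OF that]]) simp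
  have solc: "cont_Hs s T (sol u0)" if "u0 \<in> Hball s R" for u0
    unfolding sol_def by (rule cont_Hsol[OF assms(1) Pc'[OF ball(2)[OF that]]])
  have sols: "solves \<alpha> \<sigma> k T u0 (sol u0)" if "u0 \<in> Hball s R" for u0
    unfolding solves_iff[OF assms(1) ball(1)[OF that] solc[OF that]] unfolding sol_def lift_Hsol evol_cancel
    using PN[OF ball(2)[OF that]] by blast
  show ?case
  proof (rule exI[of _ T], rule conjI[OF T], rule exI[of _ "CHs T"], rule exI[of _ "CHs_norm T"],
      rule conjI[OF banach_Linf_CHs[OF T]], rule exI[of _ sol], rule ballI, intro conjI)
    fix u0 :: "real^'n \<Rightarrow> complex" assume u0: "u0 \<in> Hball s R"
    show "sol u0 \<in> CHs T" unfolding CHs_def using solc[OF u0] by simp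
    show "cont_Hs s T (sol u0)" by (rule solc[OF u0])
    show "solves \<alpha> \<sigma> k T u0 (sol u0)" by (rule sols[OF u0])
    show "\<forall>v\<in>CHs T. cont_Hs s T v \<and> solves \<alpha> \<sigma> k T u0 v \<longrightarrow> (\<forall>t\<in>{0..T}. hs_dist s (v t) (sol u0 t) = 0)"
    proof (intro ballI impI, elim conjE)
      fix v t assume "cont_Hs s T v" "solves \<alpha> \<sigma> k T u0 v" "t \<in> {0..T}"
      then show "hs_dist s (v t) (sol u0 t) = 0"
        by (rule solution_unique[OF assms(1) T ball(1)[OF u0] solc[OF u0] sols[OF u0]])
    qed
    show "\<forall>\<epsilon>>0. \<exists>\<delta>>0. \<forall>v0 \<in> Hball s R. hs_dist s v0 u0 < \<delta> \<longrightarrow> (\<forall>t\<in>{0..T}. hs_dist s (sol v0 t) (sol u0 t) < \<epsilon>)"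
    proof (intro allI impI)
      fix \<epsilon> :: real assume e: "\<epsilon> > 0"
      show "\<exists>\<delta>>0. \<forall>v0 \<in> Hball s R. hs_dist s v0 u0 < \<delta> \<longrightarrow> (\<forall>t\<in>{0..T}. hs_dist s (sol v0 t) (sol u0 t) < \<epsilon>)"
      \<comment> \<open>The solution map has Lipschitz constant 2 on the ball, hence half of
        \<epsilon>.\<close>
      proof (intro exI[of _ "\<epsilon> / 2"] conjI ballI impI)
        show "\<epsilon> / 2 > 0" using e by simp
        fix v0 :: "real^'n \<Rightarrow> complex" and t :: real
        assume v0: "v0 \<in> Hball s R" and d: "hs_dist s v0 u0 < \<epsilon> / 2" and t: "t \<in> {0..T}"
        have so: "sol w t \<in> sobolev s" for w unfolding sol_def Hsol_def by (rule sobolev_emb)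
        have "hs_dist s (sol v0 t) (sol u0 t) = norm (S (lift v0) t - S (lift u0) t)"
          unfolding hs_dist_lift[OF so so] unfolding sol_def lift_Hsol evol_diff[symmetric] norm_evol P_def cl_id[OF t] ..
        also have "\<dots> \<le> 2 * norm (lift v0 - lift u0)" by (rule Sd[OF ball(2)[OF v0] ball(2)[OF u0] t])
        also have "\<dots> = 2 * hs_dist s v0 u0" unfolding hs_dist_lift[OF ball(1)[OF v0] ball(1)[OF u0]] ..
        also have "\<dots> < \<epsilon>" using d by simp
        finally show "hs_dist s (sol v0 t) (sol u0 t) < \<epsilon>" .
      qed
    qed
    let ?U = "lift u0"
    interpret D: duhamel_curve s "TYPE('n)" \<alpha> T ?U "G ?U" "P ?U"
      by (unfold_locales, rule assms(1), rule T, rule Gc[OF ball(2)[OF u0]], rule Pc[OF ball(2)[OF u0]], rule PG[OF ball(2)[OF u0]])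
    show "\<exists>w. is_Dx (s + 1/2) T (sol u0) w \<and>
            (CARD('n) = 1 \<longrightarrow> (\<exists>C::real. AE x in lborel.
               (\<integral>\<^sup>+ t. ennreal (t powr \<alpha> * (cmod (w (t, x)))^2) * indicator {0..T} t \<partial>lborel) \<le> ennreal C))
          \<and> (CARD('n) \<ge> 2 \<longrightarrow> (\<exists>C::real. \<forall>\<beta>.
               (\<integral>\<^sup>+ p. ennreal (fst p powr \<alpha> * (cmod (w p))^2) * indicator ({0..T} \<times> cube \<beta>) p
                  \<partial>(lborel \<Otimes>\<^sub>M lborel)) \<le> ennreal C))"
    proof (intro exI[of _ D.ww] conjI impI)
      show "is_Dx (s + 1/2) T (sol u0) D.ww" unfolding sol_def by (rule D.ww_is_Dx)
    qed (rule D.ww_line_bound D.ww_cube_bound, assumption?)+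
  qed
qed

end
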